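(* Let $\{G_n\}_{n\ge1}$ be a sequence of high degree almost regular graphs. Let $\Gamma_n$ be a uniform spanning tree of $G_n$ and let $X$ be a uniformly chosen vertex of $G_n$ (independent of $\Gamma_n$). Then: (i) the local limit of $\Gamma_n$ is the Poisson$(1)$ Galton--Watson (branching process) tree conditioned to survive forever; and (ii) for any fixed finite rooted tree $T$ of height $r\ge 1$, $$\lim_{n\to\infty}\mathbb{P}\big(B_{\Gamma_n}(X,r)\cong T\big)=\frac{|T_r|\,e^{-|V(T)|+|T_r|}}{|\mathrm{Stab}_T|},$$ where $\cong$ means rooted graph isomorphism.
   Context: A sequence of finite, simple, connected graphs $\{G_n\}$ is called high degree almost regular if there exists some $d(n)\to\infty$ such that (1) at least $(1-o(1))|V(G_n)|$ of the vertices of $G_n$ have degree $(1\pm o(1))d(n)$, and (2) the sum of degrees in $G_n$ is $(1\pm o(1))d(n)|V(G_n)|$. Equivalently, there is a sequence $\delta_n\to 0$ with $|\{v\in V(G_n):|\deg(v)-d(n)|\le\delta_n d(n)\}|\ge(1-\delta_n)|V(G_n)|$ and $\big|\sum_{v}\deg(v)-d(n)|V(G_n)|\big|\le\delta_n d(n)|V(G_n)|$. The uniform spanning tree (UST) of a finite connected graph $G$ is a uniformly random element of the finite set of spanning trees of $G$. The height of a finite rooted tree $T$ is the maximal graph distance between the root and a vertex of $T$. For $T$ of height $r$, $T_r$ is the set of vertices at graph distance exactly $r$ from the root, $V(T)$ is the vertex set, and $\mathrm{Stab}_T$ is the set of graph automorphisms of $T$ that preserve the root. For a graph $G$, a vertex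 $\rho$ and an integer $r\ge 0$, $B_G(\rho,r)$ denotes the induced subgraph of $G$ on the vertices at graph distance at most $r$ from $\rho$, rooted at $\rho$. Let $\mathcal{G}_\bullet$ be the space of all locally finite rooted graphs $(G,\rho)$ up to root-preserving isomorphism, with the metric in which the distance between $(G_1,\rho_1)$ and $(G_2,\rho_2)$ is $2^{-R}$, where $R\in\{0,1,\dots\}\cup\{\infty\}$ is maximal such that $B_{G_1}(\rho_1,R)$ and $B_{G_2}(\rho_2,R)$ are isomorphic by a root-preserving isomorphism; it carries the Borel $\sigma$-algebra. The law of a random element $(G,\rho)$ of $\mathcal{G}_\bullet$ is the local limit of a sequence of (possibly random) finite graphs $H_n$ if for every integer $r\ge 0$ the random rooted graphs $B_{H_n}(\rho_n,r)$ converge in distribution to $B_G(\rho,r)$, where $\rho_n$ is a uniformly random vertex of $H_n$, drawn independently conditioned on $H_n$. The Poisson$(1)$ Galton--Watson tree conditioned to survive (forever) is the limit in distribution in $\mathcal{G}_\bullet$ (i.e., convergence in distribution of $B(\rho,r)$ for every $r$, $\rho$ being the root), as $m\to\infty$, of the rooted Galton--Watson tree with Poisson$(1)$ offspring distribution conditioned to survive $m$ generations; this limit is known to exist. *)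

theory Defs
  imports "HOL-Complex_Analysis.Great_Picard" "HOL-Probability.Probability" "HOL-Combinatorics.Permutations"
begin

section \<open>Simple graphs\<close>

datatype 'a sgraph = SGraph (verts: "'a set") (edges: "'a set set")

definition simple_graph :: "'a sgraph \<Rightarrow> bool" where
  "simple_graph G \<longleftrightarrow> (\<forall>e\<in>edges G. \<exists>u\<in>verts G. \<exists>v\<in>verts G. u \<noteq> v \<and> e = {u, v})"

definition adj :: "'a sgraph \<Rightarrow> ('a \<times> 'a) set" where
  "adj G = {(u, v). {u, v} \<in> edges G}"

definition neighbours :: "'a sgraph \<Rightarrow> 'a \<Rightarrow> 'a set" where
  "neighbours G v = {u. {u, v} \<in> edges G}"

definition degree :: "'a sgraph \<Rightarrow> 'a \<Rightarrow> nat" where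
  "degree G v = card (neighbours G v)"

definition gconnected :: "'a sgraph \<Rightarrow> bool" where
  "gconnected G \<longleftrightarrow> verts G \<noteq> {} \<and> (\<forall>u\<in>verts G. \<forall>v\<in>verts G. (u, v) \<in> (adj G)\<^sup>*)"

definition locally_finite :: "'a sgraph \<Rightarrow> bool" where
  "locally_finite G \<longleftrightarrow> (\<forall>v\<in>verts G. finite (neighbours G v))"

text \<open>Graph distance, the least length of a walk; it is \<open>\<infinity>\<close> if there is none.\<close>

definition gdist :: "'a sgraph \<Rightarrow> 'a \<Rightarrow> 'a \<Rightarrow> enat" where
  "gdist G u v = (INF n\<in>{n. (u, v) \<in> adj G ^^ n}. enat n)"

definition induced :: "'a sgraph \<Rightarrow> 'a set \<Rightarrow> 'a sgraph" where
  "induced G S = SGraph (verts G \<inter> S) {e \<in> edges G. e \<subseteq> S}"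

definition graph_iso :: "('a \<Rightarrow> 'b) \<Rightarrow> 'a sgraph \<Rightarrow> 'b sgraph \<Rightarrow> bool" where
  "graph_iso f G H \<longleftrightarrow> bij_betw f (verts G) (verts H) \<and>
     (\<forall>u\<in>verts G. \<forall>v\<in>verts G. {u, v} \<in> edges G \<longleftrightarrow> {f u, f v} \<in> edges H)"

definition graph_image :: "('a \<Rightarrow> 'b) \<Rightarrow> 'a sgraph \<Rightarrow> 'b sgraph" where
  "graph_image f G = SGraph (f ` verts G) ((`) f ` edges G)"

section \<open>Trees and spanning trees\<close>

definition is_cycle :: "'a sgraph \<Rightarrow> 'a list \<Rightarrow> bool" where
  "is_cycle G xs \<longleftrightarrow> 3 \<le> length xs \<and> distinct xs \<and>
     (\<forall>i<length xs. {xs ! i, xs ! (Suc i mod length xs)} \<in> edges G)"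

definition is_tree :: "'a sgraph \<Rightarrow> bool" where
  "is_tree T \<longleftrightarrow> simple_graph T \<and> gconnected T \<and> (\<nexists>xs. is_cycle T xs)"

definition spanning_trees :: "'a sgraph \<Rightarrow> 'a sgraph set" where
  "spanning_trees G = {T. is_tree T \<and> verts T = verts G \<and> edges T \<subseteq> edges G}"

definition ust :: "'a sgraph \<Rightarrow> 'a sgraph pmf" where
  "ust G = pmf_of_set (spanning_trees G)"

section \<open>Rooted graphs\<close>

type_synonym 'a rooted = "'a sgraph \<times> 'a"

definition rooted_iso :: "'a rooted \<Rightarrow> 'b rooted \<Rightarrow> bool" where
  "rooted_iso x y \<longleftrightarrow> (\<exists>f. graph_iso f (fst x) (fst y) \<and> f (snd x) = snd y)"

definition gball :: "'a sgraph \<Rightarrow> 'a \<Rightarrow> nat \<Rightarrow> 'a rooted" where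
  "gball G \<rho> r = (induced G {v. gdist G \<rho> v \<le> enat r}, \<rho>)"

definition tree_height :: "'a rooted \<Rightarrow> enat" where
  "tree_height T = Max (gdist (fst T) (snd T) ` verts (fst T))"

definition sphere_verts :: "'a rooted \<Rightarrow> nat \<Rightarrow> 'a set" where
  "sphere_verts T r = {v \<in> verts (fst T). gdist (fst T) (snd T) v = enat r}"

text \<open>Automorphisms are represented by permutations of the vertex set that are the identity
  outside of it, so that they can be counted.\<close>

definition root_stab :: "'a rooted \<Rightarrow> ('a \<Rightarrow> 'a) set" where
  "root_stab T = {f. f permutes verts (fst T) \<and> graph_iso f (fst T) (fst T) \<and> f (snd T) = snd T}"

section \<open>The space of rooted graphs\<close>

text \<open>A point is an isomorphism class of connected, locally finite rooted graphs. (Without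
  connectedness the local distance would only be a pseudometric, because balls see only the
  component of the root.) The vertex sets of such graphs are countable, so every class has a
  representative whose vertices are natural numbers.\<close>

definition rlf :: "'a rooted \<Rightarrow> bool" where
  "rlf x \<longleftrightarrow> simple_graph (fst x) \<and> gconnected (fst x) \<and> locally_finite (fst x) \<and> snd x \<in> verts (fst x)"

definition rlf_iso :: "'a rooted \<Rightarrow> 'a rooted \<Rightarrow> bool" where
  "rlf_iso x y \<longleftrightarrow> rlf x \<and> rlf y \<and> rooted_iso x y"

lemma graph_iso_inv:
  assumes "graph_iso f G H"
  shows "graph_iso (inv_into (verts G) f) H G"
proof -
  have b: "bij_betw f (verts G) (verts H)" using assms by (simp add: graph_iso_def)
  have b': "bij_betw (inv_into (verts G) f) (verts H) (verts G)" by (rule bij_betw_inv_into[OF b])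
  show ?thesis unfolding graph_iso_def
  proof (intro conjI b' ballI)
    fix u v assume u: "u \<in> verts H" and v: "v \<in> verts H"
    let ?g = "inv_into (verts G) f"
    have "?g u \<in> verts G" "?g v \<in> verts G" using b' u v by (auto simp: bij_betw_def)
    moreover have "f (?g u) = u" "f (?g v) = v" using b u v by (auto simp: bij_betw_inv_into_right)
    ultimately show "({u, v} \<in> edges H) = ({?g u, ?g v} \<in> edges G)"
      using assms by (auto simp: graph_iso_def)
  qed
qed

lemma graph_iso_comp:
  assumes "graph_iso f G H" "graph_iso g H K"
  shows "graph_iso (g \<circ> f) G K"
proof -
  have "bij_betw (g \<circ> f) (verts G) (verts K)" using assms by (auto simp: graph_iso_def intro: bij_betw_trans)
  moreover have "f u \<in> verts H" if "u \<in> verts G" for u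
    using assms(1) that by (auto simp: graph_iso_def bij_betw_def)
  ultimately show ?thesis using assms by (auto simp: graph_iso_def)
qed

lemma rooted_iso_refl: "rooted_iso x x"
  unfolding rooted_iso_def graph_iso_def by (intro exI[of _ id]) auto

lemma rooted_iso_sym:
  assumes "rooted_iso x y" "snd x \<in> verts (fst x)"
  shows "rooted_iso y x"
proof -
  obtain f where f: "graph_iso f (fst x) (fst y)" "f (snd x) = snd y"
    using assms by (auto simp: rooted_iso_def)
  have "inj_on f (verts (fst x))" using f(1) by (auto simp: graph_iso_def bij_betw_def)
  then have "inv_into (verts (fst x)) f (snd y) = snd x" using f(2) assms(2) by (metis inv_into_f_f)
  then show ?thesis using graph_iso_inv[OF f(1)] by (auto simp: rooted_iso_def)
qed

lemma rooted_iso_trans: "rooted_iso x y \<Longrightarrow> rooted_iso y z \<Longrightarrow> rooted_iso x z"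
  unfolding rooted_iso_def by (metis comp_apply graph_iso_comp)

quotient_type rgraph = "nat sgraph \<times> nat" / partial: rlf_iso
proof (rule part_equivpI)
  let ?G = "SGraph {0::nat} {}"
  have "rlf (?G, 0)"
    by (auto simp: rlf_def simple_graph_def gconnected_def locally_finite_def neighbours_def)
  then show "\<exists>x::nat rooted. rlf_iso x x" unfolding rlf_iso_def using rooted_iso_refl by blast
  show "symp (rlf_iso :: nat rooted \<Rightarrow> _)"
    unfolding symp_def rlf_iso_def by (metis rlf_def rooted_iso_sym)
  show "transp (rlf_iso :: nat rooted \<Rightarrow> _)"
    unfolding transp_def rlf_iso_def by (metis rooted_iso_trans)
qed

text \<open>The class of a rooted graph with vertices of any type; only meaningful for arguments
  satisfying \<^const>\<open>rlf\<close>, for which \<^const>\<open>to_nat_on\<close> is injective on the vertex set.\<close>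

definition rgraph_of :: "'a rooted \<Rightarrow> rgraph" where
  "rgraph_of x = (let f = to_nat_on (verts (fst x)) in abs_rgraph (graph_image f (fst x), f (snd x)))"

subsection \<open>Balls\<close>

lemma gdist_le_iff: "gdist G u v \<le> enat r \<longleftrightarrow> (\<exists>n\<le>r. (u, v) \<in> adj G ^^ n)"
proof
  assume le: "gdist G u v \<le> enat r"
  let ?S = "{n. (u, v) \<in> adj G ^^ n}"
  have "?S \<noteq> {}"
  proof
    assume "?S = {}"
    then show False using le by (simp add: gdist_def top_enat_def)
  qed
  then have "Inf (enat ` ?S) \<in> enat ` ?S" by (intro wellorder_InfI[of _ "enat ` ?S"]) (auto intro: LeastI)
  then show "\<exists>n\<le>r. (u, v) \<in> adj G ^^ n" using le by (auto simp: gdist_def)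
next
  assume "\<exists>n\<le>r. (u, v) \<in> adj G ^^ n"
  then obtain n where "n \<le> r" "(u, v) \<in> adj G ^^ n" by blast
  then have "gdist G u v \<le> enat n" unfolding gdist_def by (intro INF_lower) simp
  then show "gdist G u v \<le> enat r" using \<open>n \<le> r\<close> by (meson enat_ord_simps(1) order_trans)
qed

lemma adj_verts: "simple_graph G \<Longrightarrow> (u, v) \<in> adj G \<Longrightarrow> u \<in> verts G \<and> v \<in> verts G"
  unfolding simple_graph_def adj_def by (fastforce simp: doubleton_eq_iff)

lemma adj_sym: "(u, v) \<in> adj G \<Longrightarrow> (v, u) \<in> adj G"
  by (simp add: adj_def insert_commute)

lemma relpow_verts:
  "simple_graph G \<Longrightarrow> u \<in> verts G \<Longrightarrow> (u, v) \<in> adj G ^^ n \<Longrightarrow> v \<in> verts G"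
  by (cases n) (auto dest: adj_verts)

lemma iso_relpow:
  assumes "graph_iso f G H" "simple_graph G" "u \<in> verts G" "(u, v) \<in> adj G ^^ n"
  shows "(f u, f v) \<in> adj H ^^ n"
  using assms(4)
proof (induction n arbitrary: v)
  case (Suc n)
  then obtain w where w: "(u, w) \<in> adj G ^^ n" "(w, v) \<in> adj G" by auto
  have "(f w, f v) \<in> adj H" using assms(1) w(2) adj_verts[OF assms(2) w(2)]
    by (auto simp: graph_iso_def adj_def)
  then show ?case using Suc.IH[OF w(1)] by auto
qed auto

lemma iso_gdist_le:
  assumes "graph_iso f G H" "simple_graph G" "simple_graph H" "u \<in> verts G" "v \<in> verts G"
  shows "gdist H (f u) (f v) \<le> enat r \<longleftrightarrow> gdist G u v \<le> enat r"
proof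
  assume "gdist G u v \<le> enat r"
  then show "gdist H (f u) (f v) \<le> enat r"
    using iso_relpow[OF assms(1,2,4)] by (auto simp: gdist_le_iff)
next
  let ?g = "inv_into (verts G) f"
  have b: "bij_betw f (verts G) (verts H)" using assms(1) by (simp add: graph_iso_def)
  then have i: "?g (f u) = u" "?g (f v) = v" "f u \<in> verts H"
    using assms(4,5) by (auto simp: bij_betw_def)
  assume "gdist H (f u) (f v) \<le> enat r"
  then show "gdist G u v \<le> enat r"
    using iso_relpow[OF graph_iso_inv[OF assms(1)] assms(3) i(3)] i(1,2)
    by (force simp: gdist_le_iff)
qed

lemma verts_gball: "verts (fst (gball G \<rho> r)) = {v \<in> verts G. gdist G \<rho> v \<le> enat r}"
  by (auto simp: gball_def induced_def)

lemma snd_gball [simp]: "snd (gball G \<rho> r) = \<rho>"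
  by (simp add: gball_def)

lemma edges_gball:
  "{u, v} \<in> edges (fst (gball G \<rho> r)) \<longleftrightarrow>
     {u, v} \<in> edges G \<and> gdist G \<rho> u \<le> enat r \<and> gdist G \<rho> v \<le> enat r"
  by (auto simp: gball_def induced_def)

lemma gdist_self [simp]: "gdist G \<rho> \<rho> \<le> enat r"
  unfolding gdist_le_iff by (intro exI[of _ 0]) auto

lemma simple_gball: "simple_graph G \<Longrightarrow> simple_graph (fst (gball G \<rho> r))"
  unfolding simple_graph_def gball_def induced_def by fastforce

lemma gball_relpow:
  assumes "(\<rho>, v) \<in> adj G ^^ n" "n \<le> r"
  shows "(\<rho>, v) \<in> adj (fst (gball G \<rho> r)) ^^ n"
  using assms
proof (induction n arbitrary: v)
  case (Suc n)
  then obtain w where w: "(\<rho>, w) \<in> adj G ^^ n" "(w, v) \<in> adj G" by auto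
  have "gdist G \<rho> w \<le> enat r" using w Suc.prems by (auto simp: gdist_le_iff intro!: exI[of _ n])
  moreover have "gdist G \<rho> v \<le> enat r" using Suc.prems by (auto simp: gdist_le_iff intro!: exI[of _ "Suc n"])
  ultimately have "(w, v) \<in> adj (fst (gball G \<rho> r))"
    using w(2) by (simp add: adj_def edges_gball)
  then show ?case using Suc.IH[OF w(1)] Suc.prems by auto
qed auto

lemma gball_gdist_le:
  assumes "s \<le> r"
  shows "gdist (fst (gball G \<rho> r)) \<rho> v \<le> enat s \<longleftrightarrow> gdist G \<rho> v \<le> enat s"
proof
  have "adj (fst (gball G \<rho> r)) \<subseteq> adj G" by (auto simp: adj_def edges_gball)
  then have "adj (fst (gball G \<rho> r)) ^^ n \<subseteq> adj G ^^ n" for n by (induction n) auto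
  then show "gdist (fst (gball G \<rho> r)) \<rho> v \<le> enat s \<Longrightarrow> gdist G \<rho> v \<le> enat s"
    unfolding gdist_le_iff by blast
  show "gdist G \<rho> v \<le> enat s \<Longrightarrow> gdist (fst (gball G \<rho> r)) \<rho> v \<le> enat s"
    unfolding gdist_le_iff using gball_relpow assms by (metis order_trans)
qed

lemma gball_gball:
  assumes "s \<le> r"
  shows "gball (fst (gball G \<rho> r)) \<rho> s = gball G \<rho> s"
proof -
  have "{v. gdist G \<rho> v \<le> enat s} \<subseteq> {v. gdist G \<rho> v \<le> enat r}"
    using assms by (auto intro: order_trans)
  then show ?thesis
    unfolding gball_def[of "fst _"] gball_gdist_le[OF assms] by (auto simp: gball_def induced_def)
qed

lemma gball_iso:
  assumes "graph_iso f G H" "f \<rho> = \<sigma>" "simple_graph G" "simple_graph H" "\<rho> \<in> verts G"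
  shows "graph_iso f (fst (gball G \<rho> r)) (fst (gball H \<sigma> r))"
proof -
  let ?V = "\<lambda>G \<rho>. {v \<in> verts G. gdist G \<rho> v \<le> enat r}"
  have b: "bij_betw f (verts G) (verts H)" using assms(1) by (simp add: graph_iso_def)
  have d: "gdist H \<sigma> (f v) \<le> enat r \<longleftrightarrow> gdist G \<rho> v \<le> enat r" if "v \<in> verts G" for v
    using iso_gdist_le[OF assms(1,3,4,5) that] assms(2) by simp
  have "bij_betw f (?V G \<rho>) (?V H \<sigma>)"
  proof (rule bij_betw_imageI)
    show "inj_on f (?V G \<rho>)" using b by (auto simp: bij_betw_def inj_on_def)
    have im: "f ` verts G = verts H" using b by (simp add: bij_betw_def)
    show "f ` ?V G \<rho> = ?V H \<sigma>"
    proof (intro set_eqI iffI)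
      fix w assume "w \<in> f ` ?V G \<rho>"
      then obtain v where "v \<in> verts G" "gdist G \<rho> v \<le> enat r" "w = f v" by auto
      then show "w \<in> ?V H \<sigma>" using d[of v] im by auto
    next
      fix w assume w: "w \<in> ?V H \<sigma>"
      then obtain v where "v \<in> verts G" "w = f v" using im by auto
      then show "w \<in> f ` ?V G \<rho>" using d[of v] w by auto
    qed
  qed
  then show ?thesis
    using assms(1) d by (auto simp: graph_iso_def verts_gball edges_gball)
qed

lemma rlf_gball:
  assumes x: "rlf (G, \<rho>)"
  shows "rlf (gball G \<rho> r)"
proof -
  let ?B = "fst (gball G \<rho> r)"
  have c: "(\<rho>, v) \<in> (adj ?B)\<^sup>*" if "v \<in> verts ?B" for v
    using that gball_relpow[where \<rho> = \<rho> and v = v and G = G and r = r]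
    by (auto simp: verts_gball gdist_le_iff) (meson relpow_imp_rtrancl)
  have "sym (adj ?B)" by (auto intro: symI adj_sym)
  then have "sym ((adj ?B)\<^sup>*)" by (rule sym_rtrancl)
  then have "(u, v) \<in> (adj ?B)\<^sup>*" if "u \<in> verts ?B" "v \<in> verts ?B" for u v
    using c[OF that(1)] c[OF that(2)] by (meson rtrancl_trans symD)
  moreover have "\<rho> \<in> verts ?B" using assms by (simp add: rlf_def verts_gball)
  moreover have "finite (neighbours ?B v)" if "v \<in> verts ?B" for v
  proof (rule finite_subset)
    show "neighbours ?B v \<subseteq> neighbours G v" by (auto simp: neighbours_def edges_gball)
    show "finite (neighbours G v)" using assms that by (auto simp: rlf_def locally_finite_def verts_gball)
  qed
  ultimately show ?thesis using assms
    by (auto simp: rlf_def gconnected_def locally_finite_def intro: simple_gball)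
qed

lift_definition rball :: "nat \<Rightarrow> rgraph \<Rightarrow> rgraph"
  is "\<lambda>r x. gball (fst x) (snd x) r"
proof -
  fix r :: nat and x y :: "nat rooted"
  assume a: "rlf_iso x y"
  then obtain f where "graph_iso f (fst x) (fst y)" "f (snd x) = snd y"
    by (auto simp: rlf_iso_def rooted_iso_def)
  then have "rooted_iso (gball (fst x) (snd x) r) (gball (fst y) (snd y) r)"
    using a gball_iso by (fastforce simp: rooted_iso_def rlf_iso_def rlf_def)
  then show "rlf_iso (gball (fst x) (snd x) r) (gball (fst y) (snd y) r)"
    using a rlf_gball[of "fst x" "snd x"] rlf_gball[of "fst y" "snd y"] by (auto simp: rlf_iso_def)
qed

lemma rball_rball: "s \<le> r \<Longrightarrow> rball s (rball r x) = rball s x"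
proof transfer
  fix s r :: nat and x :: "nat rooted"
  assume "s \<le> r" "rlf_iso x x"
  then show "rlf_iso (gball (fst (gball (fst x) (snd x) r)) (snd (gball (fst x) (snd x) r)) s)
      (gball (fst x) (snd x) s)"
    using rlf_gball[of "fst x" "snd x"] by (auto simp: gball_gball rlf_iso_def rooted_iso_refl)
qed

lemma finite_gball:
  assumes "rlf (G, \<rho>)"
  shows "finite (verts (fst (gball G \<rho> r)))"
proof (induction r)
  case 0
  have "verts (fst (gball G \<rho> 0)) \<subseteq> {\<rho>}" by (auto simp: verts_gball gdist_le_iff)
  then show ?case by (rule finite_subset) simp
next
  case (Suc r)
  have "verts (fst (gball G \<rho> (Suc r))) \<subseteq>
      verts (fst (gball G \<rho> r)) \<union> (\<Union>v\<in>verts (fst (gball G \<rho> r)). neighbours G v)"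
  proof
    fix v assume v: "v \<in> verts (fst (gball G \<rho> (Suc r)))"
    then obtain n where n: "n \<le> Suc r" "(\<rho>, v) \<in> adj G ^^ n" by (auto simp: verts_gball gdist_le_iff)
    show "v \<in> verts (fst (gball G \<rho> r)) \<union> (\<Union>v\<in>verts (fst (gball G \<rho> r)). neighbours G v)"
    proof (cases "n = Suc r")
      case False
      then show ?thesis using n v by (auto simp: verts_gball gdist_le_iff intro!: exI[of _ n])
    next
      case True
      then obtain w where w: "(\<rho>, w) \<in> adj G ^^ r" "(w, v) \<in> adj G" using n by auto
      have "w \<in> verts G" using w(2) assms by (auto simp: rlf_def dest: adj_verts)
      then have "w \<in> verts (fst (gball G \<rho> r))" using w(1) by (auto simp: verts_gball gdist_le_iff)
      moreover have "v \<in> neighbours G w" using w(2) by (simp add: neighbours_def adj_def insert_commute)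
      ultimately show ?thesis by blast
    qed
  qed
  moreover have "finite (neighbours G v)" if "v \<in> verts (fst (gball G \<rho> r))" for v
    using assms that by (simp add: rlf_def locally_finite_def verts_gball)
  ultimately show ?case using Suc by (meson finite_UN finite_UnI finite_subset)
qed

text \<open>Koenig's lemma (via \<open>function_convergent_subsequence\<close> from Great Picard): a point is determined by its balls.\<close>

lemma rooted_iso_if_balls_iso:
  fixes G :: "nat sgraph" and H :: "nat sgraph"
  assumes G: "rlf (G, \<rho>)" and H: "rlf (H, \<sigma>)"
    and iso: "\<And>r. rooted_iso (gball G \<rho> r) (gball H \<sigma> r)"
  shows "rooted_iso (G, \<rho>) (H, \<sigma>)"
proof -
  have sG: "simple_graph G" and sH: "simple_graph H" and rG: "\<rho> \<in> verts G"
    using G H by (auto simp: rlf_def)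
  have reach: "\<exists>r. v \<in> verts (fst (gball K \<tau> r))" if "v \<in> verts K" "rlf (K, \<tau>)" for v \<tau> and K :: "nat sgraph"
  proof -
    have "(\<tau>, v) \<in> (adj K)\<^sup>*" using that by (auto simp: rlf_def gconnected_def)
    then show ?thesis using that(1) by (auto simp: verts_gball gdist_le_iff rtrancl_power)
  qed
  have "\<exists>f. graph_iso f (fst (gball G \<rho> r)) (fst (gball H \<sigma> r)) \<and> f \<rho> = \<sigma>" for r
    using iso[of r] by (auto simp: rooted_iso_def)
  then obtain F where F: "\<And>r. graph_iso (F r) (fst (gball G \<rho> r)) (fst (gball H \<sigma> r))" "\<And>r. F r \<rho> = \<sigma>"
    by metis
  have Fs: "graph_iso (F r) (fst (gball G \<rho> s)) (fst (gball H \<sigma> s))" if "s \<le> r" for s r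
  proof -
    have "graph_iso (F r) (fst (gball (fst (gball G \<rho> r)) \<rho> s)) (fst (gball (fst (gball H \<sigma> r)) \<sigma> s))"
      by (rule gball_iso[OF F simple_gball[OF sG] simple_gball[OF sH]]) (simp add: rG verts_gball)
    then show ?thesis using that by (simp add: gball_gball)
  qed
  define R where "R v = (LEAST r. v \<in> verts (fst (gball G \<rho> r)))" for v
  have R: "v \<in> verts (fst (gball G \<rho> (R v)))" if "v \<in> verts G" for v
    unfolding R_def by (rule LeastI_ex) (rule reach[OF that G])
  define M where "M v = real (Max (insert 0 (verts (fst (gball H \<sigma> (R v)))) \<union> (\<lambda>r. F r v) ` {..R v}))" for v
  have bd: "norm (real (F r v)) \<le> M v" if "v \<in> verts G" for r v
  proof -
    have fin: "finite (insert 0 (verts (fst (gball H \<sigma> (R v)))) \<union> (\<lambda>r. F r v) ` {..R v})"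
      using finite_gball[OF H] by simp
    have "F r v \<in> insert 0 (verts (fst (gball H \<sigma> (R v)))) \<union> (\<lambda>r. F r v) ` {..R v}"
    proof (cases "R v \<le> r")
      case True
      then show ?thesis using Fs[OF True] R[OF that] by (auto simp: graph_iso_def bij_betw_def)
    qed auto
    then show ?thesis unfolding M_def using Max_ge[OF fin] by simp
  qed
  have M0: "0 \<le> M v" for v by (simp add: M_def)
  have "norm (real (F r v) / (M v + 1)) \<le> 1" if "v \<in> verts G" for r v
    using bd[OF that, of r] M0[of v] by simp
  then obtain k where k: "strict_mono k"
      "\<And>v. v \<in> verts G \<Longrightarrow> \<exists>l. (\<lambda>n. real (F (k n) v) / (M v + 1)) \<longlonglongrightarrow> l"
    using function_convergent_subsequence[of "verts G" "\<lambda>r v. real (F r v) / (M v + 1)" 1, OF countableI_type]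
    by blast
  have conv: "\<exists>l. (\<lambda>n. real (F (k n) v)) \<longlonglongrightarrow> l" if v: "v \<in> verts G" for v
  proof -
    obtain l where "(\<lambda>n. real (F (k n) v) / (M v + 1)) \<longlonglongrightarrow> l" using k(2)[OF v] by blast
    then have "(\<lambda>n. (M v + 1) * (real (F (k n) v) / (M v + 1))) \<longlonglongrightarrow> (M v + 1) * l" by (rule tendsto_mult_left)
    moreover have "M v + 1 \<noteq> 0" using M0[of v] by linarith
    ultimately show ?thesis by auto
  qed
  have "\<exists>m. eventually (\<lambda>n. F (k n) v = m) sequentially" if "v \<in> verts G" for v
  proof -
    have "Cauchy (\<lambda>n. real (F (k n) v))" using conv[OF that] LIMSEQ_imp_Cauchy by blast
    then obtain N where N: "\<And>m n. m \<ge> N \<Longrightarrow> n \<ge> N \<Longrightarrow> dist (real (F (k m) v)) (real (F (k n) v)) < 1"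
      unfolding Cauchy_def by (metis zero_less_one)
    have "F (k n) v = F (k N) v" if "n \<ge> N" for n
      using N[OF that order_refl] by (simp add: dist_real_def)
    then show ?thesis by (auto simp: eventually_sequentially)
  qed
  then obtain f where f: "\<And>v. v \<in> verts G \<Longrightarrow> eventually (\<lambda>n. F (k n) v = f v) sequentially" by metis
  have ev: "\<exists>n. r \<le> n \<and> (\<forall>v\<in>verts (fst (gball G \<rho> r)). F n v = f v)" for r
  proof -
    have "eventually (\<lambda>n. \<forall>v\<in>verts (fst (gball G \<rho> r)). F (k n) v = f v) sequentially"
      by (rule eventually_ball_finite[OF finite_gball[OF G]]) (auto simp: verts_gball intro: f)
    then obtain N where "\<And>n. n \<ge> N \<Longrightarrow> \<forall>v\<in>verts (fst (gball G \<rho> r)). F (k n) v = f v"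
      by (auto simp: eventually_sequentially)
    moreover have "r \<le> k (max N r)" using seq_suble[OF k(1), of "max N r"] by simp
    ultimately show ?thesis by (meson max.cobounded1)
  qed
  have fb: "graph_iso f (fst (gball G \<rho> r)) (fst (gball H \<sigma> r))" for r
  proof -
    obtain n where n: "r \<le> n" "\<forall>v\<in>verts (fst (gball G \<rho> r)). F n v = f v" using ev by blast
    have "bij_betw f (verts (fst (gball G \<rho> r))) (verts (fst (gball H \<sigma> r)))"
      using Fs[OF n(1)] n(2) by (auto simp: graph_iso_def cong: bij_betw_cong)
    then show ?thesis using Fs[OF n(1)] n(2) by (auto simp: graph_iso_def)
  qed
  have mono: "verts (fst (gball G \<rho> r)) \<subseteq> verts (fst (gball G \<rho> s))" if "r \<le> s" for r s
    using that by (auto simp: verts_gball intro: order_trans)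
  have both: "\<exists>r. u \<in> verts (fst (gball G \<rho> r)) \<and> v \<in> verts (fst (gball G \<rho> r))"
    if "u \<in> verts G" "v \<in> verts G" for u v
    using R[OF that(1)] R[OF that(2)] mono[of "R u" "max (R u) (R v)"] mono[of "R v" "max (R u) (R v)"]
    by (auto intro!: exI[of _ "max (R u) (R v)"])
  have edge: "({u, v} \<in> edges G) = ({f u, f v} \<in> edges H) \<and> (f u = f v \<longrightarrow> u = v) \<and> f u \<in> verts H"
    if uv: "u \<in> verts G" "v \<in> verts G" for u v
  proof -
    obtain r where r: "u \<in> verts (fst (gball G \<rho> r))" "v \<in> verts (fst (gball G \<rho> r))"
      using both[OF uv] by blast
    have i: "inj_on f (verts (fst (gball G \<rho> r)))"
      and m: "f u \<in> verts (fst (gball H \<sigma> r))" "f v \<in> verts (fst (gball H \<sigma> r))"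
      using fb[of r] r by (auto simp: graph_iso_def bij_betw_def)
    have "({u, v} \<in> edges (fst (gball G \<rho> r))) = ({f u, f v} \<in> edges (fst (gball H \<sigma> r)))"
      using fb[of r] r by (auto simp: graph_iso_def)
    then show ?thesis using r m i by (auto simp: edges_gball verts_gball dest: inj_onD)
  qed
  have "verts H \<subseteq> f ` verts G"
  proof
    fix w assume "w \<in> verts H"
    then obtain r where "w \<in> verts (fst (gball H \<sigma> r))" using reach H by blast
    then have "w \<in> f ` verts (fst (gball G \<rho> r))" using fb[of r] by (simp add: graph_iso_def bij_betw_def)
    then show "w \<in> f ` verts G" by (auto simp: verts_gball)
  qed
  then have "graph_iso f G H" using edge by (auto simp: graph_iso_def bij_betw_def inj_on_def)
  moreover have "f \<rho> = \<sigma>" using ev[of 0] F(2) rG by (auto simp: verts_gball)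
  ultimately show ?thesis by (auto simp: rooted_iso_def)
qed

lemma rgraph_eqI: "(\<And>r. rball r x = rball r y) \<Longrightarrow> x = y"
proof transfer
  fix x y :: "nat rooted"
  assume "rlf_iso x x" "rlf_iso y y"
    "\<And>r. rlf_iso (gball (fst x) (snd x) r) (gball (fst y) (snd y) r)"
  then show "rlf_iso x y"
    using rooted_iso_if_balls_iso[of "fst x" "snd x" "fst y" "snd y"] by (auto simp: rlf_iso_def)
qed

subsection \<open>The local metric\<close>

text \<open>Equality in \<^typ>\<open>rgraph\<close> is root-preserving isomorphism.\<close>

definition agree_radius :: "rgraph \<Rightarrow> rgraph \<Rightarrow> enat" where
  "agree_radius x y = Sup {enat R |R. rball R x = rball R y}"

lemma agree_down: "rball r x = rball r y \<Longrightarrow> s \<le> r \<Longrightarrow> rball s x = rball s y"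
  by (metis rball_rball)

lemma le_agree_radius: "enat r \<le> agree_radius x y \<longleftrightarrow> rball r x = rball r y \<or> r = 0"
proof
  assume le: "enat r \<le> agree_radius x y"
  show "rball r x = rball r y \<or> r = 0"
  proof (rule ccontr)
    assume n: "\<not> ?thesis"
    have "agree_radius x y \<le> enat (r - 1)" unfolding agree_radius_def
    proof (rule Sup_least, clarify)
      fix R assume "rball R x = rball R y"
      then have "R < r" using n agree_down by (metis not_le)
      then show "enat R \<le> enat (r - 1)" by simp
    qed
    with le have "enat r \<le> enat (r - 1)" by (rule order_trans)
    then show False using n by auto
  qed
next
  assume a: "rball r x = rball r y \<or> r = 0"
  show "enat r \<le> agree_radius x y"
  proof (cases "r = 0")
    case False
    then have "enat r \<in> {enat R |R. rball R x = rball R y}" using a by blast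
    then show ?thesis unfolding agree_radius_def by (rule Sup_upper)
  qed (simp flip: zero_enat_def)
qed

instantiation rgraph :: metric_space
begin

definition dist_rgraph :: "rgraph \<Rightarrow> rgraph \<Rightarrow> real" where
  "dist_rgraph x y = (case agree_radius x y of enat R \<Rightarrow> (1 / 2) ^ R | \<infinity> \<Rightarrow> 0)"

definition uniformity_rgraph :: "(rgraph \<times> rgraph) filter" where
  "uniformity_rgraph = (INF e\<in>{0 <..}. principal {(x, y). dist x y < e})"

definition open_rgraph :: "rgraph set \<Rightarrow> bool" where
  "open_rgraph U \<longleftrightarrow> (\<forall>x\<in>U. eventually (\<lambda>(x', y). x' = x \<longrightarrow> y \<in> U) uniformity)"

instance
proof
  fix x y z :: rgraph
  show "dist x y = 0 \<longleftrightarrow> x = y"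
  proof
    assume "dist x y = 0"
    then have "agree_radius x y = \<infinity>" by (cases "agree_radius x y") (auto simp: dist_rgraph_def)
    then have "rball (Suc r) x = rball (Suc r) y" for r using le_agree_radius[of "Suc r" x y] by simp
    then have "rball r x = rball r y" for r by (rule agree_down[OF _ le_SucI[OF order_refl]])
    then show "x = y" by (rule rgraph_eqI)
  next
    assume "x = y"
    then have "enat r \<le> agree_radius x y" for r by (simp add: le_agree_radius)
    then have "agree_radius x y = \<infinity>" by (metis enat_ord_simps(1) not_less_eq_eq order_refl enat.exhaust)
    then show "dist x y = 0" by (simp add: dist_rgraph_def)
  qed
  show "dist x y \<le> dist x z + dist y z"
  proof -
    have s: "agree_radius y z = agree_radius z y" by (simp add: agree_radius_def eq_commute)
    have tr: "min (agree_radius x z) (agree_radius z y) \<le> agree_radius x y"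
    proof (rule ccontr)
      assume n: "\<not> ?thesis"
      then obtain R where R: "agree_radius x y = enat R" by (cases "agree_radius x y") auto
      then have "enat (Suc R) \<le> agree_radius x z" "enat (Suc R) \<le> agree_radius z y"
        using n by (auto simp: not_le Suc_ile_eq)
      then have "enat (Suc R) \<le> agree_radius x y" by (simp add: le_agree_radius)
      then show False using R by simp
    qed
    have an: "dist a b \<le> dist c d" if "agree_radius c d \<le> agree_radius a b" for a b c d :: rgraph
      using that by (cases "agree_radius a b"; cases "agree_radius c d")
        (auto simp: dist_rgraph_def intro: power_decreasing)
    have nn: "0 \<le> dist a b" for a b :: rgraph by (auto simp: dist_rgraph_def split: enat.split)
    have "dist x y \<le> dist x z \<or> dist x y \<le> dist z y" using tr an by (metis min_def)
    moreover have "dist z y = dist y z" using s by (simp add: dist_rgraph_def)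
    ultimately show ?thesis using nn[of x z] nn[of y z] by linarith
  qed
qed (simp_all add: uniformity_rgraph_def open_rgraph_def)

end

section \<open>Local limits\<close>

definition conv_in_distr :: "(nat \<Rightarrow> 'a::metric_space measure) \<Rightarrow> 'a measure \<Rightarrow> bool" where
  "conv_in_distr M \<mu> \<longleftrightarrow> (\<forall>f::'a \<Rightarrow> real. continuous_on UNIV f \<and> bounded (range f) \<longrightarrow>
     (\<lambda>n. \<integral>x. f x \<partial>M n) \<longlonglongrightarrow> (\<integral>x. f x \<partial>\<mu>))"

text \<open>\<open>H n\<close> is the law of a random finite graph. The root is uniform given the graph.\<close>

definition local_limit :: "(nat \<Rightarrow> 'a sgraph pmf) \<Rightarrow> rgraph measure \<Rightarrow> bool" where
  "local_limit H \<mu> \<longleftrightarrow> prob_space \<mu> \<and> sets \<mu> = sets borel \<and>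
     (\<forall>r. conv_in_distr
       (\<lambda>n. distr (measure_pmf (bind_pmf (H n) (\<lambda>K. map_pmf (Pair K) (pmf_of_set (verts K)))))
              borel (\<lambda>(K, x). rgraph_of (gball K x r)))
       (distr \<mu> borel (rball r)))"

section \<open>Galton--Watson trees\<close>

text \<open>Ulam--Harris coding: an individual is the list of the birth ranks along its ancestral
  line and \<open>\<xi> u\<close> is the number of children of \<open>u\<close>, with \<open>u @ [k]\<close> for \<open>k < \<xi> u\<close> as children.
  The list \<open>[]\<close> is the root.\<close>

definition gw_tree :: "(nat list \<Rightarrow> nat) \<Rightarrow> nat list sgraph" where
  "gw_tree \<xi> = (let V = {u. \<forall>i<length u. u ! i < \<xi> (take i u)}
     in SGraph V {{u, u @ [k]} |u k. u @ [k] \<in> V})"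

definition poisson_offspring :: "(nat list \<Rightarrow> nat) measure" where
  "poisson_offspring = (\<Pi>\<^sub>M u\<in>UNIV. measure_pmf (poisson_pmf 1))"

definition survives :: "nat \<Rightarrow> (nat list \<Rightarrow> nat) set" where
  "survives m = {\<xi>. \<exists>u\<in>verts (gw_tree \<xi>). length u = m}"

text \<open>The law \<open>\<mu>\<close> is that of the Poisson(1) Galton--Watson tree conditioned to survive forever;
  \<^const>\<open>uniform_measure\<close> is conditioning on an event.\<close>

definition poisson_gw_surviving :: "rgraph measure \<Rightarrow> bool" where
  "poisson_gw_surviving \<mu> \<longleftrightarrow> prob_space \<mu> \<and> sets \<mu> = sets borel \<and>
     (\<forall>r. conv_in_distr
       (\<lambda>m. distr (uniform_measure poisson_offspring (survives m))
              borel (\<lambda>\<xi>. rgraph_of (gball (gw_tree \<xi>) [] r)))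
       (distr \<mu> borel (rball r)))"

section \<open>High degree almost regular sequences\<close>

definition high_degree_almost_regular :: "(nat \<Rightarrow> 'a sgraph) \<Rightarrow> bool" where
  "high_degree_almost_regular G \<longleftrightarrow>
     (\<forall>n\<ge>1. finite (verts (G n)) \<and> simple_graph (G n) \<and> gconnected (G n)) \<and>
     (\<exists>(d :: nat \<Rightarrow> real) (\<delta> :: nat \<Rightarrow> real).
        filterlim d at_top sequentially \<and> \<delta> \<longlonglongrightarrow> 0 \<and>
        (\<forall>n\<ge>1.
           real (card {v \<in> verts (G n). \<bar>real (degree (G n) v) - d n\<bar> \<le> \<delta> n * d n})
             \<ge> (1 - \<delta> n) * real (card (verts (G n))) \<and>
           \<bar>(\<Sum>v\<in>verts (G n). real (degree (G n) v)) - d n * real (card (verts (G n)))\<bar>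
             \<le> \<delta> n * d n * real (card (verts (G n)))))"

end

theory Submission
  imports Defs
begin

text \<open>Only lower bounds on ball probabilities are needed. The \<open>r\<close>-ball of Kesten's tree always has height \<open>r\<close>,
  and it is isomorphic to \<open>T\<close> with probability exactly \<open>|T\<^sub>r| e\<^bsup>-|V(T)|+|T\<^sub>r|\<^esup> / |Stab\<^sub>T|\<close>. These atoms
  have total mass one, so any sequence of laws whose atoms are asymptotically at least as large converges.

  For the spanning tree, fix a copy of \<open>T\<close> in \<open>G\<close> with \<open>m\<close> inner vertices \<open>I\<close> and \<open>k\<close> vertices \<open>L\<close> on level \<open>r\<close>.
  The spanning trees whose ball around the root of the copy is that copy correspond to the forests of
  \<open>G - I\<close> rooted at \<open>L\<close>. Their number is at least about \<open>k e\<^bsup>-m\<^esup> d\<^bsup>-(k+m-1)\<^esup>\<close> times the number of spanning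
  trees, provided the edges of the copy have effective resistance close to the minimal value \<open>2/d\<close>. Near-minimal
  resistance makes the neighbourhood averages of every function of bounded energy nearly agree along such
  edges; this identifies the network with \<open>I\<close> wired, and an interpolation between wiring and deleting \<open>I\<close>
  yields the factor \<open>e\<^bsup>-m\<^esup>\<close>. By Foster's theorem and almost regularity nearly all edges have this property,
  so that \<open>G\<close> contains about \<open>|V(G)| d\<^bsup>k+m-1\<^esup>\<close> labelled copies of \<open>T\<close>, and each tree with ball \<open>T\<close> is
  counted \<open>|Stab\<^sub>T|\<close> times.

  For the Galton--Watson trees the ball probabilities are computed by summing over the labelings of \<open>T\<close> by
  Ulam--Harris words, which are also counted \<open>|Stab\<^sub>T|\<close> times.\<close>

section \<open>Rooted forests as parent maps\<close>

text \<open>The value \<open>2/d\<close> is forced by Foster's theorem: the resistances of all edges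
  sum to \<open>|V|\<close> minus one, there are about \<open>|V| d / 2\<close> edges, and the
  degrees of the endpoints alone already force about \<open>2/d\<close> at a typical edge. So almost
  every edge meets its lower bound nearly with equality. The obstacle is that nothing is assumed
  about expansion, so there is no spectral gap, and resistances are controlled only across typical
  edges. The argument therefore works with traces and Gram matrices of Green functions. A Gram
  matrix has Hilbert-Schmidt norm at most its trace; once an explicit main part is subtracted and
  the remaining trace is seen to be nearly zero, the whole remainder is small. The exponent
  \<open>-m\<close> arises as minus a trace, \<open>E - 1\<close> with \<open>E\<close> close to
  \<open>m + 1\<close>. Forests are encoded by parent pointers so that the weight of a forest is a
  product over vertices and the Laplace equations of the Green function come from redirecting a
  single pointer.\<close>

definition leads :: "('a \<Rightarrow> 'a) \<Rightarrow> 'a \<Rightarrow> 'a \<Rightarrow> bool" where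
  "leads f x y \<longleftrightarrow> (\<exists>k. (f ^^ k) x = y)"

text \<open>A forest on \<open>V\<close> with root set \<open>R\<close> is encoded by its parent map, made unique by letting it
  fix the roots and everything outside \<open>V\<close>.\<close>

definition pforest :: "'a set \<Rightarrow> 'a set \<Rightarrow> ('a \<Rightarrow> 'a) set" where
  "pforest V R = {f. (\<forall>v. v \<notin> V - R \<longrightarrow> f v = v) \<and> (\<forall>v\<in>V - R. f v \<in> V) \<and> (\<forall>v\<in>V. \<exists>k. (f ^^ k) v \<in> R)}"

lemma funpow_fixed: "f r = r \<Longrightarrow> (f ^^ k) r = r"
  by (induction k) auto

lemma leads_refl [simp]: "leads f x x"
  unfolding leads_def by (intro exI[of _ 0]) simp

lemma leads_step: "leads f x y \<longleftrightarrow> x = y \<or> leads f (f x) y"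
proof
  assume "leads f x y"
  then obtain k where k: "(f ^^ k) x = y" by (auto simp: leads_def)
  show "x = y \<or> leads f (f x) y"
  proof (cases k)
    case (Suc m)
    then have "(f ^^ m) (f x) = y" using k by (simp add: funpow_swap1)
    then show ?thesis by (auto simp: leads_def)
  qed (use k in simp)
next
  assume "x = y \<or> leads f (f x) y"
  then show "leads f x y"
  proof
    assume "leads f (f x) y"
    then obtain m where "(f ^^ m) (f x) = y" by (auto simp: leads_def)
    then have "(f ^^ Suc m) x = y" by (simp add: funpow_swap1)
    then show ?thesis unfolding leads_def by blast
  qed simp
qed

lemma leads_trans: "leads f x y \<Longrightarrow> leads f y z \<Longrightarrow> leads f x z"
  unfolding leads_def by (metis funpow_add comp_apply)

lemma leads_fixed: "f r = r \<Longrightarrow> leads f r y \<longleftrightarrow> y = r"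
  unfolding leads_def by (auto simp: funpow_fixed)

lemma leads_via:
  assumes "leads f z x" "f y = y" "x \<noteq> y \<or> f x = x"
  shows "leads f z y \<longleftrightarrow> leads f x y"
proof
  assume "leads f z y"
  then obtain j where j: "(f ^^ j) z = y" by (auto simp: leads_def)
  obtain k where k: "(f ^^ k) z = x" using assms(1) by (auto simp: leads_def)
  show "leads f x y"
  proof (cases "k \<le> j")
    case True
    then have "(f ^^ (j - k)) x = y" using j k by (metis funpow_add comp_apply le_add_diff_inverse2)
    then show ?thesis by (auto simp: leads_def)
  next
    case False
    then have "(f ^^ (k - j)) y = x" using j k by (metis funpow_add comp_apply le_add_diff_inverse2 nat_le_linear)
    then show ?thesis using funpow_fixed[of f y] assms(2) by (auto simp: leads_def)
  qed
next
  show "leads f x y \<Longrightarrow> leads f z y" using assms(1) leads_trans by metis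
qed

lemma funpow_upd:
  assumes "\<not> leads f z x"
  shows "((f(x := q)) ^^ k) z = (f ^^ k) z"
proof (induction k)
  case (Suc k)
  have "(f ^^ k) z \<noteq> x" using assms by (auto simp: leads_def)
  then show ?case using Suc by simp
qed simp

lemma leads_upd: "\<not> leads f z x \<Longrightarrow> leads (f(x := q)) z y \<longleftrightarrow> leads f z y"
  by (simp add: leads_def[of "f(x := q)"] funpow_upd) (simp add: leads_def)

lemma pforestD:
  assumes "f \<in> pforest V R"
  shows "v \<notin> V \<Longrightarrow> f v = v" "v \<in> R \<Longrightarrow> f v = v" "v \<in> V \<Longrightarrow> f v \<in> V"
    "v \<in> V \<Longrightarrow> \<exists>r\<in>R. leads f v r"
  using assms unfolding pforest_def leads_def by (auto, metis DiffI)

lemma pforest_funpow_V: "f \<in> pforest V R \<Longrightarrow> v \<in> V \<Longrightarrow> (f ^^ k) v \<in> V"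
  by (induction k) (auto dest: pforestD(3))

lemma pforestI:
  assumes "\<And>v. v \<notin> V \<Longrightarrow> f v = v" "\<And>v. v \<in> R \<Longrightarrow> f v = v" "\<And>v. v \<in> V \<Longrightarrow> v \<notin> R \<Longrightarrow> f v \<in> V"
    "\<And>v. v \<in> V \<Longrightarrow> \<exists>r\<in>R. leads f v r"
  shows "f \<in> pforest V R"
  using assms unfolding pforest_def leads_def by (auto, metis)

text \<open>A cycle through \<open>x\<close> makes its orbit periodic, whereas the orbit reaches
  \<open>R\<close> after some \<open>n\<close> steps and then stays put; after
  \<open>Suc k * n\<close> steps both would hold at once.\<close>

lemma pforest_acyclic:
  assumes f: "f \<in> pforest V R" and x: "x \<in> V - R"
  shows "\<not> leads f (f x) x"
proof
  assume "leads f (f x) x"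
  then obtain k where "(f ^^ k) (f x) = x" by (auto simp: leads_def)
  then have c: "(f ^^ Suc k) x = x" by (simp add: funpow_swap1)
  have p: "(f ^^ (Suc k * n)) x = x" for n
  proof (induction n)
    case (Suc n)
    have "(f ^^ (Suc k * Suc n)) x = (f ^^ (Suc k * n)) ((f ^^ Suc k) x)"
      by (metis funpow_add comp_apply mult_Suc_right add.commute)
    then show ?case using c Suc by simp
  qed simp
  obtain n where n: "(f ^^ n) x \<in> R" using f x by (auto simp: pforest_def)
  have "(f ^^ (k * n)) ((f ^^ n) x) = (f ^^ n) x" by (rule funpow_fixed) (rule pforestD(2)[OF f n])
  moreover have "(f ^^ (k * n)) ((f ^^ n) x) = (f ^^ (Suc k * n)) x"
    by (metis funpow_add comp_apply add.commute mult_Suc)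
  ultimately show False using p[of n] n x by simp
qed

lemma pforest_neq: "f \<in> pforest V R \<Longrightarrow> x \<in> V - R \<Longrightarrow> f x \<noteq> x"
  using pforest_acyclic[of f V R x] by auto

definition pdepth :: "('a \<Rightarrow> 'a) \<Rightarrow> 'a set \<Rightarrow> 'a \<Rightarrow> nat" where
  "pdepth f R v = (LEAST k. (f ^^ k) v \<in> R)"

lemma pdepth_root [simp]: "v \<in> R \<Longrightarrow> pdepth f R v = 0"
  unfolding pdepth_def by (rule Least_equality) auto

lemma pdepth_step:
  assumes f: "f \<in> pforest V R" and x: "x \<in> V - R"
  shows "pdepth f R x = Suc (pdepth f R (f x))"
proof -
  obtain n where n: "(f ^^ n) x \<in> R" using f x by (auto simp: pforest_def)
  have "(LEAST k. (f ^^ k) x \<in> R) = Suc (LEAST m. (f ^^ Suc m) x \<in> R)"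
    by (rule Least_Suc[where P = "\<lambda>k. (f ^^ k) x \<in> R", OF n]) (use x in simp)
  then show ?thesis by (simp add: pdepth_def funpow_swap1)
qed

lemma pforest_induct [consumes 2, case_names root step]:
  assumes f: "f \<in> pforest V R" and x: "x \<in> V"
    and "\<And>r. r \<in> R \<Longrightarrow> r \<in> V \<Longrightarrow> P r" "\<And>v. v \<in> V - R \<Longrightarrow> P (f v) \<Longrightarrow> P v"
  shows "P x"
  using x
proof (induction "pdepth f R x" arbitrary: x rule: less_induct)
  case less
  show ?case
  proof (cases "x \<in> R")
    case False
    then have "x \<in> V - R" using less.prems by simp
    then show ?thesis using less.hyps[of "f x"] pdepth_step[OF f] pforestD(3)[OF f] assms(4) by auto
  qed (use less.prems assms(3) in auto)
qed

lemma leads_rootD: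
  assumes "f \<in> pforest V R" "leads f x y" "leads f x z" "y \<in> R" "z \<in> R"
  shows "y = z"
  using leads_via[of f x y z] leads_fixed[of f y z] pforestD(2)[OF assms(1)] assms by metis

text \<open>The two choices of \<open>S\<close> cover two uses: moving the pointer of a non-root
  \<open>x\<close>, and hanging the tree of a root \<open>x\<close> elsewhere. The new parent
  \<open>z\<close> must not be a descendant of \<open>x\<close>, so that no cycle arises.\<close>

lemma pforest_upd:
  assumes f: "f \<in> pforest V S" and S: "S = R \<or> S = insert x R" and x: "x \<in> V - R" and z: "z \<in> V"
    and n: "\<not> leads f z x"
  shows "f(x := z) \<in> pforest V R"
proof (rule pforestI)
  fix v assume v: "v \<in> V"
  obtain s where s: "s \<in> S" "leads f z s" using pforestD(4)[OF f z] by auto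
  have sR: "s \<in> R" using s S n by auto
  have lz: "leads (f(x := z)) z s" using s leads_upd[OF n] by blast
  have lx: "leads (f(x := z)) x s" using leads_step[of "f(x := z)" x s] lz by simp
  from f v show "\<exists>r\<in>R. leads (f(x := z)) v r"
  proof (induction rule: pforest_induct)
    case (root r)
    then show ?case by (metis S insertE leads_refl lx sR)
  next
    case (step v)
    then show ?case using lx sR leads_step[of "f(x := z)" v] by (metis fun_upd_other)
  qed
qed (use f S x z in \<open>auto dest: pforestD\<close>)

lemma pforest_cut:
  assumes f: "f \<in> pforest V R" and x: "x \<in> V - R"
  shows "f(x := x) \<in> pforest V (insert x R)" "\<not> leads (f(x := x)) (f x) x"
proof -
  have n: "\<not> leads f (f x) x" by (rule pforest_acyclic[OF assms])
  show "\<not> leads (f(x := x)) (f x) x" using n leads_upd by metis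
  show "f(x := x) \<in> pforest V (insert x R)"
  proof (rule pforestI)
    fix v assume "v \<in> V"
    with f show "\<exists>r\<in>insert x R. leads (f(x := x)) v r"
    proof (induction rule: pforest_induct)
      case (root r)
      then show ?case by (metis insertI2 leads_refl)
    next
      case (step v)
      then show ?case using leads_step[of "f(x := x)" v] by (metis fun_upd_other insertI1 leads_refl)
    qed
  qed (use f x in \<open>auto dest: pforestD\<close>)
qed

lemma finite_pforest: "finite V \<Longrightarrow> finite (pforest V R)"
proof (rule finite_imageD[where f = "\<lambda>f. restrict f V"])
  assume "finite V"
  then show "finite ((\<lambda>f. restrict f V) ` pforest V R)"
    by (intro finite_subset[OF _ finite_PiE[of V "\<lambda>_. V"]]) (auto dest: pforestD(3))
  show "inj_on (\<lambda>f. restrict f V) (pforest V R)"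
  proof (rule inj_onI, rule ext)
    fix f g v assume a: "f \<in> pforest V R" "g \<in> pforest V R" "restrict f V = restrict g V"
    show "f v = g v"
      using pforestD(1)[OF a(1), of v] pforestD(1)[OF a(2), of v] fun_cong[OF a(3), of v] by (cases "v \<in> V") auto
  qed
qed

section \<open>Weighted networks\<close>

locale network =
  fixes V :: "'a set" and w :: "'a \<Rightarrow> 'a \<Rightarrow> real"
  assumes finV [simp]: "finite V" and w_sym: "w x y = w y x" and w_nonneg [simp]: "0 \<le> w x y"
begin

definition weight :: "'a set \<Rightarrow> ('a \<Rightarrow> 'a) \<Rightarrow> real" where
  "weight R f = (\<Prod>v\<in>V - R. w v (f v))"

definition forests :: "'a set \<Rightarrow> real" where
  "forests R = (\<Sum>f\<in>pforest V R. weight R f)"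

definition forests_to :: "'a set \<Rightarrow> 'a \<Rightarrow> 'a \<Rightarrow> real" where
  "forests_to R y z = (\<Sum>f\<in>pforest V (insert y R). of_bool (leads f z y) * weight (insert y R) f)"

lemma finP [simp]: "finite (pforest V R)"
  by (rule finite_pforest) simp

lemma weight_nonneg [simp]: "0 \<le> weight R f"
  unfolding weight_def by (intro prod_nonneg) auto

lemma forests_nonneg [simp]: "0 \<le> forests R"
  unfolding forests_def by (intro sum_nonneg) auto

lemma forests_to_nonneg [simp]: "0 \<le> forests_to R y z"
  unfolding forests_to_def by (intro sum_nonneg) auto

lemma weight_upd: "x \<in> V - R \<Longrightarrow> weight R (f(x := z)) * w x (f x) = weight R f * w x z"
  unfolding weight_def by (subst (1 2) prod.remove[of _ x]) (auto intro!: prod.cong)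

lemma weight_insert: "x \<in> V - R \<Longrightarrow> weight R f = w x (f x) * weight (insert x R) f"
proof -
  assume x: "x \<in> V - R"
  have "V - insert x R = (V - R) - {x}" by auto
  then show ?thesis unfolding weight_def using x by (simp add: prod.remove[of _ x])
qed

lemma weight_insert_upd: "weight (insert x R) (f(x := z)) = weight (insert x R) f"
  unfolding weight_def by (intro prod.cong) auto

text \<open>Hanging the root \<open>y\<close> onto a vertex \<open>z\<close> outside its own tree is
  a bijection onto the forests rooted at \<open>R\<close>; cutting at \<open>y\<close> is the
  inverse.\<close>

lemma green_self:
  assumes y: "y \<in> V - R"
  shows "(\<Sum>z\<in>V. w y z * (forests (insert y R) - forests_to R y z)) = forests R"
proof -
  let ?P = "pforest V (insert y R)"
  have "(\<Sum>z\<in>V. w y z * (forests (insert y R) - forests_to R y z)) =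
      (\<Sum>z\<in>V. \<Sum>f\<in>?P. if leads f z y then 0 else w y z * weight (insert y R) f)"
    unfolding forests_def forests_to_def sum_subtractf[symmetric] sum_distrib_left
    by (intro sum.cong refl) auto
  also have "\<dots> = (\<Sum>(f, z)\<in>?P \<times> V. if leads f z y then 0 else w y z * weight (insert y R) f)"
    by (subst sum.swap) (simp add: sum.cartesian_product)
  also have "\<dots> = (\<Sum>(f, z)\<in>{(f, z). f \<in> ?P \<and> z \<in> V \<and> \<not> leads f z y}. w y z * weight (insert y R) f)"
    by (rule sum.mono_neutral_cong_right) auto
  also have "\<dots> = (\<Sum>f\<in>pforest V R. weight R f)"
  proof (rule sum.reindex_bij_witness[where i = "\<lambda>f. (f(y := y), f y)" and j = "\<lambda>(f, z). f(y := z)"])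
    fix a assume "a \<in> {(f, z). f \<in> ?P \<and> z \<in> V \<and> \<not> leads f z y}"
    then obtain f z where a: "a = (f, z)" "f \<in> ?P" "z \<in> V" "\<not> leads f z y" by auto
    have "f y = y" using a(2) by (auto dest: pforestD)
    then have "f(y := y) = f" by auto
    then show "(((case a of (f, z) \<Rightarrow> f(y := z))(y := y)), (case a of (f, z) \<Rightarrow> f(y := z)) y) = a"
      by (simp add: a(1))
    show "(case a of (f, z) \<Rightarrow> f(y := z)) \<in> pforest V R"
      using pforest_upd[OF a(2) _ y a(3,4)] by (simp add: a(1))
    show "weight R (case a of (f, z) \<Rightarrow> f(y := z)) = (case a of (f, z) \<Rightarrow> w y z * weight (insert y R) f)"
      using y by (simp add: a(1) weight_insert weight_insert_upd)
  next
    fix f assume f: "f \<in> pforest V R"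
    show "(f(y := y), f y) \<in> {(f, z). f \<in> ?P \<and> z \<in> V \<and> \<not> leads f z y}"
      using pforest_cut[OF f y] pforestD(3)[OF f] y by auto
  qed auto
  finally show ?thesis by (simp add: forests_def)
qed

text \<open>Redirecting the pointer of \<open>x\<close> to a vertex \<open>z\<close> that is not a descendant of \<open>x\<close> is an
  involution on pairs (forest, \<open>z\<close>).\<close>

lemma green_other:
  assumes x: "x \<in> V - insert y R"
  shows "(\<Sum>z\<in>V. w x z * (forests_to R y x - forests_to R y z)) = 0"
proof -
  let ?R = "insert y R" and ?P = "pforest V (insert y R)"
  let ?Q = "{(f, z). f \<in> ?P \<and> z \<in> V \<and> \<not> leads f z x}"
  let ?b = "\<lambda>f z. of_bool (leads f z y) :: real"
  \<comment> \<open>If \<open>z\<close> is a descendant of \<open>x\<close>, both end in the same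
    root and the difference vanishes. What remains are the pairs in \<open>?Q\<close>, where
    redirecting creates no cycle.\<close>
  have via: "leads f z y \<longleftrightarrow> leads f x y" if "f \<in> ?P" "leads f z x" for f z
    using leads_via[OF that(2)] pforestD(2)[OF that(1), of y] x by auto
  have "(\<Sum>z\<in>V. w x z * (forests_to R y x - forests_to R y z)) =
      (\<Sum>z\<in>V. \<Sum>f\<in>?P. (?b f x - ?b f z) * (weight ?R f * w x z))"
    unfolding forests_to_def sum_subtractf[symmetric] sum_distrib_left
    by (intro sum.cong refl) (auto simp: algebra_simps)
  also have "\<dots> = (\<Sum>(f, z)\<in>?P \<times> V. (?b f x - ?b f z) * (weight ?R f * w x z))"
    by (subst sum.swap) (simp add: sum.cartesian_product)
  also have "\<dots> = (\<Sum>(f, z)\<in>?Q. (?b f x - ?b f z) * (weight ?R f * w x z))"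
  proof (rule sum.mono_neutral_right)
    show "\<forall>a\<in>?P \<times> V - ?Q. (case a of (f, z) \<Rightarrow> (?b f x - ?b f z) * (weight ?R f * w x z)) = 0"
    proof
      fix a assume "a \<in> ?P \<times> V - ?Q"
      then obtain f z where "a = (f, z)" "f \<in> ?P" "leads f z x" by auto
      then show "(case a of (f, z) \<Rightarrow> (?b f x - ?b f z) * (weight ?R f * w x z)) = 0"
        using via[of f z] by simp
    qed
  qed auto
  also have "\<dots> = (\<Sum>(f, z)\<in>?Q. ?b f x * (weight ?R f * w x z)) - (\<Sum>(f, z)\<in>?Q. ?b f z * (weight ?R f * w x z))"
    by (simp add: sum_subtractf[symmetric] case_prod_beta left_diff_distrib)
  also have "(\<Sum>(f, z)\<in>?Q. ?b f x * (weight ?R f * w x z)) = (\<Sum>(f, z)\<in>?Q. ?b f z * (weight ?R f * w x z))"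
  proof (rule sum.reindex_bij_witness[where i = "\<lambda>(f, z). (f(x := z), f x)" and j = "\<lambda>(f, z). (f(x := z), f x)"])
    fix a assume "a \<in> ?Q"
    then obtain f z where a: "a = (f, z)" "f \<in> ?P" "z \<in> V" "\<not> leads f z x" by auto
    have n: "\<not> leads f (f x) x" by (rule pforest_acyclic[OF a(2) x])
    have m: "leads (f(x := z)) (f x) y \<longleftrightarrow> leads f x y"
      using leads_upd[OF n] leads_step[of f x y] x by auto
    show "(case case a of (f, z) \<Rightarrow> (f(x := z), f x) of (f, z) \<Rightarrow> (f(x := z), f x)) = a"
      by (simp add: a(1))
    show "(case a of (f, z) \<Rightarrow> (f(x := z), f x)) \<in> ?Q"
      using pforest_upd[OF a(2) _ x a(3,4)] pforestD(3)[OF a(2)] x leads_upd[OF n] n by (auto simp: a(1))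
    show "(case (case a of (f, z) \<Rightarrow> (f(x := z), f x)) of (f, z) \<Rightarrow> ?b f z * (weight ?R f * w x z)) =
        (case a of (f, z) \<Rightarrow> ?b f x * (weight ?R f * w x z))"
      using m weight_upd[OF x, of f z] by (simp add: a(1))
  next
    fix a assume "a \<in> ?Q"
    then obtain f z where a: "a = (f, z)" "f \<in> ?P" "z \<in> V" "\<not> leads f z x" by auto
    have n: "\<not> leads f (f x) x" by (rule pforest_acyclic[OF a(2) x])
    show "(case case a of (f, z) \<Rightarrow> (f(x := z), f x) of (f, z) \<Rightarrow> (f(x := z), f x)) = a"
      by (simp add: a(1))
    show "(case a of (f, z) \<Rightarrow> (f(x := z), f x)) \<in> ?Q"
      using pforest_upd[OF a(2) _ x a(3,4)] pforestD(3)[OF a(2)] x leads_upd[OF n] n by (auto simp: a(1))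
  qed
  finally show ?thesis by simp
qed

lemma forests_to_root: "z \<in> R \<Longrightarrow> y \<notin> R \<Longrightarrow> forests_to R y z = 0"
proof -
  assume z: "z \<in> R" "y \<notin> R"
  have "\<not> leads f z y" if "f \<in> pforest V (insert y R)" for f
    using leads_fixed[of f z y] pforestD(2)[OF that, of z] z by auto
  then show ?thesis unfolding forests_to_def by (intro sum.neutral) auto
qed

lemma forests_to_self: "forests_to R y y = forests (insert y R)"
  unfolding forests_to_def forests_def by simp

end

section \<open>Energy and Green functions\<close>

context network
begin

definition lap :: "('a \<Rightarrow> real) \<Rightarrow> 'a \<Rightarrow> real" where
  "lap h x = (\<Sum>z\<in>V. w x z * (h x - h z))"

definition en :: "('a \<Rightarrow> real) \<Rightarrow> ('a \<Rightarrow> real) \<Rightarrow> real" where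
  "en f h = (\<Sum>x\<in>V. \<Sum>y\<in>V. w x y * (f x - f y) * (h x - h y)) / 2"

text \<open>By the all-minors matrix-tree theorem this is the inverse of the Laplacian killed on \<open>R\<close>; only the
  equations \<open>green_self\<close> and \<open>green_other\<close> are needed.\<close>

definition gr :: "'a set \<Rightarrow> 'a \<Rightarrow> 'a \<Rightarrow> real" where
  "gr R y z = (if y \<in> R then 0 else forests_to R y z / forests R)"

definition wdeg :: "'a \<Rightarrow> real" where
  "wdeg x = (\<Sum>z\<in>V. w x z)"

lemma wdeg_nonneg [simp]: "0 \<le> wdeg x"
  unfolding wdeg_def by (intro sum_nonneg) auto

lemma en_sym: "en f h = en h f"
  unfolding en_def by (simp add: ac_simps)

lemma en_add_left: "en (\<lambda>x. f x + g x) h = en f h + en g h"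
  unfolding en_def add_divide_distrib[symmetric] sum.distrib[symmetric]
  by (intro arg_cong2[where f = "(/)"] sum.cong refl) (auto simp: algebra_simps)

lemma en_cmult_left: "en (\<lambda>x. c * f x) h = c * en f h"
  unfolding en_def times_divide_eq_right sum_distrib_left
  by (intro arg_cong2[where f = "(/)"] sum.cong refl) (auto simp: algebra_simps)

lemma en_diff_left: "en (\<lambda>x. f x - g x) h = en f h - en g h"
  using en_add_left[of f "\<lambda>x. (-1) * g x" h] en_cmult_left[of "-1" g h] by simp

lemma en_diff_right: "en h (\<lambda>x. f x - g x) = en h f - en h g"
  using en_diff_left en_sym by metis

lemma en_cmult_right: "en h (\<lambda>x. c * f x) = c * en h f"
  using en_cmult_left en_sym by metis

lemma en_const_left [simp]: "en (\<lambda>x. c) h = 0"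
  by (simp add: en_def)

lemma en_const_right [simp]: "en h (\<lambda>x. c) = 0"
  by (simp add: en_def)

lemma en_nonneg [simp]: "0 \<le> en f f"
  unfolding en_def by (intro divide_nonneg_nonneg sum_nonneg) (auto simp: mult.assoc)

lemma en_CS: "(en f h)\<^sup>2 \<le> en f f * en h h"
proof -
  let ?I = "V \<times> V"
  let ?a = "\<lambda>f p. sqrt (w (fst p) (snd p)) * (f (fst p) - f (snd p))"
  have e: "(\<Sum>p\<in>?I. ?a f p * ?a h p) = 2 * en f h" for f h
  proof -
    have "(\<Sum>p\<in>?I. ?a f p * ?a h p) = (\<Sum>p\<in>?I. w (fst p) (snd p) * (f (fst p) - f (snd p)) * (h (fst p) - h (snd p)))"
    proof (rule sum.cong[OF refl])
      fix p
      have "?a f p * ?a h p = (sqrt (w (fst p) (snd p)) * sqrt (w (fst p) (snd p))) * (f (fst p) - f (snd p)) * (h (fst p) - h (snd p))"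
        by (simp only: ac_simps)
      then show "?a f p * ?a h p = w (fst p) (snd p) * (f (fst p) - f (snd p)) * (h (fst p) - h (snd p))"
        by simp
    qed
    then show ?thesis by (simp add: en_def sum.cartesian_product case_prod_beta)
  qed
  have "(\<Sum>p\<in>?I. ?a f p * ?a h p)\<^sup>2 \<le> (\<Sum>p\<in>?I. (?a f p)\<^sup>2) * (\<Sum>p\<in>?I. (?a h p)\<^sup>2)"
    by (rule Cauchy_Schwarz_ineq_sum)
  then show ?thesis using e[of f h] e[of f f] e[of h h] by (simp add: power2_eq_square)
qed

text \<open>Summation by parts; the two halves of the double sum agree by symmetry of
  \<open>w\<close>.\<close>

lemma en_lap: "en f h = (\<Sum>x\<in>V. f x * lap h x)"
proof -
  have "(\<Sum>x\<in>V. \<Sum>y\<in>V. w x y * f y * (h y - h x)) = (\<Sum>x\<in>V. \<Sum>y\<in>V. w x y * f x * (h x - h y))"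
    by (subst sum.swap) (simp add: w_sym)
  moreover have "(\<Sum>x\<in>V. \<Sum>y\<in>V. w x y * (f x - f y) * (h x - h y)) =
      (\<Sum>x\<in>V. \<Sum>y\<in>V. w x y * f x * (h x - h y)) + (\<Sum>x\<in>V. \<Sum>y\<in>V. w x y * f y * (h y - h x))"
    unfolding sum.distrib[symmetric] by (intro sum.cong refl) (simp add: algebra_simps)
  ultimately show ?thesis
    unfolding en_def lap_def sum_distrib_left by (simp add: ac_simps)
qed

lemma sum_lap: "(\<Sum>x\<in>V. lap h x) = 0"
  using en_lap[of "\<lambda>_. 1" h] by simp

lemma gr_root: "z \<in> R \<Longrightarrow> gr R y z = 0"
  by (simp add: gr_def forests_to_root)

lemma gr_nonneg [simp]: "0 \<le> gr R y z"
  by (simp add: gr_def)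

lemma gr_diag: "y \<notin> R \<Longrightarrow> gr R y y = forests (insert y R) / forests R"
  by (simp add: gr_def forests_to_self)

lemma lap_gr:
  assumes F: "forests R > 0" and x: "x \<in> V - R" and y: "y \<in> V - R"
  shows "lap (gr R y) x = of_bool (x = y)"
proof -
  have "lap (gr R y) x = (\<Sum>z\<in>V. w x z * (forests_to R y x - forests_to R y z)) / forests R"
    using y by (simp add: lap_def gr_def sum_divide_distrib flip: diff_divide_distrib)
  also have "\<dots> = of_bool (x = y)"
  proof (cases "x = y")
    case True
    then show ?thesis using green_self[OF y] F by (simp add: forests_to_self)
  next
    case False
    then show ?thesis using green_other[of x y R] x by simp
  qed
  finally show ?thesis .
qed

text \<open>The reproducing property: the Laplacian of \<open>gr R y\<close> is a point mass off
  \<open>R\<close>, and \<open>f\<close> kills the terms on \<open>R\<close>. Combined with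
  Cauchy-Schwarz it turns test functions into bounds on \<open>gr\<close>.\<close>

lemma en_gr:
  assumes F: "forests R > 0" and y: "y \<in> V" and f: "\<And>x. x \<in> R \<Longrightarrow> f x = 0"
  shows "en f (gr R y) = f y"
proof (cases "y \<in> R")
  case True
  then have "gr R y = (\<lambda>_. 0)" by (simp add: gr_def fun_eq_iff)
  then show ?thesis using f True by simp
next
  case False
  have "en f (gr R y) = (\<Sum>x\<in>V. if x = y then f x else 0)"
    unfolding en_lap
  proof (rule sum.cong[OF refl])
    fix x assume x: "x \<in> V"
    show "f x * lap (gr R y) x = (if x = y then f x else 0)"
      using lap_gr[OF F, of x y] x y False f[of x] by (cases "x \<in> R") auto
  qed
  then show ?thesis using y by simp
qed

lemma en_gr': "forests R > 0 \<Longrightarrow> y \<in> V \<Longrightarrow> (\<And>x. x \<in> R \<Longrightarrow> f x = 0) \<Longrightarrow> en (gr R y) f = f y"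
  using en_gr en_sym by metis

lemma en_gr_gr: "forests R > 0 \<Longrightarrow> x \<in> V \<Longrightarrow> y \<in> V \<Longrightarrow> en (gr R x) (gr R y) = gr R x y"
  using en_gr[of R y "gr R x"] gr_root by auto

lemma gr_sym: "forests R > 0 \<Longrightarrow> x \<in> V \<Longrightarrow> y \<in> V \<Longrightarrow> gr R x y = gr R y x"
  using en_gr_gr en_sym by metis

lemma gr_lower:
  assumes F: "forests R > 0" and x: "x \<in> V" and f: "\<And>x. x \<in> R \<Longrightarrow> f x = 0"
  shows "(f x)\<^sup>2 \<le> gr R x x * en f f"
  using en_CS[of f "gr R x"] en_gr[OF assms] en_gr_gr[OF F x x] by (simp add: mult.commute)

text \<open>In a forest with the two roots \<open>u\<close> and \<open>l\<close> every vertex leads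
  to exactly one of them.\<close>

lemma forests_to_total:
  assumes "z \<in> V"
  shows "forests_to {l} u z + (if u = l then 0 else forests_to {u} l z) = forests {u, l}"
proof (cases "u = l")
  case True
  have "forests_to {l} l z = forests {l}"
    unfolding forests_to_def forests_def insert_absorb2
    by (rule sum.cong[OF refl]) (use pforestD(4)[OF _ assms] in fastforce)
  then show ?thesis using True by simp
next
  case False
  have "forests_to {l} u z + forests_to {u} l z = forests {u, l}"
    unfolding forests_to_def forests_def insert_commute[of l u] sum.distrib[symmetric]
  proof (rule sum.cong[OF refl])
    fix f assume f: "f \<in> pforest V {u, l}"
    have "leads f z u \<longleftrightarrow> \<not> leads f z l"
      using pforestD(4)[OF f assms] leads_rootD[OF f, of z u l] False by auto
    then show "of_bool (leads f z u) * weight {u, l} f + of_bool (leads f z l) * weight {u, l} f = weight {u, l} f"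
      by simp
  qed
  then show ?thesis using False by simp
qed

text \<open>The function \<open>?h\<close> has Laplacian \<open>forests {l}\<close> at
  \<open>u\<close>, \<open>- forests {u}\<close> at \<open>l\<close> and zero elsewhere, and a
  Laplacian sums to zero.\<close>

lemma forests_single:
  assumes u: "u \<in> V" and l: "l \<in> V"
  shows "forests {u} = forests {l}"
proof (cases "u = l")
  case False
  let ?h = "forests_to {l} u"
  have 1: "lap ?h u = forests {l}"
    using green_self[of u "{l}"] u False unfolding lap_def by (simp add: forests_to_self)
  have 2: "lap ?h l = - forests {u}"
  proof -
    have "lap ?h l = (\<Sum>z\<in>V. - (w l z * (forests (insert l {u}) - forests_to {u} l z)))"
      unfolding lap_def
    proof (rule sum.cong[OF refl])
      fix z assume z: "z \<in> V"
      have "?h l = 0" using forests_to_root[of l "{l}" u] False by simp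
      then show "w l z * (?h l - ?h z) = - (w l z * (forests (insert l {u}) - forests_to {u} l z))"
        using forests_to_total[OF z, of l u] False
        by (simp add: insert_commute eq_diff_eq[symmetric]) (simp add: algebra_simps)
    qed
    then show ?thesis using green_self[of l "{u}"] l False by (simp add: sum_negf)
  qed
  have 3: "lap ?h x = 0" if "x \<in> V - {u, l}" for x
    using green_other[of x u "{l}"] that unfolding lap_def by (simp add: insert_commute)
  have "(\<Sum>x\<in>V. lap ?h x) = lap ?h u + (\<Sum>x\<in>V - {u}. lap ?h x)"
    using u by (simp add: sum.remove)
  also have "(\<Sum>x\<in>V - {u}. lap ?h x) = lap ?h l + (\<Sum>x\<in>V - {u} - {l}. lap ?h x)"
    using l False by (subst sum.remove[of _ l]) auto
  also have "(\<Sum>x\<in>V - {u} - {l}. lap ?h x) = 0"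
    by (rule sum.neutral) (use 3 in auto)
  finally show ?thesis using 1 2 sum_lap[of ?h] by simp
qed simp

section \<open>Effective resistance\<close>

text \<open>The effective resistance of electrical networks. By \<open>gr_diag\<close> it is, for
  distinct vertices, the weight of the two-tree forests separating \<open>u\<close> from
  \<open>v\<close> divided by the weight of the spanning trees.\<close>

definition reff :: "'a \<Rightarrow> 'a \<Rightarrow> real" where
  "reff u v = gr {u} v v"

lemma reff_bound:
  assumes F: "forests {u} > 0" and v: "v \<in> V"
  shows "(f u - f v)\<^sup>2 \<le> reff u v * en f f"
proof -
  have "(f v - f u)\<^sup>2 \<le> gr {u} v v * en (\<lambda>x. f x - f u) (\<lambda>x. f x - f u)"
    by (rule gr_lower[OF F v]) simp
  then show ?thesis
    by (simp add: en_diff_left en_diff_right reff_def power2_commute)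
qed

text \<open>The energy of \<open>?h\<close> against \<open>?k\<close> is evaluated twice, once with
  \<open>?k\<close> as the Green function rooted at \<open>u\<close>, once with \<open>?h\<close> as
  a difference of Green functions rooted at \<open>a\<close>. Energy ignores constants, so functions
  may be shifted to vanish at the root in question.\<close>

lemma reff_gr:
  assumes F: "forests {u} > 0" and a: "a \<in> V" and u: "u \<in> V" and v: "v \<in> V"
  shows "reff u v = gr {a} u u + gr {a} v v - 2 * gr {a} u v"
proof -
  have Fa: "forests {a} > 0" using F forests_single[OF u a] by simp
  let ?k = "gr {u} v" and ?h = "\<lambda>x. gr {a} v x - gr {a} u x"
  have sh: "en (\<lambda>x. f x - c) g = en f g" for f c g
    by (simp add: en_diff_left)
  have "en ?h ?k = en (\<lambda>x. ?h x - ?h u) ?k" by (simp only: sh)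
  also have "\<dots> = ?h v - ?h u" by (rule en_gr[OF F v]) auto
  finally have 1: "en ?h ?k = ?h v - ?h u" .
  have g: "en (gr {a} y) f = f y - f a" if "y \<in> V" for y f
  proof -
    have "en (gr {a} y) f = en (\<lambda>x. f x - f a) (gr {a} y)" by (simp only: sh en_sym[of _ "gr {a} y"])
    also have "\<dots> = f y - f a" by (rule en_gr[OF Fa that]) auto
    finally show ?thesis .
  qed
  have "en ?h ?k = ?k v - ?k u" by (simp add: en_diff_left g u v)
  then have "?k v = ?h v - ?h u" using 1 gr_root[of u "{u}" v] by simp
  then show ?thesis using gr_sym[OF Fa u v] by (simp add: reff_def)
qed

lemma reff_sym: "forests {u} > 0 \<Longrightarrow> u \<in> V \<Longrightarrow> v \<in> V \<Longrightarrow> reff u v = reff v u"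
  using reff_gr[of u u v] reff_gr[of v u u] forests_single[of u v] gr_sym[of "{u}" u v] by simp

text \<open>Inserting \<open>reff_gr\<close> gives twice the trace of the Laplacian applied to
  \<open>gr {a}\<close>, and each row except that of \<open>a\<close> contributes one to this
  trace.\<close>

lemma foster:
  assumes F: "forests {a} > 0" and a: "a \<in> V"
  shows "(\<Sum>x\<in>V. \<Sum>y\<in>V. w x y * reff x y) = 2 * (real (card V) - 1)"
proof -
  let ?G = "gr {a}"
  have "w x y * reff x y = w x y * (?G x x - ?G x y) + w y x * (?G y y - ?G y x)" if "x \<in> V" "y \<in> V" for x y
  proof -
    have "reff x y = ?G x x + ?G y y - 2 * ?G x y" "?G y x = ?G x y"
      using reff_gr[of x a y] gr_sym[OF F that] forests_single[OF a that(1)] F a that by auto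
    then show ?thesis unfolding w_sym[of y x] by (simp only:) (simp add: algebra_simps)
  qed
  then have "(\<Sum>x\<in>V. \<Sum>y\<in>V. w x y * reff x y) =
      (\<Sum>x\<in>V. \<Sum>y\<in>V. w x y * (?G x x - ?G x y)) + (\<Sum>x\<in>V. \<Sum>y\<in>V. w y x * (?G y y - ?G y x))"
    by (simp add: sum.distrib)
  also have "(\<Sum>x\<in>V. \<Sum>y\<in>V. w y x * (?G y y - ?G y x)) = (\<Sum>x\<in>V. \<Sum>y\<in>V. w x y * (?G x x - ?G x y))"
    by (rule sum.swap)
  also have "(\<Sum>x\<in>V. \<Sum>y\<in>V. w x y * (?G x x - ?G x y)) = (\<Sum>x\<in>V. if x = a then 0 else 1)"
  proof (rule sum.cong[OF refl])
    fix x assume x: "x \<in> V"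
    show "(\<Sum>y\<in>V. w x y * (?G x x - ?G x y)) = (if x = a then 0 else 1)"
    proof (cases "x = a")
      case True
      then show ?thesis by (simp add: gr_def)
    next
      case False
      then show ?thesis using lap_gr[OF F, of x x] x unfolding lap_def by simp
    qed
  qed
  also have "\<dots> = (\<Sum>x\<in>V - {a}. 1::real)" by (rule sum.mono_neutral_cong_right) auto
  also have "\<dots> = real (card V) - 1"
    using a by (simp add: card_Diff_singleton of_nat_diff Suc_leI card_gt_0_iff)
       (metis One_nat_def Suc_leI card_gt_0_iff empty_iff finV of_nat_1 of_nat_diff)
  finally show ?thesis by simp
qed

text \<open>Edges from \<open>x\<close> to \<open>R\<close> carry a unit difference, other edges at
  \<open>x\<close> carry \<open>1 - s\<close>, other edges at \<open>R\<close> carry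
  \<open>s\<close>, the rest nothing. The auxiliary \<open>a u v\<close> charges each edge to its
  ends in \<open>insert x R\<close>; edges from \<open>x\<close> to \<open>R\<close> are
  overcharged, which is harmless for an upper bound.\<close>

lemma en_test:
  fixes s :: real
  assumes x: "x \<in> V - R" and R: "R \<subseteq> V" and w1: "\<And>x y. w x y \<le> 1"
  defines "f \<equiv> \<lambda>z. if z = x then 1 else if z \<in> R then 0 else s"
  shows "en f f \<le> (\<Sum>r\<in>R. w x r) + wdeg x * (1 - s)\<^sup>2 + (\<Sum>r\<in>R. wdeg r) * s\<^sup>2"
proof -
  define a where "a u v = w u v * (of_bool (u = x) * ((1 - s)\<^sup>2 + of_bool (v \<in> R)) + of_bool (u \<in> R) * s\<^sup>2)" for u v
  have "w u v * (f u - f v) * (f u - f v) \<le> a u v + a v u" for u v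
  proof -
    have "(f u - f v) * (f u - f v) \<le> (of_bool (u = x) * ((1 - s)\<^sup>2 + of_bool (v \<in> R)) + of_bool (u \<in> R) * s\<^sup>2) +
       (of_bool (v = x) * ((1 - s)\<^sup>2 + of_bool (u \<in> R)) + of_bool (v \<in> R) * s\<^sup>2)"
    proof -
      have "0 \<le> (1 - s) * (1 - s) + s * s" "0 \<le> (1 - s) * (1 - s)" by simp_all
      then show ?thesis using x by (auto simp: f_def power2_eq_square algebra_simps)
    qed
    from mult_left_mono[OF this w_nonneg[of u v]] show ?thesis
      unfolding a_def by (simp add: w_sym[of v u] algebra_simps)
  qed
  then have "2 * en f f \<le> (\<Sum>u\<in>V. \<Sum>v\<in>V. a u v + a v u)"
    unfolding en_def by (simp add: sum_mono)
  also have "\<dots> = 2 * (\<Sum>u\<in>V. \<Sum>v\<in>V. a u v)"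
    by (simp add: sum.distrib sum.swap[of "\<lambda>u v. a v u"])
  finally have 1: "en f f \<le> (\<Sum>u\<in>V. \<Sum>v\<in>V. a u v)" by simp
  have "(\<Sum>v\<in>V. a u v) = (if u = x then wdeg x * (1 - s)\<^sup>2 + (\<Sum>r\<in>R. w x r) else 0) + (if u \<in> R then wdeg u * s\<^sup>2 else 0)" for u
  proof -
    have "(\<Sum>v\<in>V. w x v * of_bool (v \<in> R)) = (\<Sum>r\<in>R. w x r)"
      using R by (intro sum.mono_neutral_cong_right) auto
    then show ?thesis using x
      by (auto simp: a_def wdeg_def sum_distrib_right sum.distrib distrib_left)
  qed
  then have "(\<Sum>u\<in>V. \<Sum>v\<in>V. a u v) = (\<Sum>u\<in>V. if u = x then wdeg x * (1 - s)\<^sup>2 + (\<Sum>r\<in>R. w x r) else 0)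
      + (\<Sum>u\<in>V. if u \<in> R then wdeg u * s\<^sup>2 else 0)"
    by (simp add: sum.distrib)
  also have "(\<Sum>u\<in>V. if u \<in> R then wdeg u * s\<^sup>2 else 0) = (\<Sum>r\<in>R. wdeg r) * s\<^sup>2"
    unfolding sum_distrib_right using R by (intro sum.mono_neutral_cong_right) auto
  finally show ?thesis using 1 x by simp
qed

text \<open>\<open>gr_lower\<close> with the test function of \<open>en_test\<close>. The choice
  \<open>s = 1 / (k + 1)\<close> minimises
  \<open>D * (1 - s)\<^sup>2 + k * D * s\<^sup>2\<close>.\<close>

lemma forests_insert_lower:
  assumes x: "x \<in> V - R" and R: "R \<subseteq> V" "R \<noteq> {}" and w1: "\<And>x y. w x y \<le> 1"
    and D: "\<And>r. r \<in> insert x R \<Longrightarrow> wdeg r \<le> D" and k: "k = real (card R)"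
  shows "forests R * (k + 1) \<le> forests (insert x R) * (k * (D + k + 1))"
proof (cases "forests R = 0")
  case True
  have "0 \<le> D" using D[OF insertI1] wdeg_nonneg[of x] by linarith
  then show ?thesis using True k by simp
next
  case False
  then have F: "forests R > 0" using forests_nonneg[of R] by linarith
  have finR: "finite R" by (rule finite_subset[OF R(1)]) simp
  then have k1: "k \<ge> 1" using R k by (simp add: Suc_leI card_gt_0_iff)
  define s where "s = 1 / (k + 1)"
  let ?f = "\<lambda>z. if z = x then 1 else if z \<in> R then 0 else s"
  have D0: "0 \<le> D" using D[OF insertI1] wdeg_nonneg[of x] by linarith
  have "en ?f ?f \<le> (\<Sum>r\<in>R. w x r) + wdeg x * (1 - s)\<^sup>2 + (\<Sum>r\<in>R. wdeg r) * s\<^sup>2"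
    by (rule en_test[OF x R(1) w1])
  also have "\<dots> \<le> k + D * (1 - s)\<^sup>2 + (k * D) * s\<^sup>2"
  proof (intro add_mono mult_right_mono)
    show "(\<Sum>r\<in>R. w x r) \<le> k" using sum_mono[of R "w x" "\<lambda>_. 1"] w1 k by simp
    show "(\<Sum>r\<in>R. wdeg r) \<le> k * D" using sum_mono[of R wdeg "\<lambda>_. D"] D k by simp
  qed (use D in auto)
  also have "\<dots> = k * (D + k + 1) / (k + 1)"
  proof -
    define q where "q = k + 1"
    have q: "q \<noteq> 0" "k = q - 1" using k1 by (auto simp: q_def)
    show ?thesis unfolding s_def q_def[symmetric] unfolding q(2) using q(1) by (simp add: field_simps power2_eq_square)
  qed
  finally have e: "en ?f ?f \<le> k * (D + k + 1) / (k + 1)" .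
  have "(?f x)\<^sup>2 \<le> gr R x x * en ?f ?f"
    by (rule gr_lower[OF F]) (use x in auto)
  also have "\<dots> \<le> gr R x x * (k * (D + k + 1) / (k + 1))"
    by (rule mult_left_mono[OF e]) simp
  finally have "1 \<le> (forests (insert x R) * (k * (D + k + 1))) / (forests R * (k + 1))"
    using x by (simp add: gr_diag)
  moreover have "forests R * (k + 1) > 0" using F k1 by simp
  ultimately show ?thesis by (simp only: pos_le_divide_eq mult_1)
qed

text \<open>Roots are added one at a time to \<open>{r}\<close>; the factors
  \<open>(k + 1) / k\<close> telescope to \<open>card R\<close>.\<close>

lemma forests_lower:
  assumes "finite R" "r \<in> R" "R \<subseteq> V" and w1: "\<And>x y. w x y \<le> 1" and D: "\<And>r. r \<in> R \<Longrightarrow> wdeg r \<le> D"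
  shows "forests {r} * real (card R) \<le> forests R * (D + real (card R)) ^ (card R - 1)"
proof -
  have "finite (R - {r})" using assms by simp
  then have main: "insert r (R - {r}) \<subseteq> V \<Longrightarrow> (\<And>x. x \<in> insert r (R - {r}) \<Longrightarrow> wdeg x \<le> D) \<Longrightarrow>
      forests {r} * real (card (insert r (R - {r}))) \<le>
      forests (insert r (R - {r})) * (D + real (card (insert r (R - {r})))) ^ (card (insert r (R - {r})) - 1)"
  proof (induction "R - {r}" arbitrary: R rule: finite_induct)
    case empty
    then show ?case by (simp only: empty(1)[symmetric]) simp
  next
    case (insert x S)
    define k where "k = real (card (insert r S))"
    have rS: "r \<notin> S" "x \<noteq> r" "S = S - {r}" using insert.hyps by auto
    have sub: "insert r S \<subseteq> V" "x \<in> V" using insert.prems insert.hyps(4) by auto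
    have k1: "k \<ge> 1" unfolding k_def using insert.hyps(1) rS by simp
    have D0: "D \<ge> 0" using order_trans[OF wdeg_nonneg insert.prems(2)[of r]] by simp
    have IH: "forests {r} * k \<le> forests (insert r S) * (D + k) ^ (card (insert r S) - 1)"
      using insert.hyps(3)[of S] rS sub insert.prems(2) insert.hyps(4) unfolding k_def by auto
    have st: "forests (insert r S) * (k + 1) \<le> forests (insert x (insert r S)) * (k * (D + k + 1))"
      by (rule forests_insert_lower) (use insert.hyps rS sub insert.prems w1 k_def in auto)
    have c: "card (insert x (insert r S)) = Suc (card (insert r S))" using insert.hyps rS by simp
    have cS: "card (insert r S) = Suc (card S)" using insert.hyps rS by simp
    have e: "insert r (R - {r}) = insert x (insert r S)" using insert.hyps(4) by auto
    have "forests {r} * k * (k + 1) \<le> forests (insert r S) * (D + k) ^ card S * (k + 1)"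
      using IH k1 cS by (intro mult_right_mono) auto
    also have "\<dots> = (forests (insert r S) * (k + 1)) * (D + k) ^ card S" by simp
    also have "\<dots> \<le> (forests (insert x (insert r S)) * (k * (D + k + 1))) * (D + k + 1) ^ card S"
      using k1 D0 by (intro mult_mono st power_mono) (auto intro!: mult_nonneg_nonneg)
    finally have "k * (forests {r} * (k + 1)) \<le> k * (forests (insert x (insert r S)) * (D + k + 1) ^ Suc (card S))"
      by (simp add: algebra_simps)
    then have "forests {r} * (k + 1) \<le> forests (insert x (insert r S)) * (D + k + 1) ^ Suc (card S)"
      using k1 by simp
    then show ?case unfolding e c using cS k_def by (simp add: algebra_simps)
  qed
  have "insert r (R - {r}) = R" using assms by auto
  then show ?thesis using main D assms(3) by simp
qed

end

section \<open>Interpolation between wired and deleted vertices\<close>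

context network
begin

text \<open>Cutting the edge from \<open>u\<close> into \<open>R\<close> turns \<open>u\<close> into
  a root, and conversely any edge from \<open>u\<close> to \<open>R\<close> may be restored.\<close>

lemma sum_forests_pointing:
  assumes u: "u \<in> V - R" and R: "R \<subseteq> V"
  shows "(\<Sum>f\<in>{f \<in> pforest V R. f u \<in> R}. weight R f) = (\<Sum>r\<in>R. w u r) * forests (insert u R)"
proof -
  have "(\<Sum>r\<in>R. w u r) * forests (insert u R) = (\<Sum>(r, f)\<in>R \<times> pforest V (insert u R). w u r * weight (insert u R) f)"
    by (simp add: forests_def sum_product sum.cartesian_product)
  also have "\<dots> = (\<Sum>f\<in>{f \<in> pforest V R. f u \<in> R}. weight R f)"
  proof (rule sum.reindex_bij_witness[where i = "\<lambda>f. (f u, f(u := u))" and j = "\<lambda>(r, f). f(u := r)"])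
    fix a assume "a \<in> R \<times> pforest V (insert u R)"
    then obtain r f where a: "a = (r, f)" "r \<in> R" "f \<in> pforest V (insert u R)" by auto
    have "f u = u" "f r = r" using a by (auto dest: pforestD)
    then have n: "\<not> leads f r u" using leads_fixed[of f r u] a u by auto
    show "((case a of (r, f) \<Rightarrow> f(u := r)) u, (case a of (r, f) \<Rightarrow> f(u := r))(u := u)) = a"
      using \<open>f u = u\<close> by (auto simp: a(1))
    show "(case a of (r, f) \<Rightarrow> f(u := r)) \<in> {f \<in> pforest V R. f u \<in> R}"
      using pforest_upd[OF a(3) _ u _ n] a R by auto
    show "weight R (case a of (r, f) \<Rightarrow> f(u := r)) = (case a of (r, f) \<Rightarrow> w u r * weight (insert u R) f)"
      using u by (simp add: a(1) weight_insert weight_insert_upd)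
  next
    fix f assume "f \<in> {f \<in> pforest V R. f u \<in> R}"
    then show "(f u, f(u := u)) \<in> R \<times> pforest V (insert u R)" using pforest_cut(1)[OF _ u] by auto
  qed auto
  finally show ?thesis by simp
qed

text \<open>For a positive semidefinite matrix the Hilbert-Schmidt norm is at most the trace, here
  with respect to the weights \<open>c\<close>. Positivity enters through the two-by-two
  minors.\<close>

lemma Gram_CS:
  assumes fin: "finite U" and c: "\<And>u. u \<in> U \<Longrightarrow> 0 \<le> c u" and d: "\<And>u. u \<in> U \<Longrightarrow> (0::real) \<le> p u u"
    and g: "\<And>u v. u \<in> U \<Longrightarrow> v \<in> U \<Longrightarrow> (p u v)\<^sup>2 \<le> p u u * p v v"
  shows "(\<Sum>u\<in>U. \<Sum>v\<in>U. c u * c v * (p u v)\<^sup>2) \<le> (\<Sum>u\<in>U. c u * p u u)\<^sup>2"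
proof -
  have "(\<Sum>u\<in>U. \<Sum>v\<in>U. c u * c v * (p u v)\<^sup>2) \<le> (\<Sum>u\<in>U. \<Sum>v\<in>U. (c u * p u u) * (c v * p v v))"
  proof (intro sum_mono)
    fix u v assume uv: "u \<in> U" "v \<in> U"
    have "c u * c v * (p u v)\<^sup>2 \<le> c u * c v * (p u u * p v v)"
      by (intro mult_left_mono g uv mult_nonneg_nonneg c)
    then show "c u * c v * (p u v)\<^sup>2 \<le> (c u * p u u) * (c v * p v v)" by (simp add: ac_simps)
  qed
  then show ?thesis by (simp add: power2_eq_square sum_product)
qed

text \<open>Scaling the edges at \<open>I\<close> by \<open>t\<close> joins the wired network (\<open>t = 1\<close>, rooted at \<open>I\<close>) to the network with
  \<open>I\<close> deleted (\<open>t \<rightarrow> 0\<close>, where forests attached to \<open>I\<close> by a single edge dominate).\<close>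

definition wt :: "'a set \<Rightarrow> real \<Rightarrow> 'a \<Rightarrow> 'a \<Rightarrow> real" where
  "wt I t x y = (if (x \<in> I) \<noteq> (y \<in> I) then t * w x y else w x y)"

lemma network_wt: "0 \<le> t \<Longrightarrow> network V (wt I t)"
  by unfold_locales (auto simp: wt_def w_sym)

lemma wt_1 [simp]: "wt I 1 = w"
  by (auto simp: wt_def fun_eq_iff)

definition cw :: "'a set \<Rightarrow> 'a \<Rightarrow> real" where
  "cw I u = (\<Sum>i\<in>I. w u i)"

lemma cw_nonneg [simp]: "0 \<le> cw I u"
  unfolding cw_def by (intro sum_nonneg) auto

definition nf :: "'a set \<Rightarrow> ('a \<Rightarrow> 'a) \<Rightarrow> nat" where
  "nf I f = card {u \<in> V - I. f u \<in> I}"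

lemma weight_wt:
  assumes t: "0 \<le> t"
  shows "network.weight V (wt I t) I f = t ^ nf I f * weight I f"
proof -
  interpret T: network V "wt I t" by (rule network_wt[OF t])
  have "T.weight I f = (\<Prod>v\<in>V - I. (if f v \<in> I then t else 1) * w v (f v))"
    unfolding T.weight_def wt_def by (rule prod.cong) auto
  also have "\<dots> = (\<Prod>v\<in>V - I. if f v \<in> I then t else 1) * weight I f"
    by (simp add: prod.distrib weight_def)
  also have "(\<Prod>v\<in>V - I. if f v \<in> I then t else 1) = (\<Prod>v\<in>{u \<in> V - I. f u \<in> I}. t)"
    by (rule prod.mono_neutral_cong_right) auto
  finally show ?thesis by (simp add: nf_def)
qed

lemma forests_wt:
  assumes t: "0 \<le> t"
  shows "network.forests V (wt I t) I = (\<Sum>f\<in>pforest V I. t ^ nf I f * weight I f)"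
  using network.forests_def[OF network_wt[OF t]] weight_wt[OF t] by simp

lemma forests_wt_pos:
  assumes t: "0 < t" and F: "forests I > 0"
  shows "network.forests V (wt I t) I > 0"
proof -
  obtain f where f: "f \<in> pforest V I" "weight I f > 0"
    using F unfolding forests_def by (metis less_irrefl not_less order_antisym sum_nonpos weight_nonneg sum_nonneg)
  have "0 < t ^ nf I f * weight I f" using f t by simp
  also have "\<dots> \<le> (\<Sum>f\<in>pforest V I. t ^ nf I f * weight I f)"
    by (rule member_le_sum[OF f(1)]) (use t in auto)
  finally show ?thesis using forests_wt[of t I] t by simp
qed

text \<open>The derivative counts each forest once per vertex attached directly to \<open>I\<close>.
  Cutting such an attachment at \<open>u\<close> gives a forest rooted at \<open>insert u I\<close>,
  and the ratio of the two totals is the diagonal Green function.\<close>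

lemma forests_wt_deriv:
  assumes t: "0 < t" and I: "I \<subseteq> V" and F: "forests I > 0"
  shows "((\<lambda>t. \<Sum>f\<in>pforest V I. t ^ nf I f * weight I f) has_real_derivative
    network.forests V (wt I t) I * (\<Sum>u\<in>V - I. cw I u * network.gr V (wt I t) I u u)) (at t)"
proof -
  have t0: "0 \<le> t" using t by simp
  interpret T: network V "wt I t" by (rule network_wt[OF t0])
  have Fp: "T.forests I > 0" by (rule forests_wt_pos[OF t F])
  have d: "((\<lambda>t. \<Sum>f\<in>pforest V I. t ^ nf I f * weight I f) has_real_derivative
      (\<Sum>f\<in>pforest V I. real (nf I f) * t ^ (nf I f - 1) * weight I f)) (at t)"
    by (auto intro!: derivative_eq_intros)
  \<comment> \<open>Multiplying by \<open>t\<close> disposes of the truncated exponent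
    \<open>nf I f - 1\<close>.\<close>
  have "t * (\<Sum>f\<in>pforest V I. real (nf I f) * t ^ (nf I f - 1) * weight I f) =
      (\<Sum>f\<in>pforest V I. real (nf I f) * T.weight I f)"
    unfolding sum_distrib_left
  proof (rule sum.cong[OF refl])
    fix f
    show "t * (real (nf I f) * t ^ (nf I f - 1) * weight I f) = real (nf I f) * T.weight I f"
      by (cases "nf I f") (auto simp: weight_wt[OF t0])
  qed
  also have "\<dots> = (\<Sum>f\<in>pforest V I. \<Sum>u\<in>V - I. if f u \<in> I then T.weight I f else 0)"
  proof (rule sum.cong[OF refl])
    fix f
    have "(\<Sum>u\<in>V - I. if f u \<in> I then T.weight I f else 0) = (\<Sum>u\<in>{u \<in> V - I. f u \<in> I}. T.weight I f)"
      by (rule sum.mono_neutral_cong_right) auto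
    then show "real (nf I f) * T.weight I f = (\<Sum>u\<in>V - I. if f u \<in> I then T.weight I f else 0)"
      by (simp add: nf_def)
  qed
  also have "\<dots> = (\<Sum>u\<in>V - I. \<Sum>f\<in>pforest V I. if f u \<in> I then T.weight I f else 0)"
    by (rule sum.swap)
  also have "\<dots> = (\<Sum>u\<in>V - I. t * (cw I u * T.forests (insert u I)))"
  proof (rule sum.cong[OF refl])
    fix u assume u: "u \<in> V - I"
    have "(\<Sum>f\<in>pforest V I. if f u \<in> I then T.weight I f else 0) = (\<Sum>f\<in>{f \<in> pforest V I. f u \<in> I}. T.weight I f)"
      by (rule sum.mono_neutral_cong_right) auto
    also have "\<dots> = (\<Sum>r\<in>I. wt I t u r) * T.forests (insert u I)"
      by (rule T.sum_forests_pointing[OF u I])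
    also have "(\<Sum>r\<in>I. wt I t u r) = t * cw I u"
      using u by (simp add: wt_def cw_def sum_distrib_left)
    finally show "(\<Sum>f\<in>pforest V I. if f u \<in> I then T.weight I f else 0) = t * (cw I u * T.forests (insert u I))"
      by simp
  qed
  also have "\<dots> = t * (\<Sum>u\<in>V - I. cw I u * T.forests (insert u I))"
    by (simp add: sum_distrib_left)
  finally have "(\<Sum>f\<in>pforest V I. real (nf I f) * t ^ (nf I f - 1) * weight I f) =
      (\<Sum>u\<in>V - I. cw I u * T.forests (insert u I))"
    using t by simp
  also have "\<dots> = T.forests I * (\<Sum>u\<in>V - I. cw I u * T.gr I u u)"
    using Fp by (auto simp: T.gr_diag sum_distrib_left intro!: sum.cong)
  finally show ?thesis using d by simp
qed

text \<open>For functions vanishing on \<open>I\<close> the parameter enters linearly: the energy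
  inside \<open>V - I\<close> is fixed, and the edges to \<open>I\<close> act as killing at rate
  \<open>t * cw I u\<close>.\<close>

lemma en_wt:
  assumes t: "0 \<le> t" and I: "I \<subseteq> V" and f: "\<And>x. x \<in> I \<Longrightarrow> f x = 0" and h: "\<And>x. x \<in> I \<Longrightarrow> h x = 0"
  shows "network.en V (wt I t) f h =
    (\<Sum>x\<in>V - I. \<Sum>y\<in>V - I. w x y * (f x - f y) * (h x - h y)) / 2 + t * (\<Sum>u\<in>V - I. cw I u * f u * h u)"
proof -
  interpret T: network V "wt I t" by (rule network_wt[OF t])
  let ?U = "V - I"
  let ?e = "\<lambda>x y. wt I t x y * (f x - f y) * (h x - h y)"
  have split: "(\<Sum>x\<in>V. g x) = (\<Sum>x\<in>?U. g x) + (\<Sum>x\<in>I. g x)" for g :: "'a \<Rightarrow> real"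
    using sum.subset_diff[OF I, of g] by simp
  have UI: "(\<Sum>x\<in>?U. \<Sum>y\<in>I. ?e x y) = t * (\<Sum>u\<in>?U. cw I u * f u * h u)"
    unfolding cw_def sum_distrib_left sum_distrib_right
    by (intro sum.cong refl) (auto simp: wt_def f h)
  have IU: "(\<Sum>x\<in>I. \<Sum>y\<in>?U. ?e x y) = (\<Sum>x\<in>?U. \<Sum>y\<in>I. ?e x y)"
    by (subst sum.swap) (intro sum.cong refl, simp add: T.w_sym algebra_simps)
  have II: "(\<Sum>x\<in>I. \<Sum>y\<in>I. ?e x y) = 0" by (simp add: f)
  have UU: "(\<Sum>x\<in>?U. \<Sum>y\<in>?U. ?e x y) = (\<Sum>x\<in>?U. \<Sum>y\<in>?U. w x y * (f x - f y) * (h x - h y))"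
    by (intro sum.cong refl) (auto simp: wt_def)
  have "(\<Sum>x\<in>V. \<Sum>y\<in>V. ?e x y) = (\<Sum>x\<in>?U. \<Sum>y\<in>?U. w x y * (f x - f y) * (h x - h y)) + 2 * (t * (\<Sum>u\<in>?U. cw I u * f u * h u))"
    unfolding split sum.distrib IU UI II UU by simp
  then show ?thesis by (simp add: T.en_def)
qed

end

section \<open>The trace of the Green function along the interpolation\<close>

locale interpolation = network +
  fixes I :: "'a set"
  assumes I: "I \<subseteq> V" and F: "forests I > 0" and Cpos: "(\<Sum>u\<in>V - I. cw I u) > 0"
begin

abbreviation "U \<equiv> V - I"
abbreviation "c \<equiv> cw I"
definition "C = (\<Sum>u\<in>U. c u)"
definition "G t = network.gr V (wt I t) I"
text \<open>The function that is one off \<open>I\<close> has energy \<open>t * C\<close>; the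
  constant subtracted is the entry of the projection onto it and accounts for the divergence of
  \<open>G t\<close> as \<open>t \<rightarrow> 0\<close>. The remainder is again a Gram
  matrix.\<close>

definition "G' t u v = G t u v - 1 / (t * C)"
definition "tr t = (\<Sum>u\<in>U. c u * G' t u u)"

lemma C0: "C > 0" using Cpos by (simp add: C_def)

text \<open>The reproducing property tested on the function that is one off \<open>I\<close>, whose
  energy comes from the edges to \<open>I\<close> alone.\<close>

lemma G_row:
  assumes t: "t > 0" and u: "u \<in> U"
  shows "(\<Sum>z\<in>U. c z * G t u z) = 1 / t"
proof -
  have t0: "0 \<le> t" using t by simp
  interpret T: network V "wt I t" by (rule network_wt[OF t0])
  have Fp: "T.forests I > 0" by (rule forests_wt_pos[OF t F])
  have "T.en (\<lambda>x. of_bool (x \<notin> I)) (T.gr I u) = 1"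
    using T.en_gr[OF Fp, of u "\<lambda>x. of_bool (x \<notin> I)"] u by simp
  moreover have "T.en (\<lambda>x. of_bool (x \<notin> I)) (T.gr I u) = t * (\<Sum>z\<in>U. c z * G t u z)"
    by (subst en_wt[OF t0 I]) (auto simp: T.gr_root G_def)
  ultimately show ?thesis using t by (simp add: field_simps)
qed

lemma G'_gram:
  assumes t: "t > 0" and u: "u \<in> U" and v: "v \<in> U"
  shows "(G' t u v)\<^sup>2 \<le> G' t u u * G' t v v" "0 \<le> G' t u u"
proof -
  have t0: "0 \<le> t" using t by simp
  interpret T: network V "wt I t" by (rule network_wt[OF t0])
  have Fp: "T.forests I > 0" by (rule forests_wt_pos[OF t F])
  define ov where "ov x = (1 / (t * C)) * of_bool (x \<notin> I)" for x
  have oo: "T.en ov ov = 1 / (t * C)"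
  proof -
    have "T.en ov ov = (1 / (t * C))\<^sup>2 * T.en (\<lambda>x. of_bool (x \<notin> I)) (\<lambda>x. of_bool (x \<notin> I))"
      unfolding ov_def T.en_cmult_left T.en_cmult_right by (simp add: power2_eq_square)
    also have "T.en (\<lambda>x. of_bool (x \<notin> I)) (\<lambda>x. of_bool (x \<notin> I)) = t * C"
      by (subst en_wt[OF t0 I]) (auto simp: C_def)
    finally show ?thesis using t C0 by (simp add: power2_eq_square)
  qed
  have og: "T.en ov (T.gr I x) = 1 / (t * C)" "T.en (T.gr I x) ov = 1 / (t * C)" if "x \<in> U" for x
    using T.en_gr[OF Fp, of x ov] that T.en_sym by (auto simp: ov_def)
  have gram: "G' t x y = T.en (\<lambda>z. T.gr I x z - ov z) (\<lambda>z. T.gr I y z - ov z)" if "x \<in> U" "y \<in> U" for x y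
    using that og oo T.en_gr_gr[OF Fp, of x y]
    by (simp add: T.en_diff_left T.en_diff_right G'_def G_def)
  show "(G' t u v)\<^sup>2 \<le> G' t u u * G' t v v" "0 \<le> G' t u u"
    unfolding gram[OF u v] gram[OF u u] gram[OF v v] by (rule T.en_CS, rule T.en_nonneg)
qed

lemma tr_eq: "tr t = (\<Sum>u\<in>U. c u * G t u u) - 1 / t"
proof -
  have "tr t = (\<Sum>u\<in>U. c u * G t u u) - (\<Sum>u\<in>U. c u) * (1 / (t * C))"
    unfolding tr_def G'_def sum_distrib_right sum_subtractf[symmetric] by (simp add: right_diff_distrib)
  then show ?thesis using C0 by (simp flip: C_def)
qed

lemma tr_nonneg: "t > 0 \<Longrightarrow> 0 \<le> tr t"
  unfolding tr_def using G'_gram(2) by (intro sum_nonneg mult_nonneg_nonneg) auto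

text \<open>A resolvent identity. The mixed energy of \<open>G t\<close> and \<open>G 1\<close>
  taken at parameter \<open>t\<close> is a value of \<open>G 1\<close>, taken at parameter one a
  value of \<open>G t\<close>; the two energies differ by \<open>1 - t\<close> times the killing
  form. The row sums of \<open>G_row\<close> allow passing from \<open>G\<close> to
  \<open>G'\<close>.\<close>

lemma tr_diff:
  assumes t: "t > 0"
  shows "tr t - tr 1 = (1 - t) * (\<Sum>u\<in>U. \<Sum>v\<in>U. c u * c v * (G' t u v * G' 1 u v))"
proof -
  have t0: "0 \<le> t" using t by simp
  interpret T: network V "wt I t" by (rule network_wt[OF t0])
  have Fp: "T.forests I > 0" by (rule forests_wt_pos[OF t F])
  have G1: "G 1 = gr I" by (simp add: G_def)
  have res: "G t u u - G 1 u u = (1 - t) * (\<Sum>v\<in>U. c v * (G t u v * G 1 u v))" if u: "u \<in> U" for u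
  proof -
    have "T.en (T.gr I u) (gr I u) = gr I u u"
      by (rule T.en_gr'[OF Fp]) (use u in \<open>auto simp: gr_root\<close>)
    moreover have "en (T.gr I u) (gr I u) = T.gr I u u"
      by (rule en_gr[OF F]) (use u in \<open>auto simp: T.gr_root\<close>)
    ultimately have "G t u u - G 1 u u = en (T.gr I u) (gr I u) - T.en (T.gr I u) (gr I u)"
      by (simp add: G_def)
    also have "\<dots> = (1 - t) * (\<Sum>v\<in>U. c v * T.gr I u v * gr I u v)"
      using en_wt[OF t0 I, of "T.gr I u" "gr I u"] en_wt[of 1 I "T.gr I u" "gr I u"] I
      by (simp add: T.gr_root gr_root algebra_simps)
    finally show ?thesis by (simp add: G_def mult.assoc)
  qed
  define S where "S = (\<Sum>u\<in>U. \<Sum>v\<in>U. c u * c v * (G t u v * G 1 u v))"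
  have 1: "tr t - tr 1 = (1 - t) * S - 1 / t + 1"
  proof -
    have "(\<Sum>u\<in>U. c u * G t u u) - (\<Sum>u\<in>U. c u * G 1 u u) = (\<Sum>u\<in>U. c u * (G t u u - G 1 u u))"
      by (simp add: sum_subtractf right_diff_distrib)
    also have "\<dots> = (\<Sum>u\<in>U. c u * ((1 - t) * (\<Sum>v\<in>U. c v * (G t u v * G 1 u v))))"
      by (rule sum.cong[OF refl]) (simp add: res)
    also have "\<dots> = (1 - t) * S"
      unfolding S_def sum_distrib_left by (intro sum.cong refl) (simp add: ac_simps)
    finally show ?thesis unfolding tr_eq by simp
  qed
  have row: "(\<Sum>u\<in>U. \<Sum>v\<in>U. c u * c v * G s u v) = C / s" if "s > 0" for s
  proof -
    have "(\<Sum>u\<in>U. \<Sum>v\<in>U. c u * c v * G s u v) = (\<Sum>u\<in>U. c u * (1 / s))"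
      by (rule sum.cong[OF refl]) (simp add: G_row[OF that, symmetric] sum_distrib_left mult.assoc)
    then show ?thesis by (simp add: C_def sum_divide_distrib)
  qed
  have "(\<Sum>u\<in>U. \<Sum>v\<in>U. c u * c v * (G' t u v * G' 1 u v)) =
      (\<Sum>u\<in>U. \<Sum>v\<in>U. c u * c v * (G t u v * G 1 u v) - (1 / C) * (c u * c v * G t u v)
        - (1 / (t * C)) * (c u * c v * G 1 u v) + (c u * c v) * (1 / (t * C) * (1 / C)))"
    by (intro sum.cong refl) (simp add: G'_def algebra_simps)
  also have "\<dots> = S - (1 / C) * (C / t) - (1 / (t * C)) * (C / 1) + (\<Sum>u\<in>U. \<Sum>v\<in>U. c u * c v) * (1 / (t * C) * (1 / C))"
  proof -
    have "(\<Sum>u\<in>U. \<Sum>v\<in>U. k * (c u * c v * G s u v)) = k * (C / s)" if "s > 0" for k s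
      by (simp only: sum_distrib_left[symmetric] row[OF that])
    moreover have "(\<Sum>u\<in>U. \<Sum>v\<in>U. (c u * c v) * k) = (\<Sum>u\<in>U. \<Sum>v\<in>U. c u * c v) * k" for k
      by (simp only: sum_distrib_right)
    ultimately show ?thesis using t by (simp only: sum.distrib sum_subtractf S_def zero_less_one)
  qed
  also have "(\<Sum>u\<in>U. \<Sum>v\<in>U. c u * c v) = C * C" by (simp add: C_def sum_product)
  also have "S - (1 / C) * (C / t) - (1 / (t * C)) * (C / 1) + C * C * (1 / (t * C) * (1 / C)) = S - 1 / t"
    using C0 t by (simp add: field_simps)
  finally have e: "(\<Sum>u\<in>U. \<Sum>v\<in>U. c u * c v * (G' t u v * G' 1 u v)) = S - 1 / t" .
  show ?thesis unfolding e 1 using t by (simp add: field_simps)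
qed

text \<open>\<open>tr_diff\<close> expresses \<open>tr t - tr 1\<close> by the pairing of
  \<open>G' t\<close> with \<open>G' 1\<close>. By Cauchy-Schwarz and \<open>Gram_CS\<close> the
  pairing is at most \<open>v * tr t\<close>, which is absorbed on the left. Thus a Hilbert-Schmidt
  bound at \<open>t = 1\<close> controls the trace for all smaller \<open>t\<close>.\<close>

lemma tr_le:
  assumes t: "0 < t" "t \<le> 1" and v: "0 \<le> v" "v < 1"
    and HS: "(\<Sum>u\<in>U. \<Sum>z\<in>U. c u * c z * (G' 1 u z)\<^sup>2) \<le> v\<^sup>2"
  shows "tr t \<le> tr 1 / (1 - v)"
proof -
  let ?J = "U \<times> U"
  let ?a = "\<lambda>t p. sqrt (c (fst p) * c (snd p)) * G' t (fst p) (snd p)"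
  let ?X = "\<Sum>u\<in>U. \<Sum>z\<in>U. c u * c z * (G' t u z * G' 1 u z)"
  have e: "(\<Sum>p\<in>?J. ?a s p * ?a r p) = (\<Sum>u\<in>U. \<Sum>z\<in>U. c u * c z * (G' s u z * G' r u z))" for s r
  proof -
    have "?a s p * ?a r p = c (fst p) * c (snd p) * (G' s (fst p) (snd p) * G' r (fst p) (snd p))" for p
    proof -
      have "?a s p * ?a r p = (sqrt (c (fst p) * c (snd p)) * sqrt (c (fst p) * c (snd p))) * (G' s (fst p) (snd p) * G' r (fst p) (snd p))"
        by (simp only: ac_simps)
      then show ?thesis by simp
    qed
    then have "(\<Sum>p\<in>?J. ?a s p * ?a r p) = (\<Sum>p\<in>?J. c (fst p) * c (snd p) * (G' s (fst p) (snd p) * G' r (fst p) (snd p)))"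
      by (rule sum.cong[OF refl])
    then show ?thesis by (simp only: sum.cartesian_product case_prod_beta')
  qed
  have "?X\<^sup>2 \<le> (\<Sum>u\<in>U. \<Sum>z\<in>U. c u * c z * (G' t u z)\<^sup>2) * (\<Sum>u\<in>U. \<Sum>z\<in>U. c u * c z * (G' 1 u z)\<^sup>2)"
    using Cauchy_Schwarz_ineq_sum[of "?a t" "?a 1" ?J] unfolding power2_eq_square[of "?a _ _"] e
    by (simp add: power2_eq_square)
  also have "\<dots> \<le> (tr t)\<^sup>2 * v\<^sup>2"
  proof (rule mult_mono[OF _ HS])
    show "(\<Sum>u\<in>U. \<Sum>z\<in>U. c u * c z * (G' t u z)\<^sup>2) \<le> (tr t)\<^sup>2"
      unfolding tr_def by (rule Gram_CS) (use G'_gram[OF t(1)] in auto)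
  qed (auto intro!: sum_nonneg)
  finally have "?X\<^sup>2 \<le> (tr t * v)\<^sup>2" by (simp add: power_mult_distrib)
  then have "\<bar>?X\<bar> \<le> \<bar>tr t * v\<bar>" by (simp only: abs_le_square_iff)
  then have "\<bar>?X\<bar> \<le> tr t * v" using tr_nonneg[OF t(1)] v by (simp add: abs_mult)
  then have "(1 - t) * ?X \<le> (1 - t) * (tr t * v)" using t by (intro mult_left_mono) auto
  also have "\<dots> \<le> 1 * (tr t * v)" using t tr_nonneg[OF t(1)] v by (intro mult_right_mono) auto
  finally have "(1 - t) * ?X \<le> 1 * (tr t * v)" .
  then have "tr t * (1 - v) \<le> tr 1" using tr_diff[OF t(1)] by (simp add: algebra_simps)
  then show ?thesis using v by (simp add: pos_le_divide_eq)
qed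

definition "Q t = (\<Sum>f\<in>pforest V I. t ^ nf I f * weight I f)"

lemma Q_pos: "t > 0 \<Longrightarrow> Q t > 0"
  using forests_wt_pos[OF _ F, of t] forests_wt[of t I] by (simp add: Q_def)

text \<open>The logarithmic derivative of \<open>Q t / t\<close> is \<open>tr t\<close>, so by the
  mean value theorem on \<open>[t, 1]\<close> the loss is at most the bound of \<open>tr_le\<close>,
  uniformly in \<open>t\<close>.\<close>

lemma Q_lower:
  assumes t: "0 < t" "t < 1" and v: "0 \<le> v" "v < 1"
    and HS: "(\<Sum>u\<in>U. \<Sum>z\<in>U. c u * c z * (G' 1 u z)\<^sup>2) \<le> v\<^sup>2"
  shows "forests I * exp (- (tr 1 / (1 - v))) \<le> Q t / t"
proof -
  have d: "((\<lambda>t. ln (Q t) - ln t) has_real_derivative tr s) (at s)" if s: "0 < s" for s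
  proof -
    have "(Q has_real_derivative Q s * (\<Sum>u\<in>U. c u * G s u u)) (at s)"
      using forests_wt_deriv[OF s I F] forests_wt[of s I] s unfolding Q_def G_def by simp
    then show ?thesis using s Q_pos[OF s]
      by (auto intro!: derivative_eq_intros simp: tr_eq field_simps)
  qed
  obtain z where z: "t < z" "z < 1" "(ln (Q 1) - ln 1) - (ln (Q t) - ln t) = (1 - t) * tr z"
    using MVT2[of t 1 "\<lambda>t. ln (Q t) - ln t" tr] t d by auto
  have "(1 - t) * tr z \<le> 1 * (tr 1 / (1 - v))"
  proof (rule mult_mono)
    show "tr z \<le> tr 1 / (1 - v)" by (rule tr_le) (use z t v HS in auto)
  qed (use t z tr_nonneg in auto)
  moreover have Q1: "Q 1 = forests I" by (simp add: Q_def forests_def)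
  ultimately have "ln (forests I) - tr 1 / (1 - v) \<le> ln (Q t / t)"
    using z t Q_pos[OF t(1)] by (simp add: ln_div)
  then have "exp (ln (forests I) - tr 1 / (1 - v)) \<le> exp (ln (Q t / t))" by simp
  then show ?thesis using F Q_pos[OF t(1)] t by (simp add: exp_diff exp_minus field_simps)
qed

lemma nf_pos:
  assumes f: "f \<in> pforest V I" and "u \<in> U"
  shows "nf I f > 0"
proof -
  have "u \<in> V" using assms by simp
  with f have "u \<in> U \<longrightarrow> (\<exists>x\<in>U. f x \<in> I)"
  proof (induction rule: pforest_induct)
    case (step v)
    then show ?case using pforestD(3)[OF f, of v] by (cases "f v \<in> I") auto
  qed auto
  then have "{u \<in> U. f u \<in> I} \<noteq> {}" using assms by auto
  then show ?thesis by (simp add: nf_def card_gt_0_iff)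
qed

text \<open>A forest with one attachment is an edge from some \<open>u\<close> into \<open>I\<close>
  together with a spanning tree of \<open>U\<close> rooted at \<open>u\<close>. Injectivity of this
  decomposition gives the inequality.\<close>

lemma sum_nf_1:
  "(\<Sum>f\<in>{f \<in> pforest V I. nf I f = 1}. weight I f) \<le> (\<Sum>u\<in>U. c u * network.forests U w {u})"
proof -
  interpret H: network U w by unfold_locales (auto simp: w_sym)
  let ?P = "{f \<in> pforest V I. nf I f = 1}"
  let ?r = "\<lambda>f. THE u. u \<in> U \<and> f u \<in> I"
  let ?h = "\<lambda>f. (?r f, f (?r f), f(?r f := ?r f))"
  let ?S = "SIGMA u:U. I \<times> pforest U {u}"
  have r: "?r f \<in> U" "f (?r f) \<in> I" "\<And>u. u \<in> U \<Longrightarrow> f u \<in> I \<Longrightarrow> u = ?r f" if "f \<in> ?P" for f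
  proof -
    from that have "card {u \<in> U. f u \<in> I} = 1" by (simp add: nf_def)
    then obtain u where "{u \<in> U. f u \<in> I} = {u}" by (rule card_1_singletonE)
    then have ex: "\<exists>!u. u \<in> U \<and> f u \<in> I" by (metis (mono_tags, lifting) mem_Collect_eq singletonD singletonI)
    show "?r f \<in> U" "f (?r f) \<in> I" using theI'[OF ex] by auto
    show "u = ?r f" if "u \<in> U" "f u \<in> I" for u using the1_equality[OF ex, of u] that by auto
  qed
  have mem: "?h f \<in> ?S" if fP: "f \<in> ?P" for f
  proof -
    define u where "u = ?r f"
    define g where "g = f(u := u)"
    have f: "f \<in> pforest V I" using fP by simp
    have u: "u \<in> U" "f u \<in> I" "\<And>v. v \<in> U \<Longrightarrow> f v \<in> I \<Longrightarrow> v = u"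
      unfolding u_def by (rule r(1)[OF fP], rule r(2)[OF fP], rule r(3)[OF fP])
    have g: "g v = f v" if "v \<noteq> u" for v using that by (simp add: g_def)
    have gU: "f v \<in> U" if "v \<in> U" "v \<noteq> u" for v using that u(3) pforestD(3)[OF f, of v] by auto
    have "g \<in> pforest U {u}"
    proof (rule pforestI)
      fix v assume "v \<notin> U"
      then show "g v = v" using pforestD(1,2)[OF f, of v] u(1) g[of v] by (cases "v \<in> V") auto
    next
      fix v assume "v \<in> U" "v \<notin> {u}"
      then show "g v \<in> U" using gU[of v] g[of v] by auto
    next
      fix v assume v: "v \<in> U"
      then have "v \<in> V" by simp
      with f have "v \<in> U \<longrightarrow> leads g v u"
      proof (induction rule: pforest_induct)
        case (step v)
        then show ?case using gU[of v] g[of v] leads_step[of g v u] by (cases "v = u") auto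
      qed simp
      then show "\<exists>s\<in>{u}. leads g v s" using v by simp
    qed (simp add: g_def)
    moreover have "?h f = (u, f u, g)" by (simp only: g_def u_def)
    ultimately show ?thesis using u(1,2) by (simp only: mem_Sigma_iff)
  qed
  have wt: "weight I f = (case ?h f of (u, i, g) \<Rightarrow> w u i * H.weight {u} g)" if fP: "f \<in> ?P" for f
  proof -
    let ?u = "?r f"
    have "weight I f = w ?u (f ?u) * (\<Prod>v\<in>U - {?u}. w v (f v))"
      unfolding weight_def using r(1)[OF fP] by (subst prod.remove[of _ ?u]) auto
    also have "(\<Prod>v\<in>U - {?u}. w v (f v)) = H.weight {?u} (f(?u := ?u))"
      unfolding H.weight_def by (rule prod.cong) auto
    finally show ?thesis by simp
  qed
  have inj: "inj_on ?h ?P"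
    by (rule inj_on_inverseI[where g = "\<lambda>(u, i, g). g(u := i)"]) simp
  have "(\<Sum>f\<in>?P. weight I f) = (\<Sum>f\<in>?P. case ?h f of (u, i, g) \<Rightarrow> w u i * H.weight {u} g)"
    by (rule sum.cong[OF refl wt])
  also have "\<dots> = (\<Sum>a\<in>?h ` ?P. case a of (u, i, g) \<Rightarrow> w u i * H.weight {u} g)"
    by (rule sum.reindex_cong[OF inj refl, symmetric]) simp
  also have "\<dots> \<le> (\<Sum>a\<in>?S. case a of (u, i, g) \<Rightarrow> w u i * H.weight {u} g)"
  proof (rule sum_mono2)
    show "finite ?S" using finite_subset[OF I] by auto
    show "?h ` ?P \<subseteq> ?S" using mem by blast
  qed auto
  also have "\<dots> = (\<Sum>u\<in>U. c u * H.forests {u})"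
    using finite_subset[OF I]
    by (subst sum.Sigma[symmetric]) (auto simp: cw_def H.forests_def sum_product sum.cartesian_product intro!: sum.cong)
  finally show ?thesis .
qed

text \<open>Letting \<open>t\<close> tend to zero in \<open>Q_lower\<close>, only forests with a
  single attachment survive in \<open>Q t / t\<close>; \<open>forests_single\<close> in the network
  without \<open>I\<close> then moves all their roots to \<open>l\<close>.\<close>

theorem forests_deleted_lower:
  assumes v: "0 \<le> v" "v < 1" and HS: "(\<Sum>u\<in>U. \<Sum>z\<in>U. c u * c z * (gr I u z - 1 / C)\<^sup>2) \<le> v\<^sup>2"
    and l: "l \<in> U"
  shows "forests I * exp (- (((\<Sum>u\<in>U. c u * gr I u u) - 1) / (1 - v))) \<le> C * network.forests U w {l}"
proof -
  interpret H: network U w by unfold_locales (auto simp: w_sym)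
  have HS': "(\<Sum>u\<in>U. \<Sum>z\<in>U. c u * c z * (G' 1 u z)\<^sup>2) \<le> v\<^sup>2"
    using HS by (simp add: G'_def G_def)
  have tr1: "tr 1 = (\<Sum>u\<in>U. c u * gr I u u) - 1" by (simp add: tr_eq G_def)
  \<comment> \<open>As \<open>0 ^ 0 = 1\<close>, the limit retains exactly the forests with
    \<open>nf I f = 1\<close>. The case \<open>nf I f = 0\<close>, where the truncated exponent
    would also vanish, is excluded by \<open>nf_pos\<close>.\<close>
  have lim: "((\<lambda>t. Q t / t) \<longlongrightarrow> (\<Sum>f\<in>pforest V I. 0 ^ (nf I f - 1) * weight I f)) (at_right 0)"
  proof (rule Lim_transform_eventually)
    show "((\<lambda>t. \<Sum>f\<in>pforest V I. t ^ (nf I f - 1) * weight I f) \<longlongrightarrow> (\<Sum>f\<in>pforest V I. 0 ^ (nf I f - 1) * weight I f)) (at_right 0)"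
      by (intro tendsto_intros)
    show "\<forall>\<^sub>F t in at_right 0. (\<Sum>f\<in>pforest V I. t ^ (nf I f - 1) * weight I f) = Q t / t"
    proof (rule eventually_at_rightI[of 0 1])
      fix t :: real assume "t \<in> {0<..<1}"
      moreover have "t ^ nf I f = t * t ^ (nf I f - 1)" if "f \<in> pforest V I" for f
        using nf_pos[OF that l] by (metis Suc_diff_1 power_Suc)
      ultimately show "(\<Sum>f\<in>pforest V I. t ^ (nf I f - 1) * weight I f) = Q t / t"
        unfolding Q_def sum_divide_distrib by (intro sum.cong refl) (simp add: ac_simps)
    qed simp
  qed
  have "forests I * exp (- (tr 1 / (1 - v))) \<le> (\<Sum>f\<in>pforest V I. 0 ^ (nf I f - 1) * weight I f)"
  proof (rule tendsto_lowerbound[OF lim])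
    show "\<forall>\<^sub>F t in at_right 0. forests I * exp (- (tr 1 / (1 - v))) \<le> Q t / t"
      by (rule eventually_at_rightI[of 0 1]) (use Q_lower[OF _ _ v HS'] in auto)
  qed simp
  also have "\<dots> = (\<Sum>f\<in>{f \<in> pforest V I. nf I f = 1}. weight I f)"
  proof (rule sum.mono_neutral_cong_right)
    show "\<forall>f\<in>pforest V I - {f \<in> pforest V I. nf I f = 1}. 0 ^ (nf I f - 1) * weight I f = 0"
    proof
      fix f assume "f \<in> pforest V I - {f \<in> pforest V I. nf I f = 1}"
      then have "nf I f - 1 > 0" using nf_pos[of f, OF _ l] by auto
      then show "0 ^ (nf I f - 1) * weight I f = 0" by simp
    qed
  qed auto
  also have "\<dots> \<le> (\<Sum>u\<in>U. c u * H.forests {u})" by (rule sum_nf_1)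
  also have "\<dots> = (\<Sum>u\<in>U. c u * H.forests {l})"
    by (rule sum.cong[OF refl]) (use H.forests_single[OF _ l] in simp)
  also have "\<dots> = C * H.forests {l}" by (simp add: C_def sum_distrib_right)
  finally show ?thesis by (simp add: tr1)
qed

end

section \<open>Good vertices and good edges\<close>

locale graph_net = network +
  assumes w01: "w x y = 0 \<or> w x y = 1" and w_irrefl [simp]: "w x x = 0"
begin

lemma w_le_1 [simp]: "w x y \<le> 1" using w01[of x y] by auto

text \<open>It is one at every vertex of a regular graph of positive degree. Summed over
  \<open>I\<close> it is nearly the quantity \<open>A\<close> of \<open>HS_bound\<close>, and
  \<open>A\<close> close to \<open>card I\<close> is what makes the trace there small.\<close>

definition inv_deg_sum :: "'a \<Rightarrow> real" where
  "inv_deg_sum v = (\<Sum>u\<in>V. w v u / wdeg u)"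

text \<open>Neighbours must have degree at least \<open>1/\<epsilon>\<close>, since a low-degree
  neighbour \<open>u\<close> of \<open>I\<close> would make the ratio \<open>cw I u / wdeg u\<close>
  large. The last bound reflects the ideal case of about \<open>d\<close> edges of resistance about
  \<open>2/d\<close>.\<close>

definition good_vertex :: "real \<Rightarrow> real \<Rightarrow> 'a \<Rightarrow> bool" where
  "good_vertex \<epsilon> d v \<longleftrightarrow> v \<in> V \<and> (1 - \<epsilon>) * d \<le> wdeg v \<and> wdeg v \<le> (1 + \<epsilon>) * d \<and>
     (\<forall>u\<in>V. w v u = 1 \<longrightarrow> 1 \<le> \<epsilon> * wdeg u) \<and> 1 - \<epsilon> \<le> inv_deg_sum v \<and> inv_deg_sum v \<le> 1 + \<epsilon> \<and>
     (\<Sum>u\<in>V. w v u * reff v u) \<le> 2 + \<epsilon>"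

definition good_edge :: "real \<Rightarrow> real \<Rightarrow> 'a \<Rightarrow> 'a \<Rightarrow> bool" where
  "good_edge \<epsilon> d u v \<longleftrightarrow> w u v = 1 \<and> good_vertex \<epsilon> d u \<and> good_vertex \<epsilon> d v \<and> reff u v \<le> (2 + \<epsilon>) / d"

definition nbr_avg :: "('a \<Rightarrow> real) \<Rightarrow> 'a \<Rightarrow> real" where
  "nbr_avg f v = (\<Sum>z\<in>V. w v z * f z) / wdeg v"

definition star_en :: "('a \<Rightarrow> real) \<Rightarrow> 'a \<Rightarrow> real" where
  "star_en f v = (\<Sum>z\<in>V. w v z * (f v - f z)\<^sup>2)"

lemma star_en_nonneg [simp]: "0 \<le> star_en f v"
  unfolding star_en_def by (intro sum_nonneg) auto

text \<open>The parallel axis theorem: \<open>nbr_avg f v\<close> is the mean of \<open>f\<close>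
  under the weights at \<open>v\<close>.\<close>

lemma star_identity:
  assumes "wdeg v > 0"
  shows "(\<Sum>z\<in>V. w v z * (a - f z)\<^sup>2) = (\<Sum>z\<in>V. w v z * (nbr_avg f v - f z)\<^sup>2) + wdeg v * (a - nbr_avg f v)\<^sup>2"
proof -
  let ?m = "nbr_avg f v"
  have "(\<Sum>z\<in>V. w v z * f z) = wdeg v * ?m" using assms by (simp add: nbr_avg_def)
  then have "(\<Sum>z\<in>V. w v z * (?m - f z)) = 0"
    by (simp add: right_diff_distrib sum_subtractf wdeg_def flip: sum_distrib_right)
  moreover have "(\<Sum>z\<in>V. w v z * (a - f z)\<^sup>2) =
      (\<Sum>z\<in>V. w v z * (?m - f z)\<^sup>2 + (w v z * (a - ?m)\<^sup>2 + 2 * (a - ?m) * (w v z * (?m - f z))))"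
    by (intro sum.cong refl) (simp add: power2_eq_square algebra_simps)
  ultimately show ?thesis
    by (simp add: sum.distrib wdeg_def flip: sum_distrib_left sum_distrib_right)
qed

lemma star_avg:
  assumes "wdeg v > 0"
  shows "wdeg v * (f v - nbr_avg f v)\<^sup>2 \<le> star_en f v"
    and "(\<Sum>z\<in>V. w v z * (a - f z)\<^sup>2) \<le> star_en f v + wdeg v * (a - nbr_avg f v)\<^sup>2"
proof -
  have nn: "0 \<le> (\<Sum>z\<in>V. w v z * (nbr_avg f v - f z)\<^sup>2)" by (intro sum_nonneg) auto
  show "wdeg v * (f v - nbr_avg f v)\<^sup>2 \<le> star_en f v"
    using star_identity[OF assms, of "f v" f] nn by (simp add: star_en_def)
  have "0 \<le> wdeg v * (f v - nbr_avg f v)\<^sup>2" by simp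
  then show "(\<Sum>z\<in>V. w v z * (a - f z)\<^sup>2) \<le> star_en f v + wdeg v * (a - nbr_avg f v)\<^sup>2"
    using star_identity[OF assms, of "f v" f] star_identity[OF assms, of a f] by (simp add: star_en_def)
qed

text \<open>Isolates the part of the energy that depends on the values at \<open>i\<close> and
  \<open>v\<close>. The edge between them lies in both stars, hence the subtraction.\<close>

lemma en_two_stars:
  assumes i: "i \<in> V" and v: "v \<in> V" and iv: "i \<noteq> v"
  shows "en f f = (\<Sum>x\<in>V - {i, v}. \<Sum>y\<in>V - {i, v}. w x y * (f x - f y)\<^sup>2) / 2
    + star_en f i + star_en f v - w i v * (f i - f v)\<^sup>2"
proof -
  let ?W = "V - {i, v}" and ?e = "\<lambda>x y. w x y * (f x - f y)\<^sup>2"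
  have split: "(\<Sum>x\<in>V. g x) = g i + g v + (\<Sum>x\<in>?W. g x)" for g :: "'a \<Rightarrow> real"
  proof -
    have "V - {i} - {v} = ?W" by auto
    then show ?thesis using i v iv by (simp add: sum.remove[of V i] sum.remove[of "V - {i}" v])
  qed
  have sym: "?e x y = ?e y x" for x y using w_sym[of x y] by (simp add: power2_commute)
  have "(\<Sum>x\<in>V. \<Sum>y\<in>V. ?e x y) = star_en f i + star_en f v + (\<Sum>x\<in>?W. ?e x i + ?e x v + (\<Sum>y\<in>?W. ?e x y))"
    unfolding split[of "\<lambda>x. \<Sum>y\<in>V. ?e x y"] star_en_def by (simp add: split)
  also have "(\<Sum>x\<in>?W. ?e x i + ?e x v + (\<Sum>y\<in>?W. ?e x y)) =
      (\<Sum>x\<in>?W. ?e i x) + (\<Sum>x\<in>?W. ?e v x) + (\<Sum>x\<in>?W. \<Sum>y\<in>?W. ?e x y)"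
    by (simp add: sum.distrib sym[of _ i] sym[of _ v])
  also have "(\<Sum>x\<in>?W. ?e i x) = star_en f i - ?e i v" unfolding star_en_def split by simp
  also have "(\<Sum>x\<in>?W. ?e v x) = star_en f v - ?e i v" unfolding star_en_def split using sym[of v i] by simp
  finally have "(\<Sum>x\<in>V. \<Sum>y\<in>V. ?e x y) = 2 * (star_en f i + star_en f v - ?e i v) + (\<Sum>x\<in>?W. \<Sum>y\<in>?W. ?e x y)"
    by simp
  moreover have "en f f = (\<Sum>x\<in>V. \<Sum>y\<in>V. ?e x y) / 2"
    by (simp add: en_def power2_eq_square mult.assoc)
  ultimately show ?thesis by simp
qed

lemma star_en_le:
  assumes "i \<in> V" "v \<in> V" "i \<noteq> v"
  shows "star_en f i + star_en f v \<le> en f f + w i v * (f i - f v)\<^sup>2"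
proof -
  have "0 \<le> (\<Sum>x\<in>V - {i, v}. \<Sum>y\<in>V - {i, v}. w x y * (f x - f y)\<^sup>2)" by (intro sum_nonneg) auto
  then show ?thesis using en_two_stars[OF assms, of f] by simp
qed

lemma edge_en_le:
  assumes "i \<in> V" "v \<in> V" "i \<noteq> v"
  shows "w i v * (f i - f v)\<^sup>2 \<le> en f f"
proof -
  have a: "w i v * (f i - f v)\<^sup>2 \<le> star_en f i"
    unfolding star_en_def by (rule member_le_sum) (use assms in auto)
  have "w i v * (f i - f v)\<^sup>2 = w v i * (f v - f i)\<^sup>2" using w_sym[of i v] by (simp add: power2_commute)
  also have "\<dots> \<le> star_en f v"
    unfolding star_en_def by (rule member_le_sum) (use assms in auto)
  finally show ?thesis using a star_en_le[OF assms, of f] by simp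
qed

text \<open>If the resistance between \<open>i\<close> and \<open>v\<close> is nearly minimal, then moving the values at \<open>i\<close> and
  \<open>v\<close> away from the neighbourhood averages cannot gain much, so these averages nearly agree.\<close>

lemma good_edge_avg:
  assumes F: "forests {i} > 0" and e: "good_edge \<epsilon> d i v" and eps: "0 < \<epsilon>" "\<epsilon> \<le> 1 / 12" and d: "1 \<le> \<epsilon> * d"
    and s: "0 < s" "en f f \<le> \<epsilon> * d * s\<^sup>2"
  shows "nbr_avg f i - nbr_avg f v \<le> 9 * \<epsilon> * s"
proof (cases "nbr_avg f i - nbr_avg f v \<le> 0")
  case True
  moreover have "0 \<le> 9 * \<epsilon> * s" using eps s by simp
  ultimately show ?thesis by linarith
next
  case False
  define x where "x = nbr_avg f i - nbr_avg f v"
  \<comment> \<open>The test function \<open>g\<close> below puts \<open>i\<close> and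
    \<open>v\<close> a distance \<open>s\<close> beyond their neighbourhood averages. Compared with
    the averages this costs \<open>wdeg * s\<^sup>2\<close> per vertex, while the potential
    difference becomes \<open>y = x + 2 * s\<close>.\<close>
  define a where "a = nbr_avg f i + s"
  define b where "b = nbr_avg f v - s"
  define y where "y = x + 2 * s"
  define E where "E = en f f"
  have x0: "x > 0" using False by (simp add: x_def)
  have iv: "i \<in> V" "v \<in> V" "w i v = 1" using e by (auto simp: good_edge_def good_vertex_def)
  then have ne: "i \<noteq> v" by auto
  have d0: "d > 0" using d eps by (metis less_le_trans mult_pos_pos zero_less_mult_pos zero_less_one)
  have deg: "(1 - \<epsilon>) * d \<le> wdeg i" "(1 - \<epsilon>) * d \<le> wdeg v" "wdeg i \<le> (1 + \<epsilon>) * d" "wdeg v \<le> (1 + \<epsilon>) * d"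
    using e by (auto simp: good_edge_def good_vertex_def)
  have "0 < (1 - \<epsilon>) * d" using d0 eps by simp
  then have dp: "wdeg i > 0" "wdeg v > 0" using deg by linarith+
  define g where "g z = (if z = i then a else if z = v then b else f z)" for z
  have rest: "(\<Sum>x\<in>V - {i, v}. \<Sum>y\<in>V - {i, v}. w x y * (g x - g y)\<^sup>2) =
      (\<Sum>x\<in>V - {i, v}. \<Sum>y\<in>V - {i, v}. w x y * (f x - f y)\<^sup>2)"
    by (intro sum.cong refl) (auto simp: g_def)
  have st: "star_en g i \<le> (\<Sum>z\<in>V. w i z * (a - f z)\<^sup>2) + (a - b)\<^sup>2"
    "star_en g v \<le> (\<Sum>z\<in>V. w v z * (b - f z)\<^sup>2) + (a - b)\<^sup>2"
  proof -
    have "star_en g i \<le> (\<Sum>z\<in>V. w i z * (a - f z)\<^sup>2 + (if z = v then (a - b)\<^sup>2 else 0))"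
      unfolding star_en_def by (rule sum_mono) (use ne iv in \<open>auto simp: g_def\<close>)
    then show "star_en g i \<le> (\<Sum>z\<in>V. w i z * (a - f z)\<^sup>2) + (a - b)\<^sup>2" using iv by (simp add: sum.distrib)
    have "star_en g v \<le> (\<Sum>z\<in>V. w v z * (b - f z)\<^sup>2 + (if z = i then (a - b)\<^sup>2 else 0))"
      unfolding star_en_def by (rule sum_mono) (use ne iv w_sym[of v i] in \<open>auto simp: g_def power2_commute\<close>)
    then show "star_en g v \<le> (\<Sum>z\<in>V. w v z * (b - f z)\<^sup>2) + (a - b)\<^sup>2" using iv by (simp add: sum.distrib)
  qed
  have ab: "a - b = y" "g i = a" "g v = b" using ne by (auto simp: a_def b_def y_def x_def g_def)
  have "en g g \<le> E + (f i - f v)\<^sup>2 + wdeg i * s\<^sup>2 + wdeg v * s\<^sup>2 + y\<^sup>2"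
    using en_two_stars[OF iv(1,2) ne, of g] en_two_stars[OF iv(1,2) ne, of f] st rest
      star_avg(2)[OF dp(1), of a f] star_avg(2)[OF dp(2), of b f] ab iv(3)
    by (simp add: E_def a_def b_def)
  moreover have "(f i - f v)\<^sup>2 \<le> E" using edge_en_le[OF iv(1,2) ne, of f] iv(3) by (simp add: E_def)
  moreover have "wdeg i * s\<^sup>2 \<le> ((1 + \<epsilon>) * d) * s\<^sup>2" "wdeg v * s\<^sup>2 \<le> ((1 + \<epsilon>) * d) * s\<^sup>2"
    using deg by (auto intro!: mult_right_mono)
  ultimately have eg: "en g g \<le> 2 * E + 2 * ((1 + \<epsilon>) * d * s\<^sup>2) + y\<^sup>2" by simp
  have "y\<^sup>2 \<le> reff i v * en g g" using reff_bound[OF F iv(2), of g] ab by simp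
  also have "\<dots> \<le> ((2 + \<epsilon>) / d) * (2 * E + 2 * ((1 + \<epsilon>) * d * s\<^sup>2) + y\<^sup>2)"
    by (intro mult_mono eg) (use e d0 eps in \<open>auto simp: good_edge_def\<close>)
  finally have "d * y\<^sup>2 \<le> (2 + \<epsilon>) * (2 * E + 2 * ((1 + \<epsilon>) * d * s\<^sup>2) + y\<^sup>2)"
    using d0 by (simp add: field_simps)
  also have "\<dots> \<le> (2 + \<epsilon>) * (2 * (\<epsilon> * d * s\<^sup>2) + 2 * ((1 + \<epsilon>) * d * s\<^sup>2) + (\<epsilon> * d) * y\<^sup>2)"
    using s d eps mult_right_mono[OF d, of "y\<^sup>2"] by (intro mult_left_mono) (auto simp: E_def)
  also have "\<dots> = d * ((2 + \<epsilon>) * (2 * \<epsilon> * s\<^sup>2 + 2 * (1 + \<epsilon>) * s\<^sup>2 + \<epsilon> * y\<^sup>2))"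
    by (simp add: algebra_simps)
  finally have y: "y\<^sup>2 \<le> (2 + \<epsilon>) * (2 * \<epsilon> * s\<^sup>2 + 2 * (1 + \<epsilon>) * s\<^sup>2 + \<epsilon> * y\<^sup>2)"
    using d0 by simp
  have e2: "\<epsilon> * \<epsilon> \<le> \<epsilon> / 12" using mult_left_mono[OF eps(2), of \<epsilon>] eps by simp
  have c1: "(2 + \<epsilon>) * (2 * \<epsilon> + 2 * (1 + \<epsilon>)) \<le> 4 + 11 * \<epsilon>"
  proof -
    have "\<epsilon> * (\<epsilon> * 4) \<le> \<epsilon> * 1" by (rule mult_left_mono) (use eps in auto)
    then show ?thesis by (simp add: algebra_simps)
  qed
  have c2: "(2 + \<epsilon>) * \<epsilon> \<le> 3 * \<epsilon>" using eps by (intro mult_right_mono) auto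
  have "(2 + \<epsilon>) * (2 * \<epsilon> * s\<^sup>2 + 2 * (1 + \<epsilon>) * s\<^sup>2 + \<epsilon> * y\<^sup>2) =
      ((2 + \<epsilon>) * (2 * \<epsilon> + 2 * (1 + \<epsilon>))) * s\<^sup>2 + ((2 + \<epsilon>) * \<epsilon>) * y\<^sup>2"
    by (simp add: algebra_simps)
  also have "\<dots> \<le> (4 + 11 * \<epsilon>) * s\<^sup>2 + (3 * \<epsilon>) * y\<^sup>2"
    by (intro add_mono mult_right_mono c1 c2) auto
  finally have "(1 - 3 * \<epsilon>) * y\<^sup>2 \<le> (4 + 11 * \<epsilon>) * s\<^sup>2" using y by (simp add: algebra_simps)
  \<comment> \<open>The terms \<open>4 * s\<^sup>2\<close> on both sides cancel up to order
    \<open>\<epsilon>\<close>; the cross term \<open>4 * x * s\<close> is left and bounds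
    \<open>x\<close> by a multiple of \<open>\<epsilon> * s\<close>.\<close>
  moreover have "(1 - 3 * \<epsilon>) * (4 * x * s + 4 * s\<^sup>2) \<le> (1 - 3 * \<epsilon>) * y\<^sup>2"
    using eps by (intro mult_left_mono) (auto simp: y_def power2_eq_square algebra_simps)
  ultimately have "(1 - 3 * \<epsilon>) * (4 * x * s) \<le> 23 * \<epsilon> * s\<^sup>2"
    by (simp add: algebra_simps)
  moreover have "(3 / 4) * (4 * x * s) \<le> (1 - 3 * \<epsilon>) * (4 * x * s)"
    using eps x0 s by (intro mult_right_mono) auto
  ultimately have "3 * (x * s) \<le> 23 * \<epsilon> * s\<^sup>2" by linarith
  then have "(3 * x) * s \<le> (23 * \<epsilon> * s) * s" by (simp add: power2_eq_square)
  then have "3 * x \<le> 23 * \<epsilon> * s" using s(1) by (simp only: mult_le_cancel_right_pos)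
  moreover have "0 \<le> \<epsilon> * s" using eps s by simp
  ultimately show ?thesis by (simp add: x_def)
qed

text \<open>Quantified over all \<open>f\<close>, so that the constants add up along paths. On the
  scale \<open>sqrt (en f f / d)\<close> the value of \<open>f\<close> at a vertex of degree about
  \<open>d\<close> differs from its neighbourhood average.\<close>

definition near :: "real \<Rightarrow> real \<Rightarrow> 'a \<Rightarrow> 'a \<Rightarrow> bool" where
  "near d \<kappa> i j \<longleftrightarrow> (\<forall>f. \<bar>nbr_avg f i - nbr_avg f j\<bar> \<le> \<kappa> * sqrt (en f f / d))"

lemma nbr_avg_minus: "nbr_avg (\<lambda>x. - f x) v = - nbr_avg f v"
  by (simp add: nbr_avg_def sum_negf)

lemma en_minus: "en (\<lambda>x. - f x) (\<lambda>x. - f x) = en f f"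
  by (simp add: en_def algebra_simps)

text \<open>\<open>good_edge_avg\<close> with \<open>s\<^sup>2\<close> close to
  \<open>en f f / (\<epsilon> * d)\<close>, the least admissible value, which turns
  \<open>9 * \<epsilon> * s\<close> into \<open>9 * sqrt \<epsilon>\<close> times the scale of
  \<open>near\<close>.\<close>

lemma good_edge_near:
  assumes F: "forests {i} > 0" and e: "good_edge \<epsilon> d i v" and eps: "0 < \<epsilon>" "\<epsilon> \<le> 1 / 12" and d: "1 \<le> \<epsilon> * d"
  shows "near d (9 * sqrt \<epsilon>) i v"
  unfolding near_def
proof
  fix f
  have d0: "d > 0" using d eps by (metis less_le_trans mult_pos_pos zero_less_mult_pos zero_less_one)
  have one: "nbr_avg f i - nbr_avg f v \<le> 9 * sqrt \<epsilon> * sqrt (en f f / d)" for f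
  proof (rule field_le_epsilon)
    fix r :: real assume r: "0 < r"
    \<comment> \<open>The summand containing \<open>r\<close> keeps \<open>s\<close> positive when
      the energy of \<open>f\<close> is zero.\<close>
    define s where "s = sqrt (en f f / (\<epsilon> * d)) + r / (9 * \<epsilon>)"
    have q: "0 \<le> en f f / (\<epsilon> * d)" using eps d0 by simp
    have s0: "0 < s" unfolding s_def using q r eps by (intro add_nonneg_pos) auto
    have "en f f / (\<epsilon> * d) \<le> s\<^sup>2"
      using power_mono[of "sqrt (en f f / (\<epsilon> * d))" s 2] q r eps by (simp add: s_def)
    then have "en f f \<le> \<epsilon> * d * s\<^sup>2" using eps d0 by (simp add: field_simps)
    then have "nbr_avg f i - nbr_avg f v \<le> 9 * \<epsilon> * s" by (rule good_edge_avg[OF F e eps d s0])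
    also have "\<dots> = 9 * (\<epsilon> * sqrt (en f f / (\<epsilon> * d))) + r" using eps by (simp add: s_def algebra_simps)
    also have "\<epsilon> * sqrt (en f f / (\<epsilon> * d)) = sqrt \<epsilon> * sqrt (en f f / d)"
    proof -
      have "\<epsilon> * sqrt (en f f / (\<epsilon> * d)) = (\<epsilon> / sqrt \<epsilon>) * sqrt (en f f / d)"
        by (simp add: real_sqrt_divide real_sqrt_mult)
      then show ?thesis using eps real_div_sqrt[of \<epsilon>] by simp
    qed
    finally show "nbr_avg f i - nbr_avg f v \<le> 9 * sqrt \<epsilon> * sqrt (en f f / d) + r" by simp
  qed
  show "\<bar>nbr_avg f i - nbr_avg f v\<bar> \<le> 9 * sqrt \<epsilon> * sqrt (en f f / d)"
    using one[of f] one[of "\<lambda>x. - f x"] by (simp add: nbr_avg_minus en_minus)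
qed

lemma near_trans: "near d \<kappa> i j \<Longrightarrow> near d \<kappa>' j k \<Longrightarrow> near d (\<kappa> + \<kappa>') i k"
  unfolding near_def
proof
  fix f
  assume a: "\<forall>f. \<bar>nbr_avg f i - nbr_avg f j\<bar> \<le> \<kappa> * sqrt (en f f / d)"
    "\<forall>f. \<bar>nbr_avg f j - nbr_avg f k\<bar> \<le> \<kappa>' * sqrt (en f f / d)"
  show "\<bar>nbr_avg f i - nbr_avg f k\<bar> \<le> (\<kappa> + \<kappa>') * sqrt (en f f / d)"
    using a(1)[rule_format, of f] a(2)[rule_format, of f] by (simp add: distrib_right)
qed

lemma path_near:
  assumes F: "forests {a} > 0" "a \<in> V" and eps: "0 < \<epsilon>" "\<epsilon> \<le> 1 / 12" and d: "1 \<le> \<epsilon> * d"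
    and p: "(i, j) \<in> {(u, v). good_edge \<epsilon> d u v} ^^ n"
  shows "near d (real n * (9 * sqrt \<epsilon>)) i j"
  using p
proof (induction n arbitrary: j)
  case 0
  then show ?case by (simp add: near_def)
next
  case (Suc n)
  then obtain k where k: "(i, k) \<in> {(u, v). good_edge \<epsilon> d u v} ^^ n" "good_edge \<epsilon> d k j" by auto
  have "k \<in> V" using k(2) by (auto simp: good_edge_def good_vertex_def)
  then have "forests {k} > 0" using F forests_single[of a k] by simp
  then have "near d (real n * (9 * sqrt \<epsilon>) + 9 * sqrt \<epsilon>) i j"
    using near_trans[OF Suc.IH[OF k(1)] good_edge_near[OF _ k(2) eps d]] by simp
  then show ?case by (simp add: algebra_simps)
qed

text \<open>For the potential \<open>f\<close> of a unit current between \<open>i\<close> and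
  \<open>j\<close>, the potential drop and the energy both equal the resistance. The drop is split
  at the two neighbourhood averages: the outer parts are bounded by the star energies, the middle
  part by \<open>near\<close>. The leading constant two comes from Cauchy-Schwarz over the two
  stars.\<close>

lemma near_reff:
  assumes F: "forests {i} > 0" and i: "i \<in> V" and j: "j \<in> V" and ij: "i \<noteq> j" and n: "near d \<kappa> i j"
    and deg: "(1 - \<epsilon>) * d \<le> wdeg i" "(1 - \<epsilon>) * d \<le> wdeg j"
    and eps: "0 < \<epsilon>" "\<epsilon> \<le> 1 / 12" and d: "1 \<le> \<epsilon> * d" and k: "0 \<le> \<kappa>" "\<kappa> \<le> 1 / 2"
  shows "reff i j \<le> (2 + 24 * \<epsilon> + 5 * \<kappa>) / d"
proof -
  define f where "f = gr {i} j"
  define \<rho> where "\<rho> = reff i j"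
  have d0: "d > 0" using d eps by (metis less_le_trans mult_pos_pos zero_less_mult_pos zero_less_one)
  have \<rho>0: "0 \<le> \<rho>" by (simp add: \<rho>_def reff_def)
  have f: "f i = 0" "f j = \<rho>" "en f f = \<rho>"
    using en_gr_gr[OF F j j] by (auto simp: f_def \<rho>_def reff_def gr_root)
  define D where "D = (1 - \<epsilon>) * d"
  have D0: "D > 0" using d0 eps by (simp add: D_def)
  then have dp: "wdeg i > 0" "wdeg j > 0" using deg by (auto simp: D_def)
  have av: "\<bar>f u - nbr_avg f u\<bar> \<le> sqrt (star_en f u / D)" if "D \<le> wdeg u" for u
  proof (rule real_le_rsqrt)
    have "D * (f u - nbr_avg f u)\<^sup>2 \<le> wdeg u * (f u - nbr_avg f u)\<^sup>2" using that by (intro mult_right_mono) auto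
    also have "\<dots> \<le> star_en f u" by (rule star_avg) (use that D0 in linarith)
    finally show "\<bar>f u - nbr_avg f u\<bar>\<^sup>2 \<le> star_en f u / D" using D0 by (simp add: field_simps)
  qed
  have st: "sqrt a + sqrt b \<le> sqrt (2 * (a + b))" if "0 \<le> a" "0 \<le> b" for a b :: real
  proof (rule real_le_rsqrt)
    have "0 \<le> (sqrt a - sqrt b)\<^sup>2" by simp
    then show "(sqrt a + sqrt b)\<^sup>2 \<le> 2 * (a + b)" using that by (simp add: power2_eq_square algebra_simps)
  qed
  \<comment> \<open>\<open>q\<close> bounds the share of a possible edge between \<open>i\<close>
    and \<open>j\<close>, which lies in both stars. The estimate is run twice: \<open>q = 1\<close>
    yields \<open>\<rho> \<le> 8 * \<epsilon>\<close>, and \<open>q = 8 * \<epsilon>\<close> then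
    yields the sharp constant.\<close>
  have main: "\<rho> \<le> (sqrt (2 * (1 + q) / (1 - \<epsilon>)) + \<kappa>)\<^sup>2 / d" if q: "w i j * \<rho> \<le> q" for q
  proof (cases "\<rho> = 0")
    case True
    then show ?thesis using d0 by simp
  next
    case False
    have q0: "0 \<le> q" using q \<rho>0 w_nonneg[of i j] by (meson mult_nonneg_nonneg order_trans)
    have "\<rho> \<le> \<bar>f i - nbr_avg f i\<bar> + \<bar>nbr_avg f i - nbr_avg f j\<bar> + \<bar>f j - nbr_avg f j\<bar>" using f by simp
    also have "\<dots> \<le> sqrt (star_en f i / D) + \<kappa> * sqrt (\<rho> / d) + sqrt (star_en f j / D)"
      using av[of i] av[of j] deg n[unfolded near_def, rule_format, of f] f by (simp add: D_def)
    also have "\<dots> \<le> sqrt (2 * (star_en f i / D + star_en f j / D)) + \<kappa> * sqrt (\<rho> / d)"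
      using st[of "star_en f i / D" "star_en f j / D"] D0 by simp
    also have "sqrt (2 * (star_en f i / D + star_en f j / D)) \<le> sqrt (2 * (1 + q) / (1 - \<epsilon>) * (\<rho> / d))"
    proof (rule real_sqrt_le_mono)
      have "star_en f i + star_en f j \<le> \<rho> + (w i j * \<rho>) * \<rho>"
        using star_en_le[OF i j ij, of f] f by (simp add: power2_eq_square mult.assoc)
      also have "\<dots> \<le> \<rho> + q * \<rho>" using q \<rho>0 by (intro add_mono mult_right_mono) auto
      finally have "2 * (star_en f i + star_en f j) / D \<le> 2 * (\<rho> + q * \<rho>) / D"
        using D0 by (intro divide_right_mono) auto
      also have "2 * (\<rho> + q * \<rho>) = 2 * (1 + q) * \<rho>" by (simp add: algebra_simps)
      also have "2 * (1 + q) * \<rho> / D = 2 * (1 + q) / (1 - \<epsilon>) * (\<rho> / d)" by (simp only: D_def times_divide_times_eq)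
      finally show "2 * (star_en f i / D + star_en f j / D) \<le> 2 * (1 + q) / (1 - \<epsilon>) * (\<rho> / d)"
        by (simp add: add_divide_distrib)
    qed
    finally have "\<rho> \<le> (sqrt (2 * (1 + q) / (1 - \<epsilon>)) + \<kappa>) * sqrt (\<rho> / d)"
      by (simp only: distrib_right real_sqrt_mult)
    then have "\<rho>\<^sup>2 \<le> ((sqrt (2 * (1 + q) / (1 - \<epsilon>)) + \<kappa>) * sqrt (\<rho> / d))\<^sup>2"
      using \<rho>0 by (intro power_mono) auto
    also have "\<dots> = (sqrt (2 * (1 + q) / (1 - \<epsilon>)) + \<kappa>)\<^sup>2 * (\<rho> / d)"
      using \<rho>0 d0 by (simp add: power_mult_distrib)
    finally have "\<rho> * \<rho> \<le> ((sqrt (2 * (1 + q) / (1 - \<epsilon>)) + \<kappa>)\<^sup>2 / d) * \<rho>"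
      by (simp add: power2_eq_square)
    then show ?thesis by (rule mult_right_le_imp_le) (use False \<rho>0 in simp)
  qed
  have sq: "(sqrt z + \<kappa>)\<^sup>2 \<le> z + 2 * \<kappa> * B + \<kappa>" if "0 \<le> z" "z \<le> B\<^sup>2" "0 \<le> B" for z B
  proof -
    have "sqrt z \<le> B" using that real_le_lsqrt by blast
    then have "2 * \<kappa> * sqrt z \<le> 2 * \<kappa> * B" using k by (intro mult_left_mono) auto
    moreover have "\<kappa>\<^sup>2 \<le> \<kappa>" using k by (simp add: power2_eq_square mult_left_le)
    ultimately show ?thesis using that by (simp add: power2_sum algebra_simps)
  qed
  have w\<rho>: "w i j * \<rho> \<le> 1"
  proof -
    have "w i j * \<rho>\<^sup>2 \<le> \<rho>" using edge_en_le[OF i j ij, of f] f by simp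
    then have "(w i j * \<rho>) * \<rho> \<le> 1 * \<rho>" by (simp add: power2_eq_square mult.assoc)
    then show ?thesis using \<rho>0 by (cases "\<rho> = 0") auto
  qed
  have e1: "2 * (1 + 1) / (1 - \<epsilon>) \<le> 9 / 2" using eps by (simp add: field_simps)
  have "(sqrt (2 * (1 + 1) / (1 - \<epsilon>)) + \<kappa>)\<^sup>2 \<le> 2 * (1 + 1) / (1 - \<epsilon>) + 2 * \<kappa> * (5 / 2) + \<kappa>"
    by (rule sq) (use e1 eps in \<open>auto simp: power2_eq_square\<close>)
  also have "\<dots> \<le> 8" using e1 k by simp
  finally have "(sqrt (2 * (1 + 1) / (1 - \<epsilon>)) + \<kappa>)\<^sup>2 / d \<le> 8 / d" using d0 by (intro divide_right_mono) auto
  then have "\<rho> \<le> 8 / d" using main[OF w\<rho>] by simp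
  also have "\<dots> \<le> 8 * \<epsilon>" using d d0 by (simp add: field_simps)
  finally have r8: "\<rho> \<le> 8 * \<epsilon>" .
  have "w i j * \<rho> \<le> 1 * \<rho>" using \<rho>0 by (intro mult_right_mono) auto
  then have "\<rho> \<le> (sqrt (2 * (1 + 8 * \<epsilon>) / (1 - \<epsilon>)) + \<kappa>)\<^sup>2 / d" using main[of "8 * \<epsilon>"] r8 by simp
  moreover have e2: "2 * (1 + 8 * \<epsilon>) / (1 - \<epsilon>) \<le> 2 + 24 * \<epsilon>"
  proof -
    have "24 * (\<epsilon> * \<epsilon>) \<le> 2 * \<epsilon>" using mult_left_mono[OF eps(2), of \<epsilon>] eps by simp
    then show ?thesis using eps by (simp add: field_simps)
  qed
  moreover have "(sqrt (2 * (1 + 8 * \<epsilon>) / (1 - \<epsilon>)) + \<kappa>)\<^sup>2 \<le> 2 * (1 + 8 * \<epsilon>) / (1 - \<epsilon>) + 2 * \<kappa> * 2 + \<kappa>"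
    by (rule sq) (use e2 eps in \<open>auto simp: power2_eq_square\<close>)
  ultimately have "(sqrt (2 * (1 + 8 * \<epsilon>) / (1 - \<epsilon>)) + \<kappa>)\<^sup>2 \<le> 2 + 24 * \<epsilon> + 5 * \<kappa>" by simp
  then have "(sqrt (2 * (1 + 8 * \<epsilon>) / (1 - \<epsilon>)) + \<kappa>)\<^sup>2 / d \<le> (2 + 24 * \<epsilon> + 5 * \<kappa>) / d"
    using d0 by (intro divide_right_mono) auto
  then show ?thesis using \<open>\<rho> \<le> (sqrt (2 * (1 + 8 * \<epsilon>) / (1 - \<epsilon>)) + \<kappa>)\<^sup>2 / d\<close> by (simp add: \<rho>_def)
qed

end

section \<open>The trace of the Green function with \<open>I\<close> wired\<close>

context graph_net
begin

lemma en_sum_left: "finite J \<Longrightarrow> en (\<lambda>x. \<Sum>j\<in>J. f j x) h = (\<Sum>j\<in>J. en (f j) h)"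
  by (induction J rule: finite_induct) (simp_all add: en_add_left)

lemma en_sum_right: "finite J \<Longrightarrow> en h (\<lambda>x. \<Sum>j\<in>J. f j x) = (\<Sum>j\<in>J. en h (f j))"
  using en_sum_left[of J f h] by (simp add: en_sym[of h])

lemma forests_pos:
  assumes F: "forests {a} > 0" "a \<in> V" and R: "R \<subseteq> V" "R \<noteq> {}"
  shows "forests R > 0"
proof -
  obtain r where r: "r \<in> R" using R by blast
  have fin: "finite R" by (rule finite_subset[OF R(1)]) simp
  have "forests {r} * real (card R) \<le> forests R * ((\<Sum>v\<in>V. wdeg v) + real (card R)) ^ (card R - 1)"
    by (rule forests_lower[OF fin r R(1)]) (use R in \<open>auto intro!: member_le_sum\<close>)
  moreover have "0 < forests {r} * real (card R)"
  proof (rule mult_pos_pos)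
    show "0 < forests {r}" using F forests_single[of r a] r R by auto
    show "0 < real (card R)" using r fin by (simp add: card_gt_0_iff) blast
  qed
  ultimately have "forests R \<noteq> 0" by auto
  then show ?thesis using forests_nonneg[of R] by linarith
qed

text \<open>Adding multiples of the functions \<open>gr {i} j\<close> leaves the pairing with
  \<open>gr I u\<close> unchanged, since \<open>gr I u\<close> vanishes on \<open>I\<close>.
  Cauchy-Schwarz then bounds \<open>gr I u u\<close> by the energy of the combination, whatever
  \<open>\<alpha>\<close> is.\<close>

lemma gr_quadratic:
  assumes F: "forests {i} > 0" and I: "I \<subseteq> V" "i \<in> I" and u: "u \<in> V"
  shows "gr I u u \<le> gr {i} u u - 2 * \<alpha> * (\<Sum>j\<in>I - {i}. gr {i} j u) + \<alpha>\<^sup>2 * (\<Sum>j\<in>I - {i}. \<Sum>l\<in>I - {i}. gr {i} j l)"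
proof -
  let ?J = "I - {i}"
  have fin: "finite ?J" using finite_subset[OF I(1)] by auto
  have iV: "i \<in> V" using I by auto
  have FI: "forests I > 0" by (rule forests_pos[OF F iV I(1)]) (use I in auto)
  define k where "k = (\<lambda>x. \<Sum>j\<in>?J. gr {i} j x)"
  define h where "h = (\<lambda>x. gr {i} u x - \<alpha> * k x)"
  have en_g: "en (gr {i} x) (gr {i} y) = gr {i} x y" if "x \<in> V" "y \<in> V" for x y
    by (rule en_gr_gr[OF F that])
  have uk: "en (gr {i} u) k = (\<Sum>j\<in>?J. gr {i} j u)"
    unfolding k_def en_sum_right[OF fin]
    by (rule sum.cong[OF refl]) (use en_g[OF u] gr_sym[OF F u] I in auto)
  have kk: "en k k = (\<Sum>j\<in>?J. \<Sum>l\<in>?J. gr {i} j l)"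
    unfolding k_def en_sum_left[OF fin] unfolding en_sum_right[OF fin]
    by (intro sum.cong refl en_g) (use I in auto)
  have hh: "en h h = gr {i} u u - 2 * \<alpha> * (\<Sum>j\<in>?J. gr {i} j u) + \<alpha>\<^sup>2 * (\<Sum>j\<in>?J. \<Sum>l\<in>?J. gr {i} j l)"
    unfolding h_def en_diff_left en_diff_right en_cmult_left en_cmult_right en_sym[of k "gr {i} u"] uk kk en_g[OF u u]
    by (simp add: power2_eq_square algebra_simps)
  have "en h (gr I u) = gr I u u"
  proof -
    have "en (gr {i} u) (gr I u) = gr I u u"
      by (rule en_gr'[OF F u]) (use I in \<open>auto simp: gr_root\<close>)
    moreover have "en (gr {i} j) (gr I u) = 0" if "j \<in> ?J" for j
      using en_gr'[OF F, of j "gr I u"] that I by (auto simp: gr_root)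
    ultimately show ?thesis
      unfolding h_def en_diff_left en_cmult_left k_def en_sum_left[OF fin] by simp
  qed
  then have "(gr I u u)\<^sup>2 \<le> en h h * gr I u u"
    using en_CS[of h "gr I u"] en_gr_gr[OF FI u u] by simp
  then have "gr I u u \<le> en h h"
    using gr_nonneg[of I u u] by (cases "gr I u u = 0") (auto simp: power2_eq_square)
  then show ?thesis using hh by simp
qed

text \<open>A unit current entering at \<open>j\<close> leaves at \<open>i\<close>: the Laplacian is
  known off \<open>i\<close> and sums to zero.\<close>

lemma gr_flow_in:
  assumes F: "forests {i} > 0" and i: "i \<in> V" and j: "j \<in> V" "j \<noteq> i"
  shows "(\<Sum>u\<in>V. w i u * gr {i} j u) = 1"
proof -
  have "(\<Sum>x\<in>V. lap (gr {i} j) x) = lap (gr {i} j) i + (\<Sum>x\<in>V - {i}. if x = j then 1 else 0)"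
    using lap_gr[OF F, of _ j] i j by (simp add: sum.remove[of V i])
  moreover have "lap (gr {i} j) i = - (\<Sum>u\<in>V. w i u * gr {i} j u)"
    by (simp add: lap_def gr_root sum_negf)
  ultimately show ?thesis using j sum_lap[of "gr {i} j"] by simp
qed

text \<open>In the ideal case \<open>gr {i}\<close> has entries \<open>2/d\<close> on and
  \<open>1/d\<close> off the diagonal of \<open>I - {i}\<close>. With
  \<open>\<alpha> = 1 / m\<close>, which is then the optimal coefficient, each \<open>i\<close>
  contributes \<open>2 - 2 * (m - 1) / m + (m - 1) / m = 1 + 1 / m\<close>, in total
  \<open>m + 1\<close>.\<close>

lemma EN_bound:
  assumes F: "forests {a0} > 0" "a0 \<in> V" and I: "I \<subseteq> V" "I \<noteq> {}"
    and good: "\<And>i. i \<in> I \<Longrightarrow> good_vertex \<epsilon> d i"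
    and pairs: "\<And>i j. i \<in> I \<Longrightarrow> j \<in> I \<Longrightarrow> i \<noteq> j \<Longrightarrow> reff i j \<le> (2 + a) / d"
    and eps: "0 < \<epsilon>" "\<epsilon> \<le> 1 / 12" and d: "1 \<le> \<epsilon> * d" and a: "0 \<le> a"
  shows "(\<Sum>u\<in>V - I. cw I u * gr I u u) \<le> real (card I) + 1 + 2 * real (card I) * (a + 4 * \<epsilon>)"
proof -
  define m where "m = real (card I)"
  define b where "b = a + 3 * \<epsilon>"
  have fin: "finite I" using finite_subset[OF I(1)] by auto
  have m1: "m \<ge> 1" unfolding m_def using I fin by (simp add: Suc_leI card_gt_0_iff)
  have d0: "d > 0" using d eps by (metis less_le_trans mult_pos_pos zero_less_mult_pos zero_less_one)
  have b0: "b \<ge> 0" using a eps by (simp add: b_def)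
  have Fi: "forests {i} > 0" if "i \<in> V" for i using F forests_single[OF that F(2)] by simp
  \<comment> \<open>Lower bounds on resistance matter too, because the off-diagonal entry
    \<open>gr {i} j l\<close> is half of \<open>gr {i} j j + gr {i} l l - reff j l\<close>.\<close>
  have low: "reff j l \<ge> 2 * (1 - 3 * \<epsilon>) / d" if jl: "j \<in> I" "l \<in> I" "j \<noteq> l" for j l
  proof -
    have V: "j \<in> V" "l \<in> V" using jl I by auto
    have "forests {j} * (1 + 1) \<le> forests (insert l {j}) * (1 * ((1 + \<epsilon>) * d + 1 + 1))"
      by (rule forests_insert_lower) (use jl V good in \<open>auto simp: good_vertex_def\<close>)
    then have "2 / ((1 + \<epsilon>) * d + 2) \<le> reff j l"
      using Fi[OF V(1)] jl d0 eps by (simp add: reff_def gr_diag field_simps add_pos_pos)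
    moreover have "2 / ((1 + \<epsilon>) * d + 2) \<ge> 2 / ((1 + 3 * \<epsilon>) * d)"
      using d d0 eps by (intro divide_left_mono) (auto simp: algebra_simps add_pos_pos)
    moreover have "2 / ((1 + 3 * \<epsilon>) * d) \<ge> 2 * (1 - 3 * \<epsilon>) / d"
    proof -
      have "2 * (1 - 3 * \<epsilon>) * (1 + 3 * \<epsilon>) \<le> 2" using eps by (simp add: algebra_simps)
      then have "2 * (1 - 3 * \<epsilon>) \<le> 2 / (1 + 3 * \<epsilon>)" using eps by (simp add: pos_le_divide_eq)
      then have "2 * (1 - 3 * \<epsilon>) / d \<le> (2 / (1 + 3 * \<epsilon>)) / d" using d0 by (intro divide_right_mono) auto
      then show ?thesis by simp
    qed
    ultimately show ?thesis by linarith
  qed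
  have per: "(\<Sum>u\<in>V. w i u * gr I u u) \<le> (2 + \<epsilon>) - 2 * (m - 1) / m + (m - 1) / m * ((1 + b) * (1 + \<epsilon>))"
    if i: "i \<in> I" for i
  proof -
    let ?J = "I - {i}"
    let ?S = "\<Sum>j\<in>?J. \<Sum>l\<in>?J. gr {i} j l"
    have iV: "i \<in> V" using i I by auto
    have cJ: "real (card ?J) = m - 1"
      using i fin m1 by (simp add: m_def of_nat_diff)
    have gj: "gr {i} j j \<le> 2 * (1 + b) / d" if "j \<in> ?J" for j
    proof -
      have "gr {i} j j \<le> (2 + a) / d" using pairs[OF i, of j] that by (auto simp: reff_def)
      also have "\<dots> \<le> 2 * (1 + b) / d" using d0 a eps by (intro divide_right_mono) (auto simp: b_def)
      finally show ?thesis .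
    qed
    have gjl: "gr {i} j l \<le> (1 + b) / d" if "j \<in> ?J" "l \<in> ?J" "j \<noteq> l" for j l
    proof -
      have V: "j \<in> V" "l \<in> V" using that I by auto
      have "2 * gr {i} j l = gr {i} j j + gr {i} l l - reff j l"
        using reff_gr[OF Fi[OF V(1)] iV V] by simp
      also have "\<dots> \<le> (2 + a) / d + (2 + a) / d - 2 * (1 - 3 * \<epsilon>) / d"
      proof -
        have "gr {i} j j \<le> (2 + a) / d" "gr {i} l l \<le> (2 + a) / d" "2 * (1 - 3 * \<epsilon>) / d \<le> reff j l"
          using pairs[OF i, of j] pairs[OF i, of l] low[of j l] that by (auto simp: reff_def)
        then show ?thesis by linarith
      qed
      also have "\<dots> = 2 * ((1 + b) / d)" by (simp add: b_def diff_divide_distrib add_divide_distrib)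
      finally show ?thesis by linarith
    qed
    have S: "?S \<le> (m - 1) * m * ((1 + b) / d)"
    proof -
      have "?S \<le> (\<Sum>j\<in>?J. m * ((1 + b) / d))"
      proof (rule sum_mono)
        fix j assume j: "j \<in> ?J"
        have "(\<Sum>l\<in>?J. gr {i} j l) = gr {i} j j + (\<Sum>l\<in>?J - {j}. gr {i} j l)"
          using j fin by (simp add: sum.remove)
        also have "\<dots> \<le> 2 * (1 + b) / d + (\<Sum>l\<in>?J - {j}. (1 + b) / d)"
          by (intro add_mono gj j sum_mono gjl) (use j in auto)
        also have "\<dots> = 2 * (1 + b) / d + (m - 2) * ((1 + b) / d)"
        proof -
          have "real (card (?J - {j})) = m - 2"
            using j fin cJ card_Suc_Diff1[of ?J j] by simp
          then show ?thesis by simp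
        qed
        finally show "(\<Sum>l\<in>?J. gr {i} j l) \<le> m * ((1 + b) / d)" by (simp add: algebra_simps add_divide_distrib diff_divide_distrib)
      qed
      then show ?thesis using cJ by simp
    qed
    have "(\<Sum>u\<in>V. w i u * gr I u u) \<le> (\<Sum>u\<in>V. w i u * (gr {i} u u - 2 * (1 / m) * (\<Sum>j\<in>?J. gr {i} j u) + (1 / m)\<^sup>2 * ?S))"
      by (intro sum_mono mult_left_mono gr_quadratic Fi iV I i) auto
    also have "\<dots> = (\<Sum>u\<in>V. w i u * reff i u) - 2 / m * (\<Sum>u\<in>V. w i u * (\<Sum>j\<in>?J. gr {i} j u)) + (1 / m)\<^sup>2 * ?S * wdeg i"
      unfolding reff_def wdeg_def sum_distrib_left[of "2 / m"] sum_distrib_left[of "(1 / m)\<^sup>2 * ?S"]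
        sum.distrib[symmetric] sum_subtractf[symmetric]
      by (intro sum.cong refl) (simp add: algebra_simps)
    also have "(\<Sum>u\<in>V. w i u * (\<Sum>j\<in>?J. gr {i} j u)) = m - 1"
    proof -
      have "(\<Sum>u\<in>V. w i u * (\<Sum>j\<in>?J. gr {i} j u)) = (\<Sum>j\<in>?J. \<Sum>u\<in>V. w i u * gr {i} j u)"
        unfolding sum_distrib_left by (rule sum.swap)
      also have "\<dots> = (\<Sum>j\<in>?J. 1)"
        by (rule sum.cong[OF refl], rule gr_flow_in[OF Fi[OF iV] iV]) (use I in auto)
      finally show ?thesis using cJ by simp
    qed
    also have "(\<Sum>u\<in>V. w i u * reff i u) - 2 / m * (m - 1) + (1 / m)\<^sup>2 * ?S * wdeg i \<le>
        (2 + \<epsilon>) - 2 / m * (m - 1) + (1 / m)\<^sup>2 * ((m - 1) * m * ((1 + b) / d)) * ((1 + \<epsilon>) * d)"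
    proof (intro add_mono diff_mono order_refl mult_mono S)
      show "(\<Sum>u\<in>V. w i u * reff i u) \<le> 2 + \<epsilon>" "wdeg i \<le> (1 + \<epsilon>) * d"
        using good[OF i] by (auto simp: good_vertex_def)
      show "0 \<le> (1 / m)\<^sup>2 * ((m - 1) * m * ((1 + b) / d))" using m1 b0 d0 by simp
      show "0 \<le> ?S" by (intro sum_nonneg) auto
    qed auto
    also have "(1 / m)\<^sup>2 * ((m - 1) * m * ((1 + b) / d)) * ((1 + \<epsilon>) * d) = (m - 1) / m * ((1 + b) * (1 + \<epsilon>))"
      using m1 d0 by (simp add: power2_eq_square field_simps)
    finally show ?thesis by (simp add: ac_simps)
  qed
  have "(\<Sum>u\<in>V - I. cw I u * gr I u u) = (\<Sum>u\<in>V - I. \<Sum>i\<in>I. w i u * gr I u u)"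
    unfolding cw_def sum_distrib_right by (intro sum.cong refl) (simp add: w_sym)
  also have "\<dots> = (\<Sum>i\<in>I. \<Sum>u\<in>V - I. w i u * gr I u u)" by (rule sum.swap)
  also have "\<dots> \<le> (\<Sum>i\<in>I. \<Sum>u\<in>V. w i u * gr I u u)" by (intro sum_mono sum_mono2) auto
  also have "\<dots> \<le> (\<Sum>i\<in>I. (2 + \<epsilon>) - 2 * (m - 1) / m + (m - 1) / m * ((1 + b) * (1 + \<epsilon>)))"
    by (intro sum_mono per)
  also have "\<dots> = m * ((2 + \<epsilon>) - 2 * (m - 1) / m + (m - 1) / m * ((1 + b) * (1 + \<epsilon>)))"
    by (simp add: m_def)
  also have "\<dots> = m * (2 + \<epsilon>) - 2 * (m - 1) + (m - 1) * ((1 + b) * (1 + \<epsilon>))"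
    using m1 by (simp add: field_simps)
  also have "\<dots> = m + 1 + m * \<epsilon> + (m - 1) * (b + \<epsilon> + b * \<epsilon>)" by (simp add: algebra_simps)
  also have "\<dots> \<le> m + 1 + m * \<epsilon> + m * (b + \<epsilon> + b * 1)"
    using m1 b0 eps by (intro add_left_mono mult_mono add_mono mult_left_mono) auto
  also have "\<dots> = m + 1 + 2 * m * (a + 4 * \<epsilon>)" by (simp add: b_def algebra_simps)
  finally show ?thesis by (simp add: m_def)
qed

end

section \<open>The Hilbert-Schmidt bound for the wired Green function\<close>

locale graph_interp = graph_net V w + interpolation V w I for V :: "'a set" and w and I
begin

text \<open>The deviation of \<open>gr I\<close> from \<open>1 / C\<close> has trace
  \<open>E - 1\<close>, about \<open>card I\<close> in the application, so \<open>Gram_CS\<close>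
  alone would not give a small bound. Subtracting also \<open>\<delta> u / wdeg u\<close>, the share
  of the starting point of the random walk, leaves functions \<open>\<psi> u\<close> whose Gram
  matrix \<open>P\<close> has trace at most \<open>E - 1 - A + 2 * q\<close>, which is nearly zero.
  The three correction matrices \<open>R1\<close>, \<open>R2\<close>, \<open>R3\<close> are explicit
  and small because \<open>c u / wdeg u \<le> q\<close>.\<close>

lemma HS_bound:
  assumes deg: "\<And>u. u \<in> V \<Longrightarrow> 1 \<le> wdeg u" and q: "\<And>u. u \<in> U \<Longrightarrow> c u / wdeg u \<le> q"
  defines "E \<equiv> (\<Sum>u\<in>U. c u * gr I u u)" and "A \<equiv> (\<Sum>u\<in>U. c u / wdeg u)"
  shows "0 \<le> E - 1 - A + 2 * q"
    "(\<Sum>u\<in>U. \<Sum>z\<in>U. c u * c z * (gr I u z - 1 / C)\<^sup>2) \<le> 4 * ((E - 1 - A + 2 * q)\<^sup>2 + 2 * q * A + 4 * q\<^sup>2)"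
proof -
  have "U \<noteq> {}"
  proof
    assume "U = {}"
    then show False using Cpos by (simp only: sum.empty)
  qed
  then obtain u0 where "u0 \<in> U" by blast
  then have q0: "0 \<le> q" using q[of u0] deg[of u0] by (meson Diff_iff cw_nonneg divide_nonneg_nonneg order_trans wdeg_nonneg)
  have dpos: "wdeg u > 0" if "u \<in> U" for u using deg[of u] that by simp
  define \<delta> where "\<delta> u x = (of_bool (x = u) :: real)" for u x :: 'a
  define o1 where "o1 x = (of_bool (x \<notin> I) :: real)" for x :: 'a
  define \<psi> where "\<psi> u = (\<lambda>x. gr I u x - (1 / wdeg u) * \<delta> u x - (1 / C) * o1 x)" for u
  have gd: "en (gr I u) (\<delta> z) = of_bool (u = z)" if "u \<in> U" "z \<in> U" for u z
  proof -
    have "\<delta> z x = 0" if "x \<in> I" for x using that \<open>z \<in> U\<close> by (auto simp: \<delta>_def)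
    then show ?thesis using en_gr'[OF F, of u "\<delta> z"] that by (auto simp: \<delta>_def)
  qed
  have dd: "en (\<delta> u) (\<delta> z) = of_bool (u = z) * wdeg u - w u z" if "u \<in> U" "z \<in> U" for u z
  proof -
    have "en (\<delta> u) (\<delta> z) = (\<Sum>x\<in>V. if x = u then lap (\<delta> z) u else 0)"
      unfolding en_lap by (rule sum.cong) (auto simp: \<delta>_def)
    also have "\<dots> = lap (\<delta> z) u" using that by simp
    also have "\<dots> = (\<Sum>y\<in>V. of_bool (u = z) * w u y - (if y = z then w u z else 0))"
      unfolding lap_def by (rule sum.cong) (auto simp: \<delta>_def)
    also have "\<dots> = of_bool (u = z) * wdeg u - w u z"
      using that by (simp add: sum_subtractf wdeg_def)
    finally show ?thesis .
  qed
  have g1: "en (gr I u) o1 = 1" if "u \<in> U" for u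
    using en_gr'[OF F, of u o1] that by (auto simp: o1_def)
  have d1: "en (\<delta> u) o1 = c u" if "u \<in> U" for u
  proof -
    have "en (\<delta> u) o1 = (\<Sum>x\<in>V. if x = u then lap o1 u else 0)"
      unfolding en_lap by (rule sum.cong) (auto simp: \<delta>_def)
    also have "\<dots> = lap o1 u" using that by simp
    also have "\<dots> = (\<Sum>y\<in>I. w u y)"
      unfolding lap_def using that I by (intro sum.mono_neutral_cong_right) (auto simp: o1_def)
    finally show ?thesis by (simp add: cw_def)
  qed
  have oo: "en o1 o1 = C"
    using en_wt[of 1 I o1 o1] I by (simp add: o1_def C_def)
  have sym: "en (\<delta> z) (gr I u) = en (gr I u) (\<delta> z)" "en o1 (gr I u) = en (gr I u) o1" "en o1 (\<delta> u) = en (\<delta> u) o1" for u z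
    by (rule en_sym)+
  define P where "P u z = en (\<psi> u) (\<psi> z)" for u z
  have P: "P u z = gr I u z - 1 / C - of_bool (u = z) / wdeg u - w u z / (wdeg u * wdeg z) + (c u / wdeg u + c z / wdeg z) / C"
    if uz: "u \<in> U" "z \<in> U" for u z
  proof -
    have g: "en (gr I u) (gr I z) = gr I u z" using en_gr_gr[OF F, of u z] uz by simp
    have e: "P u z = gr I u z - (1 / wdeg z) * of_bool (u = z) - 1 / C
        - (1 / wdeg u) * (of_bool (z = u) - (1 / wdeg z) * (of_bool (u = z) * wdeg u - w u z) - (1 / C) * c u)
        - (1 / C) * (1 - (1 / wdeg z) * c z - (1 / C) * C)"
      unfolding P_def \<psi>_def en_diff_left en_diff_right en_cmult_left en_cmult_right sym
        gd[OF uz] gd[OF uz(2,1)] dd[OF uz] g1[OF uz(1)] g1[OF uz(2)] d1[OF uz(1)] d1[OF uz(2)] oo g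
      by (simp add: algebra_simps)
    show ?thesis unfolding e using dpos[OF uz(1)] dpos[OF uz(2)] C0
      by (cases "u = z") (simp_all add: field_simps)
  qed
  have trP: "(\<Sum>u\<in>U. c u * P u u) \<le> E - 1 - A + 2 * q"
  proof -
    have "(\<Sum>u\<in>U. c u * P u u) = (\<Sum>u\<in>U. c u * gr I u u - c u * (1 / C) - c u / wdeg u + c u * (2 * (c u / wdeg u) / C))"
      by (intro sum.cong refl) (simp add: P algebra_simps add_divide_distrib)
    also have "\<dots> = E - C * (1 / C) - A + (\<Sum>u\<in>U. c u * (2 * (c u / wdeg u) / C))"
      unfolding E_def A_def C_def sum_distrib_right sum.distrib sum_subtractf ..
    also have "(\<Sum>u\<in>U. c u * (2 * (c u / wdeg u) / C)) \<le> (\<Sum>u\<in>U. c u * (2 * q / C))"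
      using C0 q by (intro sum_mono mult_left_mono divide_right_mono) auto
    also have "\<dots> = C * (2 * q / C)" by (simp only: C_def sum_distrib_right)
    finally show ?thesis using C0 by simp
  qed
  have Pnn: "0 \<le> P u u" "(P u z)\<^sup>2 \<le> P u u * P z z" for u z
    unfolding P_def by (rule en_nonneg, rule en_CS)
  have trP0: "0 \<le> (\<Sum>u\<in>U. c u * P u u)" by (intro sum_nonneg mult_nonneg_nonneg Pnn) auto
  then show "0 \<le> E - 1 - A + 2 * q" using trP by linarith
  define R1 where "R1 u z = of_bool (u = z) / wdeg u" for u z
  define R2 where "R2 u z = w u z / (wdeg u * wdeg z)" for u z
  define R3 where "R3 u z = (c u / wdeg u + c z / wdeg z) / C" for u z
  have HP: "(\<Sum>u\<in>U. \<Sum>z\<in>U. c u * c z * (P u z)\<^sup>2) \<le> (E - 1 - A + 2 * q)\<^sup>2"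
  proof -
    have "(\<Sum>u\<in>U. \<Sum>z\<in>U. c u * c z * (P u z)\<^sup>2) \<le> (\<Sum>u\<in>U. c u * P u u)\<^sup>2"
      by (rule Gram_CS) (use Pnn in auto)
    also have "\<dots> \<le> (E - 1 - A + 2 * q)\<^sup>2" by (rule power_mono[OF trP trP0])
    finally show ?thesis .
  qed
  have H1: "(\<Sum>u\<in>U. \<Sum>z\<in>U. c u * c z * (R1 u z)\<^sup>2) \<le> q * A"
  proof -
    have "(\<Sum>u\<in>U. \<Sum>z\<in>U. c u * c z * (R1 u z)\<^sup>2) = (\<Sum>u\<in>U. (c u / wdeg u) * (c u / wdeg u))"
    proof (rule sum.cong[OF refl])
      fix u assume u: "u \<in> U"
      have "(\<Sum>z\<in>U. c u * c z * (R1 u z)\<^sup>2) = (\<Sum>z\<in>U. if z = u then (c u / wdeg u) * (c u / wdeg u) else 0)"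
        by (rule sum.cong[OF refl]) (auto simp: R1_def power2_eq_square)
      then show "(\<Sum>z\<in>U. c u * c z * (R1 u z)\<^sup>2) = (c u / wdeg u) * (c u / wdeg u)" using u by simp
    qed
    also have "\<dots> \<le> (\<Sum>u\<in>U. q * (c u / wdeg u))"
      by (intro sum_mono mult_right_mono q) auto
    finally show ?thesis by (simp add: A_def sum_distrib_left)
  qed
  have H2: "(\<Sum>u\<in>U. \<Sum>z\<in>U. c u * c z * (R2 u z)\<^sup>2) \<le> q * A"
  proof -
    have "(\<Sum>u\<in>U. \<Sum>z\<in>U. c u * c z * (R2 u z)\<^sup>2) \<le> (\<Sum>u\<in>U. (c u / (wdeg u)\<^sup>2) * (\<Sum>z\<in>U. q * w u z))"
      unfolding sum_distrib_left
    proof (intro sum_mono)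
      fix u z assume uz: "u \<in> U" "z \<in> U"
      have "(w u z)\<^sup>2 = w u z" using w01[of u z] by auto
      then have "c u * c z * (R2 u z)\<^sup>2 = c u * c z * (w u z / (wdeg u * wdeg z)\<^sup>2)"
        by (simp only: R2_def power_divide)
      also have "\<dots> = (c u / (wdeg u)\<^sup>2) * ((c z / wdeg z) * (w u z * (1 / wdeg z)))"
        by (simp add: power2_eq_square ac_simps)
      also have "\<dots> \<le> (c u / (wdeg u)\<^sup>2) * (q * (w u z * 1))"
        using q[OF uz(2)] deg[of z] uz q0 by (intro mult_left_mono mult_mono) auto
      finally show "c u * c z * (R2 u z)\<^sup>2 \<le> (c u / (wdeg u)\<^sup>2) * (q * w u z)" by simp
    qed
    also have "\<dots> \<le> (\<Sum>u\<in>U. (c u / (wdeg u)\<^sup>2) * (q * wdeg u))"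
    proof (intro sum_mono mult_left_mono)
      fix u
      show "(\<Sum>z\<in>U. q * w u z) \<le> q * wdeg u"
        unfolding wdeg_def sum_distrib_left[symmetric] using q0 by (intro mult_left_mono sum_mono2) auto
    qed auto
    also have "\<dots> = (\<Sum>u\<in>U. q * (c u / wdeg u))"
      by (intro sum.cong refl) (use dpos in \<open>auto simp: power2_eq_square\<close>)
    finally show ?thesis by (simp add: A_def sum_distrib_left)
  qed
  have H3: "(\<Sum>u\<in>U. \<Sum>z\<in>U. c u * c z * (R3 u z)\<^sup>2) \<le> 4 * q\<^sup>2"
  proof -
    have "(\<Sum>u\<in>U. \<Sum>z\<in>U. c u * c z * (R3 u z)\<^sup>2) \<le> (\<Sum>u\<in>U. \<Sum>z\<in>U. c u * c z * (2 * q / C)\<^sup>2)"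
    proof (intro sum_mono mult_left_mono power_mono)
      fix u z assume uz: "u \<in> U" "z \<in> U"
      show "R3 u z \<le> 2 * q / C" unfolding R3_def
        using q[OF uz(1)] q[OF uz(2)] C0 by (intro divide_right_mono) auto
      show "0 \<le> R3 u z" unfolding R3_def using C0 by simp
    qed auto
    also have "\<dots> = (\<Sum>u\<in>U. \<Sum>z\<in>U. c u * c z) * (2 * q / C)\<^sup>2" by (simp only: sum_distrib_right)
    also have "(\<Sum>u\<in>U. \<Sum>z\<in>U. c u * c z) = C * C" by (simp only: C_def sum_product)
    also have "C * C * (2 * q / C)\<^sup>2 = 4 * q\<^sup>2" using C0 by (simp add: power2_eq_square)
    finally show ?thesis .
  qed
  have "(\<Sum>u\<in>U. \<Sum>z\<in>U. c u * c z * (gr I u z - 1 / C)\<^sup>2) \<le>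
      (\<Sum>u\<in>U. \<Sum>z\<in>U. 4 * (c u * c z * (P u z)\<^sup>2) + 4 * (c u * c z * (R1 u z)\<^sup>2) + 4 * (c u * c z * (R2 u z)\<^sup>2) + 4 * (c u * c z * (R3 u z)\<^sup>2))"
  proof (intro sum_mono)
    fix u z assume uz: "u \<in> U" "z \<in> U"
    have e: "gr I u z - 1 / C = P u z + R1 u z + R2 u z - R3 u z"
      using P[OF uz] by (simp add: R1_def R2_def R3_def)
    have four: "(p + r + s - t)\<^sup>2 \<le> 4 * (p\<^sup>2 + r\<^sup>2 + s\<^sup>2 + t\<^sup>2)" for p r s t :: real
    proof -
      have "0 \<le> (p - r)\<^sup>2 + (p - s)\<^sup>2 + (p + t)\<^sup>2 + (r - s)\<^sup>2 + (r + t)\<^sup>2 + (s + t)\<^sup>2" by simp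
      then show ?thesis by (simp add: power2_eq_square algebra_simps)
    qed
    have "c u * c z * (gr I u z - 1 / C)\<^sup>2 \<le> c u * c z * (4 * ((P u z)\<^sup>2 + (R1 u z)\<^sup>2 + (R2 u z)\<^sup>2 + (R3 u z)\<^sup>2))"
      unfolding e by (intro mult_left_mono four) auto
    then show "c u * c z * (gr I u z - 1 / C)\<^sup>2 \<le> 4 * (c u * c z * (P u z)\<^sup>2) + 4 * (c u * c z * (R1 u z)\<^sup>2) + 4 * (c u * c z * (R2 u z)\<^sup>2) + 4 * (c u * c z * (R3 u z)\<^sup>2)"
      by (simp add: algebra_simps)
  qed
  also have "\<dots> = 4 * ((\<Sum>u\<in>U. \<Sum>z\<in>U. c u * c z * (P u z)\<^sup>2) + (\<Sum>u\<in>U. \<Sum>z\<in>U. c u * c z * (R1 u z)\<^sup>2)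
      + (\<Sum>u\<in>U. \<Sum>z\<in>U. c u * c z * (R2 u z)\<^sup>2) + (\<Sum>u\<in>U. \<Sum>z\<in>U. c u * c z * (R3 u z)\<^sup>2))"
    by (simp add: sum.distrib flip: sum_distrib_left)
  also have "\<dots> \<le> 4 * ((E - 1 - A + 2 * q)\<^sup>2 + q * A + q * A + 4 * q\<^sup>2)"
    by (intro mult_left_mono add_mono HP H1 H2 H3) simp
  finally show "(\<Sum>u\<in>U. \<Sum>z\<in>U. c u * c z * (gr I u z - 1 / C)\<^sup>2) \<le> 4 * ((E - 1 - A + 2 * q)\<^sup>2 + 2 * q * A + 4 * q\<^sup>2)"
    by (simp add: ac_simps)
qed

end

section \<open>A lower bound for the number of forests away from a good set\<close>

text \<open>The error of \<open>near_reff\<close> for two vertices joined by at most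
  \<open>2 * m\<close> good edges, each contributing \<open>9 * sqrt \<epsilon>\<close>.\<close>

definition pair_err :: "real \<Rightarrow> real \<Rightarrow> real" where
  "pair_err m \<epsilon> = 24 * \<epsilon> + 5 * (2 * m * (9 * sqrt \<epsilon>))"

text \<open>The excess over \<open>m + 1\<close> in \<open>EN_bound\<close> with
  \<open>a = pair_err m \<epsilon>\<close>.\<close>

definition exp_err :: "real \<Rightarrow> real \<Rightarrow> real" where
  "exp_err m \<epsilon> = 2 * m * (pair_err m \<epsilon> + 4 * \<epsilon>)"

text \<open>The bound of \<open>HS_bound\<close> with \<open>q = m * \<epsilon>\<close> and
  \<open>A\<close> between \<open>m * (1 - \<epsilon> - m * \<epsilon>)\<close> and
  \<open>m * (1 + \<epsilon>)\<close>.\<close>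

definition hs_err :: "real \<Rightarrow> real \<Rightarrow> real" where
  "hs_err m \<epsilon> = sqrt (4 * ((exp_err m \<epsilon> + 3 * m * \<epsilon> + m * m * \<epsilon>)\<^sup>2 + 2 * (m * \<epsilon>) * (m * (1 + \<epsilon>)) + 4 * (m * \<epsilon>)\<^sup>2))"

text \<open>The ideal value \<open>k * exp (- m)\<close> with all losses included. Since
  \<open>1 \<le> \<epsilon> * d\<close> in the application, the summands \<open>m\<close> and
  \<open>k\<close> beside the degree bound \<open>(1 + \<epsilon>) * d\<close> are absorbed into
  \<open>(1 + (1 + m + k) * \<epsilon>) * d\<close>.\<close>

definition forest_bound :: "nat \<Rightarrow> nat \<Rightarrow> real \<Rightarrow> real" where
  "forest_bound m k \<epsilon> = real k * exp (- ((real m + exp_err m \<epsilon>) / (1 - hs_err m \<epsilon>))) / (1 + (1 + real m + real k) * \<epsilon>) ^ (k + m - 1)"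

definition small_enough :: "nat \<Rightarrow> nat \<Rightarrow> real \<Rightarrow> real \<Rightarrow> bool" where
  "small_enough m k \<eta> \<epsilon> \<longleftrightarrow> 0 < \<epsilon> \<and> \<epsilon> \<le> 1 / 12 \<and> 2 * real m * (9 * sqrt \<epsilon>) \<le> 1 / 2 \<and> hs_err m \<epsilon> < 1 \<and>
     (real m + 1) * \<epsilon> < 1 \<and> real k * exp (- real m) - \<eta> \<le> forest_bound m k \<epsilon>"

text \<open>None of the errors depends on the graph, so \<open>\<epsilon>\<close> can be fixed
  before \<open>n\<close>.\<close>

lemma eventually_small_enough:
  assumes "\<eta> > 0"
  shows "eventually (small_enough m k \<eta>) (at_right 0)"
proof -
  have id: "((\<lambda>\<epsilon>. \<epsilon>) \<longlongrightarrow> (0::real)) (at_right 0)" by (rule tendsto_ident_at)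
  have p: "((\<lambda>\<epsilon>. pair_err m \<epsilon>) \<longlongrightarrow> 0) (at_right 0)" for m
    unfolding pair_err_def by (auto intro!: tendsto_eq_intros)
  have e: "((\<lambda>\<epsilon>. exp_err m \<epsilon>) \<longlongrightarrow> 0) (at_right 0)" for m
    unfolding exp_err_def by (auto intro!: tendsto_eq_intros p)
  have h: "((\<lambda>\<epsilon>. hs_err m \<epsilon>) \<longlongrightarrow> 0) (at_right 0)" for m
    unfolding hs_err_def by (auto intro!: tendsto_eq_intros e)
  have f: "((\<lambda>\<epsilon>. forest_bound m k \<epsilon>) \<longlongrightarrow> real k * exp (- real m)) (at_right 0)"
    unfolding forest_bound_def by (auto intro!: tendsto_eq_intros e h)
  have s: "((\<lambda>\<epsilon>. 2 * real m * (9 * sqrt \<epsilon>)) \<longlongrightarrow> 0) (at_right 0)" by (auto intro!: tendsto_eq_intros)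
  have l: "((\<lambda>\<epsilon>. (real m + 1) * \<epsilon>) \<longlongrightarrow> 0) (at_right 0)" by (auto intro!: tendsto_eq_intros)
  have "eventually (\<lambda>\<epsilon>::real. 0 < \<epsilon>) (at_right 0)" by (rule eventually_at_right_less)
  moreover have "eventually (\<lambda>\<epsilon>::real. \<epsilon> < 1 / 12) (at_right 0)" by (rule order_tendstoD(2)[OF id]) simp
  moreover have "eventually (\<lambda>\<epsilon>. 2 * real m * (9 * sqrt \<epsilon>) < 1 / 2) (at_right 0)" by (rule order_tendstoD(2)[OF s]) simp
  moreover have "eventually (\<lambda>\<epsilon>. hs_err m \<epsilon> < 1) (at_right 0)" by (rule order_tendstoD(2)[OF h]) simp
  moreover have "eventually (\<lambda>\<epsilon>. (real m + 1) * \<epsilon> < 1) (at_right 0)" by (rule order_tendstoD(2)[OF l]) simp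
  moreover have "eventually (\<lambda>\<epsilon>. real k * exp (- real m) - \<eta> < forest_bound m k \<epsilon>) (at_right 0)"
    by (rule order_tendstoD(1)[OF f]) (use assms in simp)
  ultimately show ?thesis by eventually_elim (simp add: small_enough_def)
qed

context graph_net
begin

text \<open>Three lower bounds are chained. \<open>forests_lower\<close> makes
  \<open>forests I\<close> at least about \<open>m / d ^ (m - 1)\<close> times the tree count;
  \<open>forests_deleted_lower\<close> removes \<open>I\<close> at the price
  \<open>exp (- m) / C\<close>, with \<open>C\<close> at most about \<open>m * d\<close>;
  \<open>forests_lower\<close> in the remaining network gives \<open>k / d ^ (k - 1)\<close> for the
  roots \<open>L\<close>. The factors \<open>m\<close> cancel.\<close>

theorem forests_away_lower:
  assumes F: "forests {a0} > 0" "a0 \<in> V" and deg: "\<And>u. u \<in> V \<Longrightarrow> 1 \<le> wdeg u"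
    and I: "I \<subseteq> V" "I \<noteq> {}" and L: "L \<subseteq> V - I" "L \<noteq> {}"
    and good: "\<And>v. v \<in> I \<union> L \<Longrightarrow> good_vertex \<epsilon> d v"
    and path: "\<And>i j. i \<in> I \<Longrightarrow> j \<in> I \<Longrightarrow> \<exists>n\<le>2 * card I. (i, j) \<in> {(u, v). good_edge \<epsilon> d u v} ^^ n"
    and eps: "small_enough (card I) (card L) \<eta> \<epsilon>" and d: "1 \<le> \<epsilon> * d"
  shows "(real (card L) * exp (- real (card I)) - \<eta>) * forests {a0} \<le> network.forests (V - I) w L * d ^ (card L + card I - 1)"
proof -
  define m where "m = real (card I)"
  define k where "k = real (card L)"
  have e: "0 < \<epsilon>" "\<epsilon> \<le> 1 / 12" "2 * m * (9 * sqrt \<epsilon>) \<le> 1 / 2" "hs_err m \<epsilon> < 1" "(m + 1) * \<epsilon> < 1"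
    "k * exp (- m) - \<eta> \<le> forest_bound (card I) (card L) \<epsilon>"
    using eps by (auto simp: small_enough_def m_def k_def)
  have finI: "finite I" and finL: "finite L" using finite_subset[OF I(1)] finite_subset[OF L(1)] by auto
  have m1: "m \<ge> 1" unfolding m_def using I finI by (simp add: Suc_leI card_gt_0_iff)
  have k1: "k \<ge> 1" unfolding k_def using L finL by (simp add: Suc_leI card_gt_0_iff)
  have d0: "d > 0" using d e by (metis less_le_trans mult_pos_pos zero_less_mult_pos zero_less_one)
  have Fi: "forests {i} > 0" if "i \<in> V" for i using F forests_single[OF that F(2)] by simp
  have pe0: "0 \<le> pair_err m \<epsilon>" using e m1 by (simp add: pair_err_def)
  have ee0: "0 \<le> exp_err m \<epsilon>" using e m1 pe0 by (simp add: exp_err_def)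
  have hs0: "0 \<le> hs_err m \<epsilon>" unfolding hs_err_def using e m1
    by (intro real_sqrt_ge_zero mult_nonneg_nonneg add_nonneg_nonneg) auto
  have gI: "good_vertex \<epsilon> d i" if "i \<in> I" for i using good that by auto
  have pairs: "reff i j \<le> (2 + pair_err m \<epsilon>) / d" if ij: "i \<in> I" "j \<in> I" "i \<noteq> j" for i j
  proof -
    obtain n where n: "n \<le> 2 * card I" "(i, j) \<in> {(u, v). good_edge \<epsilon> d u v} ^^ n" using path[OF ij(1,2)] by blast
    have nm: "real n \<le> 2 * m" using n(1) unfolding m_def by linarith
    have V: "i \<in> V" "j \<in> V" using ij I by auto
    have near: "near d (real n * (9 * sqrt \<epsilon>)) i j" by (rule path_near[OF F e(1,2) d n(2)])
    have le: "real n * (9 * sqrt \<epsilon>) \<le> 2 * m * (9 * sqrt \<epsilon>)" using nm e by (intro mult_right_mono) auto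
    have le2: "real n * (9 * sqrt \<epsilon>) \<le> 1 / 2" using le e(3) by linarith
    have "reff i j \<le> (2 + 24 * \<epsilon> + 5 * (real n * (9 * sqrt \<epsilon>))) / d"
      by (rule near_reff[OF Fi[OF V(1)] V ij(3) near _ _ e(1,2) d])
        (use gI[OF ij(1)] gI[OF ij(2)] e(1) le2 in \<open>auto simp: good_vertex_def\<close>)
    also have "\<dots> \<le> (2 + pair_err m \<epsilon>) / d"
      using le d0 by (intro divide_right_mono) (auto simp: pair_err_def)
    finally show ?thesis .
  qed
  have E: "(\<Sum>u\<in>V - I. cw I u * gr I u u) \<le> m + 1 + exp_err m \<epsilon>"
    using EN_bound[OF F I gI pairs e(1,2) d pe0] by (simp add: m_def exp_err_def)
  have dp: "wdeg u > 0" if "u \<in> V" for u using deg[OF that] by simp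
  have nb: "w i u / wdeg u \<le> \<epsilon>" if "i \<in> I" "u \<in> V" for i u
  proof (cases "w i u = 1")
    case True
    then have "1 \<le> \<epsilon> * wdeg u" using gI[OF that(1)] that by (auto simp: good_vertex_def)
    then show ?thesis using True dp[OF that(2)] by (simp add: pos_divide_le_eq)
  next
    case False
    then show ?thesis using w01[of i u] e by auto
  qed
  define A where "A = (\<Sum>u\<in>V - I. cw I u / wdeg u)"
  have q: "cw I u / wdeg u \<le> m * \<epsilon>" if "u \<in> V - I" for u
  proof -
    have "cw I u / wdeg u = (\<Sum>i\<in>I. w i u / wdeg u)" by (simp add: cw_def sum_divide_distrib w_sym)
    also have "\<dots> \<le> (\<Sum>i\<in>I. \<epsilon>)" by (intro sum_mono nb) (use that in auto)
    finally show ?thesis by (simp add: m_def)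
  qed
  have A_eq: "A = (\<Sum>i\<in>I. \<Sum>u\<in>V - I. w i u / wdeg u)"
    unfolding A_def cw_def sum_divide_distrib by (subst sum.swap) (simp add: w_sym)
  have spl: "(\<Sum>u\<in>V - I. w i u / wdeg u) = inv_deg_sum i - (\<Sum>u\<in>I. w i u / wdeg u)" for i
    unfolding inv_deg_sum_def using sum.subset_diff[OF I(1) finV, of "\<lambda>u. w i u / wdeg u"] by simp
  have A_up: "A \<le> m * (1 + \<epsilon>)"
  proof -
    have "A \<le> (\<Sum>i\<in>I. 1 + \<epsilon>)" unfolding A_eq
    proof (rule sum_mono)
      fix i assume i: "i \<in> I"
      have "0 \<le> (\<Sum>u\<in>I. w i u / wdeg u)" by (intro sum_nonneg) auto
      then show "(\<Sum>u\<in>V - I. w i u / wdeg u) \<le> 1 + \<epsilon>"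
        unfolding spl using gI[OF i] by (auto simp: good_vertex_def)
    qed
    then show ?thesis by (simp add: m_def)
  qed
  have A_lo: "A \<ge> m * (1 - \<epsilon> - m * \<epsilon>)"
  proof -
    have "(\<Sum>i\<in>I. 1 - \<epsilon> - m * \<epsilon>) \<le> A" unfolding A_eq
    proof (rule sum_mono)
      fix i assume i: "i \<in> I"
      have "(\<Sum>u\<in>I. w i u / wdeg u) \<le> (\<Sum>u\<in>I. \<epsilon>)" by (intro sum_mono nb i) (use I in auto)
      then show "1 - \<epsilon> - m * \<epsilon> \<le> (\<Sum>u\<in>V - I. w i u / wdeg u)"
        unfolding spl using gI[OF i] by (auto simp: good_vertex_def m_def)
    qed
    then show ?thesis by (simp add: m_def)
  qed
  have A0: "A > 0"
  proof -
    have "0 < m * (1 - \<epsilon> - m * \<epsilon>)" using m1 e(5) by (intro mult_pos_pos) (auto simp: algebra_simps)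
    then show ?thesis using A_lo by linarith
  qed
  have Cpos: "(\<Sum>u\<in>V - I. cw I u) > 0"
  proof -
    have "A \<le> (\<Sum>u\<in>V - I. cw I u / 1)"
      unfolding A_def using deg dp by (intro sum_mono divide_left_mono) auto
    then show ?thesis using A0 by simp
  qed
  interpret GI: graph_interp V w I
    by unfold_locales (use I forests_pos[OF F I] Cpos in auto)
  let ?S = "\<Sum>u\<in>V - I. \<Sum>z\<in>V - I. cw I u * cw I z * (gr I u z - 1 / GI.C)\<^sup>2"
  let ?E = "\<Sum>u\<in>V - I. cw I u * gr I u u"
  have hs: "?S \<le> (hs_err m \<epsilon>)\<^sup>2"
  proof -
    have nn: "0 \<le> ?E - 1 - A + 2 * (m * \<epsilon>)"
      and "?S \<le> 4 * ((?E - 1 - A + 2 * (m * \<epsilon>))\<^sup>2 + 2 * (m * \<epsilon>) * A + 4 * (m * \<epsilon>)\<^sup>2)"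
      using GI.HS_bound[OF deg q] unfolding A_def by auto
    note this(2)
    also have "\<dots> \<le> 4 * ((exp_err m \<epsilon> + 3 * m * \<epsilon> + m * m * \<epsilon>)\<^sup>2 + 2 * (m * \<epsilon>) * (m * (1 + \<epsilon>)) + 4 * (m * \<epsilon>)\<^sup>2)"
    proof -
      have "?E - 1 - A + 2 * (m * \<epsilon>) \<le> exp_err m \<epsilon> + 3 * m * \<epsilon> + m * m * \<epsilon>"
        using E A_lo by (simp add: algebra_simps)
      from power_mono[OF this nn, of 2]
      have "(?E - 1 - A + 2 * (m * \<epsilon>))\<^sup>2 \<le> (exp_err m \<epsilon> + 3 * m * \<epsilon> + m * m * \<epsilon>)\<^sup>2" .
      moreover have "2 * (m * \<epsilon>) * A \<le> 2 * (m * \<epsilon>) * (m * (1 + \<epsilon>))"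
        using m1 e by (intro mult_left_mono A_up) auto
      moreover have "x \<le> x' \<Longrightarrow> y \<le> y' \<Longrightarrow> 4 * (x + y + z) \<le> 4 * (x' + y' + z)" for x x' y y' z :: real
        by simp
      ultimately show ?thesis by blast
    qed
    also have "\<dots> = (hs_err m \<epsilon>)\<^sup>2" unfolding hs_err_def using m1 e
      by (subst real_sqrt_pow2) (auto intro!: mult_nonneg_nonneg add_nonneg_nonneg)
    finally show ?thesis .
  qed
  obtain l where l: "l \<in> L" using L by blast
  obtain i where i: "i \<in> I" using I by blast
  interpret H: network "V - I" w by unfold_locales (auto simp: w_sym)
  define X where "X = exp (- ((m + exp_err m \<epsilon>) / (1 - hs_err m \<epsilon>)))"
  have s1: "forests I * X \<le> GI.C * H.forests {l}"
  proof -
    have "forests I * X \<le> forests I * exp (- ((?E - 1) / (1 - hs_err m \<epsilon>)))"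
      unfolding X_def using E e(4) by (intro mult_left_mono) (auto intro!: divide_right_mono)
    also have "\<dots> \<le> GI.C * H.forests {l}"
      by (rule GI.forests_deleted_lower[OF hs0 e(4) hs]) (use l L in auto)
    finally show ?thesis .
  qed
  define D where "D = (1 + \<epsilon>) * d"
  define B where "B = (1 + (1 + m + k) * \<epsilon>) * d"
  have D0: "D > 0" using d0 e by (simp add: D_def)
  have Hdeg: "H.wdeg u \<le> D" if "u \<in> L" for u
  proof -
    have "H.wdeg u \<le> wdeg u" unfolding H.wdeg_def wdeg_def by (rule sum_mono2) auto
    also have "\<dots> \<le> D" using good that by (auto simp: good_vertex_def D_def)
    finally show ?thesis .
  qed
  have s2: "H.forests {l} * k \<le> H.forests L * (D + k) ^ (card L - 1)"
    unfolding k_def by (rule H.forests_lower[OF finL l L(1) _ Hdeg]) auto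
  have s3: "forests {i} * m \<le> forests I * (D + m) ^ (card I - 1)"
    unfolding m_def by (rule forests_lower[OF finI i I(1)]) (use gI in \<open>auto simp: good_vertex_def D_def\<close>)
  have CmD: "GI.C \<le> m * D"
  proof -
    have "GI.C = (\<Sum>i\<in>I. \<Sum>u\<in>V - I. w i u)"
      unfolding GI.C_def cw_def by (subst sum.swap) (simp add: w_sym)
    also have "\<dots> \<le> (\<Sum>i\<in>I. D)"
    proof (rule sum_mono)
      fix i assume i: "i \<in> I"
      have "(\<Sum>u\<in>V - I. w i u) \<le> wdeg i" unfolding wdeg_def by (rule sum_mono2) auto
      also have "\<dots> \<le> D" using gI[OF i] by (auto simp: good_vertex_def D_def)
      finally show "(\<Sum>u\<in>V - I. w i u) \<le> D" .
    qed
    finally show ?thesis by (simp add: m_def)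
  qed
  have BD: "D \<le> B" "D + k \<le> B" "D + m \<le> B"
  proof -
    have "k * 1 \<le> k * (\<epsilon> * d)" "m * 1 \<le> m * (\<epsilon> * d)" using d k1 m1 by (auto intro!: mult_left_mono)
    moreover have "0 \<le> m * (\<epsilon> * d)" "0 \<le> k * (\<epsilon> * d)" using d0 e m1 k1 by auto
    ultimately show "D \<le> B" "D + k \<le> B" "D + m \<le> B" by (auto simp: D_def B_def algebra_simps)
  qed
  have X0: "X > 0" by (simp add: X_def)
  have f0: "0 \<le> H.forests L" by simp
  have "m * (k * X * forests {i}) = (forests {i} * m) * (X * k)" by simp
  also have "\<dots> \<le> (forests I * (D + m) ^ (card I - 1)) * (X * k)"
    using X0 k1 by (intro mult_right_mono s3) auto
  also have "\<dots> = (forests I * X) * (k * (D + m) ^ (card I - 1))" by simp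
  also have "\<dots> \<le> (GI.C * H.forests {l}) * (k * (D + m) ^ (card I - 1))"
    using k1 D0 m1 by (intro mult_right_mono s1) auto
  also have "\<dots> = (H.forests {l} * k) * (GI.C * (D + m) ^ (card I - 1))" by simp
  also have "\<dots> \<le> (H.forests L * (D + k) ^ (card L - 1)) * ((m * D) * (D + m) ^ (card I - 1))"
    using k1 D0 m1 GI.C0 by (intro mult_mono s2 CmD mult_right_mono) auto
  also have "\<dots> = m * (H.forests L * ((D + k) ^ (card L - 1) * (D * (D + m) ^ (card I - 1))))" by simp
  also have "\<dots> \<le> m * (H.forests L * (B ^ (card L - 1) * (B * B ^ (card I - 1))))"
    using k1 D0 m1 BD by (intro mult_left_mono mult_mono power_mono) auto
  also have "B ^ (card L - 1) * (B * B ^ (card I - 1)) = B ^ (card L + card I - 1)"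
  proof -
    have "card L + card I - 1 = (card L - 1) + Suc (card I - 1)"
      using m1 k1 unfolding m_def k_def by linarith
    then show ?thesis by (simp only: power_add power_Suc)
  qed
  finally have "k * X * forests {i} \<le> H.forests L * B ^ (card L + card I - 1)" using m1 by simp
  moreover have "B ^ (card L + card I - 1) = (1 + (1 + m + k) * \<epsilon>) ^ (card L + card I - 1) * d ^ (card L + card I - 1)"
    by (simp add: B_def power_mult_distrib)
  moreover have pos: "0 < (1 + (1 + m + k) * \<epsilon>) ^ (card L + card I - 1)" using m1 k1 e by (intro zero_less_power add_pos_nonneg) auto
  ultimately have "forest_bound (card I) (card L) \<epsilon> * forests {i} \<le> H.forests L * d ^ (card L + card I - 1)"
    unfolding forest_bound_def m_def[symmetric] k_def[symmetric] X_def[symmetric]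
    by (simp add: pos_divide_le_eq ac_simps)
  moreover have "(k * exp (- m) - \<eta>) * forests {i} \<le> forest_bound (card I) (card L) \<epsilon> * forests {i}"
    using e(6) by (intro mult_right_mono) auto
  moreover have "forests {i} = forests {a0}" using forests_single[of i a0] i I F by auto
  ultimately show ?thesis by (simp add: m_def k_def)
qed

end

section \<open>Trees and parent maps\<close>

definition ptree :: "'a set \<Rightarrow> ('a \<Rightarrow> 'a) \<Rightarrow> 'a \<Rightarrow> 'a sgraph" where
  "ptree V p \<rho> = SGraph V {{v, p v} |v. v \<in> V - {\<rho>}}"

lemma verts_ptree [simp]: "verts (ptree V p \<rho>) = V"
  by (simp add: ptree_def)

lemma ptree_edge_iff:
  "{u, v} \<in> edges (ptree V p \<rho>) \<longleftrightarrow> (u \<in> V - {\<rho>} \<and> v = p u) \<or> (v \<in> V - {\<rho>} \<and> u = p v)"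
  by (auto simp: ptree_def doubleton_eq_iff)

lemma adj_iff: "(u, v) \<in> adj G \<longleftrightarrow> {u, v} \<in> edges G"
  by (simp add: adj_def)

locale parent_tree =
  fixes V :: "'a set" and p \<rho>
  assumes root: "\<rho> \<in> V" and p: "p \<in> pforest V {\<rho>}"
begin

abbreviation "T \<equiv> ptree V p \<rho>"
abbreviation "dp \<equiv> pdepth p {\<rho>}"

lemma p_V: "v \<in> V \<Longrightarrow> p v \<in> V"
  using pforestD(3)[OF p] .

lemma p_root: "p \<rho> = \<rho>"
  using pforestD(2)[OF p] by simp

lemma p_neq: "v \<in> V - {\<rho>} \<Longrightarrow> p v \<noteq> v"
  using pforest_neq[OF p] .

lemma dp_step: "v \<in> V - {\<rho>} \<Longrightarrow> dp v = Suc (dp (p v))"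
  using pdepth_step[OF p] .

lemma dp_0: "v \<in> V \<Longrightarrow> dp v = 0 \<longleftrightarrow> v = \<rho>"
  using dp_step[of v] by (cases "v = \<rho>") auto

lemma dp_root [simp]: "dp \<rho> = 0"
  by simp

lemma simple: "simple_graph T"
  unfolding simple_graph_def ptree_def using p_V p_neq by fastforce

lemma dp_adj: "(u, v) \<in> adj T \<Longrightarrow> dp v \<le> Suc (dp u)"
  unfolding adj_iff ptree_edge_iff using dp_step by fastforce

lemma dp_le: "(\<rho>, v) \<in> adj T ^^ n \<Longrightarrow> dp v \<le> n"
  by (induction n arbitrary: v) (auto dest!: dp_adj, meson Suc_le_mono order_trans)

lemma relpow_dp: "v \<in> V \<Longrightarrow> (\<rho>, v) \<in> adj T ^^ dp v"
proof (induction "dp v" arbitrary: v)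
  case 0
  then show ?case using dp_0 by simp
next
  case (Suc n)
  then have v: "v \<in> V - {\<rho>}" using dp_0 by fastforce
  have "(\<rho>, p v) \<in> adj T ^^ dp (p v)" using Suc.hyps(1)[of "p v"] Suc.hyps(2) dp_step[OF v] p_V v by auto
  moreover have "(p v, v) \<in> adj T" using v by (simp add: adj_iff ptree_edge_iff)
  ultimately show ?case using dp_step[OF v] by auto
qed

lemma gdist_le: "v \<in> V \<Longrightarrow> gdist T \<rho> v \<le> enat r \<longleftrightarrow> dp v \<le> r"
  unfolding gdist_le_iff using relpow_dp dp_le by (meson order_trans)

lemma gdist: "v \<in> V \<Longrightarrow> gdist T \<rho> v = enat (dp v)"
proof (rule antisym)
  assume v: "v \<in> V"
  show "gdist T \<rho> v \<le> enat (dp v)" using gdist_le[OF v] by simp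
  then obtain k where k: "gdist T \<rho> v = enat k" by (cases "gdist T \<rho> v") auto
  then show "enat (dp v) \<le> gdist T \<rho> v" using gdist_le[OF v, of k] by simp
qed

lemma connected: "gconnected T"
  unfolding gconnected_def
proof (intro conjI ballI)
  have r: "(\<rho>, v) \<in> (adj T)\<^sup>*" if "v \<in> V" for v using relpow_dp[OF that] relpow_imp_rtrancl by metis
  have "sym (adj T)" by (auto intro: symI adj_sym)
  then have "sym ((adj T)\<^sup>*)" by (rule sym_rtrancl)
  then show "(u, v) \<in> (adj T)\<^sup>*" if "u \<in> verts T" "v \<in> verts T" for u v
    using r that by (metis rtrancl_trans symD verts_ptree)
qed (use root in auto)

text \<open>At a vertex of maximal depth on a cycle both neighbours along the cycle would have to be
  its parent, but they are distinct.\<close>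

lemma no_cycle: "\<not> is_cycle T xs"
proof
  assume c: "is_cycle T xs"
  then have l: "3 \<le> length xs" and d: "distinct xs"
    and e: "\<And>i. i < length xs \<Longrightarrow> {xs ! i, xs ! (Suc i mod length xs)} \<in> edges T"
    by (auto simp: is_cycle_def)
  let ?n = "length xs"
  have ne: "set xs \<noteq> {}" using l by auto
  define M where "M = Max (dp ` set xs)"
  have "M \<in> dp ` set xs" unfolding M_def using ne by (intro Max_in) auto
  then obtain i where i: "i < ?n" "dp (xs ! i) = M" by (auto simp: in_set_conv_nth)
  have M: "dp (xs ! j) \<le> M" if "j < ?n" for j unfolding M_def using that by (intro Max_ge) auto
  define j where "j = Suc i mod ?n"
  \<comment> \<open>The index before \<open>i\<close> on the cycle; length at least three makes it
    differ from the index \<open>j\<close> after \<open>i\<close>.\<close>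
  define k where "k = (if i = 0 then ?n - 1 else i - 1)"
  have k: "Suc k mod ?n = i" "k < ?n" using l i by (auto simp: k_def)
  have j: "j < ?n" unfolding j_def by (rule mod_less_divisor) (use l in linarith)
  have jk: "j \<noteq> k"
  proof (cases "Suc i = ?n")
    case True
    then show ?thesis using l by (auto simp: j_def k_def)
  next
    case False
    then have "j = Suc i" using i by (simp add: j_def)
    then show ?thesis using l False i by (auto simp: k_def)
  qed
  have par: "xs ! q = p (xs ! i)" if "{xs ! i, xs ! q} \<in> edges T" "q < ?n" for q
  proof (rule ccontr)
    assume "xs ! q \<noteq> p (xs ! i)"
    then have "xs ! q \<in> V - {\<rho>}" "xs ! i = p (xs ! q)" using that(1) by (auto simp: ptree_edge_iff)
    then have "dp (xs ! q) = Suc M" using dp_step i by auto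
    then show False using M[OF that(2)] by simp
  qed
  have "xs ! j = p (xs ! i)" by (rule par) (use e[OF i(1)] j in \<open>auto simp: j_def\<close>)
  moreover have "xs ! k = p (xs ! i)" by (rule par) (use e[OF k(2)] k in \<open>auto simp: insert_commute\<close>)
  ultimately show False using nth_eq_iff_index_eq[OF d j k(2)] jk by simp
qed

lemma tree: "is_tree T"
  unfolding is_tree_def using simple connected no_cycle by blast

lemma dp_iter:
  assumes "v \<in> V" "\<And>i. i < k \<Longrightarrow> (p ^^ i) v \<noteq> \<rho>" "i < j" "j \<le> k"
  shows "dp ((p ^^ j) v) < dp ((p ^^ i) v)"
  using assms(3,4)
proof (induction j)
  case (Suc j)
  have "(p ^^ j) v \<in> V - {\<rho>}" using pforest_funpow_V[OF p assms(1)] assms(2)[of j] Suc.prems by auto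
  then have "dp ((p ^^ Suc j) v) < dp ((p ^^ j) v)" using dp_step by simp
  then show ?case using Suc by (cases "i = j") auto
qed simp

text \<open>The cycle closed by an additional edge \<open>{x, y}\<close> runs from \<open>x\<close> up to the first common
  ancestor and down to \<open>y\<close>.\<close>

lemma extra_edge_cycle:
  assumes x: "x \<in> V" and y: "y \<in> V" and xy: "x \<noteq> y" and n: "{x, y} \<notin> edges T"
    and sub: "edges T \<subseteq> edges G" and e: "{x, y} \<in> edges G"
  shows "\<exists>xs. is_cycle G xs"
proof -
  have lead: "\<exists>k. (p ^^ k) v = \<rho>" if "v \<in> V" for v using p that by (auto simp: pforest_def)
  have ex: "\<exists>k l. (p ^^ k) x = (p ^^ l) y" using lead[OF x] lead[OF y] by metis
  define k where "k = (LEAST k. \<exists>l. (p ^^ k) x = (p ^^ l) y)"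
  have k: "\<exists>l. (p ^^ k) x = (p ^^ l) y" unfolding k_def by (rule LeastI_ex[OF ex])
  have kmin: "(p ^^ i) x \<noteq> (p ^^ j) y" if "i < k" for i j
    using not_less_Least[of i "\<lambda>k. \<exists>l. (p ^^ k) x = (p ^^ l) y"] that unfolding k_def by blast
  define l where "l = (LEAST l. (p ^^ k) x = (p ^^ l) y)"
  have l: "(p ^^ k) x = (p ^^ l) y" unfolding l_def by (rule LeastI_ex[OF k])
  have lmin: "(p ^^ k) x \<noteq> (p ^^ j) y" if "j < l" for j
    using not_less_Least[of j "\<lambda>l. (p ^^ k) x = (p ^^ l) y"] that unfolding l_def by blast
  have xr: "(p ^^ i) x \<noteq> \<rho>" if "i < k" for i using kmin[OF that] lead[OF y] by metis
  have yr: "(p ^^ j) y \<noteq> \<rho>" if j: "j < l" for j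
  proof
    assume a: "(p ^^ j) y = \<rho>"
    have "(p ^^ l) y = (p ^^ (l - j)) ((p ^^ j) y)" using j by (metis funpow_add comp_apply le_add_diff_inverse2 less_imp_le)
    then have "(p ^^ l) y = \<rho>" using a funpow_fixed[of p \<rho>] p_root by simp
    then show False using lmin[OF j] l a by simp
  qed
  define s where "s i = (if i \<le> k then (p ^^ i) x else (p ^^ (k + l - i)) y)" for i
  let ?n = "Suc (k + l)"
  have inj: "inj_on s {..<?n}"
  proof (rule linorder_inj_onI)
    fix i j assume ij: "i < j" "i \<in> {..<?n}" "j \<in> {..<?n}"
    show "s i \<noteq> s j"
    proof (cases "j \<le> k")
      case True
      then show ?thesis using dp_iter[OF x xr ij(1), of k] ij by (auto simp: s_def)
    next
      case False
      show ?thesis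
      proof (cases "i \<le> k")
        case True
        have "k + l - j < l" using False ij by auto
        then show ?thesis using True False kmin[of i] lmin[of "k + l - j"] by (cases "i = k") (auto simp: s_def)
      next
        case i: False
        have lt: "k + l - j < k + l - i" "k + l - i \<le> l" using ij i by auto
        show ?thesis using dp_iter[OF y yr lt] i False by (auto simp: s_def)
      qed
    qed
  qed auto
  have three: "2 \<le> k + l"
  proof (rule ccontr)
    assume "\<not> 2 \<le> k + l"
    then consider "k = 0" "l = 0" | "k = 1" "l = 0" | "k = 0" "l = 1" by linarith
    then show False
    proof cases
      case 2
      then show False using l n x xr[of 0] by (auto simp: ptree_edge_iff)
    next
      case 3
      then show False using l n y yr[of 0] by (auto simp: ptree_edge_iff)
    qed (use l xy in auto)
  qed
  have pe: "{v, p v} \<in> edges G" "{p v, v} \<in> edges G" if "v \<in> V" "v \<noteq> \<rho>" for v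
    using sub ptree_edge_iff[of v "p v" V p \<rho>] that by (auto simp: insert_commute)
  have edge: "{s i, s (Suc i mod ?n)} \<in> edges G" if i: "i < ?n" for i
  proof (cases "i = k + l")
    case True
    have "s i = y"
    proof (cases "l = 0")
      case True
      then show ?thesis using l \<open>i = k + l\<close> by (simp add: s_def)
    qed (use True in \<open>simp add: s_def\<close>)
    moreover have "s 0 = x" by (simp add: s_def)
    ultimately show ?thesis using e True by (simp add: insert_commute)
  next
    case False
    then have m: "Suc i mod ?n = Suc i" "i < k + l" using i by auto
    consider "i < k" | "i = k" | "k < i" by linarith
    then show ?thesis
    proof cases
      case 1
      then show ?thesis using pe(1)[OF pforest_funpow_V[OF p x] xr[OF 1]] m by (simp add: s_def)
    next
      case 2
      then have l1: "l = Suc (l - 1)" using m by simp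
      then have "(p ^^ l) y = p ((p ^^ (l - 1)) y)" by (metis funpow.simps(2) comp_apply)
      then show ?thesis using pe(2)[OF pforest_funpow_V[OF p y], of "l - 1"] yr[of "l - 1"] l l1 m 2
        by (simp add: s_def)
    next
      case 3
      define j where "j = k + l - Suc i"
      have j: "k + l - i = Suc j" "j < l" using 3 m by (auto simp: j_def)
      have "{(p ^^ Suc j) y, (p ^^ j) y} \<in> edges G"
        using pe(2)[OF pforest_funpow_V[OF p y] yr[OF j(2)]] by simp
      then show ?thesis using 3 m j j_def by (simp add: s_def)
    qed
  qed
  have "is_cycle G (map s [0..<?n])"
    unfolding is_cycle_def
  proof (intro conjI allI impI)
    show "distinct (map s [0..<?n])" using inj by (simp add: distinct_map atLeast0LessThan del: upt_Suc)
    show "3 \<le> length (map s [0..<?n])" using three by simp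
    fix i assume i: "i < length (map s [0..<?n])"
    then have "i < ?n" "Suc i mod ?n < ?n" by auto
    then show "{map s [0..<?n] ! i, map s [0..<?n] ! (Suc i mod length (map s [0..<?n]))} \<in> edges G"
      using edge[of i] by (simp del: upt_Suc)
  qed
  then show ?thesis by blast
qed

lemma ball_verts: "verts (fst (gball T \<rho> r)) = {v \<in> V. dp v \<le> r}"
  unfolding verts_gball using gdist_le by auto

lemma ball_edge_iff:
  "{u, v} \<in> edges (fst (gball T \<rho> r)) \<longleftrightarrow>
    ((u \<in> V - {\<rho>} \<and> v = p u) \<or> (v \<in> V - {\<rho>} \<and> u = p v)) \<and> dp u \<le> r \<and> dp v \<le> r"
  unfolding edges_gball ptree_edge_iff using gdist_le p_V by auto

end

text \<open>Breadth-first search: any neighbour nearer to \<open>\<rho>\<close> may serve as parent,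
  and the distance decreases along the pointers.\<close>

lemma bfs_parent:
  assumes sG: "simple_graph G" and cG: "gconnected G" and r: "\<rho> \<in> verts G"
  obtains p where "p \<in> pforest (verts G) {\<rho>}" "edges (ptree (verts G) p \<rho>) \<subseteq> edges G"
proof -
  let ?V = "verts G"
  define D where "D v = (LEAST n. (\<rho>, v) \<in> adj G ^^ n)" for v
  have ex: "\<exists>n. (\<rho>, v) \<in> adj G ^^ n" if "v \<in> ?V" for v
    using cG r that by (auto simp: gconnected_def rtrancl_power)
  have D: "(\<rho>, v) \<in> adj G ^^ D v" if "v \<in> ?V" for v unfolding D_def by (rule LeastI_ex[OF ex[OF that]])
  have Dle: "D v \<le> n" if "(\<rho>, v) \<in> adj G ^^ n" for v n unfolding D_def by (rule Least_le[where P = "\<lambda>n. (\<rho>, v) \<in> adj G ^^ n", OF that])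
  have par: "\<exists>u. (u, v) \<in> adj G \<and> u \<in> ?V \<and> D u < D v" if v: "v \<in> ?V" "v \<noteq> \<rho>" for v
  proof -
    obtain m where m: "D v = Suc m" using D[OF v(1)] v(2) by (cases "D v") auto
    then obtain u where u: "(\<rho>, u) \<in> adj G ^^ m" "(u, v) \<in> adj G" using D[OF v(1)] by auto
    then show ?thesis using Dle[OF u(1)] adj_verts[OF sG u(2)] m by (intro exI[of _ u]) auto
  qed
  define p where "p v = (if v \<in> ?V \<and> v \<noteq> \<rho> then SOME u. (u, v) \<in> adj G \<and> u \<in> ?V \<and> D u < D v else v)" for v
  have p: "(p v, v) \<in> adj G" "p v \<in> ?V" "D (p v) < D v" if "v \<in> ?V" "v \<noteq> \<rho>" for v
    using someI_ex[OF par[OF that]] that by (auto simp: p_def)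
  have pf: "p \<in> pforest ?V {\<rho>}"
  proof (rule pforestI)
    fix v assume "v \<in> ?V"
    then have "leads p v \<rho>"
    proof (induction "D v" arbitrary: v rule: less_induct)
      case less
      then show ?case using p[of v] leads_step[of p v \<rho>] by (cases "v = \<rho>") auto
    qed
    then show "\<exists>s\<in>{\<rho>}. leads p v s" by simp
  qed (auto simp: p_def[of \<rho>] p(2), simp_all add: p_def)
  have sub: "edges (ptree ?V p \<rho>) \<subseteq> edges G"
    using p(1) by (auto simp: ptree_def adj_def insert_commute)
  show thesis by (rule that[OF pf sub])
qed

text \<open>The breadth-first parents span a subtree; an edge outside it would close a cycle, so it
  is the whole tree.\<close>

lemma tree_parent:
  assumes T: "is_tree G" and r: "\<rho> \<in> verts G"
  obtains p where "p \<in> pforest (verts G) {\<rho>}" "G = ptree (verts G) p \<rho>"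
proof -
  let ?V = "verts G"
  have sG: "simple_graph G" and cG: "gconnected G" and nc: "\<And>xs. \<not> is_cycle G xs"
    using T by (auto simp: is_tree_def)
  obtain p where pf: "p \<in> pforest ?V {\<rho>}" and sub: "edges (ptree ?V p \<rho>) \<subseteq> edges G"
    by (rule bfs_parent[OF sG cG r])
  interpret P: parent_tree ?V p \<rho> by unfold_locales (use r pf in auto)
  have "edges G \<subseteq> edges (ptree ?V p \<rho>)"
  proof
    fix e assume e: "e \<in> edges G"
    then obtain x y where xy: "x \<in> ?V" "y \<in> ?V" "x \<noteq> y" "e = {x, y}" using sG by (auto simp: simple_graph_def)
    show "e \<in> edges (ptree ?V p \<rho>)"
      using P.extra_edge_cycle[OF xy(1,2,3) _ sub] e nc xy(4) by blast
  qed
  then have "G = ptree ?V p \<rho>" using sub by (cases G) (auto simp: ptree_def)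
  then show thesis using that pf by blast
qed

text \<open>Depth is graph distance from the root and therefore the same for both maps; every edge
  points towards smaller depth.\<close>

lemma ptree_inj:
  assumes p: "p \<in> pforest V {\<rho>}" and q: "q \<in> pforest V {\<rho>}" and r: "\<rho> \<in> V" and eq: "ptree V p \<rho> = ptree V q \<rho>"
  shows "p = q"
proof
  fix v
  interpret P: parent_tree V p \<rho> by unfold_locales (use r p in auto)
  interpret Q: parent_tree V q \<rho> by unfold_locales (use r q in auto)
  have d: "P.dp v = Q.dp v" if "v \<in> V" for v using P.gdist[OF that] Q.gdist[OF that] eq by simp
  show "p v = q v"
  proof (cases "v \<in> V - {\<rho>}")
    case True
    have "{v, p v} \<in> edges (ptree V q \<rho>)" using True ptree_edge_iff[of v "p v" V p \<rho>] eq by auto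
    then have "p v = q v \<or> (p v \<in> V - {\<rho>} \<and> v = q (p v))" by (auto simp: ptree_edge_iff)
    then show ?thesis
    proof
      assume a: "p v \<in> V - {\<rho>} \<and> v = q (p v)"
      then have "Q.dp (p v) = Suc (Q.dp v)" using Q.dp_step[of "p v"] by auto
      then show ?thesis using P.dp_step[OF True] d[of v] d[of "p v"] a True by auto
    qed
  next
    case False
    then show ?thesis using pforestD(1,2)[OF p, of v] pforestD(1,2)[OF q, of v] by auto
  qed
qed

section \<open>Isomorphisms of rooted graphs\<close>

text \<open>Extensionality fixes the values off the vertex set, so that isomorphisms can be counted;
  \<open>root_stab\<close> achieves the same with the identity.\<close>

definition isos :: "'a rooted \<Rightarrow> 'b rooted \<Rightarrow> ('a \<Rightarrow> 'b) set" where
  "isos x y = {f \<in> extensional (verts (fst x)). graph_iso f (fst x) (fst y) \<and> f (snd x) = snd y}"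

lemma graph_iso_cong:
  assumes "\<And>v. v \<in> verts G \<Longrightarrow> f v = g v"
  shows "graph_iso f G H \<longleftrightarrow> graph_iso g G H"
  unfolding graph_iso_def using assms by (auto simp: bij_betw_cong[of "verts G" f g])

lemma isos_nonempty:
  assumes "snd x \<in> verts (fst x)"
  shows "isos x y \<noteq> {} \<longleftrightarrow> rooted_iso x y"
proof
  assume "rooted_iso x y"
  then obtain f where f: "graph_iso f (fst x) (fst y)" "f (snd x) = snd y" by (auto simp: rooted_iso_def)
  then have "restrict f (verts (fst x)) \<in> isos x y"
    using assms graph_iso_cong[of "fst x" f "restrict f (verts (fst x))" "fst y"] by (simp add: isos_def)
  then show "isos x y \<noteq> {}" by blast
qed (auto simp: isos_def rooted_iso_def)

text \<open>Once one isomorphism \<open>g\<close> is fixed, every other one is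
  \<open>g \<circ> s\<close> for a unique \<open>s\<close> in the stabiliser.\<close>

lemma card_isos:
  assumes r: "snd x \<in> verts (fst x)" and iso: "rooted_iso x y"
  shows "card (isos x y) = card (root_stab x)"
proof -
  let ?V = "verts (fst x)"
  obtain g where g: "g \<in> isos x y" using isos_nonempty[OF r, of y] iso by blast
  then have gi: "graph_iso g (fst x) (fst y)" "g (snd x) = snd y" "g \<in> extensional ?V" by (auto simp: isos_def)
  have gb: "bij_betw g ?V (verts (fst y))" using gi(1) by (simp add: graph_iso_def)
  let ?h = "\<lambda>s. restrict (g \<circ> s) ?V"
  have "bij_betw ?h (root_stab x) (isos x y)"
  proof (rule bij_betwI')
    fix s t assume st: "s \<in> root_stab x" "t \<in> root_stab x"
    have perm: "s permutes ?V" "t permutes ?V" using st by (auto simp: root_stab_def)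
    show "(?h s = ?h t) = (s = t)"
    proof
      assume eq: "?h s = ?h t"
      show "s = t"
      proof
        fix v
        show "s v = t v"
        proof (cases "v \<in> ?V")
          case True
          then have "g (s v) = g (t v)" using fun_cong[OF eq, of v] by simp
          moreover have "s v \<in> ?V" "t v \<in> ?V" using True perm permutes_in_image by metis+
          ultimately show ?thesis using gb by (auto simp: bij_betw_def dest: inj_onD)
        next
          case False
          then show ?thesis using perm by (simp add: permutes_not_in)
        qed
      qed
    qed simp
  next
    fix s assume s: "s \<in> root_stab x"
    have "graph_iso (g \<circ> s) (fst x) (fst y)"
      by (rule graph_iso_comp[OF _ gi(1)]) (use s in \<open>simp add: root_stab_def\<close>)
    then have "graph_iso (?h s) (fst x) (fst y)"
      using graph_iso_cong[of "fst x" "g \<circ> s" "?h s" "fst y"] by simp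
    then show "?h s \<in> isos x y" using s r gi(2) by (simp add: isos_def root_stab_def)
  next
    fix f assume f: "f \<in> isos x y"
    then have fi: "graph_iso f (fst x) (fst y)" "f (snd x) = snd y" "f \<in> extensional ?V" by (auto simp: isos_def)
    have fb: "bij_betw f ?V (verts (fst y))" using fi(1) by (simp add: graph_iso_def)
    define k where "k = inv_into ?V g \<circ> f"
    define s where "s v = (if v \<in> ?V then k v else v)" for v
    have kiso: "graph_iso k (fst x) (fst x)"
      unfolding k_def by (rule graph_iso_comp[OF fi(1) graph_iso_inv[OF gi(1)]])
    then have siso: "graph_iso s (fst x) (fst x)"
      using graph_iso_cong[of "fst x" k s "fst x"] by (simp add: s_def)
    then have "bij_betw s ?V ?V" by (simp add: graph_iso_def)
    then have perm: "s permutes ?V" by (rule bij_imp_permutes) (simp add: s_def)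
    have "inv_into ?V g (snd y) = snd x" using gi(2) gb r by (metis bij_betw_def inv_into_f_f)
    then have "s \<in> root_stab x" using perm siso r fi(2) by (simp add: root_stab_def s_def k_def)
    moreover have "f = ?h s"
    proof
      fix v
      show "f v = ?h s v"
      proof (cases "v \<in> ?V")
        case True
        then have "f v \<in> verts (fst y)" using fb by (auto simp: bij_betw_def)
        then show ?thesis using True gb by (simp add: s_def k_def bij_betw_inv_into_right)
      next
        case False
        then show ?thesis using fi(3) by (simp add: extensional_def)
      qed
    qed
    ultimately show "\<exists>s\<in>root_stab x. f = ?h s" by blast
  qed
  then show ?thesis by (rule bij_betw_same_card[symmetric])
qed

section \<open>Counting spanning trees with a given ball\<close>

definition gwt :: "'a sgraph \<Rightarrow> 'a \<Rightarrow> 'a \<Rightarrow> real" where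
  "gwt G u v = of_bool ({u, v} \<in> edges G)"

definition gforest :: "'a sgraph \<Rightarrow> 'a set \<Rightarrow> 'a set \<Rightarrow> ('a \<Rightarrow> 'a) set" where
  "gforest G V R = {f \<in> pforest V R. \<forall>v\<in>V - R. {v, f v} \<in> edges G}"

lemma network_gwt: "finite V \<Longrightarrow> network V (gwt G)"
  by unfold_locales (auto simp: gwt_def insert_commute)

lemma graph_net_gwt:
  assumes "finite V" "simple_graph G"
  shows "graph_net V (gwt G)"
proof -
  have "{x} \<notin> edges G" for x using assms(2) unfolding simple_graph_def by (metis doubleton_eq_iff insert_absorb2)
  then show ?thesis using assms(1) by unfold_locales (auto simp: gwt_def insert_commute)
qed

lemma forests_gwt:
  assumes "finite V"
  shows "network.forests V (gwt G) R = real (card (gforest G V R))"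
proof -
  interpret network V "gwt G" by (rule network_gwt[OF assms])
  have "weight R f = of_bool (\<forall>v\<in>V - R. {v, f v} \<in> edges G)" for f
    unfolding weight_def gwt_def using assms by (simp add: prod_zero_iff)
  then have "forests R = (\<Sum>f\<in>pforest V R. if \<forall>v\<in>V - R. {v, f v} \<in> edges G then 1 else 0)"
    unfolding forests_def by (intro sum.cong refl) auto
  also have "\<dots> = (\<Sum>f\<in>gforest G V R. 1)"
    unfolding gforest_def by (rule sum.mono_neutral_cong_right) (use assms in auto)
  finally show ?thesis by simp
qed

lemma bij_spanning_trees:
  assumes a: "a \<in> verts G"
  shows "bij_betw (\<lambda>f. ptree (verts G) f a) (gforest G (verts G) {a}) (spanning_trees G)"
proof (rule bij_betwI')
  fix f g assume fg: "f \<in> gforest G (verts G) {a}" "g \<in> gforest G (verts G) {a}"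
  show "(ptree (verts G) f a = ptree (verts G) g a) = (f = g)"
    using ptree_inj[of f "verts G" a g] fg a by (auto simp: gforest_def)
next
  fix f assume f: "f \<in> gforest G (verts G) {a}"
  then interpret parent_tree "verts G" f a by unfold_locales (use a in \<open>auto simp: gforest_def\<close>)
  show "ptree (verts G) f a \<in> spanning_trees G"
    using tree f by (auto simp: spanning_trees_def gforest_def ptree_def)
next
  fix T assume T: "T \<in> spanning_trees G"
  then have "is_tree T" "verts T = verts G" "edges T \<subseteq> edges G" by (auto simp: spanning_trees_def)
  moreover from this obtain p where "p \<in> pforest (verts T) {a}" "T = ptree (verts T) p a"
    using tree_parent[of T a] a by auto
  ultimately have "p \<in> gforest G (verts G) {a}" "T = ptree (verts G) p a"
    using ptree_edge_iff[of _ "p _" "verts G" p a] by (auto simp: gforest_def)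
  then show "\<exists>f\<in>gforest G (verts G) {a}. T = ptree (verts G) f a" by blast
qed

locale fin_graph =
  fixes G :: "'a sgraph"
  assumes fin [simp]: "finite (verts G)" and simple: "simple_graph G" and conn: "gconnected G"
begin

abbreviation "V \<equiv> verts G"

sublocale graph_net V "gwt G"
  by (rule graph_net_gwt[OF fin simple])

lemma finite_gforest: "finite (gforest G V R)"
  unfolding gforest_def by (rule finite_subset[OF _ finP]) auto

lemma V_ne: "V \<noteq> {}"
  using conn by (simp add: gconnected_def)

lemma forests_trees: "a \<in> V \<Longrightarrow> forests {a} = real (card (spanning_trees G))"
  using forests_gwt[OF fin, of G "{a}"] bij_betw_same_card[OF bij_spanning_trees[of a G]] by simp

lemma finite_trees: "finite (spanning_trees G)"
  by (metis V_ne all_not_in_conv bij_betw_finite bij_spanning_trees finite_gforest)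

lemma trees_pos: "0 < card (spanning_trees G)"
proof -
  obtain a where a: "a \<in> V" using V_ne by blast
  obtain p where "p \<in> pforest V {a}" "edges (ptree V p a) \<subseteq> edges G" by (rule bfs_parent[OF simple conn a])
  then have "p \<in> gforest G V {a}" by (auto simp: gforest_def ptree_def)
  then have "gforest G V {a} \<noteq> {}" by blast
  then show ?thesis
    using bij_betw_same_card[OF bij_spanning_trees[OF a]] finite_gforest[of "{a}"] by (metis card_gt_0_iff)
qed

lemma forests_single_pos: "a \<in> V \<Longrightarrow> forests {a} > 0"
  using forests_trees trees_pos by simp

end

text \<open>\<open>\<phi>\<close> embeds a tree of height at most \<open>r\<close> into \<open>G\<close>. A forest \<open>h\<close> that avoids the images of the
  vertices of depth less than \<open>r\<close> and is rooted at the images of the vertices of depth \<open>r\<close>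
  completes the image to a spanning tree.\<close>

locale embedded_tree = T: parent_tree W p \<rho> + fin_graph G
  for W :: "'b set" and p \<rho> and G :: "'a sgraph" +
  fixes r :: nat and \<phi> :: "'b \<Rightarrow> 'a"
  assumes height: "\<And>v. v \<in> W \<Longrightarrow> T.dp v \<le> r"
    and inj: "inj_on \<phi> W" and into: "\<phi> ` W \<subseteq> V"
    and emb: "\<And>v. v \<in> W - {\<rho>} \<Longrightarrow> {\<phi> v, \<phi> (p v)} \<in> edges G"
begin

definition "core = \<phi> ` {v \<in> W. T.dp v < r}"
definition "rim = \<phi> ` {v \<in> W. T.dp v = r}"

lemma image_eq: "\<phi> ` W = core \<union> rim"
  unfolding core_def rim_def using height by fastforce

text \<open>On the rim, which consists of the roots of \<open>h\<close>, the parent is taken from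
  the embedded tree, so that the trees of \<open>h\<close> hang below level
  \<open>r\<close>.\<close>

definition extend :: "('a \<Rightarrow> 'a) \<Rightarrow> 'a \<Rightarrow> 'a" where
  "extend h u = (if u \<in> \<phi> ` W then \<phi> (p (inv_into W \<phi> u)) else h u)"

lemma extend_image: "v \<in> W \<Longrightarrow> extend h (\<phi> v) = \<phi> (p v)"
  using inj by (simp add: extend_def)

context
  fixes h assumes h: "h \<in> gforest G (V - core) rim"
begin

lemma hp: "h \<in> pforest (V - core) rim" and he: "\<And>u. u \<in> V - core - rim \<Longrightarrow> {u, h u} \<in> edges G"
  using h by (auto simp: gforest_def)

lemma extend_out: "u \<in> V - core - rim \<Longrightarrow> extend h u = h u"
  by (simp add: extend_def image_eq)

lemma extend_leads_T: "v \<in> W \<Longrightarrow> leads (extend h) (\<phi> v) (\<phi> \<rho>)"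
  using T.p
proof (induction rule: pforest_induct[consumes 2])
  case (step v)
  then show ?case using leads_step[of "extend h" "\<phi> v"] extend_image[of v h] by auto
qed (use T.p in auto)

lemma extend_pforest: "extend h \<in> pforest V {\<phi> \<rho>}"
proof (rule pforestI)
  fix u assume "u \<notin> V"
  then show "extend h u = u" using into pforestD(1)[OF hp, of u] by (auto simp: extend_def)
next
  fix u assume "u \<in> {\<phi> \<rho>}"
  then show "extend h u = u" using extend_image[OF T.root] T.p_root by simp
next
  fix u assume u: "u \<in> V" "u \<notin> {\<phi> \<rho>}"
  show "extend h u \<in> V"
  proof (cases "u \<in> \<phi> ` W")
    case True
    then show ?thesis using extend_image T.p_V into by auto
  next
    case False
    then show ?thesis using pforestD(3)[OF hp, of u] u by (auto simp: image_eq extend_def)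
  qed
next
  fix u assume u: "u \<in> V"
  have "leads (extend h) u (\<phi> \<rho>)"
  proof (cases "u \<in> core")
    case True
    then show ?thesis using extend_leads_T by (auto simp: core_def)
  next
    case False
    then have "u \<in> V - core" using u by simp
    with hp show ?thesis
    proof (induction rule: pforest_induct)
      case (root x)
      then show ?case using extend_leads_T by (auto simp: rim_def)
    next
      case (step v)
      then show ?case using leads_step[of "extend h" v] extend_out[of v] by auto
    qed
  qed
  then show "\<exists>s\<in>{\<phi> \<rho>}. leads (extend h) u s" by simp
qed

lemma extend_gforest: "extend h \<in> gforest G V {\<phi> \<rho>}"
proof -
  have "{u, extend h u} \<in> edges G" if u: "u \<in> V - {\<phi> \<rho>}" for u
  proof (cases "u \<in> \<phi> ` W")
    case True
    then obtain x where x: "x \<in> W" "u = \<phi> x" by blast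
    then have "x \<in> W - {\<rho>}" using u by auto
    then show ?thesis using emb[of x] extend_image[of x h] x by simp
  next
    case False
    then show ?thesis using he[of u] extend_out[of u] u by (auto simp: image_eq)
  qed
  then show ?thesis using extend_pforest by (simp add: gforest_def)
qed

interpretation E: parent_tree V "extend h" "\<phi> \<rho>"
  by unfold_locales (use extend_pforest T.root into in auto)

lemma depth_T: "v \<in> W \<Longrightarrow> E.dp (\<phi> v) = T.dp v"
  using T.p
proof (induction rule: pforest_induct[consumes 2])
  case (step v)
  have "\<phi> v \<noteq> \<phi> \<rho>" using step inj T.root by (auto dest: inj_onD)
  then have "\<phi> v \<in> V - {\<phi> \<rho>}" using step into by auto
  then have "E.dp (\<phi> v) = Suc (E.dp (\<phi> (p v)))" using E.dp_step[of "\<phi> v"] extend_image[of v h] step by auto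
  then show ?case using step T.dp_step[of v] by auto
qed (use T.p in auto)

text \<open>Pointers of \<open>h\<close> enter the embedded tree only at the rim, that is at depth
  \<open>r\<close>. This keeps the ball of radius \<open>r\<close> equal to the embedded
  copy.\<close>

lemma depth_out: "u \<in> V - core \<Longrightarrow> r \<le> E.dp u \<and> (u \<notin> rim \<longrightarrow> r < E.dp u)"
  using hp
proof (induction rule: pforest_induct[consumes 2])
  case (root x)
  then show ?case using depth_T by (auto simp: rim_def)
next
  case (step u)
  have "u \<noteq> \<phi> \<rho>" using step T.root image_eq by auto
  then have "E.dp u = Suc (E.dp (h u))" using E.dp_step[of u] extend_out[of u] step by auto
  then show ?case using step by auto
qed

lemma extend_iso:
  "restrict \<phi> W \<in> isos (ptree W p \<rho>, \<rho>) (gball (ptree V (extend h) (\<phi> \<rho>)) (\<phi> \<rho>) r)"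
proof -
  let ?B = "fst (gball (ptree V (extend h) (\<phi> \<rho>)) (\<phi> \<rho>) r)"
  have v: "verts ?B = \<phi> ` W"
  proof -
    have "u \<in> \<phi> ` W \<longleftrightarrow> E.dp u \<le> r" if "u \<in> V" for u
    proof (cases "u \<in> \<phi> ` W")
      case True
      then show ?thesis using depth_T height by auto
    next
      case False
      then show ?thesis using depth_out[of u] that by (auto simp: image_eq)
    qed
    then show ?thesis unfolding E.ball_verts using into by auto
  qed
  have "{u, v} \<in> edges (ptree W p \<rho>) \<longleftrightarrow> {\<phi> u, \<phi> v} \<in> edges ?B" if uv: "u \<in> W" "v \<in> W" for u v
  proof -
    have i: "\<phi> x = \<phi> y \<longleftrightarrow> x = y" if "x \<in> W" "y \<in> W" for x y using inj that by (auto dest: inj_onD)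
    show ?thesis
      unfolding E.ball_edge_iff ptree_edge_iff
      using uv depth_T height extend_image i T.p_V T.root into by auto
  qed
  then have "graph_iso \<phi> (ptree W p \<rho>) ?B" using v inj by (auto simp: graph_iso_def bij_betw_def)
  then show ?thesis using graph_iso_cong[of "ptree W p \<rho>" \<phi> "restrict \<phi> W" ?B] T.root by (simp add: isos_def)
qed

end

end

context fin_graph
begin

definition ball_pairs :: "'b rooted \<Rightarrow> nat \<Rightarrow> ('a sgraph \<times> 'a) set" where
  "ball_pairs T r = {(\<Gamma>, x). \<Gamma> \<in> spanning_trees G \<and> x \<in> V \<and> rooted_iso (gball \<Gamma> x r) T}"

lemma prob_ball_pairs:
  "measure_pmf.prob (pair_pmf (ust G) (pmf_of_set V)) {(\<Gamma>, X). rooted_iso (gball \<Gamma> X r) T} =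
    real (card (ball_pairs T r)) / (real (card (spanning_trees G)) * real (card V))"
proof -
  have ne: "spanning_trees G \<noteq> {}" using trees_pos by auto
  have "pair_pmf (ust G) (pmf_of_set V) = pmf_of_set (spanning_trees G \<times> V)"
  proof (rule pmf_eqI)
    fix z :: "'a sgraph \<times> 'a"
    obtain a b where z: "z = (a, b)" by (cases z)
    have "spanning_trees G \<times> V \<noteq> {}" "finite (spanning_trees G \<times> V)" using ne V_ne finite_trees by auto
    then show "pmf (pair_pmf (ust G) (pmf_of_set V)) z = pmf (pmf_of_set (spanning_trees G \<times> V)) z"
      unfolding z ust_def pmf_pair pmf_of_set[OF ne finite_trees] pmf_of_set[OF V_ne fin]
      by (simp add: card_cartesian_product indicator_def)
  qed
  moreover have "(spanning_trees G \<times> V) \<inter> {(\<Gamma>, X). rooted_iso (gball \<Gamma> X r) T} = ball_pairs T r"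
    by (auto simp: ball_pairs_def)
  ultimately show ?thesis using ne V_ne finite_trees
    by (simp add: measure_pmf_of_set card_cartesian_product)
qed

text \<open>Double counting of triples (tree, vertex, isomorphism). By \<open>card_isos\<close> each
  pair in \<open>ball_pairs\<close> belongs to as many triples as the stabiliser has elements. A
  pair \<open>(\<phi>, h)\<close> is recovered from its triple: \<open>\<phi>\<close> is kept, and
  \<open>h\<close> is read off outside the image and is the identity elsewhere.\<close>

lemma ball_pairs_lower:
  fixes E :: "('b \<Rightarrow> 'a) set" and W :: "'b set"
  assumes T: "parent_tree W p \<rho>" and fW: "finite W" and Eext: "E \<subseteq> extensional W"
    and E: "\<And>\<phi>. \<phi> \<in> E \<Longrightarrow> embedded_tree W p \<rho> G r \<phi>"
    and b: "\<And>\<phi>. \<phi> \<in> E \<Longrightarrow> b \<le> real (card (gforest G (V - \<phi> ` {v \<in> W. pdepth p {\<rho>} v < r}) (\<phi> ` {v \<in> W. pdepth p {\<rho>} v = r})))"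
  shows "real (card E) * b \<le> real (card (root_stab (ptree W p \<rho>, \<rho>))) * real (card (ball_pairs (ptree W p \<rho>, \<rho>) r))"
proof -
  interpret T: parent_tree W p \<rho> by (rule T)
  let ?T = "(ptree W p \<rho>, \<rho>)"
  let ?H = "\<lambda>\<phi>. gforest G (V - \<phi> ` {v \<in> W. T.dp v < r}) (\<phi> ` {v \<in> W. T.dp v = r})"
  have finE: "finite E"
  proof (rule finite_subset[OF _ finite_PiE[of W "\<lambda>_. V"]])
    show "E \<subseteq> W \<rightarrow>\<^sub>E V"
    proof
      fix \<phi> assume "\<phi> \<in> E"
      then show "\<phi> \<in> W \<rightarrow>\<^sub>E V" using Eext embedded_tree.into[OF E] by (auto simp: PiE_def)
    qed
  qed (use fW in auto)
  have finH: "finite (gforest G (V - A) B)" for A B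
    unfolding gforest_def by (rule finite_subset[OF _ finite_pforest[of "V - A" B]]) auto
  define S where "S = (SIGMA a:ball_pairs ?T r. isos ?T (gball (fst a) (snd a) r))"
  have finB: "finite (ball_pairs ?T r)"
    by (rule finite_subset[of _ "spanning_trees G \<times> V"]) (use finite_trees in \<open>auto simp: ball_pairs_def\<close>)
  have cI: "card (isos ?T (gball (fst a) (snd a) r)) = card (root_stab ?T)" if "a \<in> ball_pairs ?T r" for a
  proof (rule card_isos)
    show "snd ?T \<in> verts (fst ?T)" using T.root by simp
    show "rooted_iso ?T (gball (fst a) (snd a) r)"
      using that rooted_iso_sym[of "gball (fst a) (snd a) r" ?T]
      by (auto simp: ball_pairs_def spanning_trees_def verts_gball)
  qed
  have st0: "finite (root_stab ?T)"
    by (rule finite_subset[of _ "{f. f permutes W}"]) (use fW in \<open>auto simp: root_stab_def finite_permutations\<close>)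
  have st1: "card (root_stab ?T) > 0"
  proof -
    have "id \<in> root_stab ?T" by (auto simp: root_stab_def permutes_id graph_iso_def)
    then show ?thesis using st0 card_gt_0_iff by blast
  qed
  have finI: "finite (isos ?T (gball (fst a) (snd a) r))" if "a \<in> ball_pairs ?T r" for a
    using cI[OF that] st1 by (intro card_ge_0_finite) simp
  have cS: "card S = card (ball_pairs ?T r) * card (root_stab ?T)"
    unfolding S_def by (subst card_SigmaI) (use finB finI cI in auto)
  have finS: "finite S" unfolding S_def using finB finI by (intro finite_SigmaI) auto
  let ?j = "\<lambda>(\<phi>, h). ((ptree V (embedded_tree.extend W p \<phi> h) (\<phi> \<rho>), \<phi> \<rho>), \<phi>)"
  have "card (SIGMA \<phi>:E. ?H \<phi>) \<le> card S"
  proof (rule card_inj_on_le[of ?j, OF _ _ finS])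
    show "?j ` (SIGMA \<phi>:E. ?H \<phi>) \<subseteq> S"
    proof
      fix z assume "z \<in> ?j ` (SIGMA \<phi>:E. ?H \<phi>)"
      then obtain \<phi> h where a: "\<phi> \<in> E" "h \<in> ?H \<phi>" and z: "z = ?j (\<phi>, h)" by blast
      interpret M: embedded_tree W p \<rho> G r \<phi> by (rule E[OF a(1)])
      have h: "h \<in> gforest G (V - M.core) M.rim" using a(2) by (simp add: M.core_def M.rim_def)
      have r\<phi>: "restrict \<phi> W = \<phi>" using a(1) Eext by (auto simp: extensional_restrict)
      have iso: "\<phi> \<in> isos ?T (gball (ptree V (M.extend h) (\<phi> \<rho>)) (\<phi> \<rho>) r)"
        using M.extend_iso[OF h] r\<phi> by simp
      then have "isos ?T (gball (ptree V (M.extend h) (\<phi> \<rho>)) (\<phi> \<rho>) r) \<noteq> {}" by blast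
      then have "rooted_iso ?T (gball (ptree V (M.extend h) (\<phi> \<rho>)) (\<phi> \<rho>) r)"
        using isos_nonempty[of ?T "gball (ptree V (M.extend h) (\<phi> \<rho>)) (\<phi> \<rho>) r"] T.root by simp
      then have "rooted_iso (gball (ptree V (M.extend h) (\<phi> \<rho>)) (\<phi> \<rho>) r) ?T"
        by (rule rooted_iso_sym) (use T.root in simp)
      moreover have "\<phi> \<rho> \<in> V" using M.into T.root by auto
      moreover have "ptree V (M.extend h) (\<phi> \<rho>) \<in> spanning_trees G"
        using bij_spanning_trees[OF \<open>\<phi> \<rho> \<in> V\<close>] M.extend_gforest[OF h] by (auto simp: bij_betw_def)
      ultimately show "z \<in> S" using iso by (simp add: S_def ball_pairs_def z)
    qed
    show "inj_on ?j (SIGMA \<phi>:E. ?H \<phi>)"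
    proof (rule inj_onI)
      fix z z' assume zz: "z \<in> (SIGMA \<phi>:E. ?H \<phi>)" "z' \<in> (SIGMA \<phi>:E. ?H \<phi>)" "?j z = ?j z'"
      then obtain \<phi> h h' where z: "z = (\<phi>, h)" "z' = (\<phi>, h')" and a: "\<phi> \<in> E" "h \<in> ?H \<phi>" "h' \<in> ?H \<phi>"
        by auto
      have eq: "ptree V (embedded_tree.extend W p \<phi> h) (\<phi> \<rho>) = ptree V (embedded_tree.extend W p \<phi> h') (\<phi> \<rho>)"
        using zz(3) by (simp add: z)
      interpret M: embedded_tree W p \<rho> G r \<phi> by (rule E[OF a(1)])
      have h: "h \<in> gforest G (V - M.core) M.rim" "h' \<in> gforest G (V - M.core) M.rim"
        using a by (auto simp: M.core_def M.rim_def)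
      have "\<phi> \<rho> \<in> V" using M.into T.root by auto
      then have e: "M.extend h = M.extend h'"
        using ptree_inj[OF M.extend_pforest[OF h(1)] M.extend_pforest[OF h(2)]] eq by simp
      have "h = h'"
      proof
        fix u
        show "h u = h' u"
        proof (cases "u \<in> V - M.core - M.rim")
          case True
          then show ?thesis using M.extend_out[OF h(1) True] M.extend_out[OF h(2) True] e by simp
        next
          case False
          then show ?thesis
            using pforestD(1,2)[OF M.hp[OF h(1)], of u] pforestD(1,2)[OF M.hp[OF h(2)], of u] by auto
        qed
      qed
      then show "z = z'" by (simp add: z)
    qed
  qed
  then have "(\<Sum>\<phi>\<in>E. card (?H \<phi>)) \<le> card S"
    using finE finH by (subst (asm) card_SigmaI) auto
  then have "(\<Sum>\<phi>\<in>E. real (card (?H \<phi>))) \<le> real (card S)"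
    by (simp flip: of_nat_sum)
  moreover have "real (card E) * b \<le> (\<Sum>\<phi>\<in>E. real (card (?H \<phi>)))"
    using sum_mono[of E "\<lambda>_. b" "\<lambda>\<phi>. real (card (?H \<phi>))"] b by simp
  ultimately show ?thesis by (simp add: cS mult.commute)
qed

end

section \<open>Most edges of an almost regular graph are good\<close>

lemma card_markov:
  assumes "finite A" "c > 0" "\<And>x. x \<in> A \<Longrightarrow> 0 \<le> (f x :: real)" "(\<Sum>x\<in>A. f x) \<le> M"
  shows "real (card {x \<in> A. f x > c}) \<le> M / c"
proof -
  have "c * real (card {x \<in> A. f x > c}) = (\<Sum>x\<in>{x \<in> A. f x > c}. c)" by simp
  also have "\<dots> \<le> (\<Sum>x\<in>{x \<in> A. f x > c}. f x)" by (intro sum_mono) auto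
  also have "\<dots> \<le> (\<Sum>x\<in>A. f x)" by (intro sum_mono2) (use assms in auto)
  also have "\<dots> \<le> M" by (rule assms)
  finally show ?thesis using assms(2) by (simp add: pos_le_divide_eq mult.commute)
qed

context fin_graph
begin

lemma wdeg_degree: "wdeg v = real (degree G v)"
proof -
  have "neighbours G v = {z \<in> V. {v, z} \<in> edges G}"
    using simple unfolding neighbours_def simple_graph_def by (fastforce simp: doubleton_eq_iff insert_commute)
  moreover have "wdeg v = (\<Sum>z\<in>{z \<in> V. {v, z} \<in> edges G}. 1)"
    unfolding wdeg_def gwt_def by (rule sum.mono_neutral_cong_right) auto
  ultimately show ?thesis by (simp add: degree_def)
qed

lemma wdeg_ge_1:
  assumes "u \<in> V" "u' \<in> V" "u \<noteq> u'" "v \<in> V"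
  shows "1 \<le> wdeg v"
proof -
  obtain x where x: "x \<in> V" "x \<noteq> v" using assms by metis
  then have "(v, x) \<in> (adj G)\<^sup>*" using conn assms(4) by (auto simp: gconnected_def)
  then obtain y where y: "(v, y) \<in> adj G" using x(2) by (metis converse_rtranclE)
  then have "y \<in> V" using adj_verts[OF simple y] by simp
  then have "gwt G v y \<le> wdeg v" unfolding wdeg_def by (intro member_le_sum) auto
  then show ?thesis using y by (simp add: gwt_def adj_def)
qed

end

locale almost_regular = fin_graph +
  fixes d \<delta> \<epsilon> :: real
  assumes d0: "d > 0" and \<delta>0: "0 \<le> \<delta>" and \<delta>\<epsilon>: "\<delta> \<le> \<epsilon> / 8" and \<epsilon>0: "0 < \<epsilon>" "\<epsilon> \<le> 1 / 12" and \<epsilon>d: "2 \<le> \<epsilon> * d"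
    and most: "(1 - \<delta>) * real (card V) \<le> real (card {v \<in> V. \<bar>wdeg v - d\<bar> \<le> \<delta> * d})"
    and total: "\<bar>(\<Sum>v\<in>V. wdeg v) - d * real (card V)\<bar> \<le> \<delta> * d * real (card V)"
begin

definition "n = real (card V)"
definition "A = {v \<in> V. \<bar>wdeg v - d\<bar> \<le> \<delta> * d}"

lemma n0: "n > 0" using V_ne by (simp add: n_def card_gt_0_iff)

lemma \<delta>1: "\<delta> \<le> 1 / 96" using \<delta>\<epsilon> \<epsilon>0 by simp

lemma A_deg: "v \<in> A \<Longrightarrow> (1 - \<delta>) * d \<le> wdeg v \<and> wdeg v \<le> (1 + \<delta>) * d"
  by (auto simp: A_def abs_le_iff algebra_simps)

text \<open>Some vertex has degree near \<open>d\<close>, so there are at least two vertices, and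
  connectedness then excludes isolated ones.\<close>

lemma deg1: "v \<in> V \<Longrightarrow> 1 \<le> wdeg v"
proof -
  have "0 < (1 - \<delta>) * n" using n0 \<delta>1 by simp
  then have "0 < real (card A)" using most by (simp add: A_def n_def)
  then have "A \<noteq> {}" by auto
  then obtain u where u: "u \<in> A" by blast
  have "0 < (1 - \<delta>) * d" using d0 \<delta>1 by simp
  then have "wdeg u > 0" using A_deg[OF u] by linarith
  then obtain z where z: "z \<in> V" "gwt G u z \<noteq> 0" unfolding wdeg_def by (metis less_irrefl sum.neutral)
  then have "u \<noteq> z" by auto
  then show "v \<in> V \<Longrightarrow> 1 \<le> wdeg v" using wdeg_ge_1[of u z v] u z(1) by (auto simp: A_def)
qed

lemma degp: "v \<in> V \<Longrightarrow> wdeg v > 0" using deg1[of v] by simp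

lemma card_V_A: "real (card (V - A)) \<le> \<delta> * n"
proof -
  have "A \<subseteq> V" by (auto simp: A_def)
  then have "real (card (V - A)) = n - real (card A)"
    unfolding n_def by (simp add: card_Diff_subset finite_subset[OF _ fin] card_mono of_nat_diff)
  then show ?thesis using most by (simp add: A_def n_def algebra_simps)
qed

lemma sum_split_A: "(\<Sum>v\<in>V. f v) = (\<Sum>v\<in>A. f v) + (\<Sum>v\<in>V - A. f v)" for f :: "'a \<Rightarrow> real"
  using sum.subset_diff[of A V f] by (simp add: A_def add.commute)

text \<open>Degrees outside \<open>A\<close> are not bounded individually, but the vertices of
  \<open>A\<close> already account for nearly all of \<open>d * n\<close>.\<close>

lemma deg_V_A: "(\<Sum>v\<in>V - A. wdeg v) \<le> 3 * \<delta> * d * n"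
proof -
  have "(\<Sum>v\<in>A. (1 - \<delta>) * d) \<le> (\<Sum>v\<in>A. wdeg v)" by (intro sum_mono) (use A_deg in auto)
  moreover have "(1 - \<delta>) * d * ((1 - \<delta>) * n) \<le> (1 - \<delta>) * d * real (card A)"
    using most d0 \<delta>1 by (intro mult_left_mono) (auto simp: A_def n_def)
  ultimately have "(1 - \<delta>) * d * ((1 - \<delta>) * n) \<le> (\<Sum>v\<in>A. wdeg v)" by (simp add: ac_simps)
  moreover have "(\<Sum>v\<in>V. wdeg v) \<le> d * n + \<delta> * d * n" using total by (simp add: n_def)
  ultimately have "(\<Sum>v\<in>V - A. wdeg v) \<le> d * n + \<delta> * d * n - (1 - \<delta>) * d * ((1 - \<delta>) * n)"
    unfolding sum_split_A[of wdeg] by simp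
  also have "\<dots> = 3 * \<delta> * d * n - \<delta>\<^sup>2 * (d * n)" by (simp add: power2_eq_square algebra_simps)
  also have "\<dots> \<le> 3 * \<delta> * d * n" using d0 n0 by simp
  finally show ?thesis .
qed

definition S :: "'a \<Rightarrow> 'a \<Rightarrow> real" where
  "S u v = 1 / wdeg u + 1 / wdeg v"

text \<open>\<open>S u v - (S u v)\<^sup>2\<close> is a pointwise lower bound for the resistance of the edge \<open>u v\<close>, while by Foster's theorem
  the resistances add up to little more than these bounds; hence the excess is mostly small.\<close>

definition exc :: "'a \<Rightarrow> 'a \<Rightarrow> real" where
  "exc u v = gwt G u v * (reff u v - S u v + (S u v)\<^sup>2)"

text \<open>A test function with values 0 at \<open>u\<close>, 1 at \<open>v\<close> and
  \<open>s\<close> elsewhere shows that \<open>reff u v\<close> is at least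
  \<open>S u v / (1 + S u v)\<close>, which is at least
  \<open>S u v - (S u v)\<^sup>2\<close>.\<close>

lemma exc_nonneg:
  assumes u: "u \<in> V" and v: "v \<in> V"
  shows "0 \<le> exc u v"
proof (cases "gwt G u v = 0")
  case True
  then show ?thesis by (simp add: exc_def)
next
  case False
  then have uv: "u \<noteq> v" by auto
  have F: "forests {u} > 0" by (rule forests_single_pos[OF u])
  let ?a = "wdeg u" and ?b = "wdeg v"
  have ab: "?a > 0" "?b > 0" using degp u v by auto
  \<comment> \<open>The minimiser of \<open>?b * (1 - s)\<^sup>2 + ?a * s\<^sup>2\<close>, as for
    two resistors in series.\<close>
  define s where "s = ?b / (?a + ?b)"
  let ?f = "\<lambda>z. if z = v then 1 else if z \<in> {u} then 0 else s"
  have "en ?f ?f \<le> (\<Sum>r\<in>{u}. gwt G v r) + ?b * (1 - s)\<^sup>2 + (\<Sum>r\<in>{u}. wdeg r) * s\<^sup>2"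
    by (rule en_test) (use u v uv in auto)
  also have "\<dots> \<le> 1 + ?b * (1 - s)\<^sup>2 + ?a * s\<^sup>2" using w_le_1 by simp
  also have "\<dots> = 1 + 1 / S u v"
  proof -
    have "1 - s = ?a / (?a + ?b)" using ab by (simp add: s_def field_simps)
    moreover have "1 / S u v = ?a * ?b / (?a + ?b)" using ab by (simp add: S_def field_simps)
    moreover have "?b * (?a / (?a + ?b))\<^sup>2 + ?a * (?b / (?a + ?b))\<^sup>2 = ?a * ?b / (?a + ?b)"
    proof -
      define q where "q = ?a + ?b"
      have "?b * (?a / q)\<^sup>2 + ?a * (?b / q)\<^sup>2 = ?a * ?b * (?a + ?b) / q\<^sup>2"
        by (simp add: power_divide add_divide_distrib power2_eq_square algebra_simps)
      also have "\<dots> = ?a * ?b / q" using ab by (simp add: q_def[symmetric] power2_eq_square)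
      finally show ?thesis by (simp add: q_def)
    qed
    ultimately show ?thesis by (simp add: s_def)
  qed
  finally have e: "en ?f ?f \<le> 1 + 1 / S u v" .
  have S0: "S u v > 0" using ab by (simp add: S_def add_pos_pos)
  have r0: "0 \<le> reff u v" by (simp add: reff_def)
  have "(?f v)\<^sup>2 \<le> gr {u} v v * en ?f ?f" by (rule gr_lower[OF F v]) (use uv in auto)
  also have "\<dots> \<le> reff u v * (1 + 1 / S u v)" unfolding reff_def by (intro mult_left_mono e) auto
  finally have "1 \<le> reff u v * (1 + 1 / S u v)" by simp
  then have "S u v \<le> reff u v * (S u v + 1)" using S0 by (simp add: field_simps)
  then have "S u v * (1 - S u v) * (S u v + 1) \<le> reff u v * (S u v + 1)"
  proof -
    have "S u v * (1 - S u v) * (S u v + 1) = S u v - S u v * (S u v * S u v)" by (simp add: algebra_simps)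
    also have "\<dots> \<le> S u v" using S0 by simp
    finally show ?thesis using \<open>S u v \<le> reff u v * (S u v + 1)\<close> by linarith
  qed
  then have "S u v * (1 - S u v) \<le> reff u v" by (rule mult_right_le_imp_le) (use S0 in simp)
  then show ?thesis unfolding exc_def by (intro mult_nonneg_nonneg) (auto simp: power2_eq_square algebra_simps)
qed

lemma sum_w_S: "(\<Sum>v\<in>V. gwt G u v * S u v) = 1 + inv_deg_sum u" if "u \<in> V"
proof -
  have "(\<Sum>v\<in>V. gwt G u v * (1 / wdeg u)) = wdeg u * (1 / wdeg u)"
    by (simp only: sum_distrib_right[symmetric] wdeg_def[symmetric])
  then have "(\<Sum>v\<in>V. gwt G u v * S u v) = wdeg u * (1 / wdeg u) + inv_deg_sum u"
    unfolding S_def inv_deg_sum_def distrib_left sum.distrib by simp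
  then show ?thesis using degp[OF that] by simp
qed

lemma sum_inv_deg: "(\<Sum>v\<in>V. inv_deg_sum v) = n"
proof -
  have "(\<Sum>v\<in>V. inv_deg_sum v) = (\<Sum>u\<in>V. \<Sum>v\<in>V. gwt G u v / wdeg u)"
    unfolding inv_deg_sum_def by (subst sum.swap) (simp add: w_sym)
  also have "\<dots> = (\<Sum>u\<in>V. 1)"
  proof (rule sum.cong[OF refl])
    fix u assume "u \<in> V"
    moreover have "(\<Sum>v\<in>V. gwt G u v / wdeg u) = wdeg u / wdeg u"
      by (simp only: sum_divide_distrib[symmetric] wdeg_def[symmetric])
    ultimately show "(\<Sum>v\<in>V. gwt G u v / wdeg u) = 1" using degp[of u] by simp
  qed
  finally show ?thesis by (simp add: n_def)
qed

text \<open>Four times the bound of \<open>sum_inv\<close> per vertex.\<close>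

definition "\<xi> = 8 / d + 4 * \<delta>"

lemma \<xi>0: "\<xi> \<ge> 0" using d0 \<delta>0 by (simp add: \<xi>_def)

lemma sum_inv: "(\<Sum>u\<in>V. 1 / wdeg u) \<le> n * (2 / d + \<delta>)"
proof -
  have "(\<Sum>u\<in>A. 1 / wdeg u) \<le> (\<Sum>u\<in>A. 2 / d)"
  proof (rule sum_mono)
    fix u assume u: "u \<in> A"
    have "d / 2 \<le> (1 - \<delta>) * d" using d0 \<delta>1 by simp
    then have "d / 2 \<le> wdeg u" using A_deg[OF u] by linarith
    then have "1 / wdeg u \<le> 1 / (d / 2)" using d0 by (intro divide_left_mono) auto
    then show "1 / wdeg u \<le> 2 / d" by simp
  qed
  also have "\<dots> \<le> n * (2 / d)"
    using d0 card_mono[OF fin, of A] by (auto simp: n_def A_def intro!: divide_right_mono)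
  finally have 1: "(\<Sum>u\<in>A. 1 / wdeg u) \<le> n * (2 / d)" .
  have "(\<Sum>u\<in>V - A. 1 / wdeg u) \<le> (\<Sum>u\<in>V - A. 1)"
    by (intro sum_mono) (use deg1 degp in \<open>auto simp: divide_le_eq_1_pos\<close>)
  then have "(\<Sum>u\<in>V - A. 1 / wdeg u) \<le> \<delta> * n" using card_V_A by simp
  then show ?thesis using 1 sum_split_A[of "\<lambda>u. 1 / wdeg u"] by (simp add: algebra_simps)
qed

text \<open>Foster's sum \<open>2 * (n - 1)\<close> is offset by the sum \<open>2 * n\<close> of the
  terms \<open>S u v\<close>, so at most the squares remain.\<close>

lemma sum_exc: "(\<Sum>u\<in>V. \<Sum>v\<in>V. exc u v) \<le> n * \<xi>"
proof -
  obtain a where a: "a \<in> V" using V_ne by blast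
  have "(\<Sum>u\<in>V. \<Sum>v\<in>V. exc u v) = (\<Sum>u\<in>V. \<Sum>v\<in>V. gwt G u v * reff u v)
      - (\<Sum>u\<in>V. \<Sum>v\<in>V. gwt G u v * S u v) + (\<Sum>u\<in>V. \<Sum>v\<in>V. gwt G u v * (S u v)\<^sup>2)"
    unfolding exc_def distrib_left right_diff_distrib sum.distrib sum_subtractf ..
  also have "(\<Sum>u\<in>V. \<Sum>v\<in>V. gwt G u v * reff u v) = 2 * (n - 1)"
    unfolding n_def by (rule foster[OF forests_single_pos[OF a] a])
  also have "(\<Sum>u\<in>V. \<Sum>v\<in>V. gwt G u v * S u v) = 2 * n"
    using sum_inv_deg by (simp add: sum_w_S sum.distrib n_def)
  also have "(\<Sum>u\<in>V. \<Sum>v\<in>V. gwt G u v * (S u v)\<^sup>2) \<le> 4 * (\<Sum>u\<in>V. 1 / wdeg u)"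
  proof -
    have sq: "gwt G u v * (S u v)\<^sup>2 \<le> 2 * (gwt G u v / (wdeg u)\<^sup>2) + 2 * (gwt G v u / (wdeg v)\<^sup>2)" for u v
    proof -
      have "0 \<le> (1 / wdeg u - 1 / wdeg v)\<^sup>2" by simp
      then have "(S u v)\<^sup>2 \<le> 2 * (1 / wdeg u)\<^sup>2 + 2 * (1 / wdeg v)\<^sup>2"
        unfolding S_def by (simp add: power2_sum power2_diff)
      from mult_left_mono[OF this, of "gwt G u v"] show ?thesis
        by (simp add: w_sym[of v u] power_divide algebra_simps)
    qed
    have "(\<Sum>u\<in>V. \<Sum>v\<in>V. gwt G u v * (S u v)\<^sup>2) \<le>
        (\<Sum>u\<in>V. \<Sum>v\<in>V. 2 * (gwt G u v / (wdeg u)\<^sup>2) + 2 * (gwt G v u / (wdeg v)\<^sup>2))"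
      by (intro sum_mono sq)
    also have "\<dots> = 4 * (\<Sum>u\<in>V. \<Sum>v\<in>V. gwt G u v / (wdeg u)\<^sup>2)"
    proof -
      have "(\<Sum>u\<in>V. \<Sum>v\<in>V. gwt G v u / (wdeg v)\<^sup>2) = (\<Sum>u\<in>V. \<Sum>v\<in>V. gwt G u v / (wdeg u)\<^sup>2)"
        by (rule sum.swap)
      then show ?thesis by (simp only: sum.distrib sum_distrib_left[symmetric])
    qed
    also have "(\<Sum>u\<in>V. \<Sum>v\<in>V. gwt G u v / (wdeg u)\<^sup>2) = (\<Sum>u\<in>V. 1 / wdeg u)"
    proof (rule sum.cong[OF refl])
      fix u assume u: "u \<in> V"
      have "(\<Sum>v\<in>V. gwt G u v / (wdeg u)\<^sup>2) = wdeg u / (wdeg u)\<^sup>2"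
        unfolding wdeg_def by (simp add: sum_divide_distrib)
      then show "(\<Sum>v\<in>V. gwt G u v / (wdeg u)\<^sup>2) = 1 / wdeg u" using degp[OF u] by (simp add: power2_eq_square)
    qed
    finally show ?thesis .
  qed
  finally have "(\<Sum>u\<in>V. \<Sum>v\<in>V. exc u v) \<le> 2 * (n - 1) - 2 * n + 4 * (\<Sum>u\<in>V. 1 / wdeg u)" by simp
  also have "\<dots> \<le> 4 * (n * (2 / d + \<delta>))" using sum_inv by simp
  also have "\<dots> = n * \<xi>" by (simp add: \<xi>_def algebra_simps)
  finally show ?thesis .
qed

text \<open>By \<open>sum_inv_deg\<close> the mean of \<open>inv_deg_sum\<close> is exactly one, so
  the absolute deviations sum to twice the positive parts of \<open>1 - inv_deg_sum v\<close>. At a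
  vertex of \<open>A\<close> this part is small unless many edges lead to \<open>V - A\<close>;
  their numbers \<open>b v\<close> have a small sum by \<open>deg_V_A\<close>.\<close>

lemma sum_abs_inv_deg: "(\<Sum>v\<in>V. \<bar>1 - inv_deg_sum v\<bar>) \<le> 12 * \<delta> * n"
proof -
  define b where "b v = (\<Sum>u\<in>V - A. gwt G v u)" for v
  have b0: "0 \<le> b v" for v unfolding b_def by (intro sum_nonneg) auto
  have sb: "(\<Sum>v\<in>V. b v) \<le> 3 * \<delta> * d * n"
  proof -
    have "(\<Sum>v\<in>V. b v) = (\<Sum>u\<in>V - A. wdeg u)"
      unfolding b_def wdeg_def by (subst sum.swap) (simp add: w_sym)
    then show ?thesis using deg_V_A by simp
  qed
  have inv0: "0 \<le> inv_deg_sum v" for v unfolding inv_deg_sum_def by (intro sum_nonneg) auto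
  have low: "1 - inv_deg_sum v \<le> 2 * \<delta> + b v / d" if v: "v \<in> A" for v
  proof -
    have "(\<Sum>u\<in>A. gwt G v u) / ((1 + \<delta>) * d) \<le> (\<Sum>u\<in>A. gwt G v u / wdeg u)"
      unfolding sum_divide_distrib
    proof (intro sum_mono divide_left_mono)
      fix u assume u: "u \<in> A"
      show "wdeg u \<le> (1 + \<delta>) * d" using A_deg[OF u] by simp
      have "wdeg u > 0" using degp u by (auto simp: A_def)
      then show "0 < (1 + \<delta>) * d * wdeg u" using d0 \<delta>0 by simp
    qed auto
    also have "\<dots> \<le> inv_deg_sum v" unfolding inv_deg_sum_def by (rule sum_mono2) (auto simp: A_def)
    finally have "(wdeg v - b v) / ((1 + \<delta>) * d) \<le> inv_deg_sum v"
      unfolding b_def wdeg_def sum_split_A[of "gwt G v"] by simp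
    moreover have "((1 - \<delta>) * d - b v) / ((1 + \<delta>) * d) \<le> (wdeg v - b v) / ((1 + \<delta>) * d)"
      using A_deg[OF v] d0 \<delta>0 by (intro divide_right_mono) auto
    moreover have "1 - 2 * \<delta> - b v / d \<le> ((1 - \<delta>) * d - b v) / ((1 + \<delta>) * d)"
    proof -
      have "(1 - 2 * \<delta> - y) * (1 + \<delta>) \<le> 1 - \<delta> - y" if "0 \<le> y" for y
        using that \<delta>0 by (simp add: algebra_simps)
      then have "(1 - 2 * \<delta> - b v / d) * (1 + \<delta>) \<le> 1 - \<delta> - b v / d" using b0[of v] d0 by simp
      then have "1 - 2 * \<delta> - b v / d \<le> (1 - \<delta> - b v / d) / (1 + \<delta>)" using \<delta>0 by (simp add: pos_le_divide_eq)
      also have "\<dots> = ((1 - \<delta>) * d - b v) / ((1 + \<delta>) * d)"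
        using d0 by (simp add: diff_divide_distrib)
      finally show ?thesis .
    qed
    ultimately show ?thesis by linarith
  qed
  have pos: "(\<Sum>v\<in>V. max 0 (1 - inv_deg_sum v)) \<le> 6 * \<delta> * n"
  proof -
    have "(\<Sum>v\<in>A. max 0 (1 - inv_deg_sum v)) \<le> (\<Sum>v\<in>A. 2 * \<delta> + b v / d)"
      by (intro sum_mono) (use low b0 \<delta>0 d0 in auto)
    also have "\<dots> \<le> (\<Sum>v\<in>V. 2 * \<delta> + b v / d)" by (intro sum_mono2) (use b0 \<delta>0 d0 in \<open>auto simp: A_def\<close>)
    also have "\<dots> = 2 * \<delta> * n + (\<Sum>v\<in>V. b v) / d" by (simp add: sum.distrib n_def sum_divide_distrib)
    also have "\<dots> \<le> 2 * \<delta> * n + 3 * \<delta> * n" using sb d0 by (simp add: field_simps)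
    finally have 1: "(\<Sum>v\<in>A. max 0 (1 - inv_deg_sum v)) \<le> 5 * \<delta> * n" by simp
    have "(\<Sum>v\<in>V - A. max 0 (1 - inv_deg_sum v)) \<le> (\<Sum>v\<in>V - A. 1)"
      by (intro sum_mono) (use inv0 in auto)
    then show ?thesis using 1 card_V_A sum_split_A[of "\<lambda>v. max 0 (1 - inv_deg_sum v)"] by simp
  qed
  have "(\<Sum>v\<in>V. \<bar>1 - inv_deg_sum v\<bar>) = (\<Sum>v\<in>V. 2 * max 0 (1 - inv_deg_sum v) - 1 + inv_deg_sum v)"
    by (intro sum.cong refl) (auto simp: max_def abs_if)
  also have "\<dots> = 2 * (\<Sum>v\<in>V. max 0 (1 - inv_deg_sum v)) - n + n"
    unfolding sum_inv_deg[symmetric] by (simp add: sum.distrib sum_subtractf sum_distrib_left sum_inv_deg n_def)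
  finally show ?thesis using pos by simp
qed

text \<open>One summand for each way of failing \<open>good_vertex\<close>: the degree, a neighbour
  of low degree, \<open>inv_deg_sum\<close>, and the total resistance.\<close>

definition "\<beta> = \<delta> + \<delta> / \<epsilon> + 24 * \<delta> / \<epsilon> + 2 * \<xi> / \<epsilon>"

lemma few_bad: "real (card {v \<in> V. \<not> good_vertex \<epsilon> d v}) \<le> \<beta> * n"
proof -
  let ?B1 = "{v \<in> V. \<exists>u\<in>V. gwt G v u = 1 \<and> \<epsilon> * wdeg u < 1}"
  let ?B2 = "{v \<in> V. \<bar>1 - inv_deg_sum v\<bar> > \<epsilon> / 2}"
  let ?B3 = "{v \<in> V. (\<Sum>u\<in>V. exc v u) > \<epsilon> / 2}"
  have sub: "{v \<in> V. \<not> good_vertex \<epsilon> d v} \<subseteq> (V - A) \<union> ?B1 \<union> ?B2 \<union> ?B3"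
  proof (rule subsetI, rule ccontr)
    fix v assume a: "v \<in> {v \<in> V. \<not> good_vertex \<epsilon> d v}" and b: "v \<notin> (V - A) \<union> ?B1 \<union> ?B2 \<union> ?B3"
    have v: "v \<in> V" "v \<in> A" "\<And>u. u \<in> V \<Longrightarrow> gwt G v u = 1 \<Longrightarrow> 1 \<le> \<epsilon> * wdeg u"
      "\<bar>1 - inv_deg_sum v\<bar> \<le> \<epsilon> / 2" "(\<Sum>u\<in>V. exc v u) \<le> \<epsilon> / 2"
      using a b by (auto simp: not_less)
    have "(1 - \<epsilon>) * d \<le> (1 - \<delta>) * d" "(1 + \<delta>) * d \<le> (1 + \<epsilon>) * d"
      using d0 \<delta>\<epsilon> \<epsilon>0 by (auto intro!: mult_right_mono)
    then have dg: "(1 - \<epsilon>) * d \<le> wdeg v" "wdeg v \<le> (1 + \<epsilon>) * d" using A_deg[OF v(2)] by linarith+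
    have "(\<Sum>u\<in>V. gwt G v u * reff v u) \<le> (\<Sum>u\<in>V. exc v u + gwt G v u * S v u)"
      by (intro sum_mono) (simp add: exc_def algebra_simps)
    also have "\<dots> = (\<Sum>u\<in>V. exc v u) + (1 + inv_deg_sum v)" using v(1) by (simp add: sum.distrib sum_w_S)
    also have "\<dots> \<le> 2 + \<epsilon>" using v(4,5) by linarith
    finally have "(\<Sum>u\<in>V. gwt G v u * reff v u) \<le> 2 + \<epsilon>" .
    moreover have "1 - \<epsilon> \<le> inv_deg_sum v" "inv_deg_sum v \<le> 1 + \<epsilon>" using v(4) \<epsilon>0 by linarith+
    ultimately have "good_vertex \<epsilon> d v" using v dg unfolding good_vertex_def by auto
    then show False using a by simp
  qed
  \<comment> \<open>A neighbour \<open>u\<close> with \<open>\<epsilon> * wdeg u < 1\<close> lies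
    outside \<open>A\<close> and spoils fewer than \<open>1 / \<epsilon>\<close> vertices.\<close>
  have c1: "real (card ?B1) \<le> \<delta> / \<epsilon> * n"
  proof -
    let ?L = "{u \<in> V - A. \<epsilon> * wdeg u < 1}"
    have "?B1 \<subseteq> (\<Union>u\<in>?L. {v \<in> V. gwt G v u = 1})"
    proof
      fix v assume "v \<in> ?B1"
      then obtain u where u: "v \<in> V" "u \<in> V" "gwt G v u = 1" "\<epsilon> * wdeg u < 1" by auto
      have "u \<notin> A"
      proof
        assume "u \<in> A"
        then have "\<epsilon> * ((1 - \<delta>) * d) \<le> \<epsilon> * wdeg u" using A_deg \<epsilon>0 by (intro mult_left_mono) auto
        moreover have "2 * (1 - \<delta>) \<le> (\<epsilon> * d) * (1 - \<delta>)" using \<epsilon>d \<delta>1 by (intro mult_right_mono) auto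
        ultimately show False using u(4) \<delta>1 by (simp add: algebra_simps)
      qed
      then show "v \<in> (\<Union>u\<in>?L. {v \<in> V. gwt G v u = 1})" using u by auto
    qed
    then have "card ?B1 \<le> card (\<Union>u\<in>?L. {v \<in> V. gwt G v u = 1})" by (intro card_mono) auto
    also have "\<dots> \<le> (\<Sum>u\<in>?L. card {v \<in> V. gwt G v u = 1})" by (rule card_UN_le) auto
    finally have "real (card ?B1) \<le> (\<Sum>u\<in>?L. real (card {v \<in> V. gwt G v u = 1}))"
      by (simp flip: of_nat_sum)
    also have "\<dots> \<le> (\<Sum>u\<in>?L. 1 / \<epsilon>)"
    proof (rule sum_mono)
      fix u assume u: "u \<in> ?L"
      have "wdeg u = (\<Sum>z\<in>{v \<in> V. gwt G v u = 1}. 1)"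
        unfolding wdeg_def by (rule sum.mono_neutral_cong_right) (use w01 w_sym in auto)
      then show "real (card {v \<in> V. gwt G v u = 1}) \<le> 1 / \<epsilon>" using u \<epsilon>0 by (simp add: field_simps)
    qed
    also have "\<dots> \<le> (\<Sum>u\<in>V - A. 1 / \<epsilon>)" by (intro sum_mono2) (use \<epsilon>0 in auto)
    also have "\<dots> \<le> (\<delta> * n) * (1 / \<epsilon>)"
      unfolding sum_constant using card_V_A \<epsilon>0 by (intro mult_right_mono) auto
    finally show ?thesis by simp
  qed
  have c2: "real (card ?B2) \<le> 24 * \<delta> / \<epsilon> * n"
    using card_markov[OF fin, of "\<epsilon> / 2" "\<lambda>v. \<bar>1 - inv_deg_sum v\<bar>", OF _ _ sum_abs_inv_deg] \<epsilon>0 by simp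
  have c3: "real (card ?B3) \<le> 2 * \<xi> / \<epsilon> * n"
    using card_markov[OF fin, of "\<epsilon> / 2" "\<lambda>v. \<Sum>u\<in>V. exc v u", OF _ _ sum_exc] \<epsilon>0 exc_nonneg
    by (simp add: sum_nonneg ac_simps)
  have "card {v \<in> V. \<not> good_vertex \<epsilon> d v} \<le> card ((V - A) \<union> ?B1 \<union> ?B2 \<union> ?B3)"
    by (intro card_mono sub) auto
  also have "\<dots> \<le> card (V - A) + card ?B1 + card ?B2 + card ?B3"
    by (meson add_le_mono1 card_Un_le order_trans)
  finally have "real (card {v \<in> V. \<not> good_vertex \<epsilon> d v}) \<le> real (card (V - A)) + real (card ?B1) + real (card ?B2) + real (card ?B3)"
    by linarith
  also have "\<dots> \<le> \<delta> * n + \<delta> / \<epsilon> * n + 24 * \<delta> / \<epsilon> * n + 2 * \<xi> / \<epsilon> * n"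
    using card_V_A c1 c2 c3 by linarith
  finally show ?thesis by (simp add: \<beta>_def algebra_simps)
qed

text \<open>Relative loss among ordered pairs of adjacent vertices: \<open>7 * \<delta>\<close> from
  the total degree and from edges at \<open>V - A\<close>, \<open>4 * \<beta>\<close> from bad ends,
  the rest from edges with large \<open>exc\<close>.\<close>

definition "\<tau> = 7 * \<delta> + 4 * \<beta> + 2 * \<xi> / \<epsilon>"

text \<open>Between good vertices of \<open>A\<close> the value \<open>S u v\<close> is at most
  \<open>(2 + \<epsilon> / 2) / d\<close>, so an edge fails to be good only if
  \<open>exc u v\<close> exceeds \<open>\<epsilon> / (2 * d)\<close>; Markov's inequality bounds the
  number of such edges.\<close>

theorem many_good_edges:
  "(1 - \<tau>) * n * d \<le> (\<Sum>u\<in>V. real (card {v. good_edge \<epsilon> d u v}))"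
proof -
  let ?Z = "{v \<in> V. \<not> good_vertex \<epsilon> d v}"
  let ?X = "\<lambda>u v. of_bool (exc u v > \<epsilon> / (2 * d)) :: real"
  have gen: "y \<le> of_bool P + y * of_bool Q + y * of_bool R + of_bool T"
    if "P \<or> Q \<or> R \<or> y = 0 \<or> T" "0 \<le> y" "y \<le> 1" for y :: real and P Q R T
    using that by (cases P; cases Q; cases R; cases T) auto
  have pt: "gwt G u v \<le> of_bool (good_edge \<epsilon> d u v) + gwt G u v * of_bool (u \<in> ?Z \<union> (V - A)) + gwt G v u * of_bool (v \<in> ?Z \<union> (V - A)) + ?X u v"
    if uv: "u \<in> V" "v \<in> V" for u v
  proof (cases "gwt G u v = 1 \<and> u \<notin> ?Z \<union> (V - A) \<and> v \<notin> ?Z \<union> (V - A) \<and> \<not> good_edge \<epsilon> d u v")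
    case True
    then have "gwt G u v = 1" "good_vertex \<epsilon> d u" "good_vertex \<epsilon> d v" "u \<in> A" "v \<in> A" using uv by auto
    then have r: "reff u v > (2 + \<epsilon>) / d" using True by (auto simp: good_edge_def)
    have inv: "1 / wdeg x \<le> (1 + 2 * \<delta>) / d" if x: "x \<in> A" for x
    proof -
      have "1 \<le> (1 + 2 * \<delta>) * (1 - \<delta>)" using \<delta>0 \<delta>1 mult_left_mono[OF \<delta>1 \<delta>0] by (simp add: algebra_simps)
      then have "d \<le> ((1 + 2 * \<delta>) * (1 - \<delta>)) * d" using d0 by simp
      also have "\<dots> \<le> (1 + 2 * \<delta>) * wdeg x" using A_deg[OF x] \<delta>0 by (simp add: mult.assoc mult_left_mono)
      finally show ?thesis using d0 degp[of x] x by (simp add: A_def field_simps)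
    qed
    have "S u v \<le> (2 + 4 * \<delta>) / d"
      unfolding S_def using inv[OF \<open>u \<in> A\<close>] inv[OF \<open>v \<in> A\<close>] by (simp add: add_divide_distrib)
    also have "\<dots> \<le> (2 + \<epsilon> / 2) / d" using d0 \<delta>\<epsilon> by (intro divide_right_mono) auto
    finally have "S u v \<le> (2 + \<epsilon> / 2) / d" .
    moreover have "(2 + \<epsilon>) / d - (2 + \<epsilon> / 2) / d = \<epsilon> / (2 * d)" using d0 by (simp add: field_simps)
    moreover have "exc u v \<ge> reff u v - S u v" using \<open>gwt G u v = 1\<close> by (simp add: exc_def)
    ultimately have "exc u v > \<epsilon> / (2 * d)" using r by linarith
    then have or: "good_edge \<epsilon> d u v \<or> u \<in> ?Z \<union> (V - A) \<or> v \<in> ?Z \<union> (V - A) \<or> gwt G u v = 0 \<or> exc u v > \<epsilon> / (2 * d)"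
      by blast
    from gen[OF or w_nonneg w_le_1] show ?thesis unfolding w_sym[of v u] by blast
  next
    case False
    then have or: "good_edge \<epsilon> d u v \<or> u \<in> ?Z \<union> (V - A) \<or> v \<in> ?Z \<union> (V - A) \<or> gwt G u v = 0 \<or> exc u v > \<epsilon> / (2 * d)"
      using w01[of u v] by blast
    from gen[OF or w_nonneg w_le_1] show ?thesis unfolding w_sym[of v u] by blast
  qed
  have "(\<Sum>u\<in>V. wdeg u) \<le> (\<Sum>u\<in>V. \<Sum>v\<in>V. of_bool (good_edge \<epsilon> d u v) + gwt G u v * of_bool (u \<in> ?Z \<union> (V - A)) + gwt G v u * of_bool (v \<in> ?Z \<union> (V - A)) + ?X u v)"
    unfolding wdeg_def by (intro sum_mono pt)
  also have "\<dots> = (\<Sum>u\<in>V. \<Sum>v\<in>V. of_bool (good_edge \<epsilon> d u v)) + 2 * (\<Sum>u\<in>V. \<Sum>v\<in>V. gwt G u v * of_bool (u \<in> ?Z \<union> (V - A))) + (\<Sum>u\<in>V. \<Sum>v\<in>V. ?X u v)"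
  proof -
    have "(\<Sum>u\<in>V. \<Sum>v\<in>V. gwt G v u * of_bool (v \<in> ?Z \<union> (V - A))) =
        (\<Sum>u\<in>V. \<Sum>v\<in>V. gwt G u v * of_bool (u \<in> ?Z \<union> (V - A)))"
      by (rule sum.swap)
    then show ?thesis by (simp only: sum.distrib mult_2 add.assoc)
  qed
  also have "(\<Sum>u\<in>V. \<Sum>v\<in>V. of_bool (good_edge \<epsilon> d u v)) = (\<Sum>u\<in>V. real (card {v. good_edge \<epsilon> d u v}))"
  proof (rule sum.cong[OF refl])
    fix u
    have "(\<Sum>v\<in>V. of_bool (good_edge \<epsilon> d u v)) = (\<Sum>v\<in>{v. good_edge \<epsilon> d u v}. 1::real)"
      by (rule sum.mono_neutral_cong_right) (auto simp: good_edge_def good_vertex_def)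
    then show "(\<Sum>v\<in>V. of_bool (good_edge \<epsilon> d u v)) = real (card {v. good_edge \<epsilon> d u v})" by simp
  qed
  also have "(\<Sum>u\<in>V. \<Sum>v\<in>V. gwt G u v * of_bool (u \<in> ?Z \<union> (V - A))) \<le> 2 * \<beta> * d * n + 3 * \<delta> * d * n"
  proof -
    have "(\<Sum>u\<in>V. \<Sum>v\<in>V. gwt G u v * of_bool (u \<in> ?Z \<union> (V - A))) = (\<Sum>u\<in>V. wdeg u * of_bool (u \<in> ?Z \<union> (V - A)))"
      unfolding wdeg_def sum_distrib_right ..
    also have "\<dots> = (\<Sum>u\<in>A. wdeg u * of_bool (u \<in> ?Z)) + (\<Sum>u\<in>V - A. wdeg u)"
      unfolding sum_split_A by (intro arg_cong2[where f = "(+)"] sum.cong refl) (auto simp: A_def)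
    also have "(\<Sum>u\<in>A. wdeg u * of_bool (u \<in> ?Z)) \<le> (\<Sum>u\<in>A. 2 * d * of_bool (u \<in> ?Z))"
    proof (intro sum_mono mult_right_mono)
      fix u assume u: "u \<in> A"
      have "(1 + \<delta>) * d \<le> 2 * d" using d0 \<delta>1 by (intro mult_right_mono) auto
      then show "wdeg u \<le> 2 * d" using A_deg[OF u] by linarith
    qed auto
    also have "\<dots> \<le> (\<Sum>u\<in>V. 2 * d * of_bool (u \<in> ?Z))" by (intro sum_mono2) (use d0 in \<open>auto simp: A_def\<close>)
    also have "\<dots> = (\<Sum>u\<in>?Z. 2 * d)" by (rule sum.mono_neutral_cong_right) auto
    also have "\<dots> = 2 * d * real (card ?Z)" by simp
    also have "\<dots> \<le> 2 * d * (\<beta> * n)" using d0 by (intro mult_left_mono few_bad) auto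
    finally show ?thesis using deg_V_A by (simp add: algebra_simps)
  qed
  also have "(\<Sum>u\<in>V. \<Sum>v\<in>V. ?X u v) \<le> 2 * \<xi> / \<epsilon> * d * n"
  proof -
    have "(\<Sum>u\<in>V. \<Sum>v\<in>V. ?X u v) \<le> (\<Sum>u\<in>V. \<Sum>v\<in>V. (2 * d / \<epsilon>) * exc u v)"
    proof (intro sum_mono)
      fix u v assume uv: "u \<in> V" "v \<in> V"
      show "?X u v \<le> (2 * d / \<epsilon>) * exc u v"
      proof (cases "exc u v > \<epsilon> / (2 * d)")
        case True
        then have "(2 * d / \<epsilon>) * (\<epsilon> / (2 * d)) \<le> (2 * d / \<epsilon>) * exc u v" using d0 \<epsilon>0 by (intro mult_left_mono) auto
        then show ?thesis using True d0 \<epsilon>0 by simp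
      next
        case False
        then show ?thesis using exc_nonneg[OF uv] d0 \<epsilon>0 by simp
      qed
    qed
    also have "\<dots> = (2 * d / \<epsilon>) * (\<Sum>u\<in>V. \<Sum>v\<in>V. exc u v)" by (simp add: sum_distrib_left)
    also have "\<dots> \<le> (2 * d / \<epsilon>) * (n * \<xi>)" using d0 \<epsilon>0 by (intro mult_left_mono sum_exc) auto
    finally show ?thesis by (simp add: ac_simps)
  qed
  finally have "(\<Sum>u\<in>V. wdeg u) \<le> (\<Sum>u\<in>V. real (card {v. good_edge \<epsilon> d u v})) + 2 * (2 * \<beta> * d * n + 3 * \<delta> * d * n) + 2 * \<xi> / \<epsilon> * d * n"
    by simp
  moreover have "d * n - \<delta> * d * n \<le> (\<Sum>u\<in>V. wdeg u)" using total by (simp add: n_def)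
  ultimately show ?thesis by (simp add: \<tau>_def algebra_simps)
qed

end

section \<open>Counting embedded trees\<close>

text \<open>In the application \<open>g\<close> is the graph of good edges; \<open>\<sigma>\<close>
  measures how far its degrees fall short of \<open>\<Delta>\<close> on average.\<close>

locale tree_embeddings = parent_tree W p \<rho> for W :: "'b set" and p \<rho> +
  fixes V :: "'a set" and g :: "'a \<Rightarrow> 'a \<Rightarrow> bool" and d \<Delta> \<sigma> :: real
  assumes finW: "finite W" and finV: "finite V" and g_sym: "g x y \<Longrightarrow> g y x" and g_V: "g x y \<Longrightarrow> x \<in> V \<and> y \<in> V"
    and d0: "0 < d" and \<Delta>: "d \<le> \<Delta>" "\<Delta> \<le> 2 * d" and deg: "\<And>x. real (card {y. g x y}) \<le> \<Delta>"
    and loss: "(\<Sum>x\<in>V. \<Delta> - real (card {y. g x y})) \<le> real (card V) * d * \<sigma>" and \<sigma>: "0 \<le> \<sigma>"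
begin

definition homs :: "'b set \<Rightarrow> ('b \<Rightarrow> 'a) set" where
  "homs S = {\<phi> \<in> extensional S. inj_on \<phi> S \<and> \<phi> ` S \<subseteq> V \<and> (\<forall>v\<in>S - {\<rho>}. g (\<phi> v) (\<phi> (p v)))}"

definition closed :: "'b set \<Rightarrow> bool" where
  "closed S \<longleftrightarrow> S \<subseteq> W \<and> \<rho> \<in> S \<and> (\<forall>v\<in>S. p v \<in> S)"

lemma finite_nbrs: "finite {y. g x y}"
  by (rule finite_subset[OF _ finV]) (use g_V in auto)

lemma finite_homs: "finite S \<Longrightarrow> finite (homs S)"
proof (rule finite_subset[OF _ finite_PiE[of S "\<lambda>_. V"]])
  show "homs S \<subseteq> S \<rightarrow>\<^sub>E V" by (auto simp: homs_def PiE_def)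
qed (use finV in auto)

lemma grow_induct [consumes 0, case_names root grow]:
  assumes "P {\<rho>}" and grow: "\<And>S v. closed S \<Longrightarrow> v \<in> W - S \<Longrightarrow> p v \<in> S \<Longrightarrow> P S \<Longrightarrow> P (insert v S)"
  shows "P W"
proof -
  have step: "\<exists>v\<in>W - S. p v \<in> S" if c: "closed S" "S \<noteq> W" for S
  proof -
    obtain x where x: "x \<in> W" "x \<notin> S" using c by (auto simp: closed_def)
    from p x(1) have "x \<notin> S \<longrightarrow> (\<exists>v\<in>W - S. p v \<in> S)"
    proof (induction rule: pforest_induct)
      case (root r)
      then show ?case using c by (auto simp: closed_def)
    next
      case (step v)
      then show ?case by (cases "p v \<in> S") auto
    qed
    then show ?thesis using x by blast
  qed
  have "\<exists>S. closed S \<and> P S \<and> card S = Suc k" if "k < card W" for k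
    using that
  proof (induction k)
    case 0
    have "closed {\<rho>}" using root p_root by (auto simp: closed_def)
    then show ?case using assms(1) by (intro exI[of _ "{\<rho>}"]) auto
  next
    case (Suc k)
    then obtain S where S: "closed S" "P S" "card S = Suc k" by auto
    then have "S \<noteq> W" using Suc.prems by auto
    then obtain v where v: "v \<in> W - S" "p v \<in> S" using step[OF S(1)] by blast
    have "finite S" using S(1) finW finite_subset by (auto simp: closed_def)
    moreover have "closed (insert v S)" using S(1) v by (auto simp: closed_def)
    ultimately show ?case using grow[OF S(1) v S(2)] S(3) v by (intro exI[of _ "insert v S"]) auto
  qed
  moreover have "card W > 0" using finW root by (auto simp: card_gt_0_iff)
  ultimately obtain S where "closed S" "P S" "card S = card W"
    by (metis Suc_diff_1 diff_less zero_less_one)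
  then show ?thesis using card_subset_eq[OF finW, of S] by (auto simp: closed_def)
qed

lemma homs_insert:
  assumes c: "closed S" and v: "v \<in> W - S" and pv: "p v \<in> S"
  shows "bij_betw (\<lambda>(\<phi>, x). \<phi>(v := x)) (SIGMA \<phi>:homs S. {x. g (\<phi> (p v)) x} - \<phi> ` S) (homs (insert v S))"
proof (rule bij_betwI[where g = "\<lambda>\<phi>. (restrict \<phi> S, \<phi> v)"])
  have vn: "v \<notin> S" "v \<noteq> \<rho>" using v c by (auto simp: closed_def)
  show "(\<lambda>(\<phi>, x). \<phi>(v := x)) \<in> (SIGMA \<phi>:homs S. {x. g (\<phi> (p v)) x} - \<phi> ` S) \<rightarrow> homs (insert v S)"
  proof
    fix a assume "a \<in> (SIGMA \<phi>:homs S. {x. g (\<phi> (p v)) x} - \<phi> ` S)"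
    then obtain \<phi> x where a: "a = (\<phi>, x)" "\<phi> \<in> homs S" "g (\<phi> (p v)) x" "x \<notin> \<phi> ` S" by auto
    have im: "(\<phi>(v := x)) ` S = \<phi> ` S" using vn by auto
    have "inj_on (\<phi>(v := x)) (insert v S)"
      using a vn im by (auto simp: homs_def inj_on_def)
    moreover have "\<phi>(v := x) \<in> extensional (insert v S)" using a by (auto simp: homs_def extensional_def)
    moreover have "g ((\<phi>(v := x)) u) ((\<phi>(v := x)) (p u))" if "u \<in> insert v S - {\<rho>}" for u
    proof (cases "u = v")
      case True
      then show ?thesis using a(3) g_sym pv vn by auto
    next
      case False
      then have "u \<in> S - {\<rho>}" "p u \<noteq> v" using that c vn by (auto simp: closed_def)
      then show ?thesis using a(2) False by (auto simp: homs_def)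
    qed
    moreover have "(\<phi>(v := x)) ` insert v S \<subseteq> V" using a(2,3) g_V[OF a(3)] im by (auto simp: homs_def)
    ultimately show "(case a of (\<phi>, x) \<Rightarrow> \<phi>(v := x)) \<in> homs (insert v S)" by (simp only: a(1) prod.case homs_def mem_Collect_eq) blast
  qed
  show "(\<lambda>\<phi>. (restrict \<phi> S, \<phi> v)) \<in> homs (insert v S) \<rightarrow> (SIGMA \<phi>:homs S. {x. g (\<phi> (p v)) x} - \<phi> ` S)"
  proof
    fix \<phi> assume \<phi>: "\<phi> \<in> homs (insert v S)"
    have r: "restrict \<phi> S \<in> homs S"
      using \<phi> c vn unfolding homs_def closed_def by (auto simp: inj_on_def)
    moreover have "g (\<phi> (p v)) (\<phi> v)" using \<phi> vn g_sym by (auto simp: homs_def)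
    moreover have "\<phi> v \<notin> restrict \<phi> S ` S" using \<phi> vn by (auto simp: homs_def inj_on_def)
    ultimately show "(restrict \<phi> S, \<phi> v) \<in> (SIGMA \<phi>:homs S. {x. g (\<phi> (p v)) x} - \<phi> ` S)"
      using pv by simp
  qed
  show "(restrict (case a of (\<phi>, x) \<Rightarrow> \<phi>(v := x)) S, (case a of (\<phi>, x) \<Rightarrow> \<phi>(v := x)) v) = a"
    if "a \<in> (SIGMA \<phi>:homs S. {x. g (\<phi> (p v)) x} - \<phi> ` S)" for a
  proof -
    obtain \<phi> x where a: "a = (\<phi>, x)" "\<phi> \<in> homs S" using \<open>a \<in> _\<close> by auto
    have "restrict (\<phi>(v := x)) S = \<phi>"
      using a(2) vn by (auto simp: homs_def fun_eq_iff extensional_def restrict_def)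
    then show ?thesis by (simp add: a(1))
  qed
  show "(case (restrict \<phi> S, \<phi> v) of (\<phi>, x) \<Rightarrow> \<phi>(v := x)) = \<phi>" if "\<phi> \<in> homs (insert v S)" for \<phi>
    using that by (auto simp: homs_def fun_eq_iff extensional_def restrict_def)
qed

text \<open>A leaf can be added in at least the good degree of the image of \<open>p v\<close> minus
  \<open>card S\<close> ways, but vertices of small good degree might be overrepresented among these
  images. The simultaneous upper bound \<open>\<Delta> ^ (card S - 1)\<close> on embeddings with one
  vertex pinned, whichever it is, rules this out: the degree deficit summed over embeddings is at
  most that power times the total deficit.\<close>

lemma embeddings_lower: "real (card V) * d ^ (card W - 1) * (1 - real (card W) * (2 ^ card W * (\<sigma> + real (card W) / d))) \<le> real (card (homs W))"
proof -
  define \<kappa> where "\<kappa> = 2 ^ card W * (\<sigma> + real (card W) / d)"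
  define N where "N = real (card V)"
  have \<Delta>0: "0 < \<Delta>" using d0 \<Delta> by simp
  have "(\<forall>a\<in>W. \<forall>x. real (card {\<phi> \<in> homs W. \<phi> a = x}) \<le> \<Delta> ^ (card W - 1)) \<and>
      N * d ^ (card W - 1) * (1 - real (card W) * \<kappa>) \<le> real (card (homs W))"
  proof (rule grow_induct[of "\<lambda>S. (\<forall>a\<in>S. \<forall>x. real (card {\<phi> \<in> homs S. \<phi> a = x}) \<le> \<Delta> ^ (card S - 1)) \<and>
      N * d ^ (card S - 1) * (1 - real (card S) * \<kappa>) \<le> real (card (homs S))"])
    have b: "bij_betw (\<lambda>x. \<lambda>v\<in>{\<rho>}. x) V (homs {\<rho>})"
      by (rule bij_betwI[where g = "\<lambda>\<phi>. \<phi> \<rho>"]) (auto simp: homs_def fun_eq_iff extensional_def)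
    have c: "card (homs {\<rho>}) = card V" using bij_betw_same_card[OF b] by simp
    have "card {\<phi> \<in> homs {\<rho>}. \<phi> \<rho> = x} \<le> card {\<lambda>v\<in>{\<rho>}. x}" for x
      by (rule card_mono) (auto simp: homs_def fun_eq_iff extensional_def)
    moreover have "0 \<le> \<kappa>" using \<sigma> d0 by (simp add: \<kappa>_def)
    ultimately show "(\<forall>a\<in>{\<rho>}. \<forall>x. real (card {\<phi> \<in> homs {\<rho>}. \<phi> a = x}) \<le> \<Delta> ^ (card {\<rho>} - 1)) \<and>
        N * d ^ (card {\<rho>} - 1) * (1 - real (card {\<rho>}) * \<kappa>) \<le> real (card (homs {\<rho>}))"
      using c by (auto simp: N_def mult_left_le)
  next
    fix S v assume c: "closed S" and v: "v \<in> W - S" and pv: "p v \<in> S"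
      and IH: "(\<forall>a\<in>S. \<forall>x. real (card {\<phi> \<in> homs S. \<phi> a = x}) \<le> \<Delta> ^ (card S - 1)) \<and>
        N * d ^ (card S - 1) * (1 - real (card S) * \<kappa>) \<le> real (card (homs S))"
    have pin: "real (card {\<phi> \<in> homs S. \<phi> a = x}) \<le> \<Delta> ^ (card S - 1)" if "a \<in> S" for a x using IH that by blast
    have finS: "finite S" using c finW finite_subset by (auto simp: closed_def)
    have S1: "card S \<ge> 1" using c finS by (auto simp: closed_def Suc_le_eq card_gt_0_iff)
    have cS': "card (insert v S) = Suc (card S)" using v finS by simp
    have SW: "Suc (card S) \<le> card W"
      using card_mono[OF finW, of "insert v S"] c v cS' by (auto simp: closed_def)
    note bij = homs_insert[OF c v pv]
    have pow: "\<Delta> ^ (card S - 1) * \<Delta> = \<Delta> ^ card S" using S1 by (metis One_nat_def Suc_diff_le diff_Suc_1 mult.commute power_Suc)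
    have pin': "real (card {\<phi> \<in> homs (insert v S). \<phi> a = x}) \<le> \<Delta> ^ card S" if a: "a \<in> insert v S" for a x
    proof (cases "a = v")
      case False
      then have aS: "a \<in> S" using a by simp
      let ?X = "SIGMA \<phi>:{\<phi> \<in> homs S. \<phi> a = x}. {y. g (\<phi> (p v)) y}"
      have fX: "finite ?X" using finite_homs[OF finS] finite_nbrs by (intro finite_SigmaI) auto
      have "{\<phi> \<in> homs (insert v S). \<phi> a = x} \<subseteq> (\<lambda>(\<phi>, y). \<phi>(v := y)) ` ?X"
      proof
        fix \<phi> assume f: "\<phi> \<in> {\<phi> \<in> homs (insert v S). \<phi> a = x}"
        then have "\<phi> \<in> (\<lambda>(\<phi>, x). \<phi>(v := x)) ` (SIGMA \<phi>:homs S. {x. g (\<phi> (p v)) x} - \<phi> ` S)"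
          using bij by (auto simp: bij_betw_def)
        then obtain \<psi> y where "\<phi> = \<psi>(v := y)" "\<psi> \<in> homs S" "g (\<psi> (p v)) y" by auto
        moreover from this have "\<psi> a = x" using f False by auto
        ultimately show "\<phi> \<in> (\<lambda>(\<phi>, y). \<phi>(v := y)) ` ?X" by force
      qed
      then have "card {\<phi> \<in> homs (insert v S). \<phi> a = x} \<le> card ?X"
        using fX by (rule surj_card_le[rotated])
      also have "card ?X = (\<Sum>\<phi>\<in>{\<phi> \<in> homs S. \<phi> a = x}. card {y. g (\<phi> (p v)) y})"
        by (rule card_SigmaI) (use finite_homs[OF finS] finite_nbrs in auto)
      finally have "real (card {\<phi> \<in> homs (insert v S). \<phi> a = x}) \<le> (\<Sum>\<phi>\<in>{\<phi> \<in> homs S. \<phi> a = x}. real (card {y. g (\<phi> (p v)) y}))"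
        by (simp flip: of_nat_sum)
      also have "\<dots> \<le> (\<Sum>\<phi>\<in>{\<phi> \<in> homs S. \<phi> a = x}. \<Delta>)" by (intro sum_mono deg)
      also have "\<dots> \<le> \<Delta> ^ (card S - 1) * \<Delta>" using pin[OF aS, of x] \<Delta>0 by simp
      finally show ?thesis unfolding pow .
    next
      case True
      \<comment> \<open>The pinned vertex is the new leaf: the image of \<open>p v\<close> is one of
        at most \<open>\<Delta>\<close> neighbours of \<open>x\<close>, and the bound for
        \<open>S\<close> is used with \<open>p v\<close> pinned.\<close>
      let ?X = "\<Union>y\<in>{y. g x y}. {\<phi> \<in> homs S. \<phi> (p v) = y}"
      have fX: "finite ?X" using finite_homs[OF finS] finite_nbrs by auto
      have "{\<phi> \<in> homs (insert v S). \<phi> a = x} \<subseteq> (\<lambda>\<phi>. \<phi>(v := x)) ` ?X"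
      proof
        fix \<phi> assume f: "\<phi> \<in> {\<phi> \<in> homs (insert v S). \<phi> a = x}"
        then have "\<phi> \<in> (\<lambda>(\<phi>, x). \<phi>(v := x)) ` (SIGMA \<phi>:homs S. {x. g (\<phi> (p v)) x} - \<phi> ` S)"
          using bij by (auto simp: bij_betw_def)
        then obtain \<psi> y where y: "\<phi> = \<psi>(v := y)" "\<psi> \<in> homs S" "g (\<psi> (p v)) y" by auto
        then have "y = x" using f True by auto
        then show "\<phi> \<in> (\<lambda>\<phi>. \<phi>(v := x)) ` ?X" using y g_sym by auto
      qed
      then have "card {\<phi> \<in> homs (insert v S). \<phi> a = x} \<le> card ?X"
        using fX by (rule surj_card_le[rotated])
      also have "\<dots> \<le> (\<Sum>y\<in>{y. g x y}. card {\<phi> \<in> homs S. \<phi> (p v) = y})" by (rule card_UN_le[OF finite_nbrs])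
      finally have "real (card {\<phi> \<in> homs (insert v S). \<phi> a = x}) \<le> (\<Sum>y\<in>{y. g x y}. real (card {\<phi> \<in> homs S. \<phi> (p v) = y}))"
        by (simp flip: of_nat_sum)
      also have "\<dots> \<le> (\<Sum>y\<in>{y. g x y}. \<Delta> ^ (card S - 1))" by (intro sum_mono pin pv)
      also have "\<dots> = real (card {y. g x y}) * \<Delta> ^ (card S - 1)" by simp
      also have "\<dots> \<le> \<Delta> * \<Delta> ^ (card S - 1)" using \<Delta>0 by (intro mult_right_mono deg) auto
      finally show ?thesis using pow by (simp add: mult.commute)
    qed
    let ?gd = "\<lambda>x. real (card {y. g x y})"
    have fib: "(\<Sum>\<phi>\<in>homs S. f (\<phi> (p v))) = (\<Sum>x\<in>V. f x * real (card {\<phi> \<in> homs S. \<phi> (p v) = x}))" for f :: "'a \<Rightarrow> real"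
    proof -
      have "(\<Sum>\<phi>\<in>homs S. f (\<phi> (p v))) = (\<Sum>x\<in>V. \<Sum>\<phi>\<in>{\<phi> \<in> homs S. \<phi> (p v) = x}. f (\<phi> (p v)))"
        by (rule sum.group[symmetric]) (use finite_homs[OF finS] finV pv in \<open>auto simp: homs_def\<close>)
      also have "\<dots> = (\<Sum>x\<in>V. \<Sum>\<phi>\<in>{\<phi> \<in> homs S. \<phi> (p v) = x}. f x)"
        by (intro sum.cong refl) auto
      finally show ?thesis by (simp add: mult.commute)
    qed
    have NS: "real (card (homs S)) \<le> N * \<Delta> ^ (card S - 1)"
    proof -
      have "real (card (homs S)) = (\<Sum>x\<in>V. 1 * real (card {\<phi> \<in> homs S. \<phi> (p v) = x}))"
        using fib[of "\<lambda>_. 1"] by simp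
      also have "\<dots> \<le> (\<Sum>x\<in>V. \<Delta> ^ (card S - 1))" by (intro sum_mono) (use pin[OF pv] in simp)
      finally show ?thesis by (simp add: N_def)
    qed
    have ls: "(\<Sum>\<phi>\<in>homs S. \<Delta> - ?gd (\<phi> (p v))) \<le> \<Delta> ^ (card S - 1) * (N * d * \<sigma>)"
    proof -
      have "(\<Sum>\<phi>\<in>homs S. \<Delta> - ?gd (\<phi> (p v))) = (\<Sum>x\<in>V. (\<Delta> - ?gd x) * real (card {\<phi> \<in> homs S. \<phi> (p v) = x}))"
        by (rule fib)
      also have "\<dots> \<le> (\<Sum>x\<in>V. (\<Delta> - ?gd x) * \<Delta> ^ (card S - 1))"
        by (intro sum_mono mult_left_mono pin pv) (use deg in simp)
      also have "\<dots> = (\<Sum>x\<in>V. \<Delta> - ?gd x) * \<Delta> ^ (card S - 1)" by (simp add: sum_distrib_right)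
      also have "\<dots> \<le> (N * d * \<sigma>) * \<Delta> ^ (card S - 1)" unfolding N_def using \<Delta>0 by (intro mult_right_mono loss) auto
      finally show ?thesis by (simp add: mult.commute)
    qed
    have "card (homs (insert v S)) = (\<Sum>\<phi>\<in>homs S. card ({x. g (\<phi> (p v)) x} - \<phi> ` S))"
      using bij_betw_same_card[OF bij] finite_homs[OF finS] finite_nbrs
      by (subst (asm) card_SigmaI) auto
    then have "real (card (homs (insert v S))) = (\<Sum>\<phi>\<in>homs S. real (card ({x. g (\<phi> (p v)) x} - \<phi> ` S)))"
      by simp
    also have "\<dots> \<ge> (\<Sum>\<phi>\<in>homs S. ?gd (\<phi> (p v)) - real (card S))"
    proof (rule sum_mono)
      fix \<phi> assume "\<phi> \<in> homs S"
      have "card {x. g (\<phi> (p v)) x} - card (\<phi> ` S) \<le> card ({x. g (\<phi> (p v)) x} - \<phi> ` S)"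
        by (rule diff_card_le_card_Diff) (use finS in simp)
      moreover have "card (\<phi> ` S) \<le> card S" by (rule card_image_le[OF finS])
      ultimately show "?gd (\<phi> (p v)) - real (card S) \<le> real (card ({x. g (\<phi> (p v)) x} - \<phi> ` S))" by linarith
    qed
    finally have "(\<Sum>\<phi>\<in>homs S. ?gd (\<phi> (p v)) - real (card S)) \<le> real (card (homs (insert v S)))" .
    moreover have "(\<Sum>\<phi>\<in>homs S. ?gd (\<phi> (p v)) - real (card S)) =
        \<Delta> * real (card (homs S)) - (\<Sum>\<phi>\<in>homs S. \<Delta> - ?gd (\<phi> (p v))) - real (card S) * real (card (homs S))"
      by (simp add: sum_subtractf mult.commute)
    moreover have "d * real (card (homs S)) \<le> \<Delta> * real (card (homs S))" using \<Delta> by (intro mult_right_mono) auto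
    moreover have "real (card S) * real (card (homs S)) \<le> real (card S) * (N * \<Delta> ^ (card S - 1))"
      using NS by (intro mult_left_mono) auto
    ultimately have "d * real (card (homs S)) - \<Delta> ^ (card S - 1) * (N * d * \<sigma>) - real (card S) * (N * \<Delta> ^ (card S - 1))
        \<le> real (card (homs (insert v S)))" using ls by linarith
    moreover have "\<Delta> ^ (card S - 1) * (N * d * \<sigma>) + real (card S) * (N * \<Delta> ^ (card S - 1)) \<le> N * d ^ card S * \<kappa>"
    proof -
      have "\<Delta> ^ (card S - 1) \<le> (2 * d) ^ (card S - 1)" using \<Delta> \<Delta>0 by (intro power_mono) auto
      also have "\<dots> = 2 ^ (card S - 1) * d ^ (card S - 1)" by (rule power_mult_distrib)
      also have "\<dots> \<le> 2 ^ card W * d ^ (card S - 1)" using SW d0 by (intro mult_right_mono power_increasing) auto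
      finally have P: "\<Delta> ^ (card S - 1) \<le> 2 ^ card W * d ^ (card S - 1)" .
      have "\<Delta> ^ (card S - 1) * (N * d * \<sigma>) + real (card S) * (N * \<Delta> ^ (card S - 1)) = \<Delta> ^ (card S - 1) * (N * d * (\<sigma> + real (card S) / d))"
        using d0 by (simp add: algebra_simps)
      also have "\<dots> \<le> (2 ^ card W * d ^ (card S - 1)) * (N * d * (\<sigma> + real (card W) / d))"
        using SW d0 \<sigma> \<Delta>0 by (intro mult_mono P mult_left_mono add_left_mono divide_right_mono) (auto simp: N_def)
      also have "\<dots> = N * (d ^ (card S - 1) * d) * \<kappa>" by (simp add: \<kappa>_def)
      also have "d ^ (card S - 1) * d = d ^ card S" using S1 by (metis One_nat_def Suc_diff_le diff_Suc_1 mult.commute power_Suc)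
      finally show ?thesis .
    qed
    moreover have "d * (N * d ^ (card S - 1) * (1 - real (card S) * \<kappa>)) \<le> d * real (card (homs S))"
      using IH d0 by (intro mult_left_mono) auto
    moreover have "d * (N * d ^ (card S - 1) * (1 - real (card S) * \<kappa>)) = N * d ^ card S * (1 - real (card S) * \<kappa>)"
      using S1 by (metis (no_types, opaque_lifting) One_nat_def Suc_diff_le diff_Suc_1 mult.assoc mult.commute power_Suc)
    ultimately have "N * d ^ card S * (1 - real (card S) * \<kappa>) - N * d ^ card S * \<kappa> \<le> real (card (homs (insert v S)))"
      by linarith
    then have "N * d ^ card S * (1 - real (Suc (card S)) * \<kappa>) \<le> real (card (homs (insert v S)))"
      by (simp add: algebra_simps)
    then show "(\<forall>a\<in>insert v S. \<forall>x. real (card {\<phi> \<in> homs (insert v S). \<phi> a = x}) \<le> \<Delta> ^ (card (insert v S) - 1)) \<and>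
        N * d ^ (card (insert v S) - 1) * (1 - real (card (insert v S)) * \<kappa>) \<le> real (card (homs (insert v S)))"
      using pin' cS' by simp
  qed
  then show ?thesis by (simp add: N_def \<kappa>_def)
qed

end

section \<open>Lower bound for the ball probabilities\<close>

context almost_regular
begin

lemma good_edge_sym: "good_edge \<epsilon> d u v \<Longrightarrow> good_edge \<epsilon> d v u"
  using reff_sym[of u v] forests_single_pos[of u] w_sym[of u v]
  by (auto simp: good_edge_def good_vertex_def)

text \<open>\<open>ball_pairs_lower\<close> applied to the embeddings along good edges; the power of
  \<open>d\<close> gained from their number cancels the one lost in
  \<open>forests_away_lower\<close>.\<close>

theorem ball_prob_lower:
  fixes W :: "'b set"
  assumes T: "parent_tree W p \<rho>" and fW: "finite W"
    and h: "\<And>v. v \<in> W \<Longrightarrow> pdepth p {\<rho>} v \<le> r" and leaf: "\<exists>v\<in>W. pdepth p {\<rho>} v = r" and r: "r \<ge> 1"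
  defines "m \<equiv> card {v \<in> W. pdepth p {\<rho>} v < r}" and "k \<equiv> card {v \<in> W. pdepth p {\<rho>} v = r}"
  assumes se: "small_enough m k \<eta> \<epsilon>" and \<eta>: "\<eta> \<le> real k * exp (- real m)"
  shows "(1 - real (card W) * (2 ^ card W * (\<epsilon> + \<tau> + real (card W) / d))) * (real k * exp (- real m) - \<eta>)
      / real (card (root_stab (ptree W p \<rho>, \<rho>)))
    \<le> measure_pmf.prob (pair_pmf (ust G) (pmf_of_set V)) {(\<Gamma>, X). rooted_iso (gball \<Gamma> X r) (ptree W p \<rho>, \<rho>)}"
proof -
  interpret T: parent_tree W p \<rho> by (rule T)
  have \<tau>0: "0 \<le> \<tau>" using \<delta>0 \<epsilon>0 \<xi>0 by (simp add: \<tau>_def \<beta>_def)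
  have gdeg: "real (card {v. good_edge \<epsilon> d u v}) \<le> (1 + \<epsilon>) * d" for u
  proof (cases "good_vertex \<epsilon> d u")
    case True
    have sub: "{v. good_edge \<epsilon> d u v} \<subseteq> V" by (auto simp: good_edge_def good_vertex_def)
    have "real (card {v. good_edge \<epsilon> d u v}) = (\<Sum>v\<in>{v. good_edge \<epsilon> d u v}. gwt G u v)"
      by (simp add: good_edge_def)
    also have "\<dots> \<le> wdeg u" unfolding wdeg_def by (rule sum_mono2[OF fin sub]) auto
    also have "\<dots> \<le> (1 + \<epsilon>) * d" using True by (simp add: good_vertex_def)
    finally show ?thesis .
  next
    case False
    then have "{v. good_edge \<epsilon> d u v} = {}" by (auto simp: good_edge_def)
    then show ?thesis using d0 \<epsilon>0 by simp
  qed
  interpret E: tree_embeddings W p \<rho> V "good_edge \<epsilon> d" d "(1 + \<epsilon>) * d" "\<epsilon> + \<tau>"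
  proof unfold_locales
    show "(\<Sum>x\<in>V. (1 + \<epsilon>) * d - real (card {y. good_edge \<epsilon> d x y})) \<le> real (card V) * d * (\<epsilon> + \<tau>)"
      using many_good_edges by (simp add: sum_subtractf n_def algebra_simps)
    show "good_edge \<epsilon> d y x" if "good_edge \<epsilon> d x y" for x y using that by (rule good_edge_sym)
    show "x \<in> V \<and> y \<in> V" if "good_edge \<epsilon> d x y" for x y using that by (simp add: good_edge_def good_vertex_def)
    show "real (card {y. good_edge \<epsilon> d x y}) \<le> (1 + \<epsilon>) * d" for x by (rule gdeg)
  qed (use fW d0 \<epsilon>0 \<tau>0 in auto)
  obtain lf where l: "lf \<in> W" "T.dp lf = r" using leaf by blast
  let ?s = "card W - 1"
  let ?K = "real k * exp (- real m) - \<eta>"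
  let ?\<tau>G = "real (card (spanning_trees G))"
  have WU: "{v \<in> W. T.dp v < r} \<union> {v \<in> W. T.dp v = r} = W"
  proof (intro equalityI subsetI)
    fix x assume "x \<in> W"
    then show "x \<in> {v \<in> W. T.dp v < r} \<union> {v \<in> W. T.dp v = r}" using h[of x] by auto
  qed auto
  have cW: "card W = k + m"
  proof -
    have "card ({v \<in> W. T.dp v < r} \<union> {v \<in> W. T.dp v = r}) = m + k"
      unfolding m_def k_def by (rule card_Un_disjoint) (use fW in auto)
    then show ?thesis unfolding WU by simp
  qed
  \<comment> \<open>Every level below \<open>r\<close> is occupied, so \<open>r \<le> m\<close>; two
    inner vertices are then joined through the root by at most \<open>2 * m\<close> good
    edges.\<close>
  have rm: "r \<le> m"
  proof -
    have "{..<r} \<subseteq> T.dp ` {v \<in> W. T.dp v < r}"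
    proof
      fix j assume "j \<in> {..<r}"
      then have j: "j < r" by simp
      have "\<exists>v\<in>W. T.dp v = r - i" if "i \<le> r" for i
        using that
      proof (induction i)
        case 0
        then show ?case using l by auto
      next
        case (Suc i)
        then obtain v where v: "v \<in> W" "T.dp v = r - i" by auto
        then have "v \<noteq> \<rho>" using Suc.prems by auto
        then show ?case using T.dp_step[of v] T.p_V[of v] v by (intro bexI[of _ "p v"]) auto
      qed
      from this[of "r - j"] show "j \<in> T.dp ` {v \<in> W. T.dp v < r}" using j by force
    qed
    then have "card {..<r} \<le> card (T.dp ` {v \<in> W. T.dp v < r})" using fW by (intro card_mono) auto
    also have "\<dots> \<le> m" unfolding m_def using fW by (intro card_image_le) auto
    finally show ?thesis by simp
  qed
  have emb: "embedded_tree W p \<rho> G r \<phi>" if \<phi>: "\<phi> \<in> E.homs W" for \<phi>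
  proof unfold_locales
    show "{\<phi> v, \<phi> (p v)} \<in> edges G" if "v \<in> W - {\<rho>}" for v
      using \<phi> that by (auto simp: E.homs_def good_edge_def gwt_def)
  qed (use h \<phi> in \<open>auto simp: E.homs_def\<close>)
  have bound: "?K * ?\<tau>G / d ^ ?s \<le> real (card (gforest G (V - \<phi> ` {v \<in> W. T.dp v < r}) (\<phi> ` {v \<in> W. T.dp v = r})))"
    if \<phi>: "\<phi> \<in> E.homs W" for \<phi>
  proof -
    let ?I = "\<phi> ` {v \<in> W. T.dp v < r}" and ?L = "\<phi> ` {v \<in> W. T.dp v = r}"
    have inj: "inj_on \<phi> W" and into: "\<phi> ` W \<subseteq> V" and ge: "\<And>v. v \<in> W - {\<rho>} \<Longrightarrow> good_edge \<epsilon> d (\<phi> v) (\<phi> (p v))"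
      using \<phi> by (auto simp: E.homs_def)
    have cI: "card ?I = m" and cL: "card ?L = k"
      unfolding m_def k_def by (rule card_image, rule inj_on_subset[OF inj], auto)+
    have path: "(\<phi> v, \<phi> \<rho>) \<in> {(u, v). good_edge \<epsilon> d u v} ^^ T.dp v" if "v \<in> W" for v
      using T.p that
    proof (induction rule: pforest_induct)
      case (step v)
      then have "(\<phi> v, \<phi> \<rho>) \<in> {(u, v). good_edge \<epsilon> d u v} ^^ Suc (T.dp (p v))"
        using ge[of v] by (intro relpow_Suc_I2) auto
      then show ?case using T.dp_step[OF step(1)] by simp
    qed simp
    have symE: "({(u, v). good_edge \<epsilon> d u v} ^^ j)\<inverse> = {(u, v). good_edge \<epsilon> d u v} ^^ j" for j
    proof -
      have "{(u, v). good_edge \<epsilon> d u v}\<inverse> = {(u, v). good_edge \<epsilon> d u v}" using good_edge_sym by auto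
      then show ?thesis by (induction j) (simp_all add: converse_relcomp relpow_commute)
    qed
    \<comment> \<open>Every vertex except the root is the lower end of a good edge; the root is the
      upper end of one because \<open>r \<ge> 1\<close>.\<close>
    have gv: "good_vertex \<epsilon> d (\<phi> v)" if v: "v \<in> W" for v
    proof (cases "v = \<rho>")
      case False
      then show ?thesis using ge[of v] v by (simp add: good_edge_def)
    next
      case True
      obtain x where "(\<phi> lf, x) \<in> {(u, v). good_edge \<epsilon> d u v} ^^ (r - 1)" "(x, \<phi> \<rho>) \<in> {(u, v). good_edge \<epsilon> d u v}"
        using path[OF l(1)] l(2) r by (metis One_nat_def Suc_diff_le diff_Suc_1 relpow_Suc_E)
      then show ?thesis using True by (auto simp: good_edge_def)
    qed
    obtain a0 where a0: "a0 \<in> V" using V_ne by blast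
    have "(real (card ?L) * exp (- real (card ?I)) - \<eta>) * forests {a0} \<le> network.forests (V - ?I) (gwt G) ?L * d ^ (card ?L + card ?I - 1)"
    proof (rule forests_away_lower[where \<epsilon> = \<epsilon>])
      show "0 < forests {a0}" "a0 \<in> V" using forests_single_pos[OF a0] a0 by auto
      show "1 \<le> wdeg u" if "u \<in> V" for u by (rule deg1[OF that])
      show "?I \<subseteq> V" using into by auto
      show "?L \<subseteq> V - ?I" using into inj by (auto dest: inj_onD)
      show "?L \<noteq> {}" using l by auto
      have "\<rho> \<in> {v \<in> W. T.dp v < r}" using T.root r by auto
      then show "?I \<noteq> {}" by blast
      show "good_vertex \<epsilon> d v" if "v \<in> ?I \<union> ?L" for v using gv that by auto
      show "\<exists>n\<le>2 * card ?I. (i, j) \<in> {(u, v). good_edge \<epsilon> d u v} ^^ n" if ij: "i \<in> ?I" "j \<in> ?I" for i j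
      proof -
        obtain u v where uv: "i = \<phi> u" "j = \<phi> v" "u \<in> W" "v \<in> W" "T.dp u < r" "T.dp v < r" using ij by auto
        have "(\<phi> \<rho>, j) \<in> ({(u, v). good_edge \<epsilon> d u v} ^^ T.dp v)\<inverse>" using path[OF uv(4)] uv by simp
        then have "(\<phi> \<rho>, j) \<in> {(u, v). good_edge \<epsilon> d u v} ^^ T.dp v" unfolding symE .
        then have "(i, j) \<in> {(u, v). good_edge \<epsilon> d u v} ^^ (T.dp u + T.dp v)"
          using path[OF uv(3)] uv(1) by (auto simp: relpow_add)
        moreover have "T.dp u + T.dp v \<le> 2 * card ?I" using uv rm cI by linarith
        ultimately show ?thesis by blast
      qed
      show "small_enough (card ?I) (card ?L) \<eta> \<epsilon>" using se cI cL by simp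
      show "1 \<le> \<epsilon> * d" using \<epsilon>d by simp
    qed
    then have "?K * ?\<tau>G \<le> real (card (gforest G (V - ?I) ?L)) * d ^ ?s"
      unfolding cI cL forests_trees[OF a0] cW using forests_gwt[of "V - ?I" G ?L] by simp
    then show ?thesis using d0 by (simp add: pos_divide_le_eq)
  qed
  let ?st = "real (card (root_stab (ptree W p \<rho>, \<rho>)))"
  have "real (card (E.homs W)) * (?K * ?\<tau>G / d ^ ?s) \<le> ?st * real (card (ball_pairs (ptree W p \<rho>, \<rho>) r))"
    by (rule ball_pairs_lower[OF T fW _ emb bound]) (auto simp: E.homs_def)
  moreover have "(real (card V) * d ^ ?s * (1 - real (card W) * (2 ^ card W * (\<epsilon> + \<tau> + real (card W) / d)))) * (?K * ?\<tau>G / d ^ ?s)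
      \<le> real (card (E.homs W)) * (?K * ?\<tau>G / d ^ ?s)"
    using E.embeddings_lower \<eta> d0 by (intro mult_right_mono) auto
  ultimately have "(1 - real (card W) * (2 ^ card W * (\<epsilon> + \<tau> + real (card W) / d))) * ?K * (?\<tau>G * real (card V))
      \<le> ?st * real (card (ball_pairs (ptree W p \<rho>, \<rho>) r))"
    using d0 by (simp add: ac_simps)
  moreover have "?\<tau>G * real (card V) > 0" using trees_pos V_ne by (simp add: card_gt_0_iff)
  ultimately have "(1 - real (card W) * (2 ^ card W * (\<epsilon> + \<tau> + real (card W) / d))) * ?K
      \<le> ?st * (real (card (ball_pairs (ptree W p \<rho>, \<rho>) r)) / (?\<tau>G * real (card V)))"
    by (simp add: pos_le_divide_eq)
  moreover have "?st > 0"
  proof -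
    have "finite (root_stab (ptree W p \<rho>, \<rho>))"
      by (rule finite_subset[of _ "{f. f permutes W}"]) (use fW in \<open>auto simp: root_stab_def finite_permutations\<close>)
    moreover have "id \<in> root_stab (ptree W p \<rho>, \<rho>)" by (auto simp: root_stab_def permutes_id graph_iso_def)
    ultimately show ?thesis by (auto simp: card_gt_0_iff)
  qed
  ultimately show ?thesis unfolding prob_ball_pairs by (simp add: pos_divide_le_eq mult.commute)
qed

end

section \<open>Independence in Galton--Watson trees\<close>

abbreviation "pois \<equiv> pmf (poisson_pmf 1)"

interpretation offspring: product_prob_space "\<lambda>_. measure_pmf (poisson_pmf 1)" "UNIV :: nat list set"
  by unfold_locales

interpretation OP: prob_space poisson_offspring
  unfolding poisson_offspring_def by (rule offspring.prob_space_axioms)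

lemma space_offspring [simp]: "space poisson_offspring = UNIV"
  by (simp add: poisson_offspring_def space_PiM)

lemma measurable_PiM_coord: "i \<in> K \<Longrightarrow> (\<lambda>x. x i) \<in> measurable (PiM K (\<lambda>_. measure_pmf q)) (count_space UNIV)"
proof -
  assume "i \<in> K"
  then have "(\<lambda>x. x i) \<in> measurable (PiM K (\<lambda>_. measure_pmf q)) (measure_pmf q)"
    by (rule measurable_component_singleton)
  moreover have "measurable (PiM K (\<lambda>_. measure_pmf q)) (measure_pmf q) = measurable (PiM K (\<lambda>_. measure_pmf q)) (count_space UNIV)"
    by (rule measurable_cong_sets) simp_all
  ultimately show ?thesis by simp
qed

lemma measurable_coord [measurable]: "(\<lambda>\<xi>. \<xi> u) \<in> measurable poisson_offspring (count_space UNIV)"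
  unfolding poisson_offspring_def by (rule measurable_PiM_coord) simp

definition shift :: "nat list \<Rightarrow> (nat list \<Rightarrow> nat) \<Rightarrow> nat list \<Rightarrow> nat" where
  "shift l \<xi> = (\<lambda>u. \<xi> (l @ u))"

text \<open>Reindexing a product of equal laws along the injection that prepends \<open>l\<close>
  preserves it.\<close>

lemma distr_shift: "distr poisson_offspring poisson_offspring (shift l) = poisson_offspring"
proof -
  have "distr (Pi\<^sub>M UNIV (\<lambda>_::nat list. measure_pmf (poisson_pmf 1))) (\<Pi>\<^sub>M i\<in>UNIV. measure_pmf (poisson_pmf 1))
      (\<lambda>\<omega>. \<lambda>n\<in>UNIV. \<omega> (l @ n)) = (\<Pi>\<^sub>M i\<in>UNIV. measure_pmf (poisson_pmf 1))"
    by (rule distr_PiM_reindex) (auto simp: inj_on_def measure_pmf.prob_space_axioms)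
  then show ?thesis by (simp add: poisson_offspring_def shift_def[abs_def] restrict_UNIV)
qed

lemma measurable_shift [measurable]: "shift l \<in> measurable poisson_offspring poisson_offspring"
  unfolding poisson_offspring_def shift_def[abs_def]
  by (rule measurable_PiM_single') (auto simp: space_PiM intro!: measurable_PiM_coord)

lemma prob_shift:
  assumes "A \<in> sets poisson_offspring"
  shows "OP.prob {\<xi>. shift l \<xi> \<in> A} = OP.prob A"
proof -
  have "OP.prob A = measure (distr poisson_offspring poisson_offspring (shift l)) A" by (simp add: distr_shift)
  also have "\<dots> = OP.prob {\<xi>. shift l \<xi> \<in> A}"
    by (subst measure_distr) (use assms in \<open>auto simp: vimage_def\<close>)
  finally show ?thesis by simp
qed

lemma prob_coords:
  assumes "finite J"
  shows "OP.prob {\<xi>. \<forall>v\<in>J. \<xi> v = c v} = (\<Prod>v\<in>J. pois (c v))"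
proof -
  have "emeasure poisson_offspring {\<xi> \<in> space poisson_offspring. \<forall>v\<in>J. \<xi> v \<in> {c v}} = (\<Prod>v\<in>J. emeasure (measure_pmf (poisson_pmf 1)) {c v})"
    unfolding poisson_offspring_def by (rule offspring.emeasure_PiM_Collect) (use assms in auto)
  also have "\<dots> = ennreal (\<Prod>v\<in>J. pois (c v))"
    by (subst prod_ennreal[symmetric]) (auto simp: emeasure_pmf_single)
  finally show ?thesis by (simp add: measure_def prod_nonneg)
qed

lemma indep_coords: "OP.indep_vars (\<lambda>_. measure_pmf (poisson_pmf 1)) (\<lambda>u \<xi>. \<xi> u) UNIV"
proof (subst OP.indep_vars_iff_distr_eq_PiM)
  show "OP.random_variable (measure_pmf (poisson_pmf 1)) (\<lambda>\<xi>. \<xi> u)" for u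
    unfolding poisson_offspring_def by (rule measurable_component_singleton) simp
  have 1: "distr poisson_offspring (measure_pmf (poisson_pmf 1)) (\<lambda>\<xi>. \<xi> u) = measure_pmf (poisson_pmf 1)" for u
    unfolding poisson_offspring_def by (rule offspring.PiM_component) simp
  show "distr poisson_offspring (Pi\<^sub>M UNIV (\<lambda>_. measure_pmf (poisson_pmf 1))) (\<lambda>x. \<lambda>i\<in>UNIV. x i) =
      Pi\<^sub>M UNIV (\<lambda>u. distr poisson_offspring (measure_pmf (poisson_pmf 1)) (\<lambda>\<xi>. \<xi> u))"
    unfolding 1 by (simp add: poisson_offspring_def restrict_UNIV distr_id2)
qed simp

text \<open>The branching property: the coordinates in \<open>J\<close> and the descendants of the
  various words in \<open>S\<close> form disjoint, hence independent families, and each subtree is a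
  copy of the whole tree by \<open>prob_shift\<close>.\<close>

lemma prob_branching:
  assumes J: "finite J" and S: "finite S" and A: "A \<in> sets poisson_offspring"
    and JS: "\<And>l u. l \<in> S \<Longrightarrow> l @ u \<notin> J"
    and anti: "\<And>l l' u u'. l \<in> S \<Longrightarrow> l' \<in> S \<Longrightarrow> l @ u = l' @ u' \<Longrightarrow> l = l'"
  shows "OP.prob {\<xi>. (\<forall>v\<in>J. \<xi> v = c v) \<and> (\<forall>l\<in>S. shift l \<xi> \<in> A)} = (\<Prod>v\<in>J. pois (c v)) * OP.prob A ^ card S"
proof -
  let ?M = "\<lambda>_. measure_pmf (poisson_pmf 1)"
  define K where "K j = (case j of None \<Rightarrow> J | Some l \<Rightarrow> range ((@) l))" for j
  define L where "L = insert None (Some ` S)"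
  define X where "X j \<xi> = restrict (\<lambda>i. \<xi> i) (K j)" for j and \<xi> :: "nat list \<Rightarrow> nat"
  have ind: "OP.indep_vars (\<lambda>j. PiM (K j) ?M) X L"
    unfolding X_def[abs_def]
  proof (rule OP.indep_vars_restrict[OF indep_coords])
    show "disjoint_family_on K L"
      unfolding disjoint_family_on_def
    proof (intro ballI impI)
      fix i j assume ij: "i \<in> L" "j \<in> L" "i \<noteq> j"
      show "K i \<inter> K j = {}"
      proof (cases i)
        case None
        then obtain l where "j = Some l" "l \<in> S" using ij by (auto simp: L_def)
        then show ?thesis using JS[of l] None by (auto simp: K_def)
      next
        case (Some l)
        then have l: "l \<in> S" using ij by (auto simp: L_def)
        show ?thesis
        proof (cases j)
          case None
          then show ?thesis using JS[of l] l Some by (auto simp: K_def)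
        next
          case (Some l')
          then have "l' \<in> S" "l \<noteq> l'" using ij \<open>i = Some l\<close> by (auto simp: L_def)
          then show ?thesis using anti[OF l, of l'] \<open>i = Some l\<close> Some by (auto simp: K_def)
        qed
      qed
    qed
  qed auto
  define B where "B j = (case j of None \<Rightarrow> {x \<in> space (PiM J ?M). \<forall>v\<in>J. x v = c v}
      | Some l \<Rightarrow> {x \<in> space (PiM (range ((@) l)) ?M). (\<lambda>u. x (l @ u)) \<in> A})" for j
  have B: "B j \<in> sets (PiM (K j) ?M)" if "j \<in> L" for j
  proof (cases j)
    case None
    have "{x \<in> space (PiM J ?M). \<forall>v\<in>J. x v = c v} = (\<Pi>\<^sub>E v\<in>J. {c v})"
      by (auto simp: space_PiM PiE_def)
    also have "\<dots> \<in> sets (PiM J ?M)" by (rule sets_PiM_I_finite[OF J]) auto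
    finally show ?thesis by (simp add: None B_def K_def)
  next
    case (Some l)
    have "(\<lambda>x u. x (l @ u)) \<in> measurable (PiM (range ((@) l)) ?M) poisson_offspring"
      unfolding poisson_offspring_def
      by (rule measurable_PiM_single') (auto simp: space_PiM intro!: measurable_PiM_coord)
    from measurable_sets[OF this A] show ?thesis
      by (simp add: Some B_def K_def vimage_def Int_def conj_commute)
  qed
  have XN: "X None \<xi> \<in> B None \<longleftrightarrow> (\<forall>v\<in>J. \<xi> v = c v)" for \<xi>
    by (auto simp: X_def B_def K_def space_PiM PiE_def)
  have XS: "X (Some l) \<xi> \<in> B (Some l) \<longleftrightarrow> shift l \<xi> \<in> A" for l \<xi>
    by (auto simp: X_def B_def K_def space_PiM PiE_def shift_def)
  have "OP.prob (\<Inter>j\<in>L. X j -` B j \<inter> space poisson_offspring) = (\<Prod>j\<in>L. OP.prob (X j -` B j \<inter> space poisson_offspring))"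
    by (rule OP.indep_varsD[OF ind]) (use S B in \<open>auto simp: L_def\<close>)
  also have "(\<Prod>j\<in>L. OP.prob (X j -` B j \<inter> space poisson_offspring)) =
      OP.prob (X None -` B None) * (\<Prod>l\<in>S. OP.prob (X (Some l) -` B (Some l)))"
    using S by (simp add: L_def prod.reindex)
  also have "X None -` B None = {\<xi>. \<forall>v\<in>J. \<xi> v = c v}" using XN by auto
  also have "OP.prob {\<xi>. \<forall>v\<in>J. \<xi> v = c v} = (\<Prod>v\<in>J. pois (c v))" by (rule prob_coords[OF J])
  also have "(\<Prod>l\<in>S. OP.prob (X (Some l) -` B (Some l))) = (\<Prod>l\<in>S. OP.prob A)"
  proof (rule prod.cong[OF refl])
    fix l
    have "X (Some l) -` B (Some l) = {\<xi>. shift l \<xi> \<in> A}" using XS by auto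
    then show "OP.prob (X (Some l) -` B (Some l)) = OP.prob A" using prob_shift[OF A] by simp
  qed
  also have "(\<Inter>j\<in>L. X j -` B j \<inter> space poisson_offspring) = {\<xi>. (\<forall>v\<in>J. \<xi> v = c v) \<and> (\<forall>l\<in>S. shift l \<xi> \<in> A)}"
    using XN XS by (auto simp: L_def)
  finally show ?thesis by simp
qed

section \<open>Extinction of the critical Galton--Watson tree\<close>

definition gwv :: "(nat list \<Rightarrow> nat) \<Rightarrow> nat list set" where
  "gwv \<xi> = {u. \<forall>i<length u. u ! i < \<xi> (take i u)}"

lemma verts_gw [simp]: "verts (gw_tree \<xi>) = gwv \<xi>"
  by (simp add: gw_tree_def gwv_def Let_def)

lemma gwv_Nil [simp]: "[] \<in> gwv \<xi>"
  by (simp add: gwv_def)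

lemma gwv_snoc: "u @ [k] \<in> gwv \<xi> \<longleftrightarrow> u \<in> gwv \<xi> \<and> k < \<xi> u"
  unfolding gwv_def by (auto simp: nth_append less_Suc_eq)

lemma gwv_append: "l @ u \<in> gwv \<xi> \<longleftrightarrow> l \<in> gwv \<xi> \<and> u \<in> gwv (shift l \<xi>)"
proof (induction u rule: rev_induct)
  case (snoc k u)
  then show ?case by (simp add: gwv_snoc shift_def flip: append_assoc)
qed simp

lemma gwv_Cons: "k # u \<in> gwv \<xi> \<longleftrightarrow> k < \<xi> [] \<and> u \<in> gwv (shift [k] \<xi>)"
  using gwv_append[of "[k]" u \<xi>] gwv_snoc[of "[]" k \<xi>] by simp

lemma measurable_gwv [measurable]: "Measurable.pred poisson_offspring (\<lambda>\<xi>. u \<in> gwv \<xi>)"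
  unfolding gwv_def by measurable

lemma sets_gwv: "{\<xi>. P \<xi>} \<in> sets poisson_offspring" if "Measurable.pred poisson_offspring P"
  using that by (simp add: pred_def)

lemma sets_survives [measurable]: "survives m \<in> sets poisson_offspring"
proof -
  have pr: "Measurable.pred poisson_offspring (\<lambda>\<xi>. \<exists>u. length u = m \<and> u \<in> gwv \<xi>)" by measurable
  have eq: "survives m = {\<xi>. \<exists>u. length u = m \<and> u \<in> gwv \<xi>}" by (auto simp: survives_def)
  show ?thesis unfolding eq by (rule sets_gwv[OF pr])
qed

lemma survives_Suc: "\<xi> \<in> survives (Suc m) \<longleftrightarrow> (\<exists>k<\<xi> []. shift [k] \<xi> \<in> survives m)"
proof
  assume "\<xi> \<in> survives (Suc m)"
  then obtain k u where "k # u \<in> gwv \<xi>" "length u = m" by (auto simp: survives_def length_Suc_conv)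
  then show "\<exists>k<\<xi> []. shift [k] \<xi> \<in> survives m" by (auto simp: survives_def gwv_Cons)
next
  assume "\<exists>k<\<xi> []. shift [k] \<xi> \<in> survives m"
  then obtain k u where "k < \<xi> []" "u \<in> gwv (shift [k] \<xi>)" "length u = m" by (auto simp: survives_def)
  then have "k # u \<in> gwv \<xi>" "length (k # u) = Suc m" by (auto simp: gwv_Cons)
  then show "\<xi> \<in> survives (Suc m)" unfolding survives_def by fastforce
qed

definition surv :: "nat \<Rightarrow> real" where
  "surv m = OP.prob (survives m)"

lemma surv_0: "surv 0 = 1"
proof -
  have "survives 0 = UNIV" by (auto simp: survives_def)
  then show ?thesis using OP.prob_space by (simp add: surv_def)
qed

text \<open>Survival for \<open>m + 1\<close> generations fails iff it fails for \<open>m\<close>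
  below every child; summing over the number of children gives the Poisson generating function
  \<open>exp (s - 1)\<close> at \<open>s = 1 - surv m\<close>.\<close>

lemma surv_Suc: "surv (Suc m) = 1 - exp (- surv m)"
proof -
  let ?A = "- survives m"
  have A: "?A \<in> sets poisson_offspring" using sets.compl_sets[OF sets_survives[of m]] by (simp add: Compl_eq_Diff_UNIV)
  have pA: "OP.prob ?A = 1 - surv m"
    using OP.prob_compl[OF sets_survives[of m]] by (simp add: surv_def Compl_eq_Diff_UNIV)
  define E where "E c = {\<xi>. (\<forall>v\<in>{[]}. \<xi> v = c) \<and> (\<forall>l\<in>(\<lambda>k. [k]) ` {..<c}. shift l \<xi> \<in> ?A)}" for c
  have pE: "OP.prob (E c) = pois c * (1 - surv m) ^ c" for c
    unfolding E_def by (subst prob_branching[OF _ _ A]) (auto simp: pA card_image inj_on_def)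
  have pr: "Measurable.pred poisson_offspring (\<lambda>\<xi>. \<xi> [] = c \<and> (\<forall>k<c. shift [k] \<xi> \<in> ?A))" for c
    using A by measurable
  have eq: "E c = {\<xi>. \<xi> [] = c \<and> (\<forall>k<c. shift [k] \<xi> \<in> ?A)}" for c by (auto simp: E_def)
  have sE: "E c \<in> sets poisson_offspring" for c unfolding eq by (rule sets_gwv[OF pr])
  have "(\<lambda>c. OP.prob (E c)) sums OP.prob (\<Union>c. E c)"
    by (rule OP.finite_measure_UNION) (use sE in \<open>auto simp: disjoint_family_on_def E_def\<close>)
  moreover have "(\<Union>c. E c) = - survives (Suc m)"
    by (auto simp: E_def survives_Suc)
  moreover have "OP.prob (- survives (Suc m)) = 1 - surv (Suc m)"
    using OP.prob_compl[OF sets_survives[of "Suc m"]] by (simp add: surv_def Compl_eq_Diff_UNIV)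
  ultimately have s1: "(\<lambda>c. pois c * (1 - surv m) ^ c) sums (1 - surv (Suc m))" by (simp add: pE)
  have "(\<lambda>c. exp (-1) * ((1 - surv m) ^ c /\<^sub>R fact c)) sums (exp (-1) * exp (1 - surv m))"
    by (intro sums_mult exp_converges)
  moreover have "exp (-1) * ((1 - surv m) ^ c /\<^sub>R fact c) = pois c * (1 - surv m) ^ c" for c
    by (simp add: divide_inverse)
  moreover have "exp (-1) * exp (1 - surv m) = exp (- surv m)" by (simp flip: exp_add)
  ultimately have "(\<lambda>c. pois c * (1 - surv m) ^ c) sums exp (- surv m)" by simp
  from sums_unique2[OF s1 this] show ?thesis by simp
qed

lemma surv_pos: "0 < surv m"
  by (induction m) (simp_all add: surv_0 surv_Suc)

lemma surv_le_1: "surv m \<le> 1"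
  by (simp add: surv_def)

lemma surv_decseq: "decseq surv"
proof (rule decseq_SucI)
  show "surv (Suc n) \<le> surv n" for n using exp_ge_add_one_self[of "- surv n"] by (simp add: surv_Suc)
qed

lemma surv_tendsto: "surv \<longlonglongrightarrow> 0"
proof -
  have "\<forall>i. 0 \<le> surv i" using surv_pos less_imp_le by blast
  then obtain L where L: "surv \<longlonglongrightarrow> L" "\<forall>i. L \<le> surv i" using decseq_convergent[OF surv_decseq, of 0] by auto
  have "0 \<le> L" using LIMSEQ_le_const[OF L(1)] surv_pos less_imp_le by blast
  have "L \<le> 1" using L(2) surv_le_1 order_trans by blast
  have "(\<lambda>m. 1 - exp (- surv m)) \<longlonglongrightarrow> 1 - exp (- L)" by (intro tendsto_intros L)
  moreover have "(\<lambda>m. surv (Suc m)) \<longlonglongrightarrow> L" using L(1) by (rule LIMSEQ_Suc)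
  ultimately have e: "exp (- L) = 1 - L" using LIMSEQ_unique by (fastforce simp: surv_Suc)
  \<comment> \<open>The limit satisfies \<open>exp (- L) = 1 - L\<close>; squaring
    \<open>1 - L / 2 \<le> exp (- (L / 2))\<close> forces \<open>L = 0\<close>.\<close>
  have "(1 - L / 2)\<^sup>2 \<le> (exp (- (L / 2)))\<^sup>2"
    using exp_ge_add_one_self[of "- (L / 2)"] \<open>L \<le> 1\<close> by (intro power_mono) auto
  also have "\<dots> = exp (- L)" by (simp add: power2_eq_square flip: exp_add)
  finally have "L * L \<le> 0" using e by (simp add: power2_eq_square algebra_simps)
  then have "L = 0" by (metis mult_eq_0_iff order_antisym zero_le_square)
  then show ?thesis using L(1) by simp
qed

section \<open>Labelings of a finite tree in a Galton--Watson tree\<close>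

definition list_tree :: "nat list set \<Rightarrow> nat list sgraph" where
  "list_tree B = SGraph B {{u, u @ [k]} |u k. u @ [k] \<in> B}"

definition list_parent :: "nat list set \<Rightarrow> nat list \<Rightarrow> nat list" where
  "list_parent B u = (if u \<in> B then butlast u else u)"

definition prefix_closed :: "nat list set \<Rightarrow> bool" where
  "prefix_closed B \<longleftrightarrow> [] \<in> B \<and> (\<forall>u k. u @ [k] \<in> B \<longrightarrow> u \<in> B)"

lemma list_parent_tree:
  assumes B: "prefix_closed B"
  shows "parent_tree B (list_parent B) []"
proof unfold_locales
  show "list_parent B \<in> pforest B {[]}"
  proof (rule pforestI)
    fix v assume "v \<in> B"
    then have "leads (list_parent B) v []"
    proof (induction v rule: rev_induct)
      case (snoc k v)
      then have "leads (list_parent B) v []" using B by (auto simp: prefix_closed_def)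
      moreover have "list_parent B (v @ [k]) = v" using snoc by (simp add: list_parent_def)
      ultimately have "leads (list_parent B) v []" "list_parent B (v @ [k]) = v" by auto
      then show ?case using leads_step[of "list_parent B" "v @ [k]"] by simp
    qed simp
    then show "\<exists>s\<in>{[]}. leads (list_parent B) v s" by simp
    show "list_parent B v \<in> B" using \<open>v \<in> B\<close> B
      by (cases v rule: rev_cases) (auto simp: list_parent_def prefix_closed_def)
  qed (auto simp: list_parent_def)
qed (use B in \<open>simp add: prefix_closed_def\<close>)

lemma list_tree_ptree: "list_tree B = ptree B (list_parent B) []"
proof -
  have "{{u, u @ [k]} |u k. u @ [k] \<in> B} = {{v, list_parent B v} |v. v \<in> B - {[]}}"
  proof (intro equalityI subsetI)
    fix e assume "e \<in> {{u, u @ [k]} |u k. u @ [k] \<in> B}"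
    then obtain u k where "e = {u, u @ [k]}" "u @ [k] \<in> B" by auto
    then show "e \<in> {{v, list_parent B v} |v. v \<in> B - {[]}}"
      by (intro CollectI exI[of _ "u @ [k]"]) (auto simp: list_parent_def)
  next
    fix e assume "e \<in> {{v, list_parent B v} |v. v \<in> B - {[]}}"
    then obtain v where v: "e = {v, list_parent B v}" "v \<in> B" "v \<noteq> []" by auto
    then have "v = butlast v @ [last v]" by simp
    then show "e \<in> {{u, u @ [k]} |u k. u @ [k] \<in> B}"
      using v by (intro CollectI exI[of _ "butlast v"] exI[of _ "last v"]) (auto simp: list_parent_def)
  qed
  then show ?thesis by (simp add: list_tree_def ptree_def)
qed

lemma list_depth:
  assumes B: "prefix_closed B"
  shows "u \<in> B \<Longrightarrow> pdepth (list_parent B) {[]} u = length u"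
proof (induction u rule: rev_induct)
  case (snoc k u)
  interpret parent_tree B "list_parent B" "[]" by (rule list_parent_tree[OF B])
  have "list_parent B (u @ [k]) = u" using snoc by (simp add: list_parent_def)
  moreover have "u \<in> B" using snoc B by (auto simp: prefix_closed_def)
  ultimately show ?case using snoc dp_step[of "u @ [k]"] by simp
qed simp

abbreviation "gw_parent \<xi> \<equiv> list_parent (gwv \<xi>)"

lemma prefix_closed_gwv: "prefix_closed (gwv \<xi>)"
  by (simp add: prefix_closed_def gwv_snoc)

lemma gw_parent_tree: "parent_tree (gwv \<xi>) (gw_parent \<xi>) []"
  by (rule list_parent_tree[OF prefix_closed_gwv])

lemma gw_tree_ptree: "gw_tree \<xi> = ptree (gwv \<xi>) (gw_parent \<xi>) []"
  unfolding list_tree_ptree[symmetric] by (simp add: gw_tree_def list_tree_def gwv_def Let_def)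

lemma gw_depth: "u \<in> gwv \<xi> \<Longrightarrow> pdepth (gw_parent \<xi>) {[]} u = length u"
  by (rule list_depth[OF prefix_closed_gwv])

lemma gw_ball_verts: "verts (fst (gball (gw_tree \<xi>) [] r)) = {u \<in> gwv \<xi>. length u \<le> r}"
proof -
  interpret parent_tree "gwv \<xi>" "gw_parent \<xi>" "[]" by (rule gw_parent_tree)
  show ?thesis unfolding gw_tree_ptree ball_verts using gw_depth by auto
qed

lemma gw_ball_edge_iff:
  assumes "u \<in> gwv \<xi>" "v \<in> gwv \<xi>" "length u \<le> r" "length v \<le> r"
  shows "{u, v} \<in> edges (fst (gball (gw_tree \<xi>) [] r)) \<longleftrightarrow> (u \<noteq> [] \<and> v = butlast u) \<or> (v \<noteq> [] \<and> u = butlast v)"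
proof -
  interpret parent_tree "gwv \<xi>" "gw_parent \<xi>" "[]" by (rule gw_parent_tree)
  show ?thesis unfolding gw_tree_ptree ball_edge_iff using assms gw_depth by (auto simp: list_parent_def)
qed

lemma rlf_gw: "rlf (gw_tree \<xi>, [])"
proof -
  interpret parent_tree "gwv \<xi>" "gw_parent \<xi>" "[]" by (rule gw_parent_tree)
  have "finite (neighbours (gw_tree \<xi>) v)" if "v \<in> gwv \<xi>" for v
  proof (rule finite_subset)
    show "neighbours (gw_tree \<xi>) v \<subseteq> insert (butlast v) ((\<lambda>k. v @ [k]) ` {..<\<xi> v})"
    proof
      fix u assume "u \<in> neighbours (gw_tree \<xi>) v"
      then have "(u \<in> gwv \<xi> - {[]} \<and> v = gw_parent \<xi> u) \<or> (v \<in> gwv \<xi> - {[]} \<and> u = gw_parent \<xi> v)"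
        by (simp add: neighbours_def gw_tree_ptree ptree_edge_iff)
      then show "u \<in> insert (butlast v) ((\<lambda>k. v @ [k]) ` {..<\<xi> v})"
      proof
        assume u: "u \<in> gwv \<xi> - {[]} \<and> v = gw_parent \<xi> u"
        then have "u = v @ [last u]" by (auto simp: list_parent_def)
        moreover from this have "last u < \<xi> v" using u gwv_snoc by (metis DiffD1)
        ultimately show ?thesis by blast
      qed (auto simp: list_parent_def)
    qed
  qed simp
  then show ?thesis using simple connected by (auto simp: rlf_def locally_finite_def gw_tree_ptree)
qed

locale finite_tree = parent_tree W p \<rho> for W :: "'b set" and p \<rho> +
  fixes r :: nat
  assumes finW: "finite W" and height: "\<And>v. v \<in> W \<Longrightarrow> dp v \<le> r"
begin

definition "I = {v \<in> W. dp v < r}"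
definition "rim = {v \<in> W. dp v = r}"
definition "ch v = {w \<in> W - {\<rho>}. p w = v}"

text \<open>Candidate isomorphisms onto the ball of a Galton-Watson tree, described without the
  offspring numbers: the children of each inner vertex take the first \<open>card (ch v)\<close>
  birth ranks in some order.\<close>

definition labelings :: "('b \<Rightarrow> nat list) set" where
  "labelings = {\<phi> \<in> extensional W. \<phi> \<rho> = [] \<and>
     (\<forall>v\<in>I. bij_betw \<phi> (ch v) ((\<lambda>k. \<phi> v @ [k]) ` {..<card (ch v)}))}"

lemma finI: "finite I" and fin_rim: "finite rim" and fin_ch: "finite (ch v)"
  using finW by (auto simp: I_def rim_def ch_def)

lemma parent_I: "w \<in> W - {\<rho>} \<Longrightarrow> p w \<in> I \<and> w \<in> ch (p w)"
  using dp_step[of w] height[of w] p_V[of w] by (auto simp: I_def ch_def)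

lemma ch_W: "w \<in> ch v \<Longrightarrow> w \<in> W \<and> w \<noteq> \<rho> \<and> p w = v"
  by (auto simp: ch_def)

lemma tree_induct [consumes 1, case_names root child]:
  assumes "x \<in> W" "P \<rho>" "\<And>w. w \<in> W - {\<rho>} \<Longrightarrow> P (p w) \<Longrightarrow> P w"
  shows "P x"
  using p assms(1) by (induction rule: pforest_induct) (use assms in auto)

lemma labeling_step:
  assumes \<phi>: "\<phi> \<in> labelings" and w: "w \<in> W - {\<rho>}"
  shows "\<exists>k<card (ch (p w)). \<phi> w = \<phi> (p w) @ [k]"
proof -
  have "bij_betw \<phi> (ch (p w)) ((\<lambda>k. \<phi> (p w) @ [k]) ` {..<card (ch (p w))})"
    using \<phi> parent_I[OF w] by (auto simp: labelings_def)
  then have "\<phi> w \<in> (\<lambda>k. \<phi> (p w) @ [k]) ` {..<card (ch (p w))}"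
    using parent_I[OF w] by (auto simp: bij_betw_def)
  then show ?thesis by auto
qed

lemma labeling_length:
  assumes \<phi>: "\<phi> \<in> labelings" and w: "w \<in> W"
  shows "length (\<phi> w) = dp w"
  using w
proof (induction rule: tree_induct)
  case root
  then show ?case using \<phi> by (simp add: labelings_def)
next
  case (child w)
  then show ?case using labeling_step[OF \<phi> child(1)] dp_step[OF child(1)] by auto
qed

lemma labeling_butlast: "\<phi> \<in> labelings \<Longrightarrow> w \<in> W - {\<rho>} \<Longrightarrow> butlast (\<phi> w) = \<phi> (p w) \<and> \<phi> w \<noteq> []"
  using labeling_step by fastforce

lemma labeling_inj:
  assumes \<phi>: "\<phi> \<in> labelings"
  shows "inj_on \<phi> W"
proof (rule inj_onI)
  fix x y assume "x \<in> W" "y \<in> W" "\<phi> x = \<phi> y"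
  then show "x = y"
  proof (induction arbitrary: y rule: tree_induct)
    case root
    then show ?case using labeling_length[OF \<phi>, of y] \<phi> dp_0[of y] by (simp add: labelings_def)
  next
    case (child w)
    have y: "y \<noteq> \<rho>" using labeling_butlast[OF \<phi> child(1)] child \<phi> by (auto simp: labelings_def)
    then have "p w = p y"
      using child(2)[of "p y"] labeling_butlast[OF \<phi>] child p_V by (metis DiffI singletonD)
    moreover have "bij_betw \<phi> (ch (p w)) ((\<lambda>k. \<phi> (p w) @ [k]) ` {..<card (ch (p w))})"
      using \<phi> parent_I[OF child(1)] by (auto simp: labelings_def)
    ultimately show ?case
      using parent_I[OF child(1)] parent_I[of y] y child by (auto simp: bij_betw_def dest: inj_onD)
  qed
qed

text \<open>Separates the combinatorial part, a labeling, from an event that fixes finitely many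
  coordinates of \<open>\<xi>\<close>. Coordinates at the rim stay free, since the ball does not see
  the children there.\<close>

theorem isos_gw_iff:
  "\<phi> \<in> isos (ptree W p \<rho>, \<rho>) (gball (gw_tree \<xi>) [] r) \<longleftrightarrow> \<phi> \<in> labelings \<and> (\<forall>v\<in>I. \<xi> (\<phi> v) = card (ch v))"
proof
  let ?B = "fst (gball (gw_tree \<xi>) [] r)"
  assume a: "\<phi> \<in> isos (ptree W p \<rho>, \<rho>) (gball (gw_tree \<xi>) [] r)"
  then have ext: "\<phi> \<in> extensional W" and iso: "graph_iso \<phi> (ptree W p \<rho>) ?B" and r0: "\<phi> \<rho> = []"
    by (auto simp: isos_def)
  have b: "bij_betw \<phi> W {u \<in> gwv \<xi>. length u \<le> r}" using iso by (simp add: graph_iso_def gw_ball_verts)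
  then have inj: "inj_on \<phi> W" and im: "\<phi> ` W = {u \<in> gwv \<xi>. length u \<le> r}" by (auto simp: bij_betw_def)
  have mem: "\<phi> w \<in> gwv \<xi>" "length (\<phi> w) \<le> r" if "w \<in> W" for w using im that by auto
  \<comment> \<open>An edge from \<open>w\<close> to its parent could be mapped upside down only if
    \<open>w\<close> and \<open>p (p w)\<close> had the same image, which injectivity
    excludes.\<close>
  have bl: "(w \<noteq> \<rho> \<longrightarrow> butlast (\<phi> w) = \<phi> (p w) \<and> \<phi> w \<noteq> []) \<and> length (\<phi> w) = dp w" if "w \<in> W" for w
    using that
  proof (induction rule: tree_induct)
    case (child w)
    have pw: "p w \<in> W" using child(1) p_V by auto
    have "{w, p w} \<in> edges (ptree W p \<rho>)" using child(1) by (simp add: ptree_edge_iff)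
    then have "{\<phi> w, \<phi> (p w)} \<in> edges ?B" using iso child(1) pw by (auto simp: graph_iso_def)
    then have "(\<phi> w \<noteq> [] \<and> \<phi> (p w) = butlast (\<phi> w)) \<or> (\<phi> (p w) \<noteq> [] \<and> \<phi> w = butlast (\<phi> (p w)))"
      using gw_ball_edge_iff[OF mem(1) mem(1) mem(2) mem(2), of w "p w"] child(1) pw by auto
    then show ?case
    proof
      assume "\<phi> w \<noteq> [] \<and> \<phi> (p w) = butlast (\<phi> w)"
      then show ?thesis using child dp_step[OF child(1)] by (auto simp: length_greater_0_conv[symmetric] simp del: length_greater_0_conv)
    next
      assume c: "\<phi> (p w) \<noteq> [] \<and> \<phi> w = butlast (\<phi> (p w))"
      then have "p w \<noteq> \<rho>" using r0 by auto
      then have "\<phi> w = \<phi> (p (p w))" "p (p w) \<in> W" using child(2) c pw p_V by auto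
      then have "w = p (p w)" using inj child(1) by (auto dest: inj_onD)
      then show ?thesis using dp_step[OF child(1)] dp_step[of "p w"] \<open>p w \<noteq> \<rho>\<close> pw by auto
    qed
  qed (simp add: r0)
  have ch_im: "\<phi> ` ch v = (\<lambda>k. \<phi> v @ [k]) ` {..<\<xi> (\<phi> v)}" if v: "v \<in> I" for v
  proof (intro equalityI subsetI)
    fix u assume "u \<in> \<phi> ` ch v"
    then obtain w where w: "w \<in> W" "w \<noteq> \<rho>" "p w = v" "u = \<phi> w" using ch_W by auto
    then have "u = \<phi> v @ [last u]" using bl[OF w(1)] by (metis append_butlast_last_id)
    moreover from this have "last u < \<xi> (\<phi> v)" using mem(1)[OF w(1)] w(4) gwv_snoc by metis
    ultimately show "u \<in> (\<lambda>k. \<phi> v @ [k]) ` {..<\<xi> (\<phi> v)}" by blast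
  next
    fix u assume "u \<in> (\<lambda>k. \<phi> v @ [k]) ` {..<\<xi> (\<phi> v)}"
    then obtain k where k: "u = \<phi> v @ [k]" "k < \<xi> (\<phi> v)" by auto
    have vW: "v \<in> W" "dp v < r" using v by (auto simp: I_def)
    have "u \<in> gwv \<xi>" "length u \<le> r" using k mem[OF vW(1)] bl[OF vW(1)] vW(2) by (auto simp: gwv_snoc)
    then obtain w where w: "w \<in> W" "u = \<phi> w" using im by blast
    then have "w \<noteq> \<rho>" using r0 k by auto
    moreover have "butlast (\<phi> w) = \<phi> v" using w k by (metis butlast_snoc)
    ultimately have "\<phi> (p w) = \<phi> v" using bl[OF w(1)] by auto
    then have "p w = v" using inj vW p_V[OF w(1)] by (auto dest: inj_onD)
    moreover have "w \<noteq> \<rho>" using r0 k w by auto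
    ultimately show "u \<in> \<phi> ` ch v" using w by (auto simp: ch_def)
  qed
  have injc: "inj_on \<phi> (ch v)" for v by (rule inj_on_subset[OF inj]) (auto simp: ch_def)
  have cc: "\<xi> (\<phi> v) = card (ch v)" if v: "v \<in> I" for v
  proof -
    have "card (ch v) = card (\<phi> ` ch v)" using card_image[OF injc] by simp
    also have "\<dots> = \<xi> (\<phi> v)" unfolding ch_im[OF v] by (subst card_image) (auto simp: inj_on_def)
    finally show ?thesis by simp
  qed
  then have "\<phi> \<in> labelings"
    using ext r0 injc ch_im by (auto simp: labelings_def bij_betw_def)
  then show "\<phi> \<in> labelings \<and> (\<forall>v\<in>I. \<xi> (\<phi> v) = card (ch v))" using cc by blast
next
  let ?B = "fst (gball (gw_tree \<xi>) [] r)"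
  assume "\<phi> \<in> labelings \<and> (\<forall>v\<in>I. \<xi> (\<phi> v) = card (ch v))"
  then have \<phi>: "\<phi> \<in> labelings" and c: "\<And>v. v \<in> I \<Longrightarrow> \<xi> (\<phi> v) = card (ch v)" by auto
  have mem: "\<phi> w \<in> gwv \<xi>" if "w \<in> W" for w
    using that
  proof (induction rule: tree_induct)
    case root
    then show ?case using \<phi> by (simp add: labelings_def)
  next
    case (child w)
    then show ?case using labeling_step[OF \<phi> child(1)] c parent_I[OF child(1)] gwv_snoc by auto
  qed
  have len: "length (\<phi> w) \<le> r" if "w \<in> W" for w using labeling_length[OF \<phi> that] height[OF that] by simp
  have inj: "inj_on \<phi> W" by (rule labeling_inj[OF \<phi>])
  have onto: "u \<in> \<phi> ` W" if "u \<in> gwv \<xi>" "length u \<le> r" for u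
    using that
  proof (induction u rule: rev_induct)
    case Nil
    then show ?case using \<phi> root by (auto simp: labelings_def intro!: image_eqI[of _ _ \<rho>])
  next
    case (snoc k u)
    then obtain v where v: "v \<in> W" "u = \<phi> v" by (auto simp: gwv_snoc)
    then have "v \<in> I" using snoc labeling_length[OF \<phi> v(1)] by (simp add: I_def)
    then have "bij_betw \<phi> (ch v) ((\<lambda>k. \<phi> v @ [k]) ` {..<card (ch v)})" "k < card (ch v)"
      using \<phi> c[of v] snoc v by (auto simp: labelings_def gwv_snoc)
    then have "u @ [k] \<in> \<phi> ` ch v" using v by (auto simp: bij_betw_def)
    then show ?case by (auto simp: ch_def)
  qed
  have "{u, v} \<in> edges (ptree W p \<rho>) \<longleftrightarrow> {\<phi> u, \<phi> v} \<in> edges ?B" if uv: "u \<in> W" "v \<in> W" for u v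
  proof -
    have one: "(x \<in> W - {\<rho>} \<and> y = p x) \<longleftrightarrow> (\<phi> x \<noteq> [] \<and> \<phi> y = butlast (\<phi> x))" if "x \<in> W" "y \<in> W" for x y
    proof (cases "x = \<rho>")
      case True
      then show ?thesis using \<phi> by (simp add: labelings_def)
    next
      case False
      then have "butlast (\<phi> x) = \<phi> (p x)" "\<phi> x \<noteq> []" using labeling_butlast[OF \<phi>, of x] that by auto
      then show ?thesis using inj that p_V[OF that(1)] False by (auto dest: inj_onD)
    qed
    show ?thesis
      unfolding gw_ball_edge_iff[OF mem[OF uv(1)] mem[OF uv(2)] len[OF uv(1)] len[OF uv(2)]] ptree_edge_iff
      using one[OF uv] one[OF uv(2,1)] by blast
  qed
  moreover have "bij_betw \<phi> W (verts ?B)"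
    unfolding gw_ball_verts bij_betw_def using inj onto mem len by auto
  ultimately show "\<phi> \<in> isos (ptree W p \<rho>, \<rho>) (gball (gw_tree \<xi>) [] r)"
    using \<phi> by (auto simp: isos_def graph_iso_def labelings_def)
qed

text \<open>A labeling is determined by the birth ranks of the children of each inner vertex, which
  may be prescribed to be \<open>0\<close> for one child \<open>a v\<close> of each vertex \<open>v \<in> A\<close>.\<close>

definition ranks :: "'b set \<Rightarrow> ('b \<Rightarrow> 'b) \<Rightarrow> 'b \<Rightarrow> ('b \<Rightarrow> nat) set" where
  "ranks A a v = {\<sigma> \<in> extensional (ch v). bij_betw \<sigma> (ch v) {..<card (ch v)} \<and> (v \<in> A \<longrightarrow> \<sigma> (a v) = 0)}"

definition label_of :: "('b \<Rightarrow> 'b \<Rightarrow> nat) \<Rightarrow> 'b \<Rightarrow> nat list" where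
  "label_of s w = (if w \<in> W then rev (map (\<lambda>j. s ((p ^^ Suc j) w) ((p ^^ j) w)) [0..<dp w]) else undefined)"

lemma label_of_root: "label_of s \<rho> = []"
  using root by (simp add: label_of_def)

lemma label_of_step:
  assumes w: "w \<in> W - {\<rho>}"
  shows "label_of s w = label_of s (p w) @ [s (p w) w]"
proof -
  have "[0..<Suc n] = 0 # map Suc [0..<n]" for n by (simp add: map_Suc_upt upt_conv_Cons del: upt_Suc)
  then have "map (\<lambda>j. s ((p ^^ Suc j) w) ((p ^^ j) w)) [0..<dp w] = s (p w) w # map (\<lambda>j. s ((p ^^ Suc j) (p w)) ((p ^^ j) (p w))) [0..<dp (p w)]"
    unfolding dp_step[OF w] by (simp add: funpow_swap1 del: upt_Suc funpow.simps(2)) (simp add: funpow_swap1)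
  then show ?thesis using w p_V[of w] by (simp add: label_of_def)
qed

text \<open>One admissible rank function \<open>g\<close> is composed with the permutations of the
  free children, which are all except \<open>a v\<close> when \<open>v \<in> A\<close>.\<close>

lemma card_ranks:
  assumes a: "\<And>v. v \<in> A \<Longrightarrow> a v \<in> ch v"
  shows "card (ranks A a v) = fact (card (ch v) - of_bool (v \<in> A))"
proof -
  define D where "D = (if v \<in> A then ch v - {a v} else ch v)"
  have finD: "finite D" using fin_ch by (simp add: D_def)
  have cD: "card D = card (ch v) - of_bool (v \<in> A)"
    using a fin_ch by (auto simp: D_def)
  obtain g where g: "bij_betw g (ch v) {..<card (ch v)}" "v \<in> A \<longrightarrow> g (a v) = 0"
  proof -
    obtain h where h: "bij_betw h (ch v) {..<card (ch v)}"
      using ex_bij_betw_finite_nat[OF fin_ch[of v]] by (auto simp: atLeast0LessThan)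
    show thesis
    proof (cases "v \<in> A")
      case True
      have av: "a v \<in> ch v" using a True by blast
      then have c0: "0 < card (ch v)" using fin_ch card_gt_0_iff by blast
      have hv: "h (a v) < card (ch v)" using h av by (auto simp: bij_betw_def)
      have "bij_betw (Transposition.transpose 0 (h (a v))) {..<card (ch v)} {..<card (ch v)}"
        by (rule permutes_imp_bij[OF permutes_swap_id]) (use c0 hv in auto)
      then have "bij_betw (Transposition.transpose 0 (h (a v)) \<circ> h) (ch v) {..<card (ch v)}" using h by (rule bij_betw_trans[rotated])
      moreover have "(Transposition.transpose 0 (h (a v)) \<circ> h) (a v) = 0" by simp
      ultimately show ?thesis using that by blast
    next
      case False
      then show ?thesis using that h by blast
    qed
  qed
  have "bij_betw (\<lambda>s. restrict (g \<circ> s) (ch v)) {s. s permutes D} (ranks A a v)"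
  proof (rule bij_betwI')
    fix s t assume st: "s \<in> {s. s permutes D}" "t \<in> {s. s permutes D}"
    have DC: "D \<subseteq> ch v" by (auto simp: D_def)
    have pm: "s permutes ch v" "t permutes ch v" using st permutes_subset[OF _ DC] by auto
    show "(restrict (g \<circ> s) (ch v) = restrict (g \<circ> t) (ch v)) = (s = t)"
    proof
      assume eq: "restrict (g \<circ> s) (ch v) = restrict (g \<circ> t) (ch v)"
      show "s = t"
      proof
        fix x
        show "s x = t x"
        proof (cases "x \<in> ch v")
          case True
          then have "g (s x) = g (t x)" using fun_cong[OF eq, of x] by simp
          moreover have "s x \<in> ch v" "t x \<in> ch v" using True pm by (auto simp: permutes_in_image)
          ultimately show ?thesis using g(1) by (auto simp: bij_betw_def dest: inj_onD)
        next
          case False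
          then show ?thesis using pm by (simp add: permutes_not_in)
        qed
      qed
    qed simp
  next
    fix s assume s: "s \<in> {s. s permutes D}"
    have DC: "D \<subseteq> ch v" by (auto simp: D_def)
    have pm: "s permutes ch v" using s permutes_subset[OF _ DC] by auto
    have "bij_betw (g \<circ> s) (ch v) {..<card (ch v)}" by (rule bij_betw_trans[OF permutes_imp_bij[OF pm] g(1)])
    then have "bij_betw (restrict (g \<circ> s) (ch v)) (ch v) {..<card (ch v)}"
      by (subst bij_betw_cong[of "ch v" _ "g \<circ> s"]) auto
    moreover have "restrict (g \<circ> s) (ch v) (a v) = 0" if "v \<in> A"
    proof -
      have "s (a v) = a v" using s that by (intro permutes_not_in[of s D]) (auto simp: D_def)
      then show ?thesis using g(2) a that by simp
    qed
    ultimately show "restrict (g \<circ> s) (ch v) \<in> ranks A a v" by (simp add: ranks_def)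
  next
    fix \<sigma> assume "\<sigma> \<in> ranks A a v"
    then have \<sigma>: "\<sigma> \<in> extensional (ch v)" "bij_betw \<sigma> (ch v) {..<card (ch v)}" "v \<in> A \<Longrightarrow> \<sigma> (a v) = 0"
      by (auto simp: ranks_def)
    define s where "s x = (if x \<in> ch v then inv_into (ch v) g (\<sigma> x) else x)" for x
    have "bij_betw (inv_into (ch v) g \<circ> \<sigma>) (ch v) (ch v)"
      by (rule bij_betw_trans[OF \<sigma>(2) bij_betw_inv_into[OF g(1)]])
    then have "bij_betw s (ch v) (ch v)" by (subst bij_betw_cong[of "ch v" s "inv_into (ch v) g \<circ> \<sigma>"]) (auto simp: s_def)
    then have pm: "s permutes ch v" by (rule bij_imp_permutes) (simp add: s_def)
    have "s permutes D"
    proof (cases "v \<in> A")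
      case True
      have "s (a v) = a v"
        using a[OF True] \<sigma>(3)[OF True] g True by (simp add: s_def) (metis bij_betw_def inv_into_f_f)
      then have "\<forall>x. x \<notin> D \<longrightarrow> s x = x" using True by (auto simp: D_def s_def)
      moreover have "\<forall>y. \<exists>!x. s x = y" using pm by (simp add: permutes_def)
      ultimately show ?thesis by (simp add: permutes_def)
    next
      case False
      then show ?thesis using pm by (simp add: D_def)
    qed
    moreover have "\<sigma> = restrict (g \<circ> s) (ch v)"
    proof
      fix x
      show "\<sigma> x = restrict (g \<circ> s) (ch v) x"
      proof (cases "x \<in> ch v")
        case True
        then have "\<sigma> x \<in> {..<card (ch v)}" using \<sigma>(2) by (auto simp: bij_betw_def)
        then show ?thesis using True g(1) by (simp add: s_def bij_betw_inv_into_right)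
      next
        case False
        then show ?thesis using \<sigma>(1) by (simp add: extensional_def)
      qed
    qed
    ultimately show "\<exists>s\<in>{s. s permutes D}. \<sigma> = restrict (g \<circ> s) (ch v)" by blast
  qed
  then have "card (ranks A a v) = card {s. s permutes D}" by (rule bij_betw_same_card[symmetric])
  also have "\<dots> = fact (card D)" by (rule card_permutations[OF refl finD])
  finally show ?thesis by (simp add: cD)
qed

text \<open>Reading off last letters shows that a labeling amounts to independent choices of rank
  functions at the inner vertices.\<close>

theorem card_labelings:
  assumes A: "A \<subseteq> I" and a: "\<And>v. v \<in> A \<Longrightarrow> a v \<in> ch v"
  shows "card {\<phi> \<in> labelings. \<forall>v\<in>A. \<phi> (a v) = \<phi> v @ [0]} = (\<Prod>v\<in>I. fact (card (ch v) - of_bool (v \<in> A)))"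
proof -
  let ?L = "{\<phi> \<in> labelings. \<forall>v\<in>A. \<phi> (a v) = \<phi> v @ [0]}"
  have chW: "\<And>w v. w \<in> ch v \<Longrightarrow> w \<in> W - {\<rho>} \<and> p w = v" by (auto simp: ch_def)
  have "bij_betw label_of (Pi\<^sub>E I (ranks A a)) ?L"
  proof (rule bij_betwI')
    fix s t assume st: "s \<in> Pi\<^sub>E I (ranks A a)" "t \<in> Pi\<^sub>E I (ranks A a)"
    show "(label_of s = label_of t) = (s = t)"
    proof
      assume eq: "label_of s = label_of t"
      show "s = t"
      proof (rule PiE_ext[OF st])
        fix v assume v: "v \<in> I"
        have "s v \<in> extensional (ch v)" "t v \<in> extensional (ch v)"
          using st v by (auto simp: ranks_def dest!: PiE_mem)
        moreover have "s v w = t v w" if "w \<in> ch v" for w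
          using label_of_step[of w s] label_of_step[of w t] chW[OF that] eq by auto
        ultimately show "s v = t v" by (rule extensionalityI)
      qed
    qed simp
  next
    fix s assume s: "s \<in> Pi\<^sub>E I (ranks A a)"
    have step: "label_of s w = label_of s v @ [s v w]" if "w \<in> ch v" for v w
      using label_of_step[of w s] chW[OF that] by simp
    have "bij_betw (label_of s) (ch v) ((\<lambda>k. label_of s v @ [k]) ` {..<card (ch v)})" if v: "v \<in> I" for v
    proof -
      have b: "bij_betw (s v) (ch v) {..<card (ch v)}" using s v by (auto simp: ranks_def dest!: PiE_mem)
      have "bij_betw (\<lambda>k. label_of s v @ [k]) {..<card (ch v)} ((\<lambda>k. label_of s v @ [k]) ` {..<card (ch v)})"
        by (rule inj_on_imp_bij_betw) (auto simp: inj_on_def)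
      from bij_betw_trans[OF b this] show ?thesis
        by (subst bij_betw_cong[of "ch v" _ "(\<lambda>k. label_of s v @ [k]) \<circ> s v"]) (auto simp: step)
    qed
    moreover have "label_of s \<in> extensional W" by (simp add: extensional_def label_of_def)
    ultimately have "label_of s \<in> labelings" by (simp add: labelings_def label_of_root)
    moreover have "label_of s (a v) = label_of s v @ [0]" if "v \<in> A" for v
    proof -
      have "s v (a v) = 0" using s that A by (auto simp: ranks_def dest!: PiE_mem)
      then show ?thesis using step[OF a[OF that]] by simp
    qed
    ultimately show "label_of s \<in> ?L" by blast
  next
    fix \<phi> assume \<phi>: "\<phi> \<in> ?L"
    then have l: "\<phi> \<in> labelings" by simp
    define s where "s = (\<lambda>v\<in>I. \<lambda>w\<in>ch v. last (\<phi> w))"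
    have last: "\<phi> w = \<phi> v @ [last (\<phi> w)]" if "w \<in> ch v" for v w
      using labeling_step[OF l, of w] chW[OF that] by auto
    have "s v \<in> ranks A a v" if v: "v \<in> I" for v
    proof -
      have b: "bij_betw \<phi> (ch v) ((\<lambda>k. \<phi> v @ [k]) ` {..<card (ch v)})" using l v by (simp add: labelings_def)
      have "bij_betw last ((\<lambda>k. \<phi> v @ [k]) ` {..<card (ch v)}) {..<card (ch v)}"
        by (rule bij_betwI[where g = "\<lambda>k. \<phi> v @ [k]"]) auto
      from bij_betw_trans[OF b this]
      have "bij_betw (s v) (ch v) {..<card (ch v)}"
        by (subst bij_betw_cong[of "ch v" _ "last \<circ> \<phi>"]) (auto simp: s_def v)
      moreover have "s v (a v) = 0" if "v \<in> A" using \<phi> that a[OF that] v by (simp add: s_def)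
      ultimately show ?thesis using v by (simp add: ranks_def s_def)
    qed
    then have "s \<in> Pi\<^sub>E I (ranks A a)" by (auto simp: s_def)
    moreover have "\<phi> = label_of s"
    proof
      fix w
      show "\<phi> w = label_of s w"
      proof (cases "w \<in> W")
        case True
        then show ?thesis
        proof (induction rule: tree_induct)
          case root
          then show ?case using l by (simp add: label_of_root labelings_def)
        next
          case (child w)
          then have "s (p w) w = last (\<phi> w)" using parent_I[OF child(1)] by (simp add: s_def)
          then show ?case using label_of_step[OF child(1), of s] child(2) last[of w "p w"] parent_I[OF child(1)] by simp
        qed
      next
        case False
        then show ?thesis using l by (simp add: label_of_def labelings_def extensional_def)
      qed
    qed
    ultimately show "\<exists>s\<in>Pi\<^sub>E I (ranks A a). \<phi> = label_of s" by blast
  qed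
  then have "card ?L = card (Pi\<^sub>E I (ranks A a))" by (rule bij_betw_same_card[symmetric])
  also have "\<dots> = (\<Prod>v\<in>I. card (ranks A a v))" by (rule card_PiE[OF finI])
  also have "\<dots> = (\<Prod>v\<in>I. fact (card (ch v) - of_bool (v \<in> A)))" by (intro prod.cong refl card_ranks a)
  finally show ?thesis .
qed

end

section \<open>Classes of rooted graphs\<close>

lemma graph_iso_image:
  assumes f: "inj_on f (verts G)" and s: "simple_graph G"
  shows "graph_iso f G (graph_image f G)"
  unfolding graph_iso_def
proof (intro conjI ballI)
  show "bij_betw f (verts G) (verts (graph_image f G))" using f by (simp add: graph_image_def bij_betw_def)
  fix u v assume uv: "u \<in> verts G" "v \<in> verts G"
  show "({u, v} \<in> edges G) = ({f u, f v} \<in> edges (graph_image f G))"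
  proof
    assume "{u, v} \<in> edges G"
    then have "f ` {u, v} \<in> (`) f ` edges G" by (rule imageI)
    then show "{f u, f v} \<in> edges (graph_image f G)" by (simp add: graph_image_def)
  next
    assume "{f u, f v} \<in> edges (graph_image f G)"
    then obtain e where e: "e \<in> edges G" "f ` e = f ` {u, v}" by (auto simp: graph_image_def)
    have "e \<subseteq> verts G" using s e(1) by (auto simp: simple_graph_def)
    then have "e = {u, v}" using e(2) inj_on_image_eq_iff[OF f, of e "{u, v}"] uv by auto
    then show "{u, v} \<in> edges G" using e(1) by simp
  qed
qed

lemma rlf_image:
  assumes x: "rlf (G, \<rho>)" and f: "inj_on f (verts G)"
  shows "rlf (graph_image f G, f \<rho>)"
proof -
  have s: "simple_graph G" and c: "gconnected G" and r: "\<rho> \<in> verts G"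
    and lf: "\<And>v. v \<in> verts G \<Longrightarrow> finite (neighbours G v)"
    using x by (auto simp: rlf_def locally_finite_def)
  have iso: "graph_iso f G (graph_image f G)" by (rule graph_iso_image[OF f s])
  have "simple_graph (graph_image f G)"
    unfolding simple_graph_def
  proof
    fix e assume "e \<in> edges (graph_image f G)"
    then obtain e' where "e' \<in> edges G" "e = f ` e'" by (auto simp: graph_image_def)
    moreover from this obtain u v where "u \<in> verts G" "v \<in> verts G" "u \<noteq> v" "e' = {u, v}" using s by (auto simp: simple_graph_def)
    moreover from this have "f u \<noteq> f v" using f by (auto dest: inj_onD)
    ultimately show "\<exists>u\<in>verts (graph_image f G). \<exists>v\<in>verts (graph_image f G). u \<noteq> v \<and> e = {u, v}"
      by (auto simp: graph_image_def)
  qed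
  moreover have "gconnected (graph_image f G)"
    unfolding gconnected_def
  proof (intro conjI ballI)
    show "verts (graph_image f G) \<noteq> {}" using r by (auto simp: graph_image_def)
    fix u v assume "u \<in> verts (graph_image f G)" "v \<in> verts (graph_image f G)"
    then obtain a b where ab: "a \<in> verts G" "b \<in> verts G" "u = f a" "v = f b" by (auto simp: graph_image_def)
    then obtain n where "(a, b) \<in> adj G ^^ n" using c by (auto simp: gconnected_def rtrancl_power)
    then show "(u, v) \<in> (adj (graph_image f G))\<^sup>*"
      using iso_relpow[OF iso s ab(1)] ab relpow_imp_rtrancl by blast
  qed
  moreover have "finite (neighbours (graph_image f G) v)" if v: "v \<in> verts (graph_image f G)" for v
  proof -
    obtain a where a: "a \<in> verts G" "v = f a" using v by (auto simp: graph_image_def)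
    have "neighbours (graph_image f G) v \<subseteq> f ` neighbours G a"
    proof
      fix u assume "u \<in> neighbours (graph_image f G) v"
      then obtain e where e: "e \<in> edges G" "f ` e = {u, v}" by (auto simp: neighbours_def graph_image_def)
      then obtain b c where bc: "e = {b, c}" "b \<in> verts G" "c \<in> verts G" using s by (auto simp: simple_graph_def)
      have "(u = f b \<and> f c = f a) \<or> (u = f c \<and> f b = f a)" using e(2) a bc by (auto simp: doubleton_eq_iff)
      then show "u \<in> f ` neighbours G a"
        using e(1) bc a f by (auto simp: neighbours_def insert_commute dest!: inj_onD)
    qed
    then show ?thesis using lf[OF a(1)] finite_subset by blast
  qed
  ultimately show ?thesis using r by (auto simp: rlf_def locally_finite_def graph_image_def)
qed

lemma rlf_countable:
  assumes "rlf (G, \<rho>)"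
  shows "countable (verts G)"
proof -
  have "verts G \<subseteq> (\<Union>r. verts (fst (gball G \<rho> r)))"
  proof
    fix v assume "v \<in> verts G"
    moreover from this have "(\<rho>, v) \<in> (adj G)\<^sup>*" using assms by (auto simp: rlf_def gconnected_def)
    ultimately show "v \<in> (\<Union>r. verts (fst (gball G \<rho> r)))"
      by (auto simp: verts_gball gdist_le_iff rtrancl_power)
  qed
  moreover have "countable (\<Union>r. verts (fst (gball G \<rho> r)))"
    using finite_gball[OF assms] by (auto intro: countable_finite)
  ultimately show ?thesis by (rule countable_subset)
qed

definition code_of :: "'a rooted \<Rightarrow> nat rooted" where
  "code_of x = (graph_image (to_nat_on (verts (fst x))) (fst x), to_nat_on (verts (fst x)) (snd x))"

lemma rgraph_of_code: "rgraph_of x = abs_rgraph (code_of x)"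
  by (simp add: rgraph_of_def code_of_def Let_def)

lemma code_rlf:
  assumes "rlf x"
  shows "rlf (code_of x)" "rooted_iso x (code_of x)"
proof -
  have x: "rlf (fst x, snd x)" using assms by simp
  have inj: "inj_on (to_nat_on (verts (fst x))) (verts (fst x))"
    by (rule inj_on_to_nat_on[OF rlf_countable[OF x]])
  show "rlf (code_of x)" unfolding code_of_def by (rule rlf_image[OF x inj])
  show "rooted_iso x (code_of x)" unfolding rooted_iso_def code_of_def
    using graph_iso_image[OF inj] assms by (auto simp: rlf_def)
qed

lemma rgraph_of_eq_iff:
  assumes x: "rlf x" and y: "rlf y"
  shows "rgraph_of x = rgraph_of y \<longleftrightarrow> rooted_iso x y"
proof -
  have rx: "snd x \<in> verts (fst x)" and ry: "snd y \<in> verts (fst y)" using x y by (auto simp: rlf_def)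
  have cx: "rlf_iso (code_of x) (code_of x)" and cy: "rlf_iso (code_of y) (code_of y)"
    unfolding rlf_iso_def using code_rlf(1)[OF x] code_rlf(1)[OF y] rooted_iso_refl[of "code_of x"] rooted_iso_refl[of "code_of y"]
    by simp_all
  have "rgraph_of x = rgraph_of y \<longleftrightarrow> rlf_iso (code_of x) (code_of y)"
    using Quotient_rel[OF Quotient_rgraph, of "code_of x" "code_of y"] cx cy by (simp add: rgraph_of_code)
  also have "\<dots> \<longleftrightarrow> rooted_iso (code_of x) (code_of y)"
    unfolding rlf_iso_def using code_rlf(1)[OF x] code_rlf(1)[OF y] by simp
  also have "\<dots> \<longleftrightarrow> rooted_iso x y"
  proof -
    have "rooted_iso (code_of x) x" "rooted_iso (code_of y) y"
      using rooted_iso_sym[OF code_rlf(2)[OF x] rx] rooted_iso_sym[OF code_rlf(2)[OF y] ry] by simp_all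
    then show ?thesis
      using code_rlf(2)[OF x] code_rlf(2)[OF y] rooted_iso_trans[of x "code_of x" "code_of y"]
        rooted_iso_trans[of x "code_of y" y] rooted_iso_trans[of "code_of x" x y]
        rooted_iso_trans[of "code_of x" y "code_of y"] by argo
  qed
  finally show ?thesis .
qed

lemma rball_rgraph_of:
  assumes x: "rlf (G, \<rho>)"
  shows "rball r (rgraph_of (G, \<rho>)) = rgraph_of (gball G \<rho> r)"
proof -
  let ?c = "code_of (G, \<rho>)"
  have rc: "rlf ?c" and iso: "rooted_iso (G, \<rho>) ?c" using code_rlf[OF x] by auto
  have cc: "rlf_iso ?c ?c" unfolding rlf_iso_def using rc rooted_iso_refl[of ?c] by simp
  have rc': "rlf (fst ?c, snd ?c)" using rc by simp
  have bl: "rlf (gball (fst ?c) (snd ?c) r)" by (rule rlf_gball[OF rc'])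
  have br: "rlf (gball G \<rho> r)" by (rule rlf_gball[OF x])
  obtain f where f: "graph_iso f G (fst ?c)" "f \<rho> = snd ?c" using iso by (auto simp: rooted_iso_def)
  have "rooted_iso (gball G \<rho> r) (gball (fst ?c) (snd ?c) r)"
    unfolding rooted_iso_def using gball_iso[OF f] x rc f(2) by (auto simp: rlf_def)
  then have "rooted_iso (code_of (gball G \<rho> r)) (gball (fst ?c) (snd ?c) r)"
    using code_rlf(2)[OF br] rooted_iso_sym[of "gball G \<rho> r" "code_of (gball G \<rho> r)"] br rooted_iso_trans
    by (metis rlf_def)
  then have "rlf_iso (code_of (gball G \<rho> r)) (gball (fst ?c) (snd ?c) r)"
    using code_rlf(1)[OF br] bl by (simp add: rlf_iso_def)
  then have "abs_rgraph (code_of (gball G \<rho> r)) = abs_rgraph (gball (fst ?c) (snd ?c) r)"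
    using Quotient_rel_abs[OF Quotient_rgraph] by metis
  moreover have "rball r (abs_rgraph ?c) = abs_rgraph (gball (fst ?c) (snd ?c) r)"
    by (rule rball.abs_eq[OF cc])
  ultimately show ?thesis by (simp add: rgraph_of_code)
qed

text \<open>Being closer than \<open>(1 / 2) ^ r\<close> means agreement of the balls of radius
  \<open>r + 1\<close>, so openness can be expressed through \<open>rball\<close>.\<close>

lemma open_rgraph_iff: "open U \<longleftrightarrow> (\<forall>x\<in>U. \<exists>r. \<forall>y. rball r y = rball r x \<longrightarrow> y \<in> U)" for U :: "rgraph set"
proof
  assume U: "open U"
  show "\<forall>x\<in>U. \<exists>r. \<forall>y. rball r y = rball r x \<longrightarrow> y \<in> U"
  proof
    fix x assume "x \<in> U"
    then obtain e where e: "e > 0" "\<And>y. dist y x < e \<Longrightarrow> y \<in> U" using U by (auto simp: open_dist)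
    obtain r where r: "(1 / 2 :: real) ^ r < e" using real_arch_pow_inv[OF e(1), of "1 / 2"] by auto
    have "dist y x \<le> (1 / 2) ^ r" if "rball r y = rball r x" for y
    proof -
      have "enat r \<le> agree_radius y x" using that le_agree_radius by blast
      then show ?thesis by (cases "agree_radius y x") (auto simp: dist_rgraph_def intro: power_decreasing)
    qed
    then show "\<exists>r. \<forall>y. rball r y = rball r x \<longrightarrow> y \<in> U" using e(2) r by (meson le_less_trans)
  qed
next
  assume a: "\<forall>x\<in>U. \<exists>r. \<forall>y. rball r y = rball r x \<longrightarrow> y \<in> U"
  show "open U"
    unfolding open_dist
  proof
    fix x assume "x \<in> U"
    then obtain r where r: "\<And>y. rball r y = rball r x \<Longrightarrow> y \<in> U" using a by blast
    have "y \<in> U" if d: "dist y x < (1 / 2) ^ r" for y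
    proof -
      have "enat (Suc r) \<le> agree_radius y x"
      proof (cases "agree_radius y x")
        case (enat R)
        then have "(1 / 2 :: real) ^ R < (1 / 2) ^ r" using d by (simp add: dist_rgraph_def)
        then have "r < R" by (metis power_decreasing not_le zero_le_divide_1_iff zero_le_numeral half_bounded_equal less_eq_real_def
            divide_le_eq_1_pos one_le_numeral zero_less_numeral)
        then show ?thesis using enat by simp
      qed simp
      then have "rball (Suc r) y = rball (Suc r) x" using le_agree_radius[of "Suc r" y x] by simp
      then show ?thesis using agree_down[of "Suc r" y x r] r by simp
    qed
    then show "\<exists>e>0. \<forall>y. dist y x < e \<longrightarrow> y \<in> U" by (intro exI[of _ "(1 / 2) ^ r"]) auto
  qed
qed

lemma rball_continuous: "continuous_on UNIV (rball r)"
  unfolding continuous_on_open_vimage[OF open_UNIV]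
proof (intro allI impI)
  fix B :: "rgraph set" assume "open B"
  show "open (rball r -` B \<inter> UNIV)" unfolding open_rgraph_iff by (auto intro!: exI[of _ r])
qed

lemma measurable_rball [measurable]: "rball r \<in> borel_measurable borel"
  by (rule borel_measurable_continuous_onI[OF rball_continuous])

section \<open>Measurability of the ball maps\<close>

definition ball_set :: "nat \<Rightarrow> (nat list \<Rightarrow> nat) \<Rightarrow> nat list set" where
  "ball_set r \<xi> = {u \<in> gwv \<xi>. length u \<le> r}"

lemma gw_ball_list_tree: "gball (gw_tree \<xi>) [] r = (list_tree (ball_set r \<xi>), [])"
proof -
  interpret parent_tree "gwv \<xi>" "gw_parent \<xi>" "[]" by (rule gw_parent_tree)
  let ?D = "{v. gdist (gw_tree \<xi>) [] v \<le> enat r}"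
  have D: "v \<in> ?D \<longleftrightarrow> length v \<le> r" if "v \<in> gwv \<xi>" for v
    using gdist_le[OF that] gw_depth[OF that] by (simp add: gw_tree_ptree)
  have "{e \<in> edges (gw_tree \<xi>). e \<subseteq> ?D} = {{u, u @ [k]} |u k. u @ [k] \<in> ball_set r \<xi>}"
  proof (intro equalityI subsetI)
    fix e assume "e \<in> {e \<in> edges (gw_tree \<xi>). e \<subseteq> ?D}"
    then obtain u k where "e = {u, u @ [k]}" "u @ [k] \<in> gwv \<xi>" "u @ [k] \<in> ?D"
      by (auto simp: gw_tree_def Let_def gwv_def)
    then show "e \<in> {{u, u @ [k]} |u k. u @ [k] \<in> ball_set r \<xi>}" using D by (auto simp: ball_set_def)
  next
    fix e assume "e \<in> {{u, u @ [k]} |u k. u @ [k] \<in> ball_set r \<xi>}"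
    then obtain u k where e: "e = {u, u @ [k]}" "u @ [k] \<in> gwv \<xi>" "length (u @ [k]) \<le> r" by (auto simp: ball_set_def)
    then have "u \<in> gwv \<xi>" by (simp add: gwv_snoc)
    then show "e \<in> {e \<in> edges (gw_tree \<xi>). e \<subseteq> ?D}" using e D[of u] D[of "u @ [k]"]
      by (auto simp: gw_tree_def Let_def gwv_def)
  qed
  moreover have "gwv \<xi> \<inter> ?D = ball_set r \<xi>" using D by (auto simp: ball_set_def)
  ultimately show ?thesis by (simp add: gball_def induced_def list_tree_def)
qed

lemma finite_ball_set: "finite (ball_set r \<xi>)"
proof -
  have "finite (verts (fst (gball (gw_tree \<xi>) [] r)))" by (rule finite_gball[OF rlf_gw])
  then show ?thesis by (simp add: gw_ball_verts ball_set_def)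
qed

text \<open>There are only countably many finite sets of words, so it is enough to measure the
  fibres.\<close>

lemma measurable_ball_set: "ball_set r \<in> measurable poisson_offspring (count_space (Collect finite))"
proof (subst measurable_count_space_eq_countable)
  show "countable (Collect finite :: nat list set set)" by (rule countable_Collect_finite)
  have pr: "Measurable.pred poisson_offspring (\<lambda>\<xi>. \<forall>u. (u \<in> gwv \<xi> \<and> length u \<le> r) \<longleftrightarrow> u \<in> B)" for B
    by measurable
  have "ball_set r -` {B} \<inter> space poisson_offspring = {\<xi>. \<forall>u. (u \<in> gwv \<xi> \<and> length u \<le> r) \<longleftrightarrow> u \<in> B}" for B
    by (auto simp: ball_set_def)
  then show "ball_set r \<in> space poisson_offspring \<rightarrow> Collect finite \<and>
      (\<forall>a\<in>Collect finite. ball_set r -` {a} \<inter> space poisson_offspring \<in> sets poisson_offspring)"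
    using sets_gwv[OF pr] finite_ball_set by auto
qed

lemma measurable_gw_ball:
  "(\<lambda>\<xi>. rgraph_of (gball (gw_tree \<xi>) [] r)) \<in> measurable poisson_offspring (count_space UNIV)"
  unfolding gw_ball_list_tree
  by (rule measurable_compose[OF measurable_ball_set]) simp

text \<open>The preimage of an open set is a union over \<open>r\<close>: some ball already forces
  membership. The ball maps are measurable into \<open>count_space UNIV\<close>, so the sets
  \<open>?C r\<close> may be arbitrary.\<close>

lemma measurable_gw_tree: "(\<lambda>\<xi>. rgraph_of (gw_tree \<xi>, [])) \<in> borel_measurable poisson_offspring"
proof (rule borel_measurableI)
  fix U :: "rgraph set" assume U: "open U"
  let ?C = "\<lambda>r. {b. \<forall>y. rball r y = b \<longrightarrow> y \<in> U}"
  have "(\<lambda>\<xi>. rgraph_of (gw_tree \<xi>, [])) -` U = (\<Union>r. (\<lambda>\<xi>. rgraph_of (gball (gw_tree \<xi>) [] r)) -` ?C r)"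
  proof (intro equalityI subsetI)
    fix \<xi> assume "\<xi> \<in> (\<lambda>\<xi>. rgraph_of (gw_tree \<xi>, [])) -` U"
    then obtain r where "\<forall>y. rball r y = rball r (rgraph_of (gw_tree \<xi>, [])) \<longrightarrow> y \<in> U"
      using U unfolding open_rgraph_iff by auto
    then show "\<xi> \<in> (\<Union>r. (\<lambda>\<xi>. rgraph_of (gball (gw_tree \<xi>) [] r)) -` ?C r)"
      unfolding rball_rgraph_of[OF rlf_gw] by auto
  next
    fix \<xi> assume "\<xi> \<in> (\<Union>r. (\<lambda>\<xi>. rgraph_of (gball (gw_tree \<xi>) [] r)) -` ?C r)"
    then obtain r where "\<forall>y. rball r y = rgraph_of (gball (gw_tree \<xi>) [] r) \<longrightarrow> y \<in> U" by auto
    then show "\<xi> \<in> (\<lambda>\<xi>. rgraph_of (gw_tree \<xi>, [])) -` U" using rball_rgraph_of[OF rlf_gw] by auto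
  qed
  also have "\<dots> \<in> sets poisson_offspring"
  proof (rule sets.countable_UN, rule image_subsetI)
    fix r
    show "(\<lambda>\<xi>. rgraph_of (gball (gw_tree \<xi>) [] r)) -` ?C r \<in> sets poisson_offspring"
      using measurable_sets[OF measurable_gw_ball, of "?C r" r] by simp
  qed
  finally show "(\<lambda>\<xi>. rgraph_of (gw_tree \<xi>, [])) -` U \<inter> space poisson_offspring \<in> sets poisson_offspring" by simp
qed

text \<open>Kesten's tree. The size-biased Poisson(1) law is that of one plus a Poisson(1) variable, so
  it suffices to add a child to every vertex of the leftmost ray.\<close>

definition kesten :: "(nat list \<Rightarrow> nat) \<Rightarrow> nat list \<Rightarrow> nat" where
  "kesten \<xi> u = \<xi> u + of_bool (u = replicate (length u) 0)"

lemma measurable_kesten: "kesten \<in> measurable poisson_offspring poisson_offspring"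
proof -
  have "(\<lambda>\<xi>. kesten \<xi> u) \<in> measurable poisson_offspring (count_space UNIV)" for u
    unfolding kesten_def by measurable
  then show ?thesis
    by (subst (2) poisson_offspring_def) (rule measurable_PiM_single', auto)
qed

lemma kesten_ray: "replicate r 0 \<in> gwv (kesten \<xi>)"
proof (induction r)
  case (Suc r)
  have "kesten \<xi> (replicate r 0) > 0" by (simp add: kesten_def)
  then have "replicate r 0 @ [0] \<in> gwv (kesten \<xi>)" using Suc by (simp add: gwv_snoc)
  then show ?case by (simp add: replicate_append_same)
qed simp

section \<open>Ball probabilities of Galton--Watson trees\<close>

context finite_tree
begin

lemma card_labelings_all: "card labelings = (\<Prod>v\<in>I. fact (card (ch v)))"
  using card_labelings[of "{}"] by simp

lemma fin_labelings: "finite labelings"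
  using card_labelings_all by (intro card_ge_0_finite) (simp add: prod_pos)

lemma card_inner_rim: "card W = card I + card rim"
proof -
  have "W = I \<union> rim" "I \<inter> rim = {}" using height by (force simp: I_def rim_def)+
  then show ?thesis using card_Un_disjoint[OF finI fin_rim] by simp
qed

lemma sets_offspring:
  assumes X: "X \<in> measurable poisson_offspring poisson_offspring"
  shows "{\<xi>. \<forall>v\<in>I. X \<xi> (\<phi> v) = c v} \<in> sets poisson_offspring"
proof -
  have "(\<lambda>\<xi>. X \<xi> u) \<in> measurable poisson_offspring (count_space UNIV)" for u
    using measurable_compose[OF X measurable_coord] .
  then have "Measurable.pred poisson_offspring (\<lambda>\<xi>. \<forall>v\<in>I. X \<xi> (\<phi> v) = c v)"
    using finI by measurable
  then show ?thesis by (rule sets_gwv)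
qed

lemma isos_gw: "isos (ptree W p \<rho>, \<rho>) (gball (gw_tree \<xi>) [] r) = {\<phi> \<in> labelings. \<forall>v\<in>I. \<xi> (\<phi> v) = card (ch v)}"
  using isos_gw_iff by blast

lemma rooted_iso_gw_iff:
  "rooted_iso (ptree W p \<rho>, \<rho>) (gball (gw_tree \<xi>) [] r) \<longleftrightarrow> (\<exists>\<phi>\<in>labelings. \<forall>v\<in>I. \<xi> (\<phi> v) = card (ch v))"
  using isos_nonempty[of "(ptree W p \<rho>, \<rho>)" "gball (gw_tree \<xi>) [] r"] root unfolding isos_gw by simp blast

lemma sets_rooted_iso_gw:
  assumes X: "X \<in> measurable poisson_offspring poisson_offspring"
  shows "{\<xi>. rooted_iso (ptree W p \<rho>, \<rho>) (gball (gw_tree (X \<xi>)) [] r)} \<in> sets poisson_offspring"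
proof -
  have "{\<xi>. \<exists>\<phi>\<in>labelings. \<forall>v\<in>I. X \<xi> (\<phi> v) = card (ch v)} = (\<Union>\<phi>\<in>labelings. {\<xi>. \<forall>v\<in>I. X \<xi> (\<phi> v) = card (ch v)})"
    by auto
  also have "\<dots> \<in> sets poisson_offspring" using fin_labelings sets_offspring[OF X] by (intro sets.finite_UN) auto
  finally show ?thesis by (simp only: rooted_iso_gw_iff)
qed

text \<open>By \<open>card_isos\<close> the number of labelings compatible with
  \<open>X \<xi>\<close> is zero or the order of the stabiliser; integrating this number over
  \<open>E\<close> gives the identity. It serves the plain tree with survival as \<open>E\<close>,
  and Kesten's tree with \<open>X = kesten\<close>.\<close>

lemma sum_labelings:
  assumes X: "X \<in> measurable poisson_offspring poisson_offspring" and E: "E \<in> sets poisson_offspring"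
  shows "real (card (root_stab (ptree W p \<rho>, \<rho>))) *
      OP.prob ({\<xi>. rooted_iso (ptree W p \<rho>, \<rho>) (gball (gw_tree (X \<xi>)) [] r)} \<inter> E) =
    (\<Sum>\<phi>\<in>labelings. OP.prob ({\<xi>. \<forall>v\<in>I. X \<xi> (\<phi> v) = card (ch v)} \<inter> E))"
proof -
  let ?T = "(ptree W p \<rho>, \<rho>)"
  let ?s = "real (card (root_stab ?T))"
  define A where "A \<phi> = {\<xi>. \<forall>v\<in>I. X \<xi> (\<phi> v) = card (ch v)} \<inter> E" for \<phi> :: "'b \<Rightarrow> nat list"
  define B where "B = {\<xi>. rooted_iso ?T (gball (gw_tree (X \<xi>)) [] r)} \<inter> E"
  have A: "A \<phi> \<in> sets poisson_offspring" for \<phi>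
    unfolding A_def by (rule sets.Int[OF sets_offspring[OF X] E])
  have root': "snd ?T \<in> verts (fst ?T)" using root by simp
  have sB: "B \<in> sets poisson_offspring" unfolding B_def by (rule sets.Int[OF sets_rooted_iso_gw[OF X] E])
  have "(\<Sum>\<phi>\<in>labelings. indicator (A \<phi>) \<xi>) = ?s * indicator B \<xi>" for \<xi>
  proof -
    have "(\<Sum>\<phi>\<in>labelings. indicator (A \<phi>) \<xi> :: real) = real (card {\<phi> \<in> labelings. \<xi> \<in> A \<phi>})"
      using fin_labelings by (simp add: indicator_def sum.If_cases Int_def of_bool_def)
    also have "{\<phi> \<in> labelings. \<xi> \<in> A \<phi>} = (if \<xi> \<in> E then isos ?T (gball (gw_tree (X \<xi>)) [] r) else {})"
      unfolding isos_gw by (auto simp: A_def)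
    also have "real (card \<dots>) = ?s * indicator B \<xi>"
      using card_isos[OF root', of "gball (gw_tree (X \<xi>)) [] r"] isos_nonempty[OF root', of "gball (gw_tree (X \<xi>)) [] r"]
      by (cases "isos ?T (gball (gw_tree (X \<xi>)) [] r) = {}"; cases "\<xi> \<in> E") (simp_all add: B_def)
    finally show ?thesis .
  qed
  then have "(\<integral>\<xi>. (\<Sum>\<phi>\<in>labelings. indicator (A \<phi>) \<xi>) \<partial>poisson_offspring) = (\<integral>\<xi>. ?s * indicator B \<xi> \<partial>poisson_offspring)"
    by simp
  moreover have "(\<integral>\<xi>. (\<Sum>\<phi>\<in>labelings. indicator (A \<phi>) \<xi>) \<partial>poisson_offspring) = (\<Sum>\<phi>\<in>labelings. OP.prob (A \<phi>))"
    using A by (subst Bochner_Integration.integral_sum) (auto intro!: integrable_real_indicator simp: OP.emeasure_eq_measure)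
  moreover have "(\<integral>\<xi>. ?s * indicator B \<xi> \<partial>poisson_offspring) = ?s * OP.prob B"
    using sB by simp
  ultimately show ?thesis by (simp add: A_def B_def)
qed

lemma prob_labeling:
  assumes \<phi>: "\<phi> \<in> labelings"
  shows "OP.prob {\<xi>. \<forall>v\<in>I. \<xi> (\<phi> v) = c v} = (\<Prod>v\<in>I. pois (c v))"
proof -
  have inj: "inj_on \<phi> I" using labeling_inj[OF \<phi>] by (rule inj_on_subset) (auto simp: I_def)
  let ?c = "\<lambda>u. c (inv_into I \<phi> u)"
  have "{\<xi>. \<forall>v\<in>I. \<xi> (\<phi> v) = c v} = {\<xi>. \<forall>u\<in>\<phi> ` I. \<xi> u = ?c u}" using inj by auto
  then have "OP.prob {\<xi>. \<forall>v\<in>I. \<xi> (\<phi> v) = c v} = (\<Prod>u\<in>\<phi> ` I. pois (?c u))"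
    using prob_coords[of "\<phi> ` I" ?c] finI by simp
  also have "\<dots> = (\<Prod>v\<in>I. pois (c v))" by (subst prod.reindex[OF inj]) (auto simp: inj intro!: prod.cong)
  finally show ?thesis .
qed

lemma labeling_ball:
  assumes "\<phi> \<in> labelings" "\<forall>v\<in>I. \<xi> (\<phi> v) = card (ch v)"
  shows "\<phi> ` W = {u \<in> gwv \<xi>. length u \<le> r}"
proof -
  have "\<phi> \<in> isos (ptree W p \<rho>, \<rho>) (gball (gw_tree \<xi>) [] r)" using isos_gw_iff assms by blast
  then have "bij_betw \<phi> W (verts (fst (gball (gw_tree \<xi>) [] r)))" unfolding isos_def graph_iso_def by simp
  then show ?thesis unfolding gw_ball_verts bij_betw_def by blast
qed

lemma labeling_rim:
  assumes "\<phi> \<in> labelings" "\<forall>v\<in>I. \<xi> (\<phi> v) = card (ch v)"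
  shows "\<phi> ` rim = {u \<in> gwv \<xi>. length u = r}"
proof -
  have "\<phi> ` rim = {u \<in> \<phi> ` W. length u = r}" using labeling_length[OF assms(1)] by (auto simp: rim_def)
  also have "\<dots> = {u \<in> gwv \<xi>. length u = r}" unfolding labeling_ball[OF assms] by auto
  finally show ?thesis .
qed

text \<open>Given the ball, survival up to \<open>M\<close> means that the tree below some rim
  vertex survives \<open>M - r\<close> generations; the complementary event is computed by
  \<open>prob_branching\<close>.\<close>

lemma prob_labeling_survives:
  assumes \<phi>: "\<phi> \<in> labelings" and M: "r \<le> M"
  shows "OP.prob ({\<xi>. \<forall>v\<in>I. \<xi> (\<phi> v) = card (ch v)} \<inter> survives M) =
    (\<Prod>v\<in>I. pois (card (ch v))) * (1 - (1 - surv (M - r)) ^ card rim)"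
proof -
  let ?A = "- survives (M - r)"
  have A: "?A \<in> sets poisson_offspring"
    using sets.compl_sets[OF sets_survives[of "M - r"]] by (simp add: Compl_eq_Diff_UNIV)
  have pA: "OP.prob ?A = 1 - surv (M - r)"
    using OP.prob_compl[OF sets_survives[of "M - r"]] by (simp add: surv_def Compl_eq_Diff_UNIV)
  have injW: "inj_on \<phi> W" by (rule labeling_inj[OF \<phi>])
  have inj: "inj_on \<phi> I" "inj_on \<phi> rim" using inj_on_subset[OF injW] by (auto simp: I_def rim_def)
  let ?c = "\<lambda>u. card (ch (inv_into I \<phi> u))"
  let ?X = "{\<xi>. \<forall>v\<in>I. \<xi> (\<phi> v) = card (ch v)}"
  let ?Y = "{\<xi>. (\<forall>u\<in>\<phi> ` I. \<xi> u = ?c u) \<and> (\<forall>l\<in>\<phi> ` rim. shift l \<xi> \<in> ?A)}"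
  have len: "length (\<phi> v) < r" if "v \<in> I" for v using labeling_length[OF \<phi>, of v] that by (simp add: I_def)
  have lr: "length (\<phi> v) = r" if "v \<in> rim" for v using labeling_length[OF \<phi>, of v] that by (simp add: rim_def)
  have pY: "OP.prob ?Y = (\<Prod>u\<in>\<phi> ` I. pois (?c u)) * OP.prob ?A ^ card (\<phi> ` rim)"
  proof (rule prob_branching[OF _ _ A])
    fix l u assume l: "l \<in> \<phi> ` rim"
    show "l @ u \<notin> \<phi> ` I"
    proof
      assume "l @ u \<in> \<phi> ` I"
      then have "length (l @ u) < r" using len by force
      then show False using l lr by auto
    qed
  next
    fix l l' u u' assume "l \<in> \<phi> ` rim" "l' \<in> \<phi> ` rim" "l @ u = l' @ u'"
    then show "l = l'" using lr by (metis append_eq_append_conv imageE)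
  qed (use finI fin_rim in auto)
  also have "(\<Prod>u\<in>\<phi> ` I. pois (?c u)) = (\<Prod>v\<in>I. pois (card (ch v)))"
    by (subst prod.reindex[OF inj(1)]) (auto simp: inj intro!: prod.cong)
  also have "OP.prob ?A ^ card (\<phi> ` rim) = (1 - surv (M - r)) ^ card rim"
    using card_image[OF inj(2)] pA by simp
  finally have pY: "OP.prob ?Y = (\<Prod>v\<in>I. pois (card (ch v))) * (1 - surv (M - r)) ^ card rim" .
  have X: "{\<xi>. \<forall>u\<in>\<phi> ` I. \<xi> u = ?c u} = ?X" using inj by auto
  have surv: "\<xi> \<in> survives M \<longleftrightarrow> (\<exists>l\<in>\<phi> ` rim. shift l \<xi> \<in> survives (M - r))" if x: "\<xi> \<in> ?X" for \<xi>
  proof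
    have im: "\<phi> ` rim = {u \<in> gwv \<xi>. length u = r}" using labeling_rim[OF \<phi>] x by simp
    assume "\<xi> \<in> survives M"
    then obtain u where u: "u \<in> gwv \<xi>" "length u = M" by (auto simp: survives_def)
    then have "take r u \<in> gwv \<xi>" "drop r u \<in> gwv (shift (take r u) \<xi>)"
      using gwv_append[of "take r u" "drop r u" \<xi>] by auto
    then show "\<exists>l\<in>\<phi> ` rim. shift l \<xi> \<in> survives (M - r)"
      unfolding im using u M by (intro bexI[of _ "take r u"]) (auto simp: survives_def intro!: bexI[of _ "drop r u"])
  next
    have im: "\<phi> ` rim = {u \<in> gwv \<xi>. length u = r}" using labeling_rim[OF \<phi>] x by simp
    assume "\<exists>l\<in>\<phi> ` rim. shift l \<xi> \<in> survives (M - r)"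
    then obtain l u where "l \<in> gwv \<xi>" "length l = r" "u \<in> gwv (shift l \<xi>)" "length u = M - r"
      unfolding im by (auto simp: survives_def)
    then show "\<xi> \<in> survives M" using M by (auto simp: survives_def gwv_append intro!: bexI[of _ "l @ u"])
  qed
  have "?Y = ?X - survives M"
  proof (rule set_eqI)
    fix \<xi>
    have "\<xi> \<in> ?Y \<longleftrightarrow> \<xi> \<in> {\<xi>. \<forall>u\<in>\<phi> ` I. \<xi> u = ?c u} \<and> \<not> (\<exists>l\<in>\<phi> ` rim. shift l \<xi> \<in> survives (M - r))"
      unfolding mem_Collect_eq Compl_iff by blast
    also have "\<dots> \<longleftrightarrow> \<xi> \<in> ?X \<and> \<xi> \<notin> survives M" unfolding X using surv[of \<xi>] by blast
    finally show "\<xi> \<in> ?Y \<longleftrightarrow> \<xi> \<in> ?X - survives M" by (simp only: Diff_iff)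
  qed
  moreover have "OP.prob (?X - survives M) = OP.prob ?X - OP.prob (?X \<inter> survives M)"
  proof -
    have "?X \<in> sets poisson_offspring" using sets_offspring[of "\<lambda>\<xi>. \<xi>" \<phi> "\<lambda>v. card (ch v)"] by simp
    then have "OP.prob (?X - ?X \<inter> survives M) = OP.prob ?X - OP.prob (?X \<inter> survives M)"
      using sets_survives by (intro OP.finite_measure_Diff) auto
    then show ?thesis by (simp add: Diff_Int_distrib Diff_Int)
  qed
  ultimately have "OP.prob (?X \<inter> survives M) = OP.prob ?X - OP.prob ?Y" by simp
  then show ?thesis using pY prob_labeling[OF \<phi>, of "\<lambda>v. card (ch v)"] by (simp add: algebra_simps)
qed

text \<open>\<open>fact n * pois n = exp (- 1)\<close> for every \<open>n\<close>: the number of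
  labelings cancels the factorials of the Poisson weights, and only the number of inner vertices
  remains.\<close>

lemma prod_fact_pois: "real (\<Prod>v\<in>I. fact (n v)) * (\<Prod>v\<in>I. pois (n v)) = exp (- real (card I))"
proof -
  have "real (\<Prod>v\<in>I. fact (n v)) * (\<Prod>v\<in>I. pois (n v)) = (\<Prod>v\<in>I. exp (-1))"
    unfolding of_nat_prod prod.distrib[symmetric] by (intro prod.cong) auto
  also have "\<dots> = exp (- real (card I))" by (simp flip: exp_of_nat_mult)
  finally show ?thesis .
qed

theorem prob_gw_survives:
  assumes M: "r \<le> M"
  shows "real (card (root_stab (ptree W p \<rho>, \<rho>))) *
      OP.prob ({\<xi>. rooted_iso (ptree W p \<rho>, \<rho>) (gball (gw_tree \<xi>) [] r)} \<inter> survives M) =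
    exp (- real (card I)) * (1 - (1 - surv (M - r)) ^ card rim)"
proof -
  have "real (card (root_stab (ptree W p \<rho>, \<rho>))) *
      OP.prob ({\<xi>. rooted_iso (ptree W p \<rho>, \<rho>) (gball (gw_tree \<xi>) [] r)} \<inter> survives M) =
    (\<Sum>\<phi>\<in>labelings. (\<Prod>v\<in>I. pois (card (ch v))) * (1 - (1 - surv (M - r)) ^ card rim))"
    using sum_labelings[of "\<lambda>\<xi>. \<xi>" "survives M"] prob_labeling_survives[OF _ M] by simp
  also have "\<dots> = (real (card labelings) * (\<Prod>v\<in>I. pois (card (ch v)))) * (1 - (1 - surv (M - r)) ^ card rim)"
    by (simp only: sum_constant mult.assoc)
  finally show ?thesis unfolding card_labelings_all prod_fact_pois .
qed

lemma labeling_iter: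
  assumes \<phi>: "\<phi> \<in> labelings" and l: "l \<in> rim" and j: "j \<le> r"
  shows "(p ^^ j) l \<in> W \<and> dp ((p ^^ j) l) = r - j \<and> \<phi> ((p ^^ j) l) = take (r - j) (\<phi> l)"
  using j
proof (induction j)
  case 0
  then show ?case using l labeling_length[OF \<phi>, of l] by (simp add: rim_def)
next
  case (Suc j)
  let ?v = "(p ^^ j) l"
  have v: "?v \<in> W" "dp ?v = r - j" "\<phi> ?v = take (r - j) (\<phi> l)" using Suc by auto
  have "?v \<noteq> \<rho>"
  proof
    assume "?v = \<rho>"
    then have "dp ?v = 0" by (simp only: dp_root)
    then show False using v(2) Suc.prems by linarith
  qed
  then have v': "?v \<in> W - {\<rho>}" using v(1) by blast
  have "dp (p ?v) = r - Suc j" using dp_step[OF v'] v(2) by linarith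
  moreover have "\<phi> (p ?v) = take (r - Suc j) (\<phi> l)"
    using labeling_butlast[OF \<phi> v'] v(3) labeling_length[OF \<phi>, of l] l by (simp add: butlast_take rim_def)
  ultimately show ?case using p_V[OF v(1)] by simp
qed

text \<open>The ray word must label exactly one rim vertex \<open>l\<close>. Along the path to
  \<open>l\<close> the child on the path has rank zero, which leaves \<open>fact (n - 1)\<close>
  orders for \<open>n\<close> children, and \<open>kesten\<close> supplies one extra child, which
  leaves the weight \<open>pois (n - 1)\<close>. So \<open>prod_fact_pois\<close> still applies, and
  each \<open>l\<close> contributes \<open>exp (- card I)\<close>.\<close>

theorem prob_kesten:
  "real (card (root_stab (ptree W p \<rho>, \<rho>))) *
      OP.prob {\<xi>. rooted_iso (ptree W p \<rho>, \<rho>) (gball (gw_tree (kesten \<xi>)) [] r)} =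
    real (card rim) * exp (- real (card I))"
proof -
  define A where "A \<phi> = {\<xi>. \<forall>v\<in>I. kesten \<xi> (\<phi> v) = card (ch v)}" for \<phi>
  define L where "L l = {\<phi> \<in> labelings. \<phi> l = replicate r 0}" for l
  have "A \<phi> = {}" if \<phi>: "\<phi> \<in> labelings" and n: "\<forall>l\<in>rim. \<phi> l \<noteq> replicate r 0" for \<phi>
  proof (rule ccontr)
    assume "A \<phi> \<noteq> {}"
    then obtain \<xi> where "\<forall>v\<in>I. kesten \<xi> (\<phi> v) = card (ch v)" by (auto simp: A_def)
    from labeling_rim[OF \<phi> this] have "replicate r 0 \<in> \<phi> ` rim" using kesten_ray by simp
    then show False using n by auto
  qed
  then have "(\<Sum>\<phi>\<in>labelings. OP.prob (A \<phi>)) = (\<Sum>\<phi>\<in>(\<Union>l\<in>rim. L l). OP.prob (A \<phi>))"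
    using fin_labelings by (intro sum.mono_neutral_right) (auto simp: L_def)
  also have "\<dots> = (\<Sum>l\<in>rim. \<Sum>\<phi>\<in>L l. OP.prob (A \<phi>))"
  proof (rule sum.UNION_disjoint[OF fin_rim])
    show "\<forall>l\<in>rim. finite (L l)" using fin_labelings by (simp add: L_def)
    show "\<forall>l\<in>rim. \<forall>l'\<in>rim. l \<noteq> l' \<longrightarrow> L l \<inter> L l' = {}"
    proof (intro ballI impI equals0I)
      fix l l' \<phi> assume ll: "l \<in> rim" "l' \<in> rim" "l \<noteq> l'" "\<phi> \<in> L l \<inter> L l'"
      then have "\<phi> l = \<phi> l'" "\<phi> \<in> labelings" by (auto simp: L_def)
      then show False using labeling_inj[of \<phi>] ll by (auto simp: rim_def dest: inj_onD)
    qed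
  qed
  also have "\<dots> = (\<Sum>l\<in>rim. exp (- real (card I)))"
  proof (rule sum.cong[OF refl])
    fix l assume l: "l \<in> rim"
    define A\<^sub>l where "A\<^sub>l = {v \<in> I. v = (p ^^ (r - dp v)) l}"
    \<comment> \<open>For \<open>v\<close> on the path from the root to \<open>l\<close>, this is
      the next vertex on that path.\<close>
    define a where "a v = (p ^^ (r - Suc (dp v))) l" for v
    have iter: "(p ^^ j) l \<in> W \<and> dp ((p ^^ j) l) = r - j" if "j \<le> r" for j
    proof -
      have "card labelings > 0" using card_labelings_all by (simp add: prod_pos)
      then obtain \<phi> where "\<phi> \<in> labelings" by (auto simp: card_gt_0_iff)
      then show ?thesis using labeling_iter[OF _ l that] by blast
    qed
    have a: "a v \<in> ch v" if "v \<in> A\<^sub>l" for v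
    proof -
      have v: "v = (p ^^ (r - dp v)) l" "dp v < r" using that by (auto simp: A\<^sub>l_def I_def)
      have "r - dp v = Suc (r - Suc (dp v))" using v(2) by simp
      then have "p (a v) = v" using v(1) by (metis a_def funpow.simps(2) comp_apply)
      moreover have "a v \<in> W" "dp (a v) = Suc (dp v)" using iter[of "r - Suc (dp v)"] v(2) by (auto simp: a_def)
      ultimately show ?thesis using dp_root by (auto simp: ch_def)
    qed
    have L: "L l = {\<phi> \<in> labelings. \<forall>v\<in>A\<^sub>l. \<phi> (a v) = \<phi> v @ [0]}"
    proof (intro equalityI subsetI)
      fix \<phi> assume "\<phi> \<in> L l"
      then have \<phi>: "\<phi> \<in> labelings" "\<phi> l = replicate r 0" by (auto simp: L_def)
      have "\<phi> (a v) = \<phi> v @ [0]" if "v \<in> A\<^sub>l" for v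
      proof -
        have v: "v = (p ^^ (r - dp v)) l" "dp v < r" using that by (auto simp: A\<^sub>l_def I_def)
        have "\<phi> (a v) = take (Suc (dp v)) (\<phi> l)"
          using labeling_iter[OF \<phi>(1) l, of "r - Suc (dp v)"] v(2) by (simp add: a_def)
        moreover have "\<phi> v = take (dp v) (\<phi> l)"
          using labeling_iter[OF \<phi>(1) l, of "r - dp v"] v by simp
        ultimately show ?thesis using v(2) \<phi>(2) by (simp add: min_def replicate_append_same del: replicate_Suc) simp
      qed
      then show "\<phi> \<in> {\<phi> \<in> labelings. \<forall>v\<in>A\<^sub>l. \<phi> (a v) = \<phi> v @ [0]}" using \<phi> by blast
    next
      fix \<phi> assume "\<phi> \<in> {\<phi> \<in> labelings. \<forall>v\<in>A\<^sub>l. \<phi> (a v) = \<phi> v @ [0]}"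
      then have \<phi>: "\<phi> \<in> labelings" and st: "\<And>v. v \<in> A\<^sub>l \<Longrightarrow> \<phi> (a v) = \<phi> v @ [0]" by auto
      have "j \<le> r \<Longrightarrow> \<phi> ((p ^^ (r - j)) l) = replicate j 0" for j
      proof (induction j)
        case 0
        have W: "(p ^^ r) l \<in> W" and d0: "dp ((p ^^ r) l) = 0" using iter[OF order_refl] by simp_all
        have "(p ^^ r) l = \<rho>" by (rule iffD1[OF dp_0[OF W] d0])
        then show ?case using \<phi> unfolding labelings_def by simp
      next
        case (Suc j)
        let ?v = "(p ^^ (r - j)) l"
        have d: "?v \<in> W" "dp ?v = j" using iter[of "r - j"] Suc.prems by auto
        then have "?v \<in> A\<^sub>l" using Suc.prems by (simp add: A\<^sub>l_def I_def)
        then have "\<phi> (a ?v) = \<phi> ?v @ [0]" by (rule st)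
        then show ?case using Suc d by (simp add: a_def replicate_append_same)
      qed
      from this[of r] show "\<phi> \<in> L l" using \<phi> by (simp add: L_def)
    qed
    let ?n = "\<lambda>v. card (ch v) - of_bool (v \<in> A\<^sub>l)"
    have pA: "OP.prob (A \<phi>) = (\<Prod>v\<in>I. pois (?n v))" if "\<phi> \<in> L l" for \<phi>
    proof -
      have \<phi>: "\<phi> \<in> labelings" "\<phi> l = replicate r 0" using that by (auto simp: L_def)
      have "kesten \<xi> (\<phi> v) = card (ch v) \<longleftrightarrow> \<xi> (\<phi> v) = ?n v" if v: "v \<in> I" for v \<xi>
      proof -
        have vW: "v \<in> W" "dp v < r" using v by (auto simp: I_def)
        have it: "\<phi> ((p ^^ (r - dp v)) l) = replicate (dp v) 0" "(p ^^ (r - dp v)) l \<in> W"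
          using labeling_iter[OF \<phi>(1) l, of "r - dp v"] vW(2) \<phi>(2) by (auto simp: min_def)
        have "\<phi> v = replicate (length (\<phi> v)) 0 \<longleftrightarrow> \<phi> v = \<phi> ((p ^^ (r - dp v)) l)"
          using it labeling_length[OF \<phi>(1) vW(1)] by simp
        also have "\<dots> \<longleftrightarrow> v = (p ^^ (r - dp v)) l"
          by (rule inj_on_eq_iff[OF labeling_inj[OF \<phi>(1)] vW(1) it(2)])
        finally have e: "\<phi> v = replicate (length (\<phi> v)) 0 \<longleftrightarrow> v \<in> A\<^sub>l" using v unfolding A\<^sub>l_def by blast
        show ?thesis
        proof (cases "v \<in> A\<^sub>l")
          case True
          then have "card (ch v) > 0" using a[OF True] fin_ch card_gt_0_iff by blast
          then show ?thesis using True e by (simp add: kesten_def) linarith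
        next
          case False
          then show ?thesis using e by (simp add: kesten_def)
        qed
      qed
      then have "A \<phi> = {\<xi>. \<forall>v\<in>I. \<xi> (\<phi> v) = ?n v}" unfolding A_def by blast
      then show ?thesis using prob_labeling[OF \<phi>(1), of ?n] by simp
    qed
    have "(\<Sum>\<phi>\<in>L l. OP.prob (A \<phi>)) = real (card (L l)) * (\<Prod>v\<in>I. pois (?n v))" using pA by simp
    also have "card (L l) = (\<Prod>v\<in>I. fact (?n v))"
    proof -
      have "A\<^sub>l \<subseteq> I" unfolding A\<^sub>l_def by blast
      then show ?thesis unfolding L by (rule card_labelings[OF _ a])
    qed
    finally show "(\<Sum>\<phi>\<in>L l. OP.prob (A \<phi>)) = exp (- real (card I))" using prod_fact_pois[of ?n] by simp
  qed
  finally show ?thesis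
    using sum_labelings[OF measurable_kesten, of UNIV] sets.top[of poisson_offspring] by (simp add: A_def)
qed

lemma stab_pos: "card (root_stab (ptree W p \<rho>, \<rho>)) > 0"
proof -
  have "root_stab (ptree W p \<rho>, \<rho>) \<subseteq> {f. f permutes W}" by (intro subsetI) (simp add: root_stab_def)
  then have "finite (root_stab (ptree W p \<rho>, \<rho>))" using finite_permutations[OF finW] finite_subset by blast
  moreover have "id \<in> root_stab (ptree W p \<rho>, \<rho>)" by (auto simp: root_stab_def graph_iso_def permutes_id)
  ultimately show ?thesis by (auto simp: card_gt_0_iff)
qed

text \<open>Since \<open>surv (M - r) \<ge> surv M\<close>, the conditional probability is, up to a
  constant factor, at least \<open>(1 - (1 - s) ^ k) / s\<close> with \<open>s = surv M\<close>.
  This is a geometric sum and tends to \<open>k\<close> because \<open>s\<close> tends to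
  zero.\<close>

theorem gw_surviving_lower:
  assumes e: "e > 0"
  shows "eventually (\<lambda>M. real (card rim) * exp (- real (card I)) / real (card (root_stab (ptree W p \<rho>, \<rho>))) - e
    \<le> measure (uniform_measure poisson_offspring (survives M))
        {\<xi>. rooted_iso (ptree W p \<rho>, \<rho>) (gball (gw_tree \<xi>) [] r)}) sequentially"
proof -
  let ?s = "real (card (root_stab (ptree W p \<rho>, \<rho>)))" and ?k = "card rim" and ?c = "exp (- real (card I))"
  let ?B = "{\<xi>. rooted_iso (ptree W p \<rho>, \<rho>) (gball (gw_tree \<xi>) [] r)}"
  have s: "?s > 0" using stab_pos by simp
  have "(\<lambda>M. (\<Sum>i<?k. (1 - surv M) ^ i) * ?c / ?s) \<longlonglongrightarrow> (\<Sum>i<?k. (1 - 0) ^ i) * ?c / ?s"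
    by (intro tendsto_intros surv_tendsto) (use s in auto)
  then have "eventually (\<lambda>M. (\<Sum>i<?k. (1 - surv M) ^ i) * ?c / ?s > ?k * ?c / ?s - e) sequentially"
    by (rule order_tendstoD) (use e in simp)
  moreover have "eventually (\<lambda>M. r \<le> M) sequentially" by (rule eventually_ge_at_top)
  ultimately show ?thesis
  proof eventually_elim
    case (elim M)
    have sv: "surv M \<le> surv (M - r)" using surv_decseq by (simp add: decseqD)
    have B: "?B \<in> sets poisson_offspring"
      using sets_rooted_iso_gw[of "\<lambda>\<xi>. \<xi>"] by simp
    have "emeasure poisson_offspring (survives M) \<noteq> 0"
      using surv_pos[of M] by (simp add: surv_def OP.emeasure_eq_measure)
    then have "measure (uniform_measure poisson_offspring (survives M)) ?B = OP.prob (survives M \<inter> ?B) / surv M"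
      using measure_uniform_measure[of poisson_offspring "survives M" ?B] B OP.emeasure_finite[of "survives M"] unfolding surv_def infinity_ennreal_def by blast
    also have "survives M \<inter> ?B = ?B \<inter> survives M" by (rule Int_commute)
    also have "OP.prob (?B \<inter> survives M) = ?c * (1 - (1 - surv (M - r)) ^ ?k) / ?s"
      using prob_gw_survives[OF elim(2)] s by (simp add: field_simps)
    also have "?c * (1 - (1 - surv (M - r)) ^ ?k) / ?s / surv M \<ge> ?c * (1 - (1 - surv M) ^ ?k) / ?s / surv M"
      using sv surv_le_1 surv_pos[of M] s by (intro divide_right_mono mult_left_mono diff_left_mono power_mono) auto
    also have "1 - (1 - surv M) ^ ?k = surv M * (\<Sum>i<?k. (1 - surv M) ^ i)"
      using one_diff_power_eq[of "1 - surv M" ?k] by simp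
    finally show ?case using elim(1) surv_pos[of M] by (simp add: field_simps)
  qed
qed

end

section \<open>Convergence from lower bounds on atoms\<close>

text \<open>Finitely many atoms \<open>F\<close> carry all but \<open>e'\<close> of the limit mass.
  On \<open>F\<close> the integrals are compared atom by atom; off \<open>F\<close> the integrand is
  bounded by \<open>C\<close> under \<open>\<mu>\<close> and by zero from below under
  \<open>N n\<close>.\<close>

lemma integral_lower:
  fixes N :: "nat \<Rightarrow> 'a::metric_space measure" and g :: "'a \<Rightarrow> real"
  assumes N: "\<And>n. prob_space (N n)" "\<And>n. sets (N n) = sets borel"
    and \<mu>: "prob_space \<mu>" "sets \<mu> = sets borel"
    and A: "countable A" "measure \<mu> A = 1"
    and low: "\<And>a e. a \<in> A \<Longrightarrow> e > 0 \<Longrightarrow> eventually (\<lambda>n. measure \<mu> {a} - e \<le> measure (N n) {a}) sequentially"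
    and g: "g \<in> borel_measurable borel" "\<And>x. 0 \<le> g x" "\<And>x. g x \<le> C" and e: "e > 0"
  shows "eventually (\<lambda>n. (\<integral>x. g x \<partial>\<mu>) - e \<le> (\<integral>x. g x \<partial>N n)) sequentially"
proof -
  interpret \<mu>: prob_space \<mu> by (rule \<mu>)
  have C: "0 \<le> C" using g(2,3) order_trans by blast
  have sp: "space \<mu> = UNIV" using sets_eq_imp_space_eq[OF \<mu>(2)] by simp
  have cl: "B \<in> sets \<mu>" if "countable B" for B
    using that \<mu>(2) by (simp add: sets.countable)
  have int: "integrable M h" if "prob_space M" "sets M = sets borel" "h \<in> borel_measurable borel" "\<And>x. \<bar>h x\<bar> \<le> D"
    for M and h :: "'a \<Rightarrow> real" and D
  proof -
    interpret prob_space M by fact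
    have "h \<in> borel_measurable M" using that(3) measurable_cong_sets[OF that(2) refl] by blast
    then show ?thesis using that(4) by (intro integrable_const_bound[of _ D]) auto
  qed
  define e' where "e' = e / (2 * (C + 1))"
  have e': "e' > 0" using e C by (simp add: e'_def)
  obtain F where F: "finite F" "F \<subseteq> A" "1 - e' \<le> measure \<mu> F"
  proof -
    have ne: "A \<noteq> {}" using A(2) by auto
    let ?F = "\<lambda>k. from_nat_into A ` {..k}"
    have "(\<lambda>k. measure \<mu> (?F k)) \<longlonglongrightarrow> measure \<mu> (\<Union>k. ?F k)"
      using cl[OF countable_finite] by (intro \<mu>.finite_Lim_measure_incseq) (auto simp: incseq_def)
    moreover have "(\<Union>k. ?F k) = A" using range_from_nat_into[OF ne A(1)] by (simp flip: image_UN add: UN_atMost_UNIV)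
    ultimately have "(\<lambda>k. measure \<mu> (?F k)) \<longlonglongrightarrow> 1" using A(2) by simp
    then have "eventually (\<lambda>k. measure \<mu> (?F k) > 1 - e') sequentially"
      by (rule order_tendstoD) (use e' in simp)
    then obtain k where "measure \<mu> (?F k) > 1 - e'" by (auto simp: eventually_sequentially)
    moreover have "?F k \<subseteq> A" using from_nat_into[OF ne] by auto
    ultimately show thesis using that[of "?F k"] by simp
  qed
  \<comment> \<open>\<open>e'\<close> and \<open>c\<close> are chosen so that the mass off
    \<open>F\<close> and the deficit on its atoms each cost at most \<open>e / 2\<close>; the added
    ones avoid division by zero.\<close>
  define c where "c = e / (2 * (C + 1) * (real (card F) + 1))"
  have c: "c > 0" using e C by (simp add: c_def)
  have "eventually (\<lambda>n. \<forall>a\<in>F. measure \<mu> {a} - c \<le> measure (N n) {a}) sequentially"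
    using F low c by (intro eventually_ball_finite) auto
  then show ?thesis
  proof eventually_elim
    case (elim n)
    interpret N: prob_space "N n" by (rule N)
    have sF: "{a} \<in> sets \<mu>" "{a} \<in> sets (N n)" for a using \<mu>(2) N(2) by simp_all
    have "(\<integral>x. g x \<partial>\<mu>) \<le> (\<integral>x. (\<Sum>a\<in>F. g a * indicator {a} x) + C * indicator (- F) x \<partial>\<mu>)"
    proof (rule integral_mono)
      have gb: "\<bar>g x\<bar> \<le> C" for x using g(2)[of x] g(3)[of x] by simp
      show "integrable \<mu> g" by (rule int[OF \<mu> g(1) gb])
      have "- F \<in> sets \<mu>" using sets.compl_sets[OF cl[OF countable_finite[OF F(1)]]] by (simp add: sp Compl_eq_Diff_UNIV)
      then show "integrable \<mu> (\<lambda>x. (\<Sum>a\<in>F. g a * indicator {a} x) + C * indicator (- F) x)"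
        using sF by (intro Bochner_Integration.integrable_add Bochner_Integration.integrable_sum integrable_mult_right
            integrable_real_indicator) (auto simp: \<mu>.emeasure_eq_measure)
      fix x
      show "g x \<le> (\<Sum>a\<in>F. g a * indicator {a} x) + C * indicator (- F) x"
      proof (cases "x \<in> F")
        case True
        then have "(\<Sum>a\<in>F. g a * indicator {a} x) = g x"
          using F(1) by (subst sum.remove[OF F(1) True]) (auto intro!: sum.neutral)
        then show ?thesis using True by simp
      next
        case False
        then have "(\<Sum>a\<in>F. g a * indicator {a} x) = 0" by (intro sum.neutral) (auto simp: indicator_def)
        then show ?thesis using False g(3)[of x] by simp
      qed
    qed
    also have "\<dots> = (\<Sum>a\<in>F. g a * measure \<mu> {a}) + C * measure \<mu> (- F)"
    proof -
      have "- F \<in> sets \<mu>" using sets.compl_sets[OF cl[OF countable_finite[OF F(1)]]] by (simp add: sp Compl_eq_Diff_UNIV)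
      then show ?thesis using sF
        by (subst Bochner_Integration.integral_add)
          (auto simp: \<mu>.emeasure_eq_measure intro!: Bochner_Integration.integrable_sum integrable_real_indicator)
    qed
    also have "(\<Sum>a\<in>F. g a * measure \<mu> {a}) \<le> (\<Sum>a\<in>F. g a * measure (N n) {a} + C * c)"
    proof (rule sum_mono)
      fix a assume "a \<in> F"
      then have "g a * (measure \<mu> {a} - c) \<le> g a * measure (N n) {a}" using elim g(2) by (intro mult_left_mono) auto
      moreover have "g a * c \<le> C * c" using g(3) c by (intro mult_right_mono) auto
      ultimately show "g a * measure \<mu> {a} \<le> g a * measure (N n) {a} + C * c" by (simp add: algebra_simps)
    qed
    also have "\<dots> = (\<Sum>a\<in>F. g a * measure (N n) {a}) + real (card F) * (C * c)" by (simp add: sum.distrib)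
    also have "(\<Sum>a\<in>F. g a * measure (N n) {a}) = (\<integral>x. (\<Sum>a\<in>F. g a * indicator {a} x) \<partial>N n)"
      using sF by (subst Bochner_Integration.integral_sum) (auto simp: N.emeasure_eq_measure intro!: integrable_real_indicator)
    also have "\<dots> \<le> (\<integral>x. g x \<partial>N n)"
    proof (rule integral_mono)
      have gb: "\<bar>g x\<bar> \<le> C" for x using g(2)[of x] g(3)[of x] by simp
      show "integrable (N n) g" by (rule int[OF N g(1) gb])
      show "integrable (N n) (\<lambda>x. \<Sum>a\<in>F. g a * indicator {a} x)"
        using sF by (intro Bochner_Integration.integrable_sum integrable_mult_right integrable_real_indicator)
          (auto simp: N.emeasure_eq_measure)
      fix x
      show "(\<Sum>a\<in>F. g a * indicator {a} x) \<le> g x"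
      proof (cases "x \<in> F")
        case True
        then have "(\<Sum>a\<in>F. g a * indicator {a} x) = g x"
          using F(1) by (subst sum.remove[OF F(1) True]) (auto intro!: sum.neutral)
        then show ?thesis by simp
      next
        case False
        then have "(\<Sum>a\<in>F. g a * indicator {a} x) = 0" by (intro sum.neutral) (auto simp: indicator_def)
        then show ?thesis using g(2)[of x] by simp
      qed
    qed
    finally have "(\<integral>x. g x \<partial>\<mu>) \<le> (\<integral>x. g x \<partial>N n) + real (card F) * (C * c) + C * measure \<mu> (- F)" by simp
    moreover have "C * measure \<mu> (- F) \<le> e / 2"
    proof -
      have "measure \<mu> (- F) = 1 - measure \<mu> F"
        using \<mu>.prob_compl[OF cl[OF countable_finite[OF F(1)]]] by (simp add: sp Compl_eq_Diff_UNIV)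
      then have "C * measure \<mu> (- F) \<le> C * e'" using F(3) C by (intro mult_left_mono) auto
      also have "\<dots> = e / 2 * (C / (C + 1))" using C by (simp add: e'_def field_simps)
      also have "\<dots> \<le> e / 2 * 1" using C e by (intro mult_left_mono) auto
      finally show ?thesis by simp
    qed
    moreover have "real (card F) * (C * c) \<le> e / 2"
    proof -
      have "real (card F) * (C * c) = e / 2 * (C / (C + 1)) * (real (card F) / (real (card F) + 1))"
        using C by (simp add: c_def field_simps)
      also have "\<dots> \<le> e / 2 * 1 * 1" using C e by (intro mult_mono) auto
      finally show ?thesis by simp
    qed
    ultimately show ?case by linarith
  qed
qed

text \<open>The one-sided bound, applied to the nonnegative functions \<open>B + f\<close> and
  \<open>B - f\<close>, gives both directions.\<close>

theorem integral_tendsto: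
  fixes N :: "nat \<Rightarrow> 'a::metric_space measure" and f :: "'a \<Rightarrow> real"
  assumes N: "\<And>n. prob_space (N n)" "\<And>n. sets (N n) = sets borel"
    and \<mu>: "prob_space \<mu>" "sets \<mu> = sets borel"
    and A: "countable A" "measure \<mu> A = 1"
    and low: "\<And>a e. a \<in> A \<Longrightarrow> e > 0 \<Longrightarrow> eventually (\<lambda>n. measure \<mu> {a} - e \<le> measure (N n) {a}) sequentially"
    and f: "f \<in> borel_measurable borel" "bounded (range f)"
  shows "(\<lambda>n. \<integral>x. f x \<partial>N n) \<longlonglongrightarrow> (\<integral>x. f x \<partial>\<mu>)"
proof -
  obtain B where B: "\<And>x. \<bar>f x\<bar> \<le> B" using f(2) by (auto simp: bounded_iff)
  have int: "integrable M f \<and> (\<integral>x. B + f x \<partial>M) = B + (\<integral>x. f x \<partial>M) \<and> (\<integral>x. B - f x \<partial>M) = B - (\<integral>x. f x \<partial>M)"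
    if "prob_space M" "sets M = sets borel" for M
  proof -
    interpret prob_space M by fact
    have "f \<in> borel_measurable M" using f(1) measurable_cong_sets[OF that(2) refl] by blast
    then have "integrable M f" using B by (intro integrable_const_bound[of _ B]) auto
    then show ?thesis by (simp add: prob_space)
  qed
  show ?thesis
  proof (rule LIMSEQ_I)
    fix e :: real assume e: "e > 0"
    have bd: "0 \<le> B + f x" "B + f x \<le> 2 * B" "0 \<le> B - f x" "B - f x \<le> 2 * B" for x
      using B[of x] by (auto simp: abs_le_iff)
    have ms: "(\<lambda>x. B + f x) \<in> borel_measurable borel" "(\<lambda>x. B - f x) \<in> borel_measurable borel"
      using f(1) by simp_all
    have e2: "0 < e / 2" using e by simp
    have "eventually (\<lambda>n. (\<integral>x. B + f x \<partial>\<mu>) - e / 2 \<le> (\<integral>x. B + f x \<partial>N n)) sequentially"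
      by (rule integral_lower[OF N \<mu> A low ms(1) bd(1,2) e2])
    moreover have "eventually (\<lambda>n. (\<integral>x. B - f x \<partial>\<mu>) - e / 2 \<le> (\<integral>x. B - f x \<partial>N n)) sequentially"
      by (rule integral_lower[OF N \<mu> A low ms(2) bd(3,4) e2])
    ultimately have "eventually (\<lambda>n. norm ((\<integral>x. f x \<partial>N n) - (\<integral>x. f x \<partial>\<mu>)) < e) sequentially"
    proof eventually_elim
      case (elim n)
      then show ?case using int[OF \<mu>] int[OF N(1)[of n] N(2)[of n]] e by simp
    qed
    then show "\<exists>no. \<forall>n\<ge>no. norm ((\<integral>x. f x \<partial>N n) - (\<integral>x. f x \<partial>\<mu>)) < e" by (simp add: eventually_sequentially)
  qed
qed

section \<open>The law of Kesten's tree\<close>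

definition kesten_law :: "rgraph measure" where
  "kesten_law = distr poisson_offspring borel (\<lambda>\<xi>. rgraph_of (gw_tree (kesten \<xi>), []))"

lemma measurable_kesten_tree:
  "(\<lambda>\<xi>. rgraph_of (gw_tree (kesten \<xi>), [])) \<in> borel_measurable poisson_offspring"
  using measurable_compose[OF measurable_kesten measurable_gw_tree] .

lemma measurable_kesten_ball:
  "(\<lambda>\<xi>. rgraph_of (gball (gw_tree (kesten \<xi>)) [] r)) \<in> borel_measurable poisson_offspring"
proof -
  have "(\<lambda>\<xi>. rgraph_of (gball (gw_tree (kesten \<xi>)) [] r)) \<in> measurable poisson_offspring (count_space UNIV)"
    using measurable_compose[OF measurable_kesten measurable_gw_ball] .
  then show ?thesis by (rule measurable_compose) simp
qed

lemma prob_space_kesten: "prob_space kesten_law" and sets_kesten: "sets kesten_law = sets borel"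
  unfolding kesten_law_def by (rule OP.prob_space_distr[OF measurable_kesten_tree]) simp

lemma distr_kesten_rball:
  "distr kesten_law borel (rball r) = distr poisson_offspring borel (\<lambda>\<xi>. rgraph_of (gball (gw_tree (kesten \<xi>)) [] r))"
  unfolding kesten_law_def
  by (subst distr_distr[OF measurable_rball measurable_kesten_tree]) (simp add: comp_def rball_rgraph_of[OF rlf_gw])

context finite_tree
begin

lemma rlf_tree: "rlf (ptree W p \<rho>, \<rho>)"
proof -
  have "finite (neighbours (ptree W p \<rho>) v)" for v
  proof (rule finite_subset[OF _ finW])
    show "neighbours (ptree W p \<rho>) v \<subseteq> W"
      using p_V by (auto simp: neighbours_def ptree_edge_iff)
  qed
  then show ?thesis using simple connected root by (simp add: rlf_def locally_finite_def)
qed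

lemma rgraph_of_gw_iff:
  "rgraph_of (gball (gw_tree \<xi>) [] r) = rgraph_of (ptree W p \<rho>, \<rho>) \<longleftrightarrow> rooted_iso (ptree W p \<rho>, \<rho>) (gball (gw_tree \<xi>) [] r)"
  using rgraph_of_eq_iff[OF rlf_tree rlf_gball[OF rlf_gw[of \<xi>], of r]] by metis

definition "ball_mass = real (card rim) * exp (- real (card I)) / real (card (root_stab (ptree W p \<rho>, \<rho>)))"

lemma kesten_ball_mass:
  "measure (distr kesten_law borel (rball r)) {rgraph_of (ptree W p \<rho>, \<rho>)} = ball_mass"
proof -
  have "measure (distr kesten_law borel (rball r)) {rgraph_of (ptree W p \<rho>, \<rho>)} =
      OP.prob {\<xi>. rooted_iso (ptree W p \<rho>, \<rho>) (gball (gw_tree (kesten \<xi>)) [] r)}"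
    unfolding distr_kesten_rball
    by (subst measure_distr[OF measurable_kesten_ball]) (simp_all add: vimage_def rgraph_of_gw_iff)
  then show ?thesis using prob_kesten stab_pos by (simp add: ball_mass_def field_simps)
qed

end

text \<open>The atoms are the balls of Kesten's tree, coded by finite sets of words and hence
  countably many. The ray puts a word on level \<open>r\<close> of each, so lower bounds are
  required only for trees of height exactly \<open>r\<close>.\<close>

theorem kesten_limit:
  fixes N :: "nat \<Rightarrow> rgraph measure" and f :: "rgraph \<Rightarrow> real"
  assumes N: "\<And>n. prob_space (N n)" "\<And>n. sets (N n) = sets borel"
    and low: "\<And>W p (\<rho> :: nat list) e. finite_tree W p \<rho> r \<Longrightarrow> finite_tree.rim W p \<rho> r \<noteq> {} \<Longrightarrow> e > 0 \<Longrightarrow>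
      eventually (\<lambda>n. finite_tree.ball_mass W p \<rho> r - e \<le> measure (N n) {rgraph_of (ptree W p \<rho>, \<rho>)}) sequentially"
    and f: "f \<in> borel_measurable borel" "bounded (range f)"
  shows "(\<lambda>n. \<integral>x. f x \<partial>N n) \<longlonglongrightarrow> (\<integral>x. f x \<partial>distr kesten_law borel (rball r))"
proof (rule integral_tendsto[OF N _ _ _ _ _ f])
  interpret K: prob_space kesten_law by (rule prob_space_kesten)
  let ?b = "\<lambda>\<xi>. rgraph_of (gball (gw_tree (kesten \<xi>)) [] r)"
  have rb: "rball r \<in> measurable kesten_law borel"
    using measurable_rball measurable_cong_sets[OF sets_kesten refl] by blast
  show ps: "prob_space (distr kesten_law borel (rball r))" by (rule K.prob_space_distr[OF rb])
  show "sets (distr kesten_law borel (rball r)) = sets borel" by simp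
  have "range ?b \<subseteq> (\<lambda>B. rgraph_of (list_tree B, [])) ` Collect finite"
    using gw_ball_list_tree finite_ball_set by auto
  then show co: "countable (range ?b)"
    by (rule countable_subset) (intro countable_image countable_Collect_finite)
  have "range ?b \<in> sets borel" by (rule sets.countable[OF _ co]) simp
  then show "measure (distr kesten_law borel (rball r)) (range ?b) = 1"
    unfolding distr_kesten_rball using OP.prob_space
    by (subst measure_distr[OF measurable_kesten_ball]) (simp_all add: vimage_def)
  fix a and e :: real assume "a \<in> range ?b" and e: "e > 0"
  then obtain \<xi> where a: "a = ?b \<xi>" by auto
  define W where "W = ball_set r (kesten \<xi>)"
  have cl: "prefix_closed W" by (simp add: W_def prefix_closed_def ball_set_def gwv_snoc)
  interpret parent_tree W "list_parent W" "[]" by (rule list_parent_tree[OF cl])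
  interpret finite_tree W "list_parent W" "[]" r
  proof
    show "finite W" unfolding W_def by (rule finite_ball_set)
    fix v assume v: "v \<in> W"
    then have "length v \<le> r" by (simp add: W_def ball_set_def)
    then show "pdepth (list_parent W) {[]} v \<le> r" using list_depth[OF cl v] by simp
  qed
  have "replicate r 0 \<in> W" using kesten_ray by (simp add: W_def ball_set_def)
  then have rim: "rim \<noteq> {}" using list_depth[OF cl] by (auto simp: rim_def intro!: exI[of _ "replicate r 0"])
  have a': "a = rgraph_of (ptree W (list_parent W) [], [])"
    unfolding a gw_ball_list_tree W_def[symmetric] list_tree_ptree ..
  show "eventually (\<lambda>n. measure (distr kesten_law borel (rball r)) {a} - e \<le> measure (N n) {a}) sequentially"
    unfolding a' kesten_ball_mass by (rule low[OF finite_tree_axioms rim e])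
qed

theorem kesten_gw_surviving: "poisson_gw_surviving kesten_law"
  unfolding poisson_gw_surviving_def conv_in_distr_def
proof (intro conjI allI impI)
  show "prob_space kesten_law" "sets kesten_law = sets borel" by (rule prob_space_kesten sets_kesten)+
  fix r and f :: "rgraph \<Rightarrow> real" assume f: "continuous_on UNIV f \<and> bounded (range f)"
  let ?U = "\<lambda>m. uniform_measure poisson_offspring (survives m)"
  have ps: "prob_space (?U m)" for m
    using surv_pos[of m] by (intro prob_space_uniform_measure) (auto simp: surv_def OP.emeasure_eq_measure)
  have ms: "(\<lambda>\<xi>. rgraph_of (gball (gw_tree \<xi>) [] r)) \<in> borel_measurable (?U m)" for m
  proof -
    have "(\<lambda>\<xi>. rgraph_of (gball (gw_tree \<xi>) [] r)) \<in> borel_measurable poisson_offspring"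
      by (rule measurable_compose[OF measurable_gw_ball]) simp
    then show ?thesis using measurable_cong_sets[of "?U m" poisson_offspring] by (metis sets_uniform_measure)
  qed
  show "(\<lambda>m. \<integral>x. f x \<partial>distr (?U m) borel (\<lambda>\<xi>. rgraph_of (gball (gw_tree \<xi>) [] r)))
      \<longlonglongrightarrow> (\<integral>x. f x \<partial>distr kesten_law borel (rball r))"
  proof (rule kesten_limit)
    show "prob_space (distr (?U m) borel (\<lambda>\<xi>. rgraph_of (gball (gw_tree \<xi>) [] r)))" for m
      by (rule prob_space.prob_space_distr[OF ps ms])
    show "f \<in> borel_measurable borel" using f by (intro borel_measurable_continuous_onI) simp
    fix W p and \<rho> :: "nat list" and e :: real
    assume "finite_tree W p \<rho> r" and e: "e > 0"
    interpret finite_tree W p \<rho> r by fact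
    have "measure (distr (?U m) borel (\<lambda>\<xi>. rgraph_of (gball (gw_tree \<xi>) [] r))) {rgraph_of (ptree W p \<rho>, \<rho>)} =
        measure (?U m) {\<xi>. rooted_iso (ptree W p \<rho>, \<rho>) (gball (gw_tree \<xi>) [] r)}" for m
      by (subst measure_distr[OF ms]) (simp_all add: vimage_def rgraph_of_gw_iff)
    then show "eventually (\<lambda>n. ball_mass - e \<le> measure (distr (?U n) borel (\<lambda>\<xi>. rgraph_of (gball (gw_tree \<xi>) [] r)))
        {rgraph_of (ptree W p \<rho>, \<rho>)}) sequentially"
      using gw_surviving_lower[OF e] by (simp add: ball_mass_def)
  qed (use f in simp_all)
qed

section \<open>The uniform spanning tree\<close>

context finite_tree
begin

lemma single_vertex:
  assumes "r = 0"
  shows "W = {\<rho>}"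
proof -
  have "v = \<rho>" if v: "v \<in> W" for v
  proof -
    have "dp v = 0" using height[OF v] assms by linarith
    then show ?thesis by (rule iffD1[OF dp_0[OF v]])
  qed
  then show ?thesis using root by blast
qed

text \<open>Order of the choices: the tree fixes \<open>m\<close> and \<open>k\<close>, then come
  \<open>\<eta>\<close> and \<open>\<epsilon>\<close>, and finally \<open>n\<close> is large. Since
  \<open>almost_regular\<close> wants a nonnegative deviation, \<open>\<delta> n\<close> enters
  through its absolute value.\<close>

lemma ust_ball_lower:
  fixes G :: "nat \<Rightarrow> 'a sgraph"
  assumes G: "high_degree_almost_regular G" and r: "r \<ge> 1" and rim: "rim \<noteq> {}" and e: "e > 0"
  shows "eventually (\<lambda>n. ball_mass - e \<le> measure_pmf.prob (pair_pmf (ust (G n)) (pmf_of_set (verts (G n))))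
    {(\<Gamma>, X). rooted_iso (gball \<Gamma> X r) (ptree W p \<rho>, \<rho>)}) sequentially"
proof -
  obtain d :: "nat \<Rightarrow> real" and \<delta> :: "nat \<Rightarrow> real" where fc: "\<And>n. n \<ge> 1 \<Longrightarrow> fin_graph (G n)"
    and d: "filterlim d at_top sequentially" and \<delta>: "\<delta> \<longlonglongrightarrow> 0"
    and most: "\<And>n. n \<ge> 1 \<Longrightarrow> real (card {v \<in> verts (G n). \<bar>real (degree (G n) v) - d n\<bar> \<le> \<delta> n * d n})
             \<ge> (1 - \<delta> n) * real (card (verts (G n)))"
    and total: "\<And>n. n \<ge> 1 \<Longrightarrow> \<bar>(\<Sum>v\<in>verts (G n). real (degree (G n) v)) - d n * real (card (verts (G n)))\<bar>
             \<le> \<delta> n * d n * real (card (verts (G n)))"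
    using G unfolding high_degree_almost_regular_def fin_graph_def by blast
  define w where "w = real (card W)"
  define c where "c = w * 2 ^ card W * w"
  define K where "K = real (card rim) * exp (- real (card I))"
  let ?s = "real (card (root_stab (ptree W p \<rho>, \<rho>)))"
  have K0: "K > 0" using rim fin_rim by (simp add: K_def card_gt_0_iff)
  have Kw: "K \<le> w"
  proof -
    have "K \<le> real (card rim) * 1" unfolding K_def by (intro mult_left_mono) auto
    also have "\<dots> \<le> w" using card_inner_rim by (simp add: w_def)
    finally show ?thesis .
  qed
  have w0: "w > 0" using K0 Kw by simp
  have c0: "c > 0" using w0 by (simp add: c_def)
  \<comment> \<open>The bound by \<open>K\<close> keeps the factor \<open>K - \<eta>\<close>
    nonnegative, as \<open>ball_prob_lower\<close> requires.\<close>
  define \<eta> where "\<eta> = min K (e / 2)"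
  have \<eta>: "0 < \<eta>" "\<eta> \<le> K" "\<eta> \<le> e / 2" using K0 e by (auto simp: \<eta>_def)
  have "eventually (\<lambda>\<epsilon>. \<epsilon> < e / (4 * c)) (at_right (0 :: real))"
    using e c0 by (intro order_tendstoD(2)[OF tendsto_ident_at]) auto
  then have "eventually (\<lambda>\<epsilon>. small_enough (card I) (card rim) \<eta> \<epsilon> \<and> \<epsilon> < e / (4 * c)) (at_right 0)"
    by (intro eventually_conj eventually_small_enough[OF \<eta>(1)])
  then obtain \<epsilon> where se: "small_enough (card I) (card rim) \<eta> \<epsilon>" and \<epsilon>c: "\<epsilon> < e / (4 * c)"
    using eventually_happens trivial_limit_at_right_real by blast
  have \<epsilon>: "0 < \<epsilon>" "\<epsilon> \<le> 1 / 12" using se by (auto simp: small_enough_def)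
  define \<xi> where "\<xi> n = 8 / d n + 4 * \<bar>\<delta> n\<bar>" for n
  define \<beta> where "\<beta> n = \<bar>\<delta> n\<bar> + \<bar>\<delta> n\<bar> / \<epsilon> + 24 * \<bar>\<delta> n\<bar> / \<epsilon> + 2 * \<xi> n / \<epsilon>" for n
  define \<tau> where "\<tau> n = 7 * \<bar>\<delta> n\<bar> + 4 * \<beta> n + 2 * \<xi> n / \<epsilon>" for n
  have di: "(\<lambda>n. a / d n) \<longlonglongrightarrow> 0" for a using tendsto_mult[OF tendsto_const[of a] tendsto_inverse_0_at_top[OF d]]
    by (simp add: divide_inverse)
  have ab: "(\<lambda>n. \<bar>\<delta> n\<bar>) \<longlonglongrightarrow> 0" using tendsto_rabs[OF \<delta>] by simp
  have \<xi>: "\<xi> \<longlonglongrightarrow> 0"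
    using tendsto_add[OF di[of 8] tendsto_mult[OF tendsto_const[of 4] ab]] by (simp add: \<xi>_def[abs_def])
  have \<beta>: "\<beta> \<longlonglongrightarrow> 0 + 0 / \<epsilon> + 24 * 0 / \<epsilon> + 2 * 0 / \<epsilon>"
    unfolding \<beta>_def[abs_def] using \<epsilon> by (intro tendsto_intros ab \<xi>) auto
  have \<tau>: "(\<lambda>n. \<tau> n + w / d n) \<longlonglongrightarrow> (7 * 0 + 4 * (0 + 0 / \<epsilon> + 24 * 0 / \<epsilon> + 2 * 0 / \<epsilon>) + 2 * 0 / \<epsilon>) + 0"
    unfolding \<tau>_def[abs_def] using \<epsilon> by (intro tendsto_intros ab \<xi> \<beta> di) auto
  have "eventually (\<lambda>n. \<tau> n + w / d n < e / (4 * c)) sequentially"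
    using order_tendstoD(2)[OF \<tau>, of "e / (4 * c)"] e c0 by simp
  moreover have "eventually (\<lambda>n. \<bar>\<delta> n\<bar> < \<epsilon> / 8) sequentially" using order_tendstoD(2)[OF ab, of "\<epsilon> / 8"] \<epsilon> by simp
  moreover have "eventually (\<lambda>n. d n \<ge> 2 / \<epsilon>) sequentially" using d by (auto simp: filterlim_at_top)
  moreover have "eventually (\<lambda>n. n \<ge> 1) sequentially" by (rule eventually_ge_at_top)
  ultimately show ?thesis
  proof eventually_elim
    case (elim n)
    interpret fg: fin_graph "G n" by (rule fc[OF elim(4)])
    have "0 < 2 / \<epsilon>" using \<epsilon> by simp
    then have dn: "d n > 0" using elim(3) by linarith
    have \<delta>d: "\<delta> n * d n \<le> \<bar>\<delta> n\<bar> * d n" using dn by (intro mult_right_mono) auto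
    interpret ar: almost_regular "G n" "d n" "\<bar>\<delta> n\<bar>" \<epsilon>
    proof
      show "0 < d n" "0 \<le> \<bar>\<delta> n\<bar>" "\<bar>\<delta> n\<bar> \<le> \<epsilon> / 8" "0 < \<epsilon>" "\<epsilon> \<le> 1 / 12" using dn elim(2) \<epsilon> by auto
      show "2 \<le> \<epsilon> * d n" using elim(3) \<epsilon> by (simp add: field_simps)
      have "(1 - \<bar>\<delta> n\<bar>) * real (card (verts (G n))) \<le> (1 - \<delta> n) * real (card (verts (G n)))"
        by (intro mult_right_mono) auto
      also have "\<dots> \<le> real (card {v \<in> verts (G n). \<bar>real (degree (G n) v) - d n\<bar> \<le> \<delta> n * d n})" by (rule most[OF elim(4)])
      also have "\<dots> \<le> real (card {v \<in> verts (G n). \<bar>fg.wdeg v - d n\<bar> \<le> \<bar>\<delta> n\<bar> * d n})"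
        unfolding fg.wdeg_degree using \<delta>d by (intro of_nat_mono card_mono) auto
      finally show "(1 - \<bar>\<delta> n\<bar>) * real (card (verts (G n))) \<le>
        real (card {v \<in> verts (G n). \<bar>fg.wdeg v - d n\<bar> \<le> \<bar>\<delta> n\<bar> * d n})" .
      have "\<bar>(\<Sum>v\<in>verts (G n). fg.wdeg v) - d n * real (card (verts (G n)))\<bar> \<le> \<delta> n * d n * real (card (verts (G n)))"
        unfolding fg.wdeg_degree by (rule total[OF elim(4)])
      also have "\<dots> \<le> \<bar>\<delta> n\<bar> * d n * real (card (verts (G n)))" by (rule mult_right_mono[OF \<delta>d]) simp
      finally show "\<bar>(\<Sum>v\<in>verts (G n). fg.wdeg v) - d n * real (card (verts (G n)))\<bar> \<le> \<bar>\<delta> n\<bar> * d n * real (card (verts (G n)))" .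
    qed
    have \<tau>n: "ar.\<tau> = \<tau> n" by (simp add: \<tau>_def \<beta>_def \<xi>_def ar.\<tau>_def ar.\<beta>_def ar.\<xi>_def)
    have \<tau>0: "0 \<le> \<tau> n" using dn \<epsilon> by (simp add: \<tau>_def \<beta>_def \<xi>_def)
    define x where "x = w * (2 ^ card W * (\<epsilon> + \<tau> n + w / d n))"
    have x0: "0 \<le> x" using w0 \<epsilon> \<tau>0 dn by (simp add: x_def)
    have "x * K \<le> x * w" using x0 Kw by (rule mult_left_mono[rotated])
    also have "x * w = c * (\<epsilon> + (\<tau> n + w / d n))" by (simp add: x_def c_def algebra_simps)
    also have "\<dots> \<le> c * (e / (4 * c) + e / (4 * c))" using \<epsilon>c elim(1) c0 by (intro mult_left_mono add_mono) auto
    also have "\<dots> = e / 2" using c0 by (simp add: field_simps)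
    finally have xK: "x * K \<le> e / 2" .
    have s1: "1 \<le> ?s" using stab_pos by linarith
    have "ball_mass - e \<le> (K - (x * K + \<eta>)) / ?s"
    proof -
      have "(x * K + \<eta>) / ?s \<le> (x * K + \<eta>) / 1"
        using s1 x0 K0 \<eta> by (intro divide_left_mono) auto
      then show ?thesis using xK \<eta>(3) by (simp add: ball_mass_def K_def diff_divide_distrib)
    qed
    also have "\<dots> \<le> (1 - x) * (K - \<eta>) / ?s"
    proof (rule divide_right_mono)
      have "0 \<le> x * \<eta>" using x0 \<eta> by simp
      then show "K - (x * K + \<eta>) \<le> (1 - x) * (K - \<eta>)" by (simp add: algebra_simps)
    qed simp
    also have "\<dots> \<le> measure_pmf.prob (pair_pmf (ust (G n)) (pmf_of_set (verts (G n))))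
        {(\<Gamma>, X). rooted_iso (gball \<Gamma> X r) (ptree W p \<rho>, \<rho>)}"
      unfolding x_def K_def w_def I_def rim_def \<tau>n[symmetric]
      by (rule ar.ball_prob_lower[OF parent_tree_axioms finW height _ r])
        (use rim se \<eta>(2) in \<open>auto simp: rim_def I_def K_def\<close>)
    finally show ?case .
  qed
qed

end

context fin_graph
begin

lemma set_ust: "set_pmf (ust G) = spanning_trees G"
  unfolding ust_def using trees_pos finite_trees by (intro set_pmf_of_set) auto

lemma ust_pair: "bind_pmf (ust G) (\<lambda>K. map_pmf (Pair K) (pmf_of_set (verts K))) = pair_pmf (ust G) (pmf_of_set V)"
  unfolding pair_pmf_def map_pmf_def
  by (intro bind_pmf_cong refl) (auto simp: set_ust spanning_trees_def)

lemma rlf_spanning_tree: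
  assumes "K \<in> spanning_trees G" "x \<in> V"
  shows "rlf (K, x)"
proof -
  have K: "simple_graph K" "gconnected K" "verts K = V" using assms(1) by (auto simp: spanning_trees_def is_tree_def)
  have "neighbours K v \<subseteq> V" for v
    using adj_verts[OF K(1)] K(3) by (auto simp: neighbours_def adj_def)
  then have "finite (neighbours K v)" for v using finite_subset fin by blast
  then show ?thesis using K assms(2) by (simp add: rlf_def locally_finite_def)
qed

text \<open>Equality under \<open>rgraph_of\<close> means isomorphism only for arguments satisfying
  \<open>rlf\<close>, so the two events are compared almost surely, on the support of the
  law.\<close>

lemma prob_ball_class:
  assumes T: "rlf T"
  shows "measure (distr (measure_pmf (bind_pmf (ust G) (\<lambda>K. map_pmf (Pair K) (pmf_of_set (verts K)))))
     borel (\<lambda>(K, x). rgraph_of (gball K x r))) {rgraph_of T} =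
    measure_pmf.prob (pair_pmf (ust G) (pmf_of_set V)) {(\<Gamma>, X). rooted_iso (gball \<Gamma> X r) T}"
proof -
  let ?P = "pair_pmf (ust G) (pmf_of_set V)"
  have "measure (distr (measure_pmf ?P) borel (\<lambda>(K, x). rgraph_of (gball K x r))) {rgraph_of T} =
      measure_pmf.prob ?P {(K, x). rgraph_of (gball K x r) = rgraph_of T}"
    by (subst measure_distr) (auto simp: vimage_def intro!: arg_cong[where f = "measure_pmf.prob ?P"])
  also have "\<dots> = measure_pmf.prob ?P {(\<Gamma>, X). rooted_iso (gball \<Gamma> X r) T}"
  proof (rule measure_pmf.finite_measure_eq_AE)
    have "rgraph_of (gball K x r) = rgraph_of T \<longleftrightarrow> rooted_iso (gball K x r) T"
      if "K \<in> spanning_trees G" "x \<in> V" for K x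
      by (rule rgraph_of_eq_iff[OF rlf_gball[OF rlf_spanning_tree[OF that]] T])
    then show "AE z in measure_pmf ?P. (z \<in> {(K, x). rgraph_of (gball K x r) = rgraph_of T}) =
        (z \<in> {(\<Gamma>, X). rooted_iso (gball \<Gamma> X r) T})"
      using V_ne by (auto simp: AE_measure_pmf_iff set_ust)
  qed simp_all
  finally show ?thesis by (simp only: ust_pair)
qed

text \<open>The local limit also asks for radius zero, which the counting argument with
  \<open>r \<ge> 1\<close> does not cover.\<close>

lemma radius_0_iso:
  assumes "K \<in> spanning_trees G" "x \<in> V" "finite_tree W p \<rho> 0"
  shows "rooted_iso (gball K x 0) (ptree W p \<rho>, \<rho>)"
proof -
  interpret finite_tree W p \<rho> 0 by fact
  have W: "W = {\<rho>}" by (rule single_vertex) simp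
  have K: "simple_graph K" "verts K = V" using assms(1) by (auto simp: spanning_trees_def is_tree_def)
  have v: "verts (fst (gball K x 0)) = {x}"
    unfolding verts_gball gdist_le_iff using K(2) assms(2) by auto
  have "{x} \<notin> edges K" using K(1) by (auto simp: simple_graph_def doubleton_eq_iff)
  moreover have "{\<rho>} \<notin> edges (ptree W p \<rho>)" using simple by (auto simp: simple_graph_def doubleton_eq_iff)
  ultimately have "graph_iso (\<lambda>_. \<rho>) (fst (gball K x 0)) (ptree W p \<rho>)"
    unfolding graph_iso_def v using W edges_gball[of x x K x 0] by (auto simp: bij_betw_def)
  then show ?thesis by (auto simp: rooted_iso_def)
qed

end

lemma ust_class_lower:
  assumes G: "high_degree_almost_regular G" and T: "finite_tree W p \<rho> r" and rim: "finite_tree.rim W p \<rho> r \<noteq> {}"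
    and e: "e > 0"
  shows "eventually (\<lambda>n. finite_tree.ball_mass W p \<rho> r - e \<le>
    measure_pmf.prob (pair_pmf (ust (G n)) (pmf_of_set (verts (G n)))) {(\<Gamma>, X). rooted_iso (gball \<Gamma> X r) (ptree W p \<rho>, \<rho>)})
    sequentially"
proof (cases "r = 0")
  case False
  interpret finite_tree W p \<rho> r by (rule T)
  show ?thesis using ust_ball_lower[OF G _ rim e] False by simp
next
  case True
  interpret finite_tree W p \<rho> r by (rule T)
  have W: "W = {\<rho>}" by (rule single_vertex[OF True])
  have "ball_mass \<le> 1"
  proof -
    have "card W = 1" using W by simp
    then have "real (card rim) \<le> 1" using card_inner_rim by linarith
    then have "real (card rim) * exp (- real (card I)) \<le> 1 * 1" by (intro mult_mono) auto
    moreover have "1 \<le> real (card (root_stab (ptree W p \<rho>, \<rho>)))" using stab_pos by linarith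
    ultimately show ?thesis unfolding ball_mass_def by (simp add: field_simps)
  qed
  moreover have "measure_pmf.prob (pair_pmf (ust (G n)) (pmf_of_set (verts (G n))))
      {(\<Gamma>, X). rooted_iso (gball \<Gamma> X r) (ptree W p \<rho>, \<rho>)} = 1" if "n \<ge> 1" for n
  proof -
    interpret fin_graph "G n" using G that by (auto simp: high_degree_almost_regular_def fin_graph_def)
    show ?thesis
      using radius_0_iso[OF _ _ T[unfolded True]] True V_ne
      by (subst measure_pmf.prob_eq_1) (auto simp: AE_measure_pmf_iff set_ust)
  qed
  ultimately show ?thesis using e by (auto simp: eventually_sequentially intro!: exI[of _ 1])
qed

lemma ust_integral_tendsto:
  fixes f :: "rgraph \<Rightarrow> real"
  assumes G: "high_degree_almost_regular G" and f: "f \<in> borel_measurable borel" "bounded (range f)"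
  shows "(\<lambda>n. \<integral>x. f x \<partial>distr (measure_pmf (bind_pmf (ust (G n)) (\<lambda>K. map_pmf (Pair K) (pmf_of_set (verts K)))))
      borel (\<lambda>(K, x). rgraph_of (gball K x r))) \<longlonglongrightarrow> (\<integral>x. f x \<partial>distr kesten_law borel (rball r))"
proof (rule kesten_limit[OF _ _ _ f])
  fix n
  show "prob_space (distr (measure_pmf (bind_pmf (ust (G n)) (\<lambda>K. map_pmf (Pair K) (pmf_of_set (verts K)))))
      borel (\<lambda>(K, x). rgraph_of (gball K x r)))"
    by (rule measure_pmf.prob_space_distr) simp
next
  fix W p and \<rho> :: "nat list" and e :: real
  assume T: "finite_tree W p \<rho> r" and rim: "finite_tree.rim W p \<rho> r \<noteq> {}" and e: "e > 0"
  have eq: "measure (distr (measure_pmf (bind_pmf (ust (G n)) (\<lambda>K. map_pmf (Pair K) (pmf_of_set (verts K)))))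
     borel (\<lambda>(K, x). rgraph_of (gball K x r))) {rgraph_of (ptree W p \<rho>, \<rho>)} =
    measure_pmf.prob (pair_pmf (ust (G n)) (pmf_of_set (verts (G n)))) {(\<Gamma>, X). rooted_iso (gball \<Gamma> X r) (ptree W p \<rho>, \<rho>)}"
    if "n \<ge> 1" for n
  proof -
    interpret fin_graph "G n" using G that by (auto simp: high_degree_almost_regular_def fin_graph_def)
    show ?thesis by (rule prob_ball_class[OF finite_tree.rlf_tree[OF T]])
  qed
  show "eventually (\<lambda>n. finite_tree.ball_mass W p \<rho> r - e \<le> measure (distr (measure_pmf (bind_pmf (ust (G n)) (\<lambda>K. map_pmf (Pair K) (pmf_of_set (verts K)))))
     borel (\<lambda>(K, x). rgraph_of (gball K x r))) {rgraph_of (ptree W p \<rho>, \<rho>)}) sequentially"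
    using eventually_conj[OF ust_class_lower[OF G T rim e] eventually_ge_at_top[of 1]]
    by eventually_elim (simp add: eq)
qed simp

theorem theorem1p4:
  fixes G :: "nat \<Rightarrow> 'a sgraph"
  assumes "high_degree_almost_regular G"
  shows "(\<exists>\<mu>. poisson_gw_surviving \<mu> \<and> local_limit (\<lambda>n. ust (G n)) \<mu>) \<and>
    (\<forall>(T :: 'b sgraph) \<rho> r.
       finite (verts T) \<and> is_tree T \<and> \<rho> \<in> verts T \<and> tree_height (T, \<rho>) = enat r \<and> r \<ge> 1 \<longrightarrow>
       (\<lambda>n. measure_pmf.prob (pair_pmf (ust (G n)) (pmf_of_set (verts (G n))))
              {(\<Gamma>, X). rooted_iso (gball \<Gamma> X r) (T, \<rho>)})
       \<longlonglongrightarrow> real (card (sphere_verts (T, \<rho>) r))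
             * exp (- real (card (verts T)) + real (card (sphere_verts (T, \<rho>) r)))
             / real (card (root_stab (T, \<rho>))))"
proof (intro conjI allI impI)
  have "local_limit (\<lambda>n. ust (G n)) kesten_law"
    unfolding local_limit_def conv_in_distr_def
    using prob_space_kesten sets_kesten ust_integral_tendsto[OF assms borel_measurable_continuous_onI] by blast
  then show "\<exists>\<mu>. poisson_gw_surviving \<mu> \<and> local_limit (\<lambda>n. ust (G n)) \<mu>" using kesten_gw_surviving by blast
next
  fix K :: "'b sgraph" and \<rho> r
  assume a: "finite (verts K) \<and> is_tree K \<and> \<rho> \<in> verts K \<and> tree_height (K, \<rho>) = enat r \<and> r \<ge> 1"
  then have "is_tree K" "\<rho> \<in> verts K" by auto
  then obtain p where pK: "p \<in> pforest (verts K) {\<rho>}" "K = ptree (verts K) p \<rho>" by (rule tree_parent)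
  interpret parent_tree "verts K" p \<rho> by (rule parent_tree.intro) (use a pK(1) in blast)+
  note K_eq = pK(2)[symmetric]
  note g = gdist[unfolded K_eq]
  have h: "tree_height (K, \<rho>) = Max ((\<lambda>v. enat (dp v)) ` verts K)"
    unfolding tree_height_def fst_conv snd_conv by (rule arg_cong[OF image_cong[OF refl g]])
  interpret finite_tree "verts K" p \<rho> r
  proof
    show "finite (verts K)" using a by blast
    fix v assume "v \<in> verts K"
    then have "enat (dp v) \<le> enat r" using a h by (metis (no_types, lifting) Max_ge finite_imageI imageI)
    then show "dp v \<le> r" by simp
  qed
  have rim: "sphere_verts (K, \<rho>) r = rim" using g by (auto simp: sphere_verts_def rim_def)
  let ?c = "rgraph_of (K, \<rho>)"
  \<comment> \<open>Convergence holds for every bounded Borel function, in particular for the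
    indicator of the class of \<open>(K, \<rho>)\<close>; this gives the second claim.\<close>
  have ind: "indicator {?c} \<in> borel_measurable (borel :: rgraph measure)" "bounded (range (indicator {?c} :: rgraph \<Rightarrow> real))"
    by (auto simp: bounded_iff indicator_def intro!: exI[of _ 1])
  let ?N = "\<lambda>n. distr (measure_pmf (bind_pmf (ust (G n)) (\<lambda>H. map_pmf (Pair H) (pmf_of_set (verts H)))))
      borel (\<lambda>(H, x). rgraph_of (gball H x r))"
  have "(\<lambda>n. measure (?N n) {?c}) \<longlonglongrightarrow> measure (distr kesten_law borel (rball r)) {?c}"
    using ust_integral_tendsto[OF assms ind, of r] by simp
  moreover have "measure (distr kesten_law borel (rball r)) {?c} = real (card rim) * exp (- real (card (verts K)) + real (card rim)) / real (card (root_stab (K, \<rho>)))"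
    using kesten_ball_mass[unfolded ball_mass_def K_eq] card_inner_rim by simp
  moreover have "eventually (\<lambda>n. measure (?N n) {?c} = measure_pmf.prob (pair_pmf (ust (G n)) (pmf_of_set (verts (G n))))
              {(\<Gamma>, X). rooted_iso (gball \<Gamma> X r) (K, \<rho>)}) sequentially"
    using eventually_ge_at_top[of 1]
  proof eventually_elim
    case (elim n)
    interpret fin_graph "G n" using assms elim by (auto simp: high_degree_almost_regular_def fin_graph_def)
    show ?case by (rule prob_ball_class[OF rlf_tree[unfolded K_eq]])
  qed
  ultimately show "(\<lambda>n. measure_pmf.prob (pair_pmf (ust (G n)) (pmf_of_set (verts (G n))))
              {(\<Gamma>, X). rooted_iso (gball \<Gamma> X r) (K, \<rho>)})
       \<longlonglongrightarrow> real (card (sphere_verts (K, \<rho>) r))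
             * exp (- real (card (verts K)) + real (card (sphere_verts (K, \<rho>) r)))
             / real (card (root_stab (K, \<rho>)))"
    unfolding rim using Lim_transform_eventually by fastforce
qed

end
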